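(* Let $s\geq 3$ and let $\lambda_1,\dots,\lambda_s\in\mathbb{Z}\setminus\{0\}$ satisfy $\lambda_1+\dots+\lambda_s=0$. Let $\mathbf{P}=(P_1,\dots,P_r)$ be a system of $r$ homogeneous polynomials $P_i\in\mathbb{Z}[x_1,\dots,x_d]$ of degrees $k_i\geq 1$, of dimension $d$ and weight $K=k_1+\dots+k_r$, such that the system of equations $$\lambda_1\mathbf{P}(\mathbf{x}_1)+\dots+\lambda_s\mathbf{P}(\mathbf{x}_s)=0\qquad(\ast)$$ is translation-invariant, and let $Z$ be a translation-dilation invariant subset of $(\mathbb{Q}^d)^s$. Let $\mathcal{N}(N)$ be the number of solutions $(\mathbf{x}_1,\dots,\mathbf{x}_s)\in([N]^d)^s$ of $(\ast)$ and $\mathcal{N}_Z(N)$ the number of such solutions lying in $Z$. Suppose that there is a constant $\omega>0$ (depending on $s$ and $\mathbf{P}$) such that, for all $N\geq 2$, $$\mathcal{N}(N)\gtrsim N^{ds-K}\quad\text{and}\quad \mathcal{N}_Z(N)\lesssim N^{ds-K-\omega}.$$ Suppose also that there exist real numbers $0<s''<s'<s$ and $\theta>0$ (depending on $s$ and $\mathbf{P}$) such that, for all $N\geq 2$ and all functions $a:[N]^d\to\mathbb{C}$, $$\int_{\mathbb{T}^r}|F_a^{(\mathbf{P})}|^{s''}\,dm\lesssim_\varepsilon N^{ds''-K+\varepsilon}\|a\|_\infty^{s''}\ \text{ for every }\varepsilon>0,$$ $$\int_{\{|F_a^{(\mathbf{P})}|\geq N^{d/2-\theta}\|a\|_2\}}|F_a^{(\mathbf{P})}|^{s'}\,dm\lesssim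 N^{ds'/2-K}\|a\|_2^{s'}.$$ Then there exists a constant $c=c(\mathbf{P},\boldsymbol{\lambda})>0$ such that, for every $N\geq 2$ and every subset $A\subseteq[N]^d$ with $|A|\geq 2(\log N)^{-c}N^d$, there exists a tuple $(\mathbf{x}_1,\dots,\mathbf{x}_s)\in A^s\setminus Z$ satisfying $(\ast)$.
   Context: $[N]=\{1,\dots,N\}$, $e(x)=e^{2\pi i x}$, $\mathbb{T}^r=\mathbb{R}^r/\mathbb{Z}^r$ with Lebesgue measure $m$. For $a:[N]^d\to\mathbb{C}$, $F_a^{(\mathbf{P})}(\boldsymbol{\alpha})=\sum_{\mathbf{n}\in[N]^d}a(\mathbf{n})e(\boldsymbol{\alpha}\cdot\mathbf{P}(\mathbf{n}))$ for $\boldsymbol{\alpha}\in\mathbb{T}^r$; $\|a\|_2=(\sum_{\mathbf{n}}|a(\mathbf{n})|^2)^{1/2}$ and $\|a\|_\infty=\max|a|$. The system has dimension $d$ if each variable $x_i$ appears in a monomial with nonzero coefficient in at least one $P_j$. The system $(\ast)$ is translation-invariant if whenever $(\mathbf{x}_1,\dots,\mathbf{x}_s)$ is a solution, so is $(\mathbf{x}_1+\mathbf{u},\dots,\mathbf{x}_s+\mathbf{u})$ for every $\mathbf{u}\in\mathbb{Z}^d$. A subset $Z\subseteq(\mathbb{Q}^d)^s$ is translation-dilation invariant if it is invariant under the maps $(\mathbf{x}_j)_j\mapsto(\mathbf{x}_j+\mathbf{u})_j$ for $\mathbf{u}\in\mathbb{Q}^d$ and $(\mathbf{x}_j)_j\mapsto\gamma(\mathbf{x}_j)_j$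 for $\gamma\in\mathbb{Q}$. Implicit constants in $\lesssim,\gtrsim$ are independent of $N$ and $a$ (they may depend on $\mathbf{P},\boldsymbol{\lambda},s,s',s'',\theta$, and $\varepsilon$ where indicated). *)

theory Defs
  imports "HOL-Analysis.Analysis" "HOL-Library.Poly_Mapping"
begin

text \<open>
  Polynomials in \<open>\<int>[x\<^sub>i : i \<in> 'd]\<close>: finitely supported maps from exponent vectors to
  coefficients. Vectors in dimension \<open>d\<close>, systems of \<open>r\<close> polynomials and \<open>s\<close>-tuples are
  indexed by finite types \<open>'d\<close>, \<open>'r\<close>, \<open>'s\<close>.
\<close>

type_synonym 'd int_mpoly = "('d \<Rightarrow>\<^sub>0 nat) \<Rightarrow>\<^sub>0 int"

definition eval_mpoly :: "'d::finite int_mpoly \<Rightarrow> int ^ 'd \<Rightarrow> int" where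
  "eval_mpoly p x =
     (\<Sum>m\<in>Poly_Mapping.keys p.
        Poly_Mapping.lookup p m * (\<Prod>i\<in>UNIV. (x $ i) ^ Poly_Mapping.lookup m i))"

definition homogeneous_of_degree :: "nat \<Rightarrow> 'd::finite int_mpoly \<Rightarrow> bool" where
  "homogeneous_of_degree k p \<longleftrightarrow>
     p \<noteq> 0 \<and> (\<forall>m\<in>Poly_Mapping.keys p. (\<Sum>i\<in>UNIV. Poly_Mapping.lookup m i) = k)"

text \<open>The system genuinely involves all \<open>d\<close> variables.\<close>

definition has_full_dimension :: "'d::finite int_mpoly ^ 'r \<Rightarrow> bool" where
  "has_full_dimension P \<longleftrightarrow>
     (\<forall>i. \<exists>j. \<exists>m\<in>Poly_Mapping.keys (P $ j). Poly_Mapping.lookup m i \<noteq> 0)"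

definition is_solution ::
  "int ^ 's \<Rightarrow> 'd::finite int_mpoly ^ 'r \<Rightarrow> int ^ 'd ^ 's \<Rightarrow> bool" where
  "is_solution l P x \<longleftrightarrow> (\<forall>j. (\<Sum>i\<in>UNIV. l $ i * eval_mpoly (P $ j) (x $ i)) = 0)"

definition translation_invariant_system :: "int ^ 's \<Rightarrow> 'd::finite int_mpoly ^ 'r \<Rightarrow> bool" where
  "translation_invariant_system l P \<longleftrightarrow>
     (\<forall>x u. is_solution l P x \<longrightarrow> is_solution l P (\<chi> i. x $ i + u))"

definition translation_dilation_invariant :: "(rat ^ 'd ^ 's) set \<Rightarrow> bool" where
  "translation_dilation_invariant Z \<longleftrightarrow>
     (\<forall>u. \<forall>z\<in>Z. (\<chi> i. z $ i + u) \<in> Z) \<and>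
     (\<forall>\<gamma>. \<forall>z\<in>Z. (\<chi> i. \<gamma> *s (z $ i)) \<in> Z)"

definition rat_tuple :: "int ^ 'd ^ 's \<Rightarrow> rat ^ 'd ^ 's" where
  "rat_tuple x = (\<chi> i j. of_int (x $ i $ j))"

definition grid :: "nat \<Rightarrow> (int ^ 'd) set" where
  "grid N = {n. \<forall>i. 1 \<le> n $ i \<and> n $ i \<le> int N}"

definition num_solutions :: "int ^ 's \<Rightarrow> 'd::finite int_mpoly ^ 'r \<Rightarrow> nat \<Rightarrow> nat" where
  "num_solutions l P N = card {x. (\<forall>i. x $ i \<in> grid N) \<and> is_solution l P x}"

definition num_solutions_in ::
  "(rat ^ 'd ^ 's) set \<Rightarrow> int ^ 's \<Rightarrow> 'd::finite int_mpoly ^ 'r \<Rightarrow> nat \<Rightarrow> nat" where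
  "num_solutions_in Z l P N =
     card {x. (\<forall>i. x $ i \<in> grid N) \<and> is_solution l P x \<and> rat_tuple x \<in> Z}"

text \<open>
  Functions on \<open>\<real>\<^sup>r/\<int>\<^sup>r\<close> are \<open>\<int>\<^sup>r\<close>-periodic functions on \<open>\<real>\<^sup>r\<close>, integrated over the
  fundamental domain \<open>[0,1)\<^sup>r\<close>.
\<close>

definition torus_measure :: "(real ^ 'r) measure" where
  "torus_measure = restrict_space lborel {\<alpha>. \<forall>j. 0 \<le> \<alpha> $ j \<and> \<alpha> $ j < 1}"

definition unit_exp :: "real \<Rightarrow> complex" where
  "unit_exp x = exp (2 * of_real pi * \<i> * of_real x)"

text \<open>
  A function \<open>[N]\<^sup>d \<rightarrow> \<complex>\<close> is represented by a total function on \<open>\<int>\<^sup>d\<close>, of which only the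
  values on the grid are used.
\<close>

definition exp_sum ::
  "'d::finite int_mpoly ^ 'r \<Rightarrow> nat \<Rightarrow> (int ^ 'd \<Rightarrow> complex) \<Rightarrow> real ^ 'r \<Rightarrow> complex" where
  "exp_sum P N a \<alpha> =
     (\<Sum>n\<in>grid N. a n * unit_exp (\<Sum>j\<in>UNIV. \<alpha> $ j * of_int (eval_mpoly (P $ j) n)))"

definition norm_two :: "nat \<Rightarrow> (int ^ 'd \<Rightarrow> complex) \<Rightarrow> real" where
  "norm_two N a = L2_set (\<lambda>n. norm (a n)) (grid N)"

definition norm_sup :: "nat \<Rightarrow> (int ^ 'd \<Rightarrow> complex) \<Rightarrow> real" where
  "norm_sup N a = Max ((\<lambda>n. norm (a n)) ` grid N)"

end

theory Submission
  imports Defs "Jordan_Normal_Form.Determinant" "HOL-Real_Asymp.Real_Asymp"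
begin

text \<open>
  The count of solutions in a set \<open>A\<close> is the integral over the torus of a product of exponential
  sums of \<open>1\<^sub>A\<close>. If \<open>A\<close> of density \<open>\<delta>\<close> has too few solutions, the exponential sum of
  \<open>f = 1\<^sub>A - \<delta>\<close> has a large \<open>s\<close>-th moment, and the two moment hypotheses place this moment on a
  level set \<open>{|F\<^sub>f| \<ge> \<delta> t N\<^sup>d}\<close> of normalised measure at least about \<open>t\<^sup>-\<^sup>\<sigma>\<close> with \<open>s' < \<sigma> < s\<close>, where \<open>t\<close>
  is at least a power of \<open>\<delta>\<close>. Following Heath-Brown and Szemeredi, one uses about \<open>t\<^sup>-\<^sup>\<sigma>\<close>
  separated frequencies from it at once: the box is divided into cells \<open>x + q [u]\<^sup>d\<close> on which all
  these phases are nearly constant, so that the cell averages of \<open>f\<close> keep the large Fourier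
  coefficients, and a discrete version of the large values estimate forces the averages to have large
  \<open>L\<^sup>2\<close> norm. Hence some cell has density at least \<open>\<delta> (1 + \<kappa> t\<^sup>-\<^sup>\<rho>)\<close>, while \<open>log u\<close> is only
  smaller than \<open>log N\<close> by a power of \<open>t\<close>. Solutions outside \<open>Z\<close> survive the
  passage to a cell by homogeneity and translation invariance, and iterating gives a logarithmic bound.

  It is essential that the cells lose only a factor polynomial in the number \<open>D\<close> of frequencies. This
  rests on simultaneous recurrence for \<open>k\<close>-th powers with polynomial dependence on \<open>D\<close>, which follows
  from Weyl's inequality by a rank argument.
\<close>

text \<open>The proof is a competition between two powers of t. If D frequencies lie on the level
  set and no cell is denser than \<delta> (1 + \<nu>), the large values estimate gives D <= const
  (sqrt \<nu> / t)^s'. With D about t^-\<sigma> this forces \<nu> >= const t^-\<rho>, where \<rho> =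
  2 \<sigma> / s' - 2 is positive because \<sigma> > s'. So the increment is never below a constant
  factor and it grows as t shrinks, while log N is divided by about D^C, a power of 1/t. For small c
  the quantity \<delta> (log N)^c therefore does not decrease, whatever t is, and t need not be
  controlled from one step to the next. A single frequency would only give \<nu> of order t^2, which
  tends to 0 with t. The obstacle is that the large values hypothesis concerns integrals over the
  torus, whereas the averaged function is known to be large only at D chosen points. A power series
  expansion spreads the largeness of each value over a whole box, at the price of new coefficients;
  this is possible because the hypothesis holds for all a. The natural boxes have side comparable to
  N^-k_j in coordinate j, hence volume comparable to N^-K.\<close>

no_notation Matrix.vec_index (infixl "$" 100)

section \<open>Weyl sums\<close>

definition dist_int :: "real \<Rightarrow> real" where
  "dist_int x = \<bar>x - of_int (round x)\<bar>"

lemma dist_int_le: "dist_int x \<le> \<bar>x - of_int m\<bar>"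
  unfolding dist_int_def by (rule round_diff_minimal)

lemma dist_int_ex: "\<exists>m. dist_int x = \<bar>x - of_int m\<bar>"
  unfolding dist_int_def by blast

lemma dist_int_nonneg [simp]: "0 \<le> dist_int x"
  by (simp add: dist_int_def)

lemma dist_int_half: "dist_int x \<le> 1/2"
  unfolding dist_int_def using of_int_round_abs_le[of x] by (simp add: abs_minus_commute)

lemma dist_int_add: "dist_int (x + y) \<le> dist_int x + dist_int y"
proof -
  have "dist_int (x + y) \<le> \<bar>x + y - of_int (round x + round y)\<bar>" by (rule dist_int_le)
  also have "\<dots> = \<bar>(x - of_int (round x)) + (y - of_int (round y))\<bar>" by simp
  also have "\<dots> \<le> dist_int x + dist_int y" unfolding dist_int_def by (rule abs_triangle_ineq)
  finally show ?thesis .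
qed

lemma dist_int_minus [simp]: "dist_int (- x) = dist_int x"
proof (rule antisym)
  show "dist_int (- x) \<le> dist_int x" for x
    using dist_int_le[of "- x" "- round x"] by (simp add: dist_int_def)
  from this[of "- x"] show "dist_int x \<le> dist_int (- x)" by simp
qed

lemma dist_int_diff: "dist_int (x - y) \<le> dist_int x + dist_int y"
  using dist_int_add[of x "- y"] by simp

lemma dist_int_mult: "dist_int (of_int m * x) \<le> \<bar>of_int m\<bar> * dist_int x"
proof -
  have "dist_int (of_int m * x) \<le> \<bar>of_int m * x - of_int (m * round x)\<bar>"
    by (rule dist_int_le)
  also have "\<dots> = \<bar>of_int m * (x - of_int (round x))\<bar>" by (simp add: algebra_simps)
  finally show ?thesis by (simp add: abs_mult dist_int_def)
qed

lemma dist_int_mult_nat: "dist_int (real m * x) \<le> real m * dist_int x"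
  using dist_int_mult[of "int m" x] by simp

lemma dist_int_sum: "dist_int (\<Sum>i\<in>I. f i) \<le> (\<Sum>i\<in>I. dist_int (f i))"
proof (induction I rule: infinite_finite_induct)
  case (insert x F)
  then show ?case using dist_int_add[of "f x" "sum f F"] by simp
qed (auto simp: dist_int_def)

lemma dist_int_eq_abs: "\<bar>x\<bar> \<le> 1/2 \<Longrightarrow> dist_int x = \<bar>x\<bar>"
proof (rule antisym)
  assume a: "\<bar>x\<bar> \<le> 1/2"
  show "dist_int x \<le> \<bar>x\<bar>" using dist_int_le[of x 0] by simp
  show "\<bar>x\<bar> \<le> dist_int x"
  proof (cases "round x = 0")
    case False
    then have "\<bar>real_of_int (round x)\<bar> \<ge> 1" by linarith
    then show ?thesis using a unfolding dist_int_def by linarith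
  qed (simp add: dist_int_def)
qed

lemma dist_int_add_int [simp]: "dist_int (x + of_int m) = dist_int x"
proof (rule antisym)
  show *: "dist_int (x + of_int m) \<le> dist_int x" for x m
    using dist_int_le[of "x + of_int m" "round x + m"] by (simp add: dist_int_def)
  show "dist_int x \<le> dist_int (x + of_int m)"
    using *[of "x + of_int m" "- m"] by simp
qed

lemma unit_exp_cis: "unit_exp x = cis (2 * pi * x)"
  unfolding unit_exp_def by (simp add: cis_conv_exp mult.commute mult.left_commute)

lemma norm_unit_exp [simp]: "norm (unit_exp x) = 1"
  by (simp add: unit_exp_cis)

lemma unit_exp_add: "unit_exp (x + y) = unit_exp x * unit_exp y"
  by (simp add: unit_exp_cis cis_mult algebra_simps)

lemma unit_exp_0 [simp]: "unit_exp 0 = 1"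
  by (simp add: unit_exp_def)

lemma unit_exp_minus: "unit_exp (- x) = cnj (unit_exp x)"
  by (simp add: unit_exp_cis cis_cnj)

lemma unit_exp_diff: "unit_exp (x - y) = unit_exp x * cnj (unit_exp y)"
  using unit_exp_add[of x "- y"] by (simp add: unit_exp_minus)

lemma unit_exp_of_int [simp]: "unit_exp (of_int m) = 1"
proof -
  have "cis (2 * pi * of_int m) = 1"
    by (rule cis_multiple_2pi) simp
  then show ?thesis by (simp add: unit_exp_cis)
qed

lemma unit_exp_add_int [simp]: "unit_exp (x + of_int m) = unit_exp x"
  by (simp add: unit_exp_add)

lemma unit_exp_sum: "unit_exp (\<Sum>i\<in>I. f i) = (\<Prod>i\<in>I. unit_exp (f i))"
  by (induction I rule: infinite_finite_induct) (auto simp: unit_exp_add)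

lemma norm_unit_exp_minus_1: "norm (unit_exp x - 1) = 2 * \<bar>sin (pi * x)\<bar>"
proof -
  have "(norm (unit_exp x - 1))\<^sup>2 = (cos (2*pi*x) - 1)\<^sup>2 + (sin (2*pi*x))\<^sup>2"
    by (simp add: cmod_power2 unit_exp_cis)
  also have "\<dots> = 2 - 2 * cos (2 * (pi * x))"
    using sin_cos_squared_add[of "2*pi*x"] by (simp add: power2_eq_square algebra_simps)
  also have "\<dots> = (2 * \<bar>sin (pi * x)\<bar>)\<^sup>2"
    by (simp add: cos_double_sin power_mult_distrib)
  finally show ?thesis by (rule power2_eq_imp_eq) auto
qed

text \<open>The left side is half of \<open>norm (unit_exp x - 1)\<close>, hence 1-periodic and even
  in \<open>x\<close>, so \<open>x\<close> may be replaced by its distance to the nearest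
  integer.\<close>

lemma sin_pi_dist_int: "\<bar>sin (pi * x)\<bar> = sin (pi * dist_int x)"
proof -
  obtain m where m: "dist_int x = \<bar>x - of_int m\<bar>" using dist_int_ex by blast
  have e: "unit_exp x = unit_exp (x - of_int m)" using unit_exp_add_int[of "x - of_int m" m] by simp
  have "\<bar>sin (pi * x)\<bar> = \<bar>sin (pi * (x - of_int m))\<bar>"
    using norm_unit_exp_minus_1[of x] norm_unit_exp_minus_1[of "x - of_int m"] e by simp
  also have "\<dots> = \<bar>sin (pi * dist_int x)\<bar>"
  proof -
    have "pi * \<bar>z\<bar> = \<bar>pi * z\<bar>" for z by (simp add: abs_mult)
    moreover have "\<bar>sin \<bar>z\<bar>\<bar> = \<bar>sin z\<bar>" for z :: real by (simp add: abs_if)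
    ultimately show ?thesis unfolding m by metis
  qed
  also have "\<dots> = sin (pi * dist_int x)"
  proof -
    have "0 \<le> pi * dist_int x" by simp
    moreover have "pi * dist_int x \<le> pi"
      using dist_int_half[of x] mult_left_mono[of "dist_int x" 1 pi] by simp
    ultimately show ?thesis using sin_ge_zero by fastforce
  qed
  finally show ?thesis .
qed

lemma norm_unit_exp_minus_1_le: "norm (unit_exp x - 1) \<le> 2 * pi * dist_int x"
  unfolding norm_unit_exp_minus_1 sin_pi_dist_int using sin_x_le_x[of "pi * dist_int x"] by simp

text \<open>Jordan's inequality: the sine is concave on [0, pi/2], so its graph lies above the chord
  joining the endpoints.\<close>

lemma sin_pi_ge:
  assumes "0 \<le> x" "x \<le> 1/2" shows "2 * x \<le> sin (pi * x)"
proof -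
  have c: "concave_on {0..pi/2} sin"
    unfolding concave_on_def
  proof (rule f''_ge0_imp_convex[where f' = "\<lambda>x. - cos x" and f'' = "sin"])
    show "convex {0..pi/2}" by simp
    show "((\<lambda>x. - sin x) has_real_derivative - cos x) (at x)" for x
      by (auto intro!: derivative_eq_intros)
    show "((\<lambda>x. - cos x) has_real_derivative sin x) (at x)" for x
      by (auto intro!: derivative_eq_intros)
    show "x \<in> {0..pi/2} \<Longrightarrow> 0 \<le> sin x" for x
      by (auto intro!: sin_ge_zero)
  qed
  have "sin ((1 - 2 * x) *\<^sub>R 0 + (2 * x) *\<^sub>R (pi/2)) \<ge> (1 - 2 * x) * sin 0 + (2 * x) * sin (pi/2)"
    by (rule concave_onD[OF c]) (use assms in auto)
  then show ?thesis by (simp add: mult.commute)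
qed

lemma norm_unit_exp_minus_1_ge: "4 * dist_int x \<le> norm (unit_exp x - 1)"
  unfolding norm_unit_exp_minus_1 sin_pi_dist_int
  using sin_pi_ge[of "dist_int x"] dist_int_half[of x] by simp

text \<open>Here \<open>norm (unit_exp x - 1)\<close> is at most pi/4 < 1, and its square is 2 - 2
  Re. The use of this bound: a Weyl sum whose phases are all within 1/8 of integers has real part at
  least half its length.\<close>

lemma Re_unit_exp_ge: "dist_int x \<le> 1/8 \<Longrightarrow> 1/2 \<le> Re (unit_exp x)"
proof -
  assume a: "dist_int x \<le> 1/8"
  have "norm (unit_exp x - 1) \<le> 2 * pi * dist_int x" by (rule norm_unit_exp_minus_1_le)
  also have "\<dots> \<le> 2 * pi * (1/8)" using a by (intro mult_left_mono) auto
  finally have n: "norm (unit_exp x - 1) \<le> pi/4" by simp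
  have "(norm (unit_exp x - 1))\<^sup>2 = 2 - 2 * Re (unit_exp x)"
  proof -
    have "(norm (unit_exp x - 1))\<^sup>2 = (cos (2*pi*x) - 1)\<^sup>2 + (sin (2*pi*x))\<^sup>2"
      by (simp add: cmod_power2 unit_exp_cis)
    then show ?thesis
      using sin_cos_squared_add[of "2*pi*x"] by (simp add: unit_exp_cis power2_eq_square algebra_simps)
  qed
  moreover have "(norm (unit_exp x - 1))\<^sup>2 \<le> 1"
    using n pi_less_4 by (intro power_le_one) auto
  ultimately show ?thesis by linarith
qed

text \<open>Polynomial sequences of degree \<open>k\<close>, where \<open>A\<close> is \<open>k!\<close> times the leading coefficient.\<close>

primrec polyseq :: "nat \<Rightarrow> real \<Rightarrow> (nat \<Rightarrow> real) \<Rightarrow> bool" where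
  "polyseq 0 A f \<longleftrightarrow> (\<forall>n. f n = A)"
| "polyseq (Suc k) A f \<longleftrightarrow> (\<forall>h. polyseq k (A * real h) (\<lambda>n. f (n + h) - f n))"

lemma polyseq_add: "polyseq k A f \<Longrightarrow> polyseq k B g \<Longrightarrow> polyseq k (A + B) (\<lambda>n. f n + g n)"
proof (induction k arbitrary: A B f g)
  case (Suc k)
  show ?case unfolding polyseq.simps
  proof
    fix h
    have "polyseq k (A * h + B * h) (\<lambda>n. (f (n + h) - f n) + (g (n + h) - g n))"
      using Suc by simp
    then show "polyseq k ((A + B) * h) (\<lambda>n. f (n + h) + g (n + h) - (f n + g n))"
      by (simp add: algebra_simps)
  qed
qed simp

lemma polyseq_cmult: "polyseq k A f \<Longrightarrow> polyseq k (c * A) (\<lambda>n. c * f n)"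
proof (induction k arbitrary: A f)
  case (Suc k)
  show ?case unfolding polyseq.simps
  proof
    fix h
    have "polyseq k (c * (A * h)) (\<lambda>n. c * (f (n + h) - f n))"
      by (rule Suc.IH) (use Suc.prems in simp)
    then show "polyseq k (c * A * h) (\<lambda>n. c * f (n + h) - c * f n)"
      by (simp add: algebra_simps)
  qed
qed simp

lemma polyseq_shift: "polyseq k A f \<Longrightarrow> polyseq k A (\<lambda>n. f (n + m))"
proof (induction k arbitrary: A f)
  case (Suc k)
  show ?case unfolding polyseq.simps
  proof
    fix h
    have "polyseq k (A * h) (\<lambda>n. f (n + m + h) - f (n + m))"
      using Suc.IH[of "A * h" "\<lambda>n. f (n + h) - f n"] Suc.prems by simp
    then show "polyseq k (A * h) (\<lambda>n. f (n + h + m) - f (n + m))"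
      by (simp add: add_ac)
  qed
qed simp

text \<open>Discrete Leibniz rule: the difference of \<open>n * f n\<close> with step
  \<open>h\<close> is \<open>n\<close> times the difference of \<open>f\<close> plus
  \<open>h * f (n + h)\<close>. The second summand raises the leading factor by one at each
  degree.\<close>

lemma polyseq_times: "polyseq k A f \<Longrightarrow> polyseq (Suc k) (real (Suc k) * A) (\<lambda>n. real n * f n)"
proof (induction k arbitrary: A f)
  case 0
  then show ?case by (simp add: algebra_simps)
next
  case (Suc k)
  show ?case unfolding polyseq.simps(2)[of "Suc k"]
  proof
    fix h
    have 1: "polyseq (Suc k) (real (Suc k) * (A * h)) (\<lambda>n. real n * (f (n + h) - f n))"
      by (rule Suc.IH) (use Suc.prems in simp)
    have 2: "polyseq (Suc k) (real h * A) (\<lambda>n. real h * f (n + h))"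
      by (intro polyseq_cmult polyseq_shift Suc.prems)
    from polyseq_add[OF 1 2]
    show "polyseq (Suc k) (real (Suc (Suc k)) * A * h) (\<lambda>n. real (n + h) * f (n + h) - real n * f n)"
      by (simp add: algebra_simps)
  qed
qed

lemma polyseq_power: "polyseq k (fact k * c) (\<lambda>n. c * real n ^ k)"
proof (induction k)
  case (Suc k)
  then show ?case using polyseq_times[OF Suc] by (simp add: algebra_simps)
qed simp

text \<open>A frequency that returns close to 0 for a positive proportion of h <= Q does so for a
  structural reason. Pigeonhole gives two nearby elements of \<open>H\<close>, hence a small
  \<open>b\<close> with \<open>b * \<theta>\<close> within 2 \<epsilon> of an integer; counting
  \<open>H\<close> along progressions of step \<open>b\<close> then improves 2 \<epsilon> by a
  further factor of order Q. This factor Q is what one more degree costs in Weyl's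
  inequality.\<close>

lemma recurrence_lemma:
  fixes \<theta> \<epsilon> \<eta> :: real and Q :: nat
  assumes H: "H \<subseteq> {1..Q}" "real (card H) \<ge> \<eta> * Q" and \<eta>: "0 < \<eta>" "\<eta> \<le> 1"
    and close: "\<And>h. h \<in> H \<Longrightarrow> dist_int (real h * \<theta>) \<le> \<epsilon>"
    and \<epsilon>: "0 < \<epsilon>" "\<epsilon> \<le> \<eta> / 32" and Q: "Q \<ge> 64 / \<eta>\<^sup>2"
  shows "\<exists>b\<ge>1. real b \<le> 3 / \<eta> \<and> dist_int (real b * \<theta>) \<le> 64 * \<epsilon> / (\<eta>\<^sup>2 * Q)"
proof -
  have finH: "finite H" using H(1) finite_subset by blast
  have Qpos: "real Q > 0" using Q \<eta> by (smt (verit) divide_pos_pos zero_less_power)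
  have etaQ: "\<eta> * Q \<ge> 64 / \<eta>"
    using mult_left_mono[OF Q, of \<eta>] \<eta> by (simp add: power2_eq_square)
  have inv: "1 / \<eta> \<ge> 1" using \<eta> by simp
  \<comment> \<open>Blocks of this length number at most \<eta> Q / 2 + 1, fewer than the elements
    of \<open>H\<close>, so one block contains two of them.\<close>
  define l where "l = nat \<lceil>2 / \<eta>\<rceil>"
  have l: "real l \<ge> 2 / \<eta>" "real l \<le> 3 / \<eta>" "l > 0"
  proof -
    show 1: "real l \<ge> 2 / \<eta>" unfolding l_def by linarith
    have "real l < 2 / \<eta> + 1" unfolding l_def using \<eta> by (simp add: l_def) linarith
    then show "real l \<le> 3 / \<eta>" using inv by (simp add: field_simps)
    show "l > 0" using 1 \<eta> by (metis divide_pos_pos gr0I not_less of_nat_0 zero_less_numeral)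
  qed
  have "card ((\<lambda>h. h div l) ` H) < card H"
  proof -
    have "(\<lambda>h. h div l) ` H \<subseteq> {0..Q div l}" using H(1) by (force intro: div_le_mono)
    then have "card ((\<lambda>h. h div l) ` H) \<le> Q div l + 1"
      using card_mono[of "{0..Q div l}"] by simp
    moreover have "real (Q div l + 1) < real (card H)"
    proof -
      have "real (Q div l) \<le> Q / l" by (rule of_nat_div_le_of_nat)
      also have "\<dots> \<le> Q / (2/\<eta>)" using l \<eta> by (intro divide_left_mono) auto
      also have "\<dots> = \<eta> * Q / 2" by simp
      finally have "real (Q div l) \<le> \<eta> * Q / 2" .
      moreover have "\<eta> * Q / 2 > 1" using etaQ inv by linarith
      ultimately show ?thesis using H(2) by linarith
    qed
    ultimately show ?thesis by linarith
  qed
  then have "\<not> inj_on (\<lambda>h. h div l) H" using card_image less_irrefl by metis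
  then obtain h1 h2 where h: "h1 \<in> H" "h2 \<in> H" "h1 < h2" "h1 div l = h2 div l"
    unfolding inj_on_def by (metis linorder_neqE_nat)
  define b where "b = h2 - h1"
  have b1: "b \<ge> 1" using h(3) by (simp add: b_def)
  have "b < l"
  proof -
    have "h2 = h2 div l * l + h2 mod l" "h1 = h2 div l * l + h1 mod l" using h(4) by (metis div_mult_mod_eq)+
    moreover have "h2 mod l < l" using l(3) by simp
    ultimately have "h2 < h1 + l" using h(4) by linarith
    then show ?thesis using h(3) by (simp add: b_def)
  qed
  then have b3: "real b \<le> 3 / \<eta>" using l(2) by linarith
  define \<beta> where "\<beta> = dist_int (real b * \<theta>)"
  have \<beta>2: "\<beta> \<le> 2 * \<epsilon>"
  proof -
    have "real b * \<theta> = real h2 * \<theta> - real h1 * \<theta>" using h(3) by (simp add: b_def of_nat_diff algebra_simps)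
    then show ?thesis unfolding \<beta>_def using dist_int_diff[of "real h2 * \<theta>" "real h1 * \<theta>"] close[OF h(1)] close[OF h(2)] by simp
  qed
  have "\<beta> \<le> 64 * \<epsilon> / (\<eta>\<^sup>2 * Q)"
  proof (rule ccontr)
    assume neg: "\<not> ?thesis"
    then have \<beta>0: "\<beta> > 0" using \<epsilon> Qpos \<eta> by (smt (verit) divide_nonneg_nonneg mult_nonneg_nonneg zero_le_power2)
    text \<open>Over \<open>J\<close> steps of length \<open>b\<close> the multiples of \<open>\<theta>\<close> do not wrap around, so few of them are close to integers.\<close>
    define J where "J = nat \<lfloor>1 / (2 * \<beta>)\<rfloor>"
    have \<beta>s: "\<beta> \<le> 1/8" using \<beta>2 \<epsilon> \<eta> by linarith
    have "1 / (2 * \<beta>) \<ge> 4" using \<beta>s \<beta>0 by (simp add: field_simps)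
    then have J: "real J \<le> 1 / (2*\<beta>)" "real J \<ge> 1 / (4 * \<beta>)" "J \<ge> 4"
    proof -
      assume a: "1 / (2 * \<beta>) \<ge> 4"
      have "real (nat \<lfloor>x\<rfloor>) \<le> x" if "x \<ge> 4" for x :: real using that by linarith
      from this[OF a] show "real J \<le> 1 / (2*\<beta>)" unfolding J_def .
      have "real J > 1 / (2*\<beta>) - 1" unfolding J_def using a by linarith
      moreover have "1 / (4*\<beta>) = (1 / (2 * \<beta>)) / 2" by simp
      ultimately show "real J \<ge> 1 / (4 * \<beta>)" using a by linarith
      show "J \<ge> 4" unfolding J_def using a by linarith
    qed
    have step: "dist_int (real j * (real b * \<theta>)) = real j * \<beta>" if "j \<le> J" for j
    proof -
      obtain m where m: "\<beta> = \<bar>real b * \<theta> - of_int m\<bar>" using dist_int_ex \<beta>_def by metis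
      define \<rho> where "\<rho> = real b * \<theta> - of_int m"
      have "real j * (real b * \<theta>) = real j * \<rho> + of_int (int j * m)" by (simp add: \<rho>_def algebra_simps)
      then have "dist_int (real j * (real b * \<theta>)) = dist_int (real j * \<rho>)" by (metis dist_int_add_int)
      also have "\<dots> = \<bar>real j * \<rho>\<bar>"
      proof (rule dist_int_eq_abs)
        have "\<bar>real j * \<rho>\<bar> = real j * \<beta>" using m by (simp add: abs_mult \<rho>_def)
        also have "\<dots> \<le> 1 / (2*\<beta>) * \<beta>" using that J(1) \<beta>0 by (intro mult_right_mono) auto
        finally show "\<bar>real j * \<rho>\<bar> \<le> 1/2" using \<beta>0 by simp
      qed
      finally show ?thesis using m by (simp add: abs_mult \<rho>_def)
    qed
    \<comment> \<open>Elements of \<open>H\<close> in one block of length \<open>b * J\<close> and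
      one class modulo \<open>b\<close> have the form h0 + j b with j <= J. There the distance of
      \<open>j * b * \<theta>\<close> to the integers is exactly \<open>j * \<beta>\<close>, and it
      is at most 2 \<epsilon>, so there are at most \<open>S\<close> of them.\<close>
    define S where "S = nat \<lfloor>2 * \<epsilon> / \<beta>\<rfloor> + 1"
    have S: "real S \<le> 2 * \<epsilon> / \<beta> + 1" "real S > 2 * \<epsilon> / \<beta>"
    proof -
      have "0 \<le> 2 * \<epsilon> / \<beta>" using \<epsilon> \<beta>0 by simp
      then have "real S = of_int \<lfloor>2 * \<epsilon> / \<beta>\<rfloor> + 1" unfolding S_def by simp
      then show "real S \<le> 2 * \<epsilon> / \<beta> + 1" "real S > 2 * \<epsilon> / \<beta>" by linarith+
    qed
    have bJ: "b * J > 0" using b1 J(3) by simp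
    define W where "W = {0..Q div (b * J)} \<times> {0..<b}"
    define key where "key = (\<lambda>h. (h div (b * J), h mod b))"
    have fibre: "card {h\<in>H. key h = w} \<le> S" for w
    proof (cases "{h\<in>H. key h = w} = {}")
      case False
      define T where "T = {h\<in>H. key h = w}"
      have finT: "finite T" unfolding T_def using finH by simp
      have neT: "T \<noteq> {}" using False by (simp add: T_def)
      define h0 where "h0 = Min T"
      have h0: "h0 \<in> T" using finT neT by (simp add: h0_def)
      have "T \<subseteq> (\<lambda>j. h0 + j * b) ` {..<S}"
      proof
        fix h assume hT: "h \<in> T"
        have le: "h0 \<le> h" using hT finT by (simp add: h0_def)
        have mod: "h mod b = h0 mod b" and dv: "h div (b*J) = h0 div (b*J)"
          using hT h0 by (auto simp: T_def key_def)
        have "b dvd h - h0" using mod le by (simp add: mod_eq_dvd_iff_nat)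
        then obtain j where j: "h - h0 = b * j" by blast
        have "h - h0 < b * J"
        proof -
          have "h = h0 div (b*J) * (b*J) + h mod (b*J)" "h0 = h0 div (b*J) * (b*J) + h0 mod (b*J)"
            using dv by (metis div_mult_mod_eq)+
          moreover have "h mod (b*J) < b * J" using bJ by simp
          ultimately show ?thesis by linarith
        qed
        then have jJ: "j \<le> J" using j b1 by (simp add: mult_less_cancel1)
        have hh: "real h - real h0 = real b * real j" using j le by (metis of_nat_diff of_nat_mult)
        have "real j * \<beta> = dist_int (real j * (real b * \<theta>))" using step[OF jJ] by simp
        also have "real j * (real b * \<theta>) = real h * \<theta> - real h0 * \<theta>"
          using hh by (metis left_diff_distrib mult.assoc mult.commute)
        also have "dist_int \<dots> \<le> \<epsilon> + \<epsilon>"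
          using dist_int_diff[of "real h * \<theta>" "real h0 * \<theta>"] close[of h] close[of h0] hT h0 by (simp add: T_def)
        finally have "real j \<le> 2 * \<epsilon> / \<beta>" using \<beta>0 by (simp add: field_simps)
        then have "j < S" using S(2) by linarith
        moreover have "h = h0 + j * b" using j le by (simp add: mult.commute)
        ultimately show "h \<in> (\<lambda>j. h0 + j * b) ` {..<S}" by blast
      qed
      then have "card T \<le> card {..<S}" by (metis card_image_le card_mono finite_imageI finite_lessThan le_trans)
      then show ?thesis by (simp add: T_def)
    next
      case True
      then show ?thesis by (metis card.empty le0)
    qed
    have keyW: "key h \<in> W" if "h \<in> H" for h
    proof -
      have "h \<le> Q" using that H(1) by auto
      then show ?thesis using b1 unfolding key_def W_def by (auto intro!: div_le_mono)
    qed
    have "H = (\<Union>w\<in>W. {h\<in>H. key h = w})" using keyW by auto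
    moreover have "finite W" by (simp add: W_def)
    ultimately have "card H \<le> (\<Sum>w\<in>W. card {h\<in>H. key h = w})"
      using card_UN_le[of W "\<lambda>w. {h\<in>H. key h = w}"] by simp
    also have "\<dots> \<le> (\<Sum>w\<in>W. S)" by (intro sum_mono fibre)
    also have "\<dots> = (Q div (b*J) + 1) * b * S" by (simp add: W_def)
    finally have "real (card H) \<le> real ((Q div (b*J) + 1) * b * S)" using of_nat_le_iff by blast
    also have "\<dots> = (real (Q div (b*J)) + 1) * real b * real S" by (simp add: algebra_simps)
    also have "\<dots> \<le> (real Q / (real b * real J) + 1) * real b * (2 * \<epsilon> / \<beta> + 1)"
      using S(1) \<epsilon> \<beta>0 of_nat_div_le_of_nat[of Q "b * J", where ?'a = real]
      by (intro mult_mono mult_nonneg_nonneg add_nonneg_nonneg) auto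
    also have "\<dots> = (real Q / real J + real b) * (2 * \<epsilon> / \<beta> + 1)"
      using b1 by (simp add: field_simps)
    also have "\<dots> \<le> (4 * \<beta> * Q + real b) * (2 * \<epsilon> / \<beta> + 1)"
    proof -
      have "real Q / real J \<le> real Q / (1 / (4 * \<beta>))"
        using J(2) \<beta>0 Qpos J(3) by (intro divide_left_mono) auto
      then show ?thesis using \<epsilon> \<beta>0 by (intro mult_right_mono) (auto simp: algebra_simps)
    qed
    also have "\<dots> = 8 * \<epsilon> * Q + 4 * \<beta> * Q + 2 * real b * \<epsilon> / \<beta> + real b"
      using \<beta>0 by (simp add: field_simps)
    \<comment> \<open>Every term on the right will turn out to be a fraction of \<eta> Q: the first
      two together 1/2, the third 6/64, the last 3/64.\<close>
    finally have main: "\<eta> * Q \<le> 8 * \<epsilon> * Q + 4 * \<beta> * Q + 2 * real b * \<epsilon> / \<beta> + real b" using H(2) by linarith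
    have "2 * real b * \<epsilon> / \<beta> \<le> 6 / \<eta> * \<epsilon> / (64 * \<epsilon> / (\<eta>\<^sup>2 * Q))"
      using neg b3 \<epsilon> \<eta> Qpos \<beta>0 by (intro frac_le mult_right_mono) auto
    also have "\<dots> = 6 * \<eta> * Q / 64" using \<epsilon> \<eta> Qpos by (simp add: field_simps power2_eq_square)
    finally have 3: "2 * real b * \<epsilon> / \<beta> \<le> 6 * \<eta> * Q / 64" .
    have 4: "real b \<le> 3 * (\<eta> * Q) / 64" using b3 etaQ by linarith
    have "\<eta> * Q > 0" using \<eta> Qpos by simp
    have "8 * \<epsilon> * Q + 4 * \<beta> * Q \<le> 16 * \<epsilon> * Q" using mult_right_mono[OF \<beta>2, of "4 * real Q"] by simp
    moreover have "16 * \<epsilon> * Q \<le> \<eta> * Q / 2" using mult_right_mono[OF \<epsilon>(2), of "16 * real Q"] by simp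
    ultimately show False using main 3 4 \<open>\<eta> * Q > 0\<close> by linarith
  qed
  then show ?thesis using b1 b3 \<beta>_def by blast
qed

text \<open>Geometric series. Multiplying out the distance instead of dividing by it lets integral
  \<open>\<theta>\<close> pass without a case distinction.\<close>

lemma norm_sum_unit_exp_linear:
  "norm (\<Sum>n<Q. unit_exp (c + real n * \<theta>)) * (2 * dist_int \<theta>) \<le> 1"
proof -
  have "(\<Sum>n<Q. unit_exp (c + real n * \<theta>)) = unit_exp c * (\<Sum>n<Q. unit_exp \<theta> ^ n)"
  proof -
    have "unit_exp (real n * \<theta>) = unit_exp \<theta> ^ n" for n
      by (induction n) (simp_all add: algebra_simps unit_exp_add)
    then show ?thesis by (simp add: unit_exp_add sum_distrib_left)
  qed
  then have "norm (\<Sum>n<Q. unit_exp (c + real n * \<theta>)) * norm (unit_exp \<theta> - 1)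
      = norm ((\<Sum>n<Q. unit_exp \<theta> ^ n) * (unit_exp \<theta> - 1))"
    by (simp add: norm_mult)
  also have "\<dots> = norm (unit_exp \<theta> ^ Q - 1)"
    by (simp add: power_diff_1_eq mult.commute)
  also have "\<dots> \<le> 2"
    using norm_triangle_ineq4[of "unit_exp \<theta> ^ Q" 1] by (simp add: norm_power)
  finally have "norm (\<Sum>n<Q. unit_exp (c + real n * \<theta>)) * norm (unit_exp \<theta> - 1) \<le> 2" .
  moreover have "norm (\<Sum>n<Q. unit_exp (c + real n * \<theta>)) * (4 * dist_int \<theta>) \<le>
     norm (\<Sum>n<Q. unit_exp (c + real n * \<theta>)) * norm (unit_exp \<theta> - 1)"
    by (intro mult_left_mono norm_unit_exp_minus_1_ge) auto
  ultimately show ?thesis by linarith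
qed

text \<open>Expansion of the square: the diagonal contributes at most \<open>Q\<close>, and the
  pairs at distance \<open>h\<close> contribute a correlation and its conjugate. The expansion is
  proved as an identity by appending one term at a time.\<close>

lemma van_der_corput:
  fixes z :: "nat \<Rightarrow> complex"
  assumes "\<And>n. norm (z n) \<le> 1"
  shows "(norm (\<Sum>n<Q. z n))\<^sup>2 \<le> real Q + 2 * (\<Sum>h\<in>{1..<Q}. norm (\<Sum>n<Q-h. z (n + h) * cnj (z n)))"
proof (induction Q)
  case (Suc Q)
  have e: "(\<Sum>n<Suc Q. z n) = (\<Sum>n<Q. z n) + z Q" by simp
  define T where "T = (\<lambda>Q. (\<Sum>n<Q. \<Sum>m<Q. z n * cnj (z m)))"
  define D where "D = (\<lambda>Q. (\<Sum>h\<in>{1..<Q}. \<Sum>n<Q-h. z (n + h) * cnj (z n)))"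
  have Dsuc: "D (Suc Q) = D Q + (\<Sum>n<Q. z Q * cnj (z n))" for Q
  proof -
    have "D (Suc Q) = (\<Sum>h\<in>{1..<Suc Q}. (\<Sum>n<Q-h. z (n + h) * cnj (z n)) + z Q * cnj (z (Q - h)))"
      unfolding D_def
    proof (rule sum.cong)
      fix h assume "h \<in> {1..<Suc Q}"
      then have "Suc Q - h = Suc (Q - h)" "Q - h + h = Q" by auto
      then show "(\<Sum>n<Suc Q-h. z (n + h) * cnj (z n)) = (\<Sum>n<Q-h. z (n + h) * cnj (z n)) + z Q * cnj (z (Q - h))"
        by simp
    qed simp
    also have "\<dots> = (\<Sum>h\<in>{1..<Suc Q}. (\<Sum>n<Q-h. z (n + h) * cnj (z n))) + (\<Sum>h\<in>{1..<Suc Q}. z Q * cnj (z (Q - h)))"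
      by (rule sum.distrib)
    also have "(\<Sum>h\<in>{1..<Suc Q}. (\<Sum>n<Q-h. z (n + h) * cnj (z n))) = D Q"
      unfolding D_def by (cases "Q = 0") (auto simp: atLeastLessThanSuc)
    also have "(\<Sum>h\<in>{1..<Suc Q}. z Q * cnj (z (Q - h))) = (\<Sum>n<Q. z Q * cnj (z n))"
      by (rule sum.reindex_bij_witness[of _ "\<lambda>n. Q - n" "\<lambda>h. Q - h"]) auto
    finally show ?thesis .
  qed
  have key: "(norm (\<Sum>n<Q. z n))\<^sup>2 = (\<Sum>n<Q. (norm (z n))\<^sup>2) + 2 * Re (D Q)" for Q
  proof (induction Q)
    case 0
    then show ?case by (simp add: D_def)
  next
    case (Suc Q)
    have "(norm (a + b))\<^sup>2 = (norm a)\<^sup>2 + (norm b)\<^sup>2 + 2 * Re (b * cnj a)" for a b :: complex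
      unfolding cmod_power2 by (simp add: power2_eq_square algebra_simps)
    from this[of "\<Sum>n<Q. z n" "z Q"]
    have "(norm ((\<Sum>n<Q. z n) + z Q))\<^sup>2 = (norm (\<Sum>n<Q. z n))\<^sup>2 + (norm (z Q))\<^sup>2 + 2 * Re (z Q * cnj (\<Sum>n<Q. z n))" .
    moreover have "z Q * cnj (\<Sum>n<Q. z n) = (\<Sum>n<Q. z Q * cnj (z n))"
      by (simp add: sum_distrib_left)
    ultimately have n: "(norm ((\<Sum>n<Q. z n) + z Q))\<^sup>2 = (norm (\<Sum>n<Q. z n))\<^sup>2 + (norm (z Q))\<^sup>2 + 2 * Re (\<Sum>n<Q. z Q * cnj (z n))"
      by (simp only:)
    have "Re (D (Suc Q)) = Re (D Q) + Re (\<Sum>n<Q. z Q * cnj (z n))" unfolding Dsuc by simp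
    then show ?case unfolding sum.lessThan_Suc using Suc.IH n by linarith
  qed
  have "(norm (\<Sum>n<Suc Q. z n))\<^sup>2 = (\<Sum>n<Suc Q. (norm (z n))\<^sup>2) + 2 * Re (D (Suc Q))" by (rule key)
  also have "(\<Sum>n<Suc Q. (norm (z n))\<^sup>2) \<le> (\<Sum>n<Suc Q. 1)"
    using assms by (intro sum_mono) (simp add: power_le_one)
  also have "Re (D (Suc Q)) \<le> norm (D (Suc Q))" by (rule complex_Re_le_cmod)
  also have "norm (D (Suc Q)) \<le> (\<Sum>h\<in>{1..<Suc Q}. norm (\<Sum>n<Suc Q-h. z (n + h) * cnj (z n)))"
    unfolding D_def by (rule norm_sum)
  finally show ?case by simp
qed simp

text \<open>Weyl's inequality in inverse form, with polynomial dependence on \<open>w\<close>: a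
  large sum forces a rational approximation of the leading coefficient. Inductive step: differencing
  yields many \<open>h\<close> with a large sum of degree \<open>k\<close>, each giving a multiplier
  of \<open>A * h\<close>; a common multiplier for many \<open>h\<close> makes a multiple of
  \<open>A\<close> recurrent, and recurrence gains the last factor of \<open>Q\<close>.\<close>

lemma weyl:
  assumes "k \<ge> 1"
  shows "\<exists>C::nat. \<forall>w\<ge>2. \<forall>Q\<ge>1. \<forall>A f. polyseq k A f \<longrightarrow> real Q / real w \<le> norm (\<Sum>n<Q. unit_exp (f n)) \<longrightarrow>
     (\<exists>b::nat. 1 \<le> b \<and> b \<le> w ^ C \<and> dist_int (real b * A) \<le> real (w ^ C) / real Q ^ k)"
  using assms
proof (induction k rule: dec_induct)
  case base
  show ?case
  proof (rule exI[of _ 1], intro allI impI)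
    fix w Q :: nat and A f
    assume w: "2 \<le> w" and Q: "1 \<le> Q" and p: "polyseq 1 A f" and s: "real Q / real w \<le> norm (\<Sum>n<Q. unit_exp (f n))"
    have lin: "f n = f 0 + real n * A" for n
    proof -
      have "\<forall>m. f (m + n) - f m = A * real n" using p by simp
      from this[rule_format, of 0] show ?thesis by (simp add: algebra_simps)
    qed
    have "(\<Sum>n<Q. unit_exp (f n)) = (\<Sum>n<Q. unit_exp (f 0 + real n * A))"
      by (intro sum.cong refl arg_cong[of _ _ unit_exp] lin)
    then have "norm (\<Sum>n<Q. unit_exp (f n)) * (2 * dist_int A) \<le> 1"
      using norm_sum_unit_exp_linear[of "f 0" A Q] by simp
    moreover have "real Q / real w * (2 * dist_int A) \<le> norm (\<Sum>n<Q. unit_exp (f n)) * (2 * dist_int A)"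
      using s by (intro mult_right_mono) auto
    ultimately have "real Q / real w * (2 * dist_int A) \<le> 1" by linarith
    then have "2 * dist_int A \<le> real w / real Q" using w Q by (simp add: field_simps)
    then have "dist_int A \<le> real w / real Q" using dist_int_nonneg[of A] by linarith
    then show "\<exists>b::nat. 1 \<le> b \<and> b \<le> w ^ 1 \<and> dist_int (real b * A) \<le> real (w ^ 1) / real Q ^ 1"
      using w by (intro exI[of _ 1]) auto
  qed
next
  case (step k)
  then obtain C where IH: "\<And>w Q A f. w \<ge> 2 \<Longrightarrow> Q \<ge> 1 \<Longrightarrow> polyseq k A f \<Longrightarrow>
      real Q / real w \<le> norm (\<Sum>n<Q. unit_exp (f n)) \<Longrightarrow>
      \<exists>b::nat. 1 \<le> b \<and> b \<le> w ^ C \<and> dist_int (real b * A) \<le> real (w ^ C) / real Q ^ k" by blast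
  \<comment> \<open>\<open>E\<close> bounds every exponent of \<open>v\<close> that occurs below,
    both in the hypotheses of the recurrence lemma and in the resulting bound. In the final
    exponent, 5 comes from v <= w^5, and k + 1 from the range Q < v^E, where b = 1 works as soon as
    the bound exceeds Q^(k+1) / Q^(k+1) = 1.\<close>
  define E where "E = 3 * C + k + 10"
  show ?case
  proof (rule exI[of _ "5 * E * (k + 1)"], intro allI impI)
    fix w Q :: nat and A f
    assume w: "2 \<le> w" and Q: "1 \<le> Q" and p: "polyseq (Suc k) A f" and s: "real Q / real w \<le> norm (\<Sum>n<Q. unit_exp (f n))"
    \<comment> \<open>The square of Q / w is 8 Q^2 / v. After removing the diagonal term, which is
      at most Q^2 / v, and the shifts with correlation below Q / v, enough is left for at least Q /
      v good shifts.\<close>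
    define v where "v = 8 * w ^ 2"
    have v: "v \<ge> 32" using w power_mono[of 2 w 2] by (simp add: v_def)
    have vw: "v \<le> w ^ 5"
    proof -
      have "(8::nat) \<le> w ^ 3" using power_mono[OF w, of 3] by simp
      then show ?thesis unfolding v_def using mult_right_mono[of 8 "w^3" "w^2"] by (simp add: power_add[symmetric])
    qed
    have vE: "v ^ E \<le> w ^ (5 * E)" using power_mono[OF vw, of E] by (simp add: power_mult)
    have wE: "w ^ (5 * E) \<le> w ^ (5 * E * (k+1))" using w by (intro power_increasing) auto
    show "\<exists>b::nat. 1 \<le> b \<and> b \<le> w ^ (5*E*(k+1)) \<and> dist_int (real b * A) \<le> real (w ^ (5*E*(k+1))) / real Q ^ (Suc k)"
    proof (cases "Q \<ge> v ^ E")
      case False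
      have "real Q ^ Suc k \<le> real (w ^ (5*E)) ^ Suc k"
        using False vE by (intro power_mono) auto
      also have "\<dots> = real (w ^ (5*E*(k+1)))" by (simp add: power_mult[symmetric] power_add[symmetric])
      finally have "1 \<le> real (w ^ (5*E*(k+1))) / real Q ^ Suc k" using Q by simp
      then have "dist_int (real 1 * A) \<le> real (w ^ (5*E*(k+1))) / real Q ^ Suc k"
        using dist_int_half[of A] by simp
      then show ?thesis using w by (intro exI[of _ 1]) auto
    next
      case QE: True
      define S where "S = (\<lambda>h. norm (\<Sum>n<Q-h. unit_exp (f (n + h) - f n)))"
      have S_le: "S h \<le> real Q" for h
      proof -
        have "S h \<le> (\<Sum>n<Q-h. norm (unit_exp (f (n + h) - f n)))" unfolding S_def by (rule norm_sum)
        then show ?thesis by simp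
      qed
      have "(real Q / real w)\<^sup>2 \<le> (norm (\<Sum>n<Q. unit_exp (f n)))\<^sup>2"
        using s by (intro power_mono) auto
      also have "\<dots> \<le> real Q + 2 * (\<Sum>h\<in>{1..<Q}. S h)"
        using van_der_corput[of "\<lambda>n. unit_exp (f n)" Q] by (simp add: S_def unit_exp_diff)
      finally have vdc: "(real Q / real w)\<^sup>2 \<le> real Q + 2 * (\<Sum>h\<in>{1..<Q}. S h)" .
      have Qpos: "real Q > 0" and vpos: "real v > 0" and wpos: "real w > 0" using Q v w by auto
      have "v ^ 1 \<le> v ^ E" using v by (intro power_increasing) (auto simp: E_def)
      then have "real v \<le> real Q" using QE by simp
      moreover have Qw: "(real Q / real w)\<^sup>2 = 8 * (real Q)\<^sup>2 / real v" using wpos by (simp add: v_def power_divide)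
      moreover have "(real Q)\<^sup>2 / real v \<ge> real Q"
        using \<open>real v \<le> real Q\<close> vpos Qpos by (simp add: power2_eq_square field_simps)
      ultimately have Ssum: "(\<Sum>h\<in>{1..<Q}. S h) \<ge> 3 * (real Q)\<^sup>2 / real v" using vdc by linarith
      define H where "H = {h\<in>{1..<Q}. S h \<ge> real Q / real v}"
      have finH: "finite H" by (simp add: H_def)
      have "(\<Sum>h\<in>{1..<Q}. S h) \<le> (\<Sum>h\<in>{1..<Q}. (if h \<in> H then real Q else 0) + real Q / real v)"
        using S_le by (intro sum_mono) (auto simp: H_def add_increasing2)
      also have "\<dots> = (\<Sum>h\<in>{1..<Q}. if h \<in> H then real Q else 0) + real (Q - 1) * (real Q / real v)"
        by (simp add: sum.distrib)
      also have "(\<Sum>h\<in>{1..<Q}. if h \<in> H then real Q else 0) = (\<Sum>h\<in>H. real Q)"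
        by (rule sum.mono_neutral_cong_right) (auto simp: H_def)
      also have "(\<Sum>h\<in>H. real Q) = real (card H) * real Q" by simp
      also have "real (Q - 1) * (real Q / real v) \<le> real Q * (real Q / real v)"
        by (intro mult_right_mono) auto
      finally have "real (card H) * real Q \<ge> 2 * (real Q)\<^sup>2 / real v"
        using Ssum by (simp add: power2_eq_square)
      then have cardH: "real (card H) \<ge> real Q / real v"
        using Qpos vpos by (simp add: power2_eq_square field_simps)
      have "\<exists>b::nat. 1 \<le> b \<and> b \<le> v ^ C \<and> dist_int (real b * (A * real h)) \<le> real (v ^ (C + k)) / real Q ^ k" if h: "h \<in> H" for h
      proof -
        have hQ: "1 \<le> Q - h" and Sh: "S h \<ge> real Q / real v" using h by (auto simp: H_def)
        have "S h \<le> (\<Sum>n<Q-h. norm (unit_exp (f (n + h) - f n)))" unfolding S_def by (rule norm_sum)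
        then have "S h \<le> real (Q - h)" by simp
        \<comment> \<open>A sum of Q - h unit terms that reaches Q / v must have Q - h >= Q / v. So
          restating the approximation in terms of Q costs only a factor v^k.\<close>
        then have le: "real Q / real v \<le> real (Q - h)" using Sh by linarith
        have "real (Q - h) / real v \<le> real Q / real v" using vpos by (intro divide_right_mono) auto
        then have "real (Q - h) / real v \<le> norm (\<Sum>n<Q-h. unit_exp (f (n + h) - f n))"
          using Sh by (simp add: S_def)
        then obtain b where b: "1 \<le> b" "b \<le> v ^ C" "dist_int (real b * (A * real h)) \<le> real (v ^ C) / real (Q - h) ^ k"
          using IH[of v "Q - h" "A * real h" "\<lambda>n. f (n + h) - f n"] p hQ v by auto
        have "real (v ^ C) / real (Q - h) ^ k \<le> real (v ^ C) / (real Q / real v) ^ k"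
          using le Qpos vpos hQ by (intro divide_left_mono power_mono mult_pos_pos zero_less_power) auto
        also have "\<dots> = real (v ^ (C + k)) / real Q ^ k" by (simp add: power_divide power_add)
        finally show ?thesis using b by fastforce
      qed
      then obtain B where B: "\<And>h. h \<in> H \<Longrightarrow> 1 \<le> B h \<and> B h \<le> v ^ C \<and> dist_int (real (B h) * (A * real h)) \<le> real (v ^ (C + k)) / real Q ^ k"
        by metis
      \<comment> \<open>Pigeonhole over the v^C possible multipliers: one \<open>b\<close> serves a
        set of shifts of density at least v^-(C+1), on which the frequency \<open>real b * A\<close>
        recurs.\<close>
      have "\<exists>b\<in>{1..v^C}. real (card {h\<in>H. B h = b}) \<ge> real (card H) / real (v ^ C)"
      proof (rule ccontr)
        assume "\<not> ?thesis"
        then have less: "real (card {h\<in>H. B h = b}) < real (card H) / real (v ^ C)" if "b \<in> {1..v^C}" for b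
          using that by force
        have "H = (\<Union>b\<in>{1..v^C}. {h\<in>H. B h = b})" using B by auto
        then have "card H \<le> (\<Sum>b\<in>{1..v^C}. card {h\<in>H. B h = b})"
          using card_UN_le[of "{1..v^C}" "\<lambda>b. {h\<in>H. B h = b}"] by simp
        then have "real (card H) \<le> (\<Sum>b\<in>{1..v^C}. real (card {h\<in>H. B h = b}))"
          by (simp add: of_nat_sum[symmetric] del: of_nat_sum)
        also have "\<dots> < (\<Sum>b\<in>{1..v^C}. real (card H) / real (v ^ C))"
          using v by (intro sum_strict_mono less) auto
        also have "\<dots> = real (card H)" using vpos by simp
        finally show False by simp
      qed
      then obtain b where b: "1 \<le> b" "b \<le> v ^ C" "real (card {h\<in>H. B h = b}) \<ge> real (card H) / real (v ^ C)" by auto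
      define \<eta> where "\<eta> = 1 / real (v ^ (C + 1))"
      define \<epsilon> where "\<epsilon> = real (v ^ (C + k)) / real Q ^ k"
      have "\<exists>b'\<ge>1. real b' \<le> 3 / \<eta> \<and> dist_int (real b' * (real b * A)) \<le> 64 * \<epsilon> / (\<eta>\<^sup>2 * Q)"
      proof (rule recurrence_lemma)
        show "{h\<in>H. B h = b} \<subseteq> {1..Q}" by (auto simp: H_def)
        have "\<eta> * real Q = (real Q / real v) / real (v ^ C)" by (simp add: \<eta>_def)
        also have "\<dots> \<le> real (card H) / real (v ^ C)" using cardH by (intro divide_right_mono) auto
        finally show "\<eta> * real Q \<le> real (card {h\<in>H. B h = b})" using b(3) by linarith
        have "1 \<le> real v ^ (C + 1)" using v by (intro one_le_power) auto
        then show "0 < \<eta>" "\<eta> \<le> 1" by (auto simp: \<eta>_def)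
        show "dist_int (real h * (real b * A)) \<le> \<epsilon>" if "h \<in> {h\<in>H. B h = b}" for h
          using B[of h] that by (simp add: \<epsilon>_def mult_ac)
        show "0 < \<epsilon>" using v Q by (simp add: \<epsilon>_def)
        have "32 * v ^ (2*C+k+1) \<le> v * v ^ (2*C+k+1)" using v by (intro mult_right_mono) auto
        also have "\<dots> = v ^ (2*C+k+2)" by simp
        also have "\<dots> \<le> v ^ E" using v by (intro power_increasing) (auto simp: E_def)
        also have "\<dots> \<le> Q" by (rule QE)
        also have "Q \<le> Q ^ k" using Q step.hyps by (simp add: self_le_power)
        finally have "real (32 * v ^ (2*C+k+1)) \<le> real (Q ^ k)" using of_nat_le_iff by blast
        moreover have "v ^ (2*C+k+1) = v ^ (C+k) * v ^ (C+1)"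
          unfolding power_add[symmetric] by (rule arg_cong[of _ _ "power v"]) simp
        ultimately have "real (32 * (v ^ (C+k) * v ^ (C+1))) \<le> real (Q ^ k)" by (simp only:)
        then have "32 * (real v ^ (C+k) * real v ^ (C+1)) \<le> real Q ^ k" by simp
        then show "\<epsilon> \<le> \<eta> / 32" using vpos Qpos by (simp add: \<epsilon>_def \<eta>_def field_simps)
        have "64 * v ^ (2*(C+1)) \<le> v ^ 2 * v ^ (2*(C+1))"
          using power_mono[OF v, of 2] by (intro mult_right_mono) auto
        also have "\<dots> = v ^ (2*C+4)" by (simp add: power_add numeral_eq_Suc mult_ac)
        also have "\<dots> \<le> v ^ E" using v by (intro power_increasing) (auto simp: E_def)
        finally have "64 * v ^ (2*(C+1)) \<le> Q" using QE by linarith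
        then have "real (64 * v ^ (2*(C+1))) \<le> real Q" using of_nat_le_iff by blast
        moreover have "v ^ (2*(C+1)) = (v ^ (C+1))\<^sup>2" by (simp only: power_mult[symmetric] mult.commute)
        ultimately have "real (64 * (v ^ (C+1))\<^sup>2) \<le> real Q" by (simp only:)
        then show "real Q \<ge> 64 / \<eta>\<^sup>2" by (simp add: \<eta>_def power_divide)
      qed
      then obtain b' where b': "b' \<ge> 1" "real b' \<le> 3 / \<eta>" "dist_int (real b' * (real b * A)) \<le> 64 * \<epsilon> / (\<eta>\<^sup>2 * Q)" by blast
      have "real b' \<le> real (3 * v ^ (C + 1))" using b'(2) by (simp add: \<eta>_def)
      then have "b' \<le> 3 * v ^ (C+1)" using of_nat_le_iff by blast
      also have "\<dots> \<le> v * v ^ (C + 1)" using v by (intro mult_right_mono) auto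
      finally have "b' * b \<le> (v * v ^ (C+1)) * v ^ C" using b(2) by (intro mult_mono) auto
      also have "\<dots> = v ^ (2 * C + 2)" by (simp add: power_add numeral_eq_Suc mult_ac)
      also have "\<dots> \<le> v ^ E" using v by (intro power_increasing) (auto simp: E_def)
      finally have bb: "b' * b \<le> w ^ (5*E*(k+1))" using vE wE by linarith
      have "64 * \<epsilon> / (\<eta>\<^sup>2 * Q) = real (64 * v ^ (3 * C + k + 2)) / real Q ^ Suc k"
        using Qpos vpos by (simp add: \<epsilon>_def \<eta>_def field_simps power_add numeral_eq_Suc)
      also have "64 * v ^ (3 * C + k + 2) \<le> v ^ 2 * v ^ (3 * C + k + 2)"
        using power_mono[OF v, of 2] by (intro mult_right_mono) auto
      then have "real (64 * v ^ (3 * C + k + 2)) / real Q ^ Suc k \<le> real (v ^ 2 * v ^ (3 * C + k + 2)) / real Q ^ Suc k"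
        by (intro divide_right_mono) (use of_nat_le_iff in blast, simp)
      also have "v ^ 2 * v ^ (3 * C + k + 2) = v ^ (3 * C + k + 4)" by (simp add: power_add numeral_eq_Suc mult_ac)
      also have "v ^ (3 * C + k + 4) \<le> v ^ E" using v by (intro power_increasing) (auto simp: E_def)
      then have "v ^ (3 * C + k + 4) \<le> w ^ (5*E*(k+1))" using vE wE by linarith
      then have "real (v ^ (3 * C + k + 4)) / real Q ^ Suc k \<le> real (w ^ (5*E*(k+1))) / real Q ^ Suc k"
        by (intro divide_right_mono) (use of_nat_le_iff in blast, simp)
      finally have "dist_int (real (b' * b) * A) \<le> real (w ^ (5*E*(k+1))) / real Q ^ Suc k"
        using b'(3) by (simp add: mult.assoc)
      then show ?thesis using bb b(1) b'(1) by (intro exI[of _ "b' * b"]) auto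
    qed
  qed
qed

section \<open>Simultaneous recurrence for powers\<close>

definition minor :: "nat \<Rightarrow> (nat \<Rightarrow> nat \<Rightarrow> int) \<Rightarrow> (nat \<Rightarrow> nat) \<Rightarrow> int" where
  "minor j rs cs = Determinant.det (Matrix.mat j j (\<lambda>(a, b). rs a (cs b)))"

lemma minor_0: "minor 0 rs cs = 1"
  unfolding minor_def by (rule det_dim_zero) simp

text \<open>Leibniz expansion, one term for each permutation. The factorial is harmless: for D <= u
  it is at most a power of u with exponent linear in D.\<close>

lemma abs_minor_le:
  assumes "\<And>a b. a < j \<Longrightarrow> b < j \<Longrightarrow> \<bar>rs a (cs b)\<bar> \<le> M"
  shows "\<bar>minor j rs cs\<bar> \<le> fact j * M ^ j"
proof -
  let ?A = "Matrix.mat j j (\<lambda>(a, b). rs a (cs b))"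
  have eq: "minor j rs cs = (\<Sum>p\<in>{p. p permutes {0..<j}}. signof p * (\<Prod>i = 0..<j. ?A $$ (i, p i)))"
    unfolding minor_def by (rule det_def') simp
  have "\<bar>minor j rs cs\<bar> \<le> (\<Sum>p\<in>{p. p permutes {0..<j}}. \<bar>signof p * (\<Prod>i = 0..<j. ?A $$ (i, p i))\<bar>)"
    unfolding eq by (rule sum_abs)
  also have "\<dots> \<le> (\<Sum>p\<in>{p. p permutes {0..<j}}. M ^ j)"
  proof (rule sum_mono)
    fix p assume "p \<in> {p. p permutes {0..<j}}"
    then have p: "p permutes {0..<j}" by simp
    have "\<bar>signof p * (\<Prod>i = 0..<j. ?A $$ (i, p i))\<bar> = (\<Prod>i = 0..<j. \<bar>?A $$ (i, p i)\<bar>)"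
      by (simp add: abs_mult abs_prod sign_def)
    also have "\<dots> \<le> (\<Prod>i = 0..<j. M)"
      using permutes_in_image[OF p] assms by (intro prod_mono) auto
    finally show "\<bar>signof p * (\<Prod>i = 0..<j. ?A $$ (i, p i))\<bar> \<le> M ^ j" by simp
  qed
  also have "\<dots> = fact j * M ^ j" by (simp add: card_permutations[of _ j])
  finally show ?thesis .
qed

text \<open>A repeated column makes the determinant vanish. This bounds the rank: a nonzero minor of
  size \<open>j\<close> with columns below \<open>D\<close> has j <= D.\<close>

lemma minor_inj_cols:
  assumes "minor j rs cs \<noteq> 0" shows "inj_on cs {..<j}"
proof (rule inj_onI, rule ccontr)
  fix a b assume ab: "a \<in> {..<j}" "b \<in> {..<j}" "cs a = cs b" "a \<noteq> b"
  have "minor j rs cs = 0"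
    unfolding minor_def
    by (rule det_identical_columns[OF _ ab(4)]) (use ab in \<open>auto intro!: eq_vecI\<close>)
  then show False using assms by simp
qed

text \<open>The cofactors of the last column do not involve \<open>c\<close>, so expanding the bordered minors gives one
  relation for all coordinates, whose common denominator is the minor itself.\<close>
lemma minor_bordered:
  assumes zero: "\<And>c. c < D \<Longrightarrow> minor (Suc j) (rs(j := m)) (cs(j := c)) = 0"
    and bound: "\<And>a i. a < j \<Longrightarrow> i < D \<Longrightarrow> \<bar>rs a i\<bar> \<le> M" "\<And>i. i < D \<Longrightarrow> \<bar>m i\<bar> \<le> M"
    and cs: "\<And>b. b < j \<Longrightarrow> cs b < D"
  shows "\<exists>h. (\<forall>a<j. \<bar>h a\<bar> \<le> fact j * M ^ j) \<and> (\<forall>c<D. minor j rs cs * m c = (\<Sum>a<j. h a * rs a c))"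
proof -
  define rw where "rw = rs(j := m)"
  \<comment> \<open>\<open>skip i\<close> enumerates the row indices other than \<open>i\<close>,
    that is, deletes row \<open>i\<close>.\<close>
  define skip where "skip i a = (if a < i then a else Suc a)" for i a :: nat
  define cf where "cf i = (- 1) ^ (i + j) * minor j (\<lambda>a. rw (skip i a)) cs" for i
  have exp: "minor (Suc j) rw (cs(j := c)) = (\<Sum>i<Suc j. rw i c * cf i)" for c
  proof -
    let ?A = "Matrix.mat (Suc j) (Suc j) (\<lambda>(a, b). rw a ((cs(j := c)) b))"
    have "minor (Suc j) rw (cs(j := c)) = (\<Sum>i<Suc j. ?A $$ (i, j) * cofactor ?A i j)"
      unfolding minor_def by (rule laplace_expansion_column) auto
    also have "\<dots> = (\<Sum>i<Suc j. rw i c * cf i)"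
    proof (rule sum.cong)
      fix i assume i: "i \<in> {..<Suc j}"
      have "mat_delete ?A i j = Matrix.mat j j (\<lambda>(a, b). rw (skip i a) (cs b))"
        by (rule eq_matI) (auto simp: mat_delete_def skip_def)
      then show "?A $$ (i, j) * cofactor ?A i j = rw i c * cf i"
        using i by (simp add: cofactor_def cf_def minor_def)
    qed simp
    finally show ?thesis .
  qed
  have "cf j = minor j rs cs"
  proof -
    have "Matrix.mat j j (\<lambda>(a, b). rw (skip j a) (cs b)) = Matrix.mat j j (\<lambda>(a, b). rs a (cs b))"
      by (rule eq_matI) (simp_all add: rw_def skip_def)
    then show ?thesis by (simp add: cf_def minor_def)
  qed
  then have eq: "minor j rs cs * m c = (\<Sum>a<j. (- cf a) * rs a c)" if "c < D" for c
  proof -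
    have "(\<Sum>a<j. rw a c * cf a) = (\<Sum>a<j. cf a * rs a c)"
      by (rule sum.cong) (auto simp: rw_def)
    then show ?thesis
      using exp[of c] zero[OF that] \<open>cf j = minor j rs cs\<close> by (simp add: rw_def sum_negf mult.commute)
  qed
  have "\<bar>- cf a\<bar> \<le> fact j * M ^ j" if "a < j" for a
  proof -
    have "\<bar>- cf a\<bar> = \<bar>minor j (\<lambda>i. rw (skip a i)) cs\<bar>" by (simp add: cf_def abs_mult power_abs)
    also have "\<dots> \<le> fact j * M ^ j"
      by (rule abs_minor_le) (auto simp: rw_def skip_def intro!: bound cs)
    finally show ?thesis .
  qed
  then show ?thesis using eq by (intro exI[of _ "\<lambda>a. - cf a"]) auto
qed

section \<open>A trigonometric bump function and its decay\<close>

definition dot :: "nat \<Rightarrow> (nat \<Rightarrow> int) \<Rightarrow> (nat \<Rightarrow> real) \<Rightarrow> real" where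
  "dot D m x = (\<Sum>i<D. of_int (m i) * x i)"

lemma dot_cmult: "dot D m (\<lambda>i. c * x i) = c * dot D m x"
  by (simp add: dot_def sum_distrib_left mult_ac)

text \<open>The cosine is the mean of two conjugate exponentials, and the power expands binomially.
  The even exponent makes all frequencies integers j - M, and the coefficients are visibly
  nonnegative.\<close>

lemma cos_power_fourier:
  "complex_of_real (cos (pi * x) ^ (2 * M)) =
     (\<Sum>j\<le>2*M. of_real (real ((2*M) choose j) / 4 ^ M) * unit_exp (of_int (int j - int M) * x))"
proof -
  have "complex_of_real (cos (pi * x)) = (cis (pi * x) + cis (- (pi * x))) / 2"
    by (simp add: complex_eq_iff)
  then have "complex_of_real (cos (pi * x) ^ (2 * M)) = (cis (pi * x) + cis (- (pi * x))) ^ (2 * M) / 4 ^ M"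
    by (simp only: of_real_power power_divide) (simp add: power_mult)
  also have "\<dots> = (\<Sum>j\<le>2*M. of_nat ((2*M) choose j) * cis (pi * x) ^ j * cis (- (pi * x)) ^ (2*M - j)) / 4 ^ M"
    by (simp add: binomial_ring)
  also have "\<dots> = (\<Sum>j\<le>2*M. of_real (real ((2*M) choose j) / 4 ^ M) * unit_exp (of_int (int j - int M) * x))"
    unfolding sum_divide_distrib
  proof (rule sum.cong)
    fix j assume "j \<in> {..2*M}"
    then have j: "real (2*M - j) = 2 * real M - real j" by (simp add: of_nat_diff)
    have "cis (pi * x) ^ j * cis (- (pi * x)) ^ (2*M - j) = cis (real j * (pi * x) + real (2*M - j) * (- (pi * x)))"
      by (simp only: Complex.DeMoivre cis_mult)
    also have "\<dots> = unit_exp (of_int (int j - int M) * x)"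
      unfolding unit_exp_cis j by (rule arg_cong[of _ _ cis]) (simp add: algebra_simps)
    finally show "of_nat ((2*M) choose j) * cis (pi * x) ^ j * cis (- (pi * x)) ^ (2*M - j) / 4 ^ M =
       of_real (real ((2*M) choose j) / 4 ^ M) * unit_exp (of_int (int j - int M) * x)"
      by (simp add: mult.assoc)
  qed simp
  finally show ?thesis .
qed

text \<open>A bump function with values in \<open>[0,1]\<close> and nonnegative Fourier coefficients.\<close>
lemma cos_product_fourier:
  assumes "M \<ge> 1"
  obtains G :: "(nat \<Rightarrow> nat) set" and c m z where "finite G" "\<And>g. g \<in> G \<Longrightarrow> 0 \<le> c g" "(\<Sum>g\<in>G. c g) = 1"
     "\<And>g i. g \<in> G \<Longrightarrow> i < D \<Longrightarrow> \<bar>m g i\<bar> \<le> int M" "z \<in> G" "\<And>i. m z i = 0 \<or> i \<ge> D" "1 / real ((2 * M) ^ D) \<le> c z"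
     "\<And>x. complex_of_real (\<Prod>i<D. cos (pi * x i) ^ (2*M)) = (\<Sum>g\<in>G. of_real (c g) * unit_exp (dot D (m g) x))"
proof -
  define G where "G = PiE {..<D} (\<lambda>_. {..2*M})"
  define c where "c g = (\<Prod>i<D. real ((2*M) choose (g i)) / 4 ^ M)" for g
  define m where "m g i = int (g i) - int M" for g :: "nat \<Rightarrow> nat" and i
  define z where "z = (\<lambda>i\<in>{..<D}. M)"
  have fourier: "complex_of_real (\<Prod>i<D. cos (pi * x i) ^ (2*M)) = (\<Sum>g\<in>G. of_real (c g) * unit_exp (dot D (m g) x))" for x
  proof -
    have "complex_of_real (\<Prod>i<D. cos (pi * x i) ^ (2*M)) =
      (\<Prod>i<D. \<Sum>j\<le>2*M. of_real (real ((2*M) choose j) / 4 ^ M) * unit_exp (of_int (int j - int M) * x i))"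
      unfolding of_real_prod cos_power_fourier ..
    also have "\<dots> = (\<Sum>g\<in>G. \<Prod>i<D. of_real (real ((2*M) choose (g i)) / 4 ^ M) * unit_exp (of_int (int (g i) - int M) * x i))"
      unfolding G_def by (rule prod_sum_PiE) auto
    also have "\<dots> = (\<Sum>g\<in>G. of_real (c g) * unit_exp (dot D (m g) x))"
      unfolding c_def m_def dot_def unit_exp_sum of_real_prod prod.distrib ..
    finally show ?thesis .
  qed
  have "complex_of_real (\<Sum>g\<in>G. c g) = 1"
    using fourier[of "\<lambda>_. 0"] by (simp add: dot_def)
  then have 1: "(\<Sum>g\<in>G. c g) = 1" using of_real_eq_1_iff by blast
  \<comment> \<open>The central coefficient loses only a factor 2 M in each variable. The constant
    term of the product is therefore as large as (2 M)^-D, so the Weyl sums need only be large up to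
    a factor whose logarithm is of order D log u.\<close>
  have "1 / real (2 * M) \<le> real ((2*M) choose M) / 4 ^ M"
    using central_binomial_lower_bound[of M] assms by (simp add: field_simps)
  then have "(\<Prod>i<D. 1 / real (2 * M)) \<le> c z"
    unfolding c_def z_def by (intro prod_mono) auto
  then have "1 / real ((2 * M) ^ D) \<le> c z" by (simp add: power_one_over)
  moreover have "finite G" unfolding G_def by (intro finite_PiE) auto
  moreover have "z \<in> G" by (auto simp: G_def z_def)
  moreover have "\<bar>m g i\<bar> \<le> int M" if "g \<in> G" "i < D" for g i
  proof -
    have "g i \<le> 2 * M" using that unfolding G_def by (auto dest: PiE_mem)
    then show ?thesis by (simp add: m_def)
  qed
  moreover have "m z i = 0 \<or> i \<ge> D" for i by (auto simp: m_def z_def)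
  moreover have "0 \<le> c g" for g unfolding c_def by (auto intro!: prod_nonneg)
  ultimately show ?thesis using fourier 1 that[of G c m z] by presburger
qed

text \<open>One coordinate at distance more than 1/u from the integers gives cos^2 <= 1 - 4/u^2 <=
  exp (- 4/u^2). The exponent u^5 turns this into exp (- 4 u^3), which for D <= u beats the constant
  Fourier coefficient (2 u^5)^-D even after division by 8.\<close>

lemma cos_product_small:
  assumes u: "u \<ge> 2" "D \<le> u" and far: "i < D" "dist_int (x i) > 1 / real u"
  shows "(\<Prod>i<D. cos (pi * x i) ^ (2 * u ^ 5)) \<le> 1 / real (8 * (2 * u ^ 5) ^ D)"
proof -
  have upos: "real u > 0" using u by simp
  have "(\<Prod>i<D. cos (pi * x i) ^ (2 * u ^ 5)) = (\<Prod>j\<in>{..<D} - {i}. cos (pi * x j) ^ (2 * u ^ 5)) * cos (pi * x i) ^ (2 * u ^ 5)"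
    using far(1) by (subst prod.remove[of _ i]) auto
  also have "\<dots> \<le> 1 * cos (pi * x i) ^ (2 * u ^ 5)"
  proof (rule mult_right_mono)
    have c: "0 \<le> cos y ^ (2*n)" "cos y ^ (2*n) \<le> 1" for y :: real and n
      by (simp_all add: power_mult abs_square_le_1 power_le_one)
    show "(\<Prod>j\<in>{..<D} - {i}. cos (pi * x j) ^ (2 * u ^ 5)) \<le> 1"
      by (intro prod_le_1) (use c in auto)
    show "0 \<le> cos (pi * x i) ^ (2 * u ^ 5)" by (rule c)
  qed
  also have "1 * cos (pi * x i) ^ (2 * u ^ 5) = (1 - (sin (pi * x i))\<^sup>2) ^ (u ^ 5)"
    by (simp add: power_mult cos_squared_eq)
  also have "\<dots> \<le> exp (- (4 / (real u)\<^sup>2)) ^ (u ^ 5)"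
  proof (rule power_mono)
    have "2 / real u \<le> 2 * dist_int (x i)" using far(2) by simp
    also have "\<dots> \<le> sin (pi * dist_int (x i))" using dist_int_half by (intro sin_pi_ge) auto
    finally have "2 / real u \<le> \<bar>sin (pi * x i)\<bar>" by (simp add: sin_pi_dist_int)
    then have "(2 / real u)\<^sup>2 \<le> (sin (pi * x i))\<^sup>2" using power_mono[of "2 / real u" "\<bar>sin (pi * x i)\<bar>" 2] by simp
    then have "1 - (sin (pi * x i))\<^sup>2 \<le> 1 + (- (4 / (real u)\<^sup>2))" by (simp add: power_divide)
    also have "\<dots> \<le> exp (- (4 / (real u)\<^sup>2))" by (rule exp_ge_add_one_self)
    finally show "1 - (sin (pi * x i))\<^sup>2 \<le> exp (- (4 / (real u)\<^sup>2))" .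
    show "0 \<le> 1 - (sin (pi * x i))\<^sup>2" by (simp add: abs_square_le_1)
  qed
  also have "\<dots> = exp (- (4 * real u ^ 3))"
  proof -
    have "real (u ^ 5) * (- (4 / (real u)\<^sup>2)) = - (4 * real u ^ 3)"
      using upos by (simp add: field_simps numeral_eq_Suc)
    then show ?thesis using exp_of_nat_mult[of "u ^ 5" "- (4 / (real u)\<^sup>2)"] by simp
  qed
  also have "\<dots> \<le> exp (- ln (real (8 * (2 * u ^ 5) ^ D)))"
  proof -
    have "ln (real (8 * (2 * u ^ 5) ^ D)) = ln 8 + real D * (ln 2 + 5 * ln (real u))"
      using upos by (simp add: ln_mult ln_realpow algebra_simps)
    also have "\<dots> \<le> 3 + real u * (ln (real u) + 5 * ln (real u))"
    proof (intro add_mono mult_mono)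
      have "ln (8::real) = 3 * ln 2" using ln_realpow[of 2 3] by simp
      then show "ln (8::real) \<le> 3" using ln_2_less_1 by simp
      show "ln 2 \<le> ln (real u)" using u by simp
    qed (use u in auto)
    also have "\<dots> \<le> 3 + real u * (6 * (real u - 1))"
      using ln_le_minus_one[of "real u"] upos by (intro add_left_mono mult_left_mono) auto
    also have "\<dots> \<le> 4 * real u ^ 3"
    proof -
      have "real u ^ 3 \<ge> 2 * (real u)\<^sup>2" using u upos by (simp add: power3_eq_cube power2_eq_square)
      moreover have "(real u)\<^sup>2 \<ge> 4" using u power_mono[of 2 "real u" 2] by simp
      moreover have "real u * (6 * (real u - 1)) = 6 * (real u)\<^sup>2 - 6 * real u" by (simp add: algebra_simps power2_eq_square)
      ultimately show ?thesis using u by linarith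
    qed
    finally show ?thesis by simp
  qed
  also have "\<dots> = 1 / real (8 * (2 * u ^ 5) ^ D)" using upos by (simp add: exp_minus inverse_eq_divide)
  finally show ?thesis .
qed

text \<open>
  At stage \<open>j\<close> there are \<open>j\<close> independent integer vectors \<open>m\<close> with \<open>b\<^sup>k (m \<cdot> \<alpha>)\<close> nearly integral. If no
  multiple of \<open>b\<close> is good, a further independent vector is found, at the cost of a factor \<open>G\<close> in \<open>b\<close>;
  the scales \<open>QQ j\<close> decrease fast enough for the old relations to remain accurate. This stops at rank \<open>D\<close>.
\<close>
lemma simultaneous_recurrence_aux:
  assumes k: "k \<ge> 1" and D: "D \<ge> 1" "D \<le> u" and u: "u \<ge> 2"
    and weyl: "\<And>w Q A f. w \<ge> 2 \<Longrightarrow> Q \<ge> 1 \<Longrightarrow> polyseq k A f \<Longrightarrow> real Q / real w \<le> norm (\<Sum>n<Q. unit_exp (f n)) \<Longrightarrow>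
     \<exists>b::nat. 1 \<le> b \<and> b \<le> w ^ C \<and> dist_int (real b * A) \<le> real (w ^ C) / real Q ^ k"
    and w_def: "w = 8 * (2 * u ^ 5) ^ D" and H_def: "H = fact D * (u ^ 5) ^ D"
    and G_def: "G = 8 * D * H * fact k * w ^ C"
  shows "\<exists>q\<ge>1. q \<le> G ^ (4 * D + 4) \<and> (\<forall>i<D. dist_int (real q ^ k * \<alpha> i) \<le> 1 / real u)"
proof (rule ccontr)
  assume neg: "\<not> ?thesis"
  define M where "M = u ^ 5"
  have M1: "M \<ge> 1" using u by (simp add: M_def)
  have w2: "w \<ge> 2" and H1: "H \<ge> 1"
    using u by (auto simp: w_def H_def Suc_le_eq)
  have HG: "8 * D * H \<le> G" and wG: "w ^ C * fact k * H \<le> G" and kG: "w ^ C * fact k \<le> G"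
  proof -
    have "fact k * w ^ C \<ge> 1" using w2 by (simp add: Suc_le_eq)
    then have "8 * D * H * 1 \<le> 8 * D * H * (fact k * w ^ C)" by (rule mult_le_mono2)
    then show "8 * D * H \<le> G" unfolding G_def by (simp only: mult.assoc mult_1_right)
    have "1 * (w ^ C * fact k * H) \<le> 8 * D * (w ^ C * fact k * H)" using D by (intro mult_right_mono) auto
    then show 1: "w ^ C * fact k * H \<le> G" unfolding G_def by (simp add: mult_ac)
    have "w ^ C * fact k * 1 \<le> w ^ C * fact k * H" using H1 by (intro mult_left_mono) auto
    then show "w ^ C * fact k \<le> G" using 1 by linarith
  qed
  have G1: "G \<ge> 1"
  proof -
    have "1 * 1 \<le> 8 * D * H" using D H1 by (intro mult_mono) auto
    then show ?thesis using HG by linarith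
  qed
  \<comment> \<open>Three powers of \<open>G\<close> per stage: relations are kept accurate up to
    the margin \<open>G ^ (2 * k)\<close>, which uses two, and passing to the next stage multiplies
    errors, in terms of the old scale, up to \<open>G ^ k\<close>, which uses the third.\<close>
  define QQ where "QQ j = G ^ (3 * (D + 1 - j))" for j
  obtain F :: "(nat \<Rightarrow> nat) set" and c m z where F: "finite F" "\<And>g. g \<in> F \<Longrightarrow> 0 \<le> c g" "(\<Sum>g\<in>F. c g) = 1"
     "\<And>g i. g \<in> F \<Longrightarrow> i < D \<Longrightarrow> \<bar>m g i\<bar> \<le> int M" "z \<in> F" "\<And>i. m z i = 0 \<or> i \<ge> D" "1 / real ((2 * M) ^ D) \<le> c z"
     "\<And>x. complex_of_real (\<Prod>i<D. cos (pi * x i) ^ (2*M)) = (\<Sum>g\<in>F. of_real (c g) * unit_exp (dot D (m g) x))"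
    by (rule cos_product_fourier[OF M1, of D]) (rule that; assumption)
  define stage where "stage j \<longleftrightarrow> (\<exists>rs cs b. (\<forall>a<j. \<forall>i<D. \<bar>rs a i\<bar> \<le> int M) \<and> (\<forall>a<j. cs a < D) \<and>
     minor j rs cs \<noteq> 0 \<and> 1 \<le> b \<and> b \<le> G ^ j \<and>
     (\<forall>a<j. dist_int (real b ^ k * dot D (rs a) \<alpha>) \<le> 1 / real (G ^ (2 * k) * QQ j ^ k)))" for j
  have stage_le: "j \<le> D" if st: "stage j" for j
  proof -
    obtain rs cs where "\<forall>a<j. cs a < D" "minor j rs cs \<noteq> 0" using st unfolding stage_def by blast
    then have "inj_on cs {..<j}" "cs ` {..<j} \<subseteq> {..<D}" by (auto intro: minor_inj_cols)
    then have "card {..<j} \<le> card {..<D}" by (rule card_inj_on_le) simp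
    then show ?thesis by simp
  qed
  have step: "stage (Suc j)" if st: "stage j" for j
  proof -
    have jD: "j \<le> D" by (rule stage_le[OF st])
    obtain rs cs b where rs: "\<And>a i. a < j \<Longrightarrow> i < D \<Longrightarrow> \<bar>rs a i\<bar> \<le> int M" and cs: "\<And>a. a < j \<Longrightarrow> cs a < D"
      and nz: "minor j rs cs \<noteq> 0" and b: "1 \<le> b" "b \<le> G ^ j"
      and rel: "\<And>a. a < j \<Longrightarrow> dist_int (real b ^ k * dot D (rs a) \<alpha>) \<le> 1 / real (G ^ (2 * k) * QQ j ^ k)"
      using st unfolding stage_def by blast
    define \<Delta> where "\<Delta> = nat \<bar>minor j rs cs\<bar>"
    have factH: "fact j * int M ^ j \<le> int H"
    proof -
      have "fact j * M ^ j \<le> H" unfolding H_def M_def using jD u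
        by (intro mult_mono power_increasing fact_mono_nat) auto
      then have "int (fact j * M ^ j) \<le> int H" by (simp only: of_nat_le_iff)
      then show ?thesis by simp
    qed
    have \<Delta>: "1 \<le> \<Delta>" "\<Delta> \<le> H"
    proof -
      show "1 \<le> \<Delta>" using nz unfolding \<Delta>_def by linarith
      have "\<bar>minor j rs cs\<bar> \<le> fact j * int M ^ j" by (rule abs_minor_le) (use rs cs in auto)
      then show "\<Delta> \<le> H" using factH unfolding \<Delta>_def by linarith
    qed
    \<comment> \<open>The minor is the common denominator of all vectors dependent on the
      \<open>j\<close> old ones. With this multiplier every such vector \<open>m\<close> has
      \<beta>^k (m \<cdot> \<alpha>) nearly integral, so a phase that is not nearly integral must
      come from an independent vector.\<close>
    define \<beta> where "\<beta> = \<Delta> * b"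
    define Q where "Q = QQ j"
    have Q1: "1 \<le> Q" using G1 by (simp add: Q_def QQ_def)
    have \<beta>1: "1 \<le> \<beta>" using \<Delta> b by (simp add: \<beta>_def)
    have HG': "H \<le> G"
    proof -
      have "1 * H \<le> 8 * D * H" using D by (intro mult_right_mono) auto
      then show ?thesis using HG by linarith
    qed
    define \<theta> where "\<theta> g = real \<beta> ^ k * dot D (m g) \<alpha>" for g
    define S where "S g = (\<Sum>n<Q. unit_exp (\<theta> g * real (n + 1) ^ k))" for g
    text \<open>If no \<open>q\<close> works, all cosine products are small, and then some Weyl sum must cancel the constant coefficient.\<close>
    have "\<exists>g\<in>F. Re (S g) < real Q / 2 \<and> real Q / real w \<le> norm (S g)"
    proof (rule ccontr)
      assume "\<not> ?thesis"
      then have alt: "real Q / 2 \<le> Re (S g) \<or> norm (S g) < real Q / real w" if "g \<in> F" for g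
        using that by force
      have Wn: "(\<Prod>i<D. cos (pi * (real (\<beta> * (n + 1)) ^ k * \<alpha> i)) ^ (2*M)) \<le> 1 / real w" if "n < Q" for n
      proof -
        have "\<beta> * (n + 1) \<le> (G * G ^ j) * QQ j"
          using \<Delta>(2) HG' b(2) that unfolding \<beta>_def Q_def by (intro mult_mono) auto
        also have "\<dots> = G ^ (j + 1 + 3 * (D + 1 - j))" by (simp add: QQ_def power_add)
        also have "\<dots> \<le> G ^ (4 * D + 4)" using G1 jD by (intro power_increasing) auto
        finally have "\<not> (\<forall>i<D. dist_int (real (\<beta> * (n + 1)) ^ k * \<alpha> i) \<le> 1 / real u)"
          using neg \<beta>1 by (metis le_add2 mult_le_mono nat_mult_1)
        then obtain i where "i < D" "dist_int (real (\<beta> * (n + 1)) ^ k * \<alpha> i) > 1 / real u" by force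
        then show ?thesis unfolding M_def w_def
          using cos_product_small[OF u D(2), of i "\<lambda>i. real (\<beta> * (n + 1)) ^ k * \<alpha> i"] by blast
      qed
      have th: "dot D (m g) (\<lambda>i. real (\<beta> * (n + 1)) ^ k * \<alpha> i) = \<theta> g * real (n + 1) ^ k" for g n
        unfolding dot_cmult \<theta>_def of_nat_mult power_mult_distrib by (simp only: mult_ac)
      have "complex_of_real (\<Sum>n<Q. \<Prod>i<D. cos (pi * (real (\<beta> * (n + 1)) ^ k * \<alpha> i)) ^ (2*M))
          = (\<Sum>n<Q. \<Sum>g\<in>F. of_real (c g) * unit_exp (\<theta> g * real (n + 1) ^ k))"
        unfolding of_real_sum F(8) th ..
      also have "\<dots> = (\<Sum>g\<in>F. of_real (c g) * S g)"
        by (subst sum.swap) (simp add: S_def sum_distrib_left)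
      finally have eq: "complex_of_real (\<Sum>n<Q. \<Prod>i<D. cos (pi * (real (\<beta> * (n + 1)) ^ k * \<alpha> i)) ^ (2*M)) = (\<Sum>g\<in>F. of_real (c g) * S g)" .
      have "Re (\<Sum>g\<in>F. of_real (c g) * S g) = (\<Sum>n<Q. \<Prod>i<D. cos (pi * (real (\<beta> * (n + 1)) ^ k * \<alpha> i)) ^ (2*M))"
        unfolding eq[symmetric] by (rule Re_complex_of_real)
      also have "\<dots> \<le> (\<Sum>n<Q. 1 / real w)" by (intro sum_mono Wn) auto
      finally have upper: "(\<Sum>g\<in>F. c g * Re (S g)) \<le> real Q / real w" by simp
      \<comment> \<open>The frequency 0 has coefficient at least 8 / w and contributes 8 Q / w,
        while all other terms together are at least - Q / w. Their sum would exceed Q / w, the bound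
        for the average of the bump.\<close>
      have Sz: "Re (S z) = real Q"
      proof -
        have "dot D (m z) \<alpha> = 0" unfolding dot_def using F(6) by (intro sum.neutral) (metis lessThan_iff mult_eq_0_iff not_less of_int_0)
        then show ?thesis by (simp add: S_def \<theta>_def)
      qed
      have "(\<Sum>g\<in>F. c g * Re (S g)) = c z * Re (S z) + (\<Sum>g\<in>F - {z}. c g * Re (S g))"
        using F(1,5) by (rule sum.remove)
      moreover have "(\<Sum>g\<in>F - {z}. c g * Re (S g)) \<ge> (\<Sum>g\<in>F - {z}. c g * (- (real Q / real w)))"
      proof (intro sum_mono mult_left_mono)
        fix g assume g: "g \<in> F - {z}"
        have n: "\<bar>Re (S g)\<bar> \<le> norm (S g)" by (rule abs_Re_le_cmod)
        have p: "0 \<le> real Q / real w" by simp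
        have "real Q / 2 \<le> Re (S g) \<or> norm (S g) < real Q / real w" using alt g by blast
        then show "- (real Q / real w) \<le> Re (S g)"
        proof
          assume "real Q / 2 \<le> Re (S g)"
          then show ?thesis using p by linarith
        next
          assume "norm (S g) < real Q / real w"
          then show ?thesis using n by linarith
        qed
      qed (use F(2) in auto)
      moreover have "(\<Sum>g\<in>F - {z}. c g * (- (real Q / real w))) \<ge> - (real Q / real w)"
      proof -
        have "(\<Sum>g\<in>F - {z}. c g) \<le> 1" using F(1,2,3) by (metis Diff_iff Diff_subset sum_mono2)
        then have "(\<Sum>g\<in>F - {z}. c g) * (real Q / real w) \<le> 1 * (real Q / real w)" by (intro mult_right_mono) auto
        then show ?thesis by (simp add: sum_distrib_right[symmetric] sum_negf sum_divide_distrib[symmetric])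
      qed
      moreover have "c z * Re (S z) \<ge> 8 / real w * real Q"
        unfolding Sz using F(7) by (intro mult_right_mono) (auto simp: w_def M_def)
      moreover have "8 / real w * real Q = 8 * (real Q / real w)" by simp
      moreover have "real Q / real w > 0" using Q1 w2 by simp
      ultimately show False using upper by linarith
    qed
    then obtain g where g: "g \<in> F" "Re (S g) < real Q / 2" "real Q / real w \<le> norm (S g)" by blast
    \<comment> \<open>If all bordered minors vanished, \<open>m g\<close> would depend on the old
      vectors, all phases of \<open>S g\<close> would be within 1/8 of integers, and the real part
      of \<open>S g\<close> would be at least Q / 2.\<close>
    have "\<exists>c<D. minor (Suc j) (rs(j := m g)) (cs(j := c)) \<noteq> 0"
    proof (rule ccontr)
      assume "\<not> ?thesis"
      then obtain h where h: "\<And>a. a < j \<Longrightarrow> \<bar>h a\<bar> \<le> fact j * int M ^ j"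
        "\<And>c. c < D \<Longrightarrow> minor j rs cs * m g c = (\<Sum>a<j. h a * rs a c)"
        using minor_bordered[of D j rs "m g" cs "int M"] rs cs F(4)[OF g(1)] by blast
      have comb: "of_int (minor j rs cs) * dot D (m g) \<alpha> = (\<Sum>a<j. of_int (h a) * dot D (rs a) \<alpha>)"
      proof -
        have "of_int (minor j rs cs) * dot D (m g) \<alpha> = (\<Sum>i<D. of_int (minor j rs cs * m g i) * \<alpha> i)"
          by (simp add: dot_def sum_distrib_left mult_ac)
        also have "\<dots> = (\<Sum>i<D. \<Sum>a<j. of_int (h a) * (of_int (rs a i) * \<alpha> i))"
        proof (rule sum.cong)
          fix i assume "i \<in> {..<D}"
          then have "minor j rs cs * m g i = (\<Sum>a<j. h a * rs a i)" using h(2) by simp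
          then show "of_int (minor j rs cs * m g i) * \<alpha> i = (\<Sum>a<j. of_int (h a) * (of_int (rs a i) * \<alpha> i))"
            by (simp add: sum_distrib_right mult.assoc)
        qed simp
        also have "\<dots> = (\<Sum>a<j. of_int (h a) * dot D (rs a) \<alpha>)"
          by (subst sum.swap) (simp add: dot_def sum_distrib_left)
        finally show ?thesis .
      qed
      have small: "dist_int (\<theta> g * real (n + 1) ^ k) \<le> 1 / 8" if "n < Q" for n
      proof -
        define q where "q = n + 1"
        have q: "q \<le> Q" using that by (simp add: q_def)
        obtain k' where k': "k = Suc k'" using k by (cases k) auto
        define sg where "sg = sgn (minor j rs cs)"
        have \<Delta>m: "int \<Delta> = sg * minor j rs cs" unfolding \<Delta>_def sg_def by (simp add: abs_sgn[symmetric] mult.commute[of "sgn _"])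
        \<comment> \<open>One factor \<Delta> of \<Delta>^k clears the denominator of the relation.
          The other k' = k - 1 factors only enlarge the error, by at most H^k'.\<close>
        have "\<theta> g * real q ^ k = real (q ^ k * \<Delta> ^ k') * (real b ^ k * (real \<Delta> * dot D (m g) \<alpha>))"
          by (simp add: \<theta>_def \<beta>_def k' power_mult_distrib mult_ac)
        also have "real \<Delta> * dot D (m g) \<alpha> = of_int sg * (\<Sum>a<j. of_int (h a) * dot D (rs a) \<alpha>)"
        proof -
          have "real \<Delta> = real_of_int (int \<Delta>)" by simp
          also have "\<dots> = of_int sg * of_int (minor j rs cs)" unfolding \<Delta>m by simp
          finally have "real \<Delta> = of_int sg * of_int (minor j rs cs)" .
          then show ?thesis by (simp add: mult.assoc comb)
        qed
        also have "real b ^ k * (of_int sg * (\<Sum>a<j. of_int (h a) * dot D (rs a) \<alpha>)) =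
           (\<Sum>a<j. of_int (sg * h a) * (real b ^ k * dot D (rs a) \<alpha>))"
          by (simp add: sum_distrib_left mult_ac)
        finally have "dist_int (\<theta> g * real q ^ k) \<le> real (q ^ k * \<Delta> ^ k') * dist_int (\<Sum>a<j. of_int (sg * h a) * (real b ^ k * dot D (rs a) \<alpha>))"
          using dist_int_mult_nat by metis
        also have "\<dots> \<le> real (Q ^ k * H ^ k') * (\<Sum>a<j. real H * (1 / real (G ^ (2 * k) * Q ^ k)))"
        proof (intro mult_mono)
          show "real (q ^ k * \<Delta> ^ k') \<le> real (Q ^ k * H ^ k')"
            using q \<Delta>(2) by (intro of_nat_mono mult_mono power_mono) auto
          have "dist_int (\<Sum>a<j. of_int (sg * h a) * (real b ^ k * dot D (rs a) \<alpha>)) \<le>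
             (\<Sum>a<j. dist_int (of_int (sg * h a) * (real b ^ k * dot D (rs a) \<alpha>)))" by (rule dist_int_sum)
          also have "\<dots> \<le> (\<Sum>a<j. real H * (1 / real (G ^ (2 * k) * Q ^ k)))"
          proof (rule sum_mono)
            fix a assume a: "a \<in> {..<j}"
            have "\<bar>sg * h a\<bar> \<le> 1 * (fact j * int M ^ j)" unfolding abs_mult
              using h(1)[of a] a by (intro mult_mono) (auto simp: sg_def abs_sgn_eq)
            then have "\<bar>real_of_int (sg * h a)\<bar> \<le> real H" using factH by linarith
            then show "dist_int (of_int (sg * h a) * (real b ^ k * dot D (rs a) \<alpha>)) \<le> real H * (1 / real (G ^ (2 * k) * Q ^ k))"
              using rel[of a] a by (intro order_trans[OF dist_int_mult] mult_mono) (auto simp: Q_def)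
          qed
          finally show "dist_int (\<Sum>a<j. of_int (sg * h a) * (real b ^ k * dot D (rs a) \<alpha>)) \<le> (\<Sum>a<j. real H * (1 / real (G ^ (2 * k) * Q ^ k)))" .
        qed auto
        also have "\<dots> = real j * real (H ^ k) / real (G ^ (2 * k))" using Q1 by (simp add: k' field_simps)
        also have "\<dots> \<le> 1 / 8"
        proof -
          have "8 * (j * H ^ k) \<le> 8 * (D * H ^ k)" using jD by simp
          also have "\<dots> = (8 * D) * H ^ k" by simp
          also have "\<dots> \<le> (8 * D) ^ k * H ^ k" using D k by (intro mult_right_mono self_le_power) auto
          also have "\<dots> = (8 * D * H) ^ k" by (simp add: power_mult_distrib)
          also have "\<dots> \<le> G ^ k" by (intro power_mono HG) auto
          also have "\<dots> \<le> G ^ (2 * k)" using G1 by (intro power_increasing) auto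
          finally have "real (8 * (j * H ^ k)) \<le> real (G ^ (2 * k))" by (rule of_nat_mono)
          then show ?thesis using G1 by (simp add: field_simps)
        qed
        finally show ?thesis by (simp add: q_def)
      qed
      have "(\<Sum>n<Q. 1 / 2) \<le> (\<Sum>n<Q. Re (unit_exp (\<theta> g * real (n + 1) ^ k)))"
        by (intro sum_mono Re_unit_exp_ge small) auto
      then show False using g(2) by (simp add: S_def)
    qed
    then obtain cc where cc: "cc < D" "minor (Suc j) (rs(j := m g)) (cs(j := cc)) \<noteq> 0" by blast
    have "polyseq k (fact k * \<theta> g) (\<lambda>n. \<theta> g * real (n + 1) ^ k)"
      using polyseq_shift[OF polyseq_power, of k "\<theta> g" 1] by simp
    then obtain b' where b': "1 \<le> b'" "b' \<le> w ^ C" "dist_int (real b' * (fact k * \<theta> g)) \<le> real (w ^ C) / real Q ^ k"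
      using weyl[OF w2 Q1 _ g(3)[unfolded S_def]] by blast
    \<comment> \<open>Weyl's inequality controls \<open>fact k\<close> times the leading
      coefficient. Taking \<open>fact k\<close> into the multiplier makes r^k a multiple of the
      controlled factor b' k!.\<close>
    define r where "r = b' * fact k"
    have r: "1 \<le> r" "r \<le> w ^ C * fact k" using b' by (auto simp: r_def)
    have QQj: "QQ j = G ^ 3 * QQ (Suc j)"
    proof -
      have "3 * (D + 1 - j) = 3 + 3 * (D + 1 - Suc j)" using jD by simp
      then show ?thesis by (simp only: QQ_def power_add)
    qed
    have Gpos: "real G > 0" using G1 by simp
    have Qpos: "real (QQ (Suc j)) > 0" using G1 by (simp add: QQ_def)
    have tauj: "1 / real (G ^ (2 * k) * QQ (Suc j) ^ k) = real G ^ k / real (QQ j) ^ k"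
      unfolding QQj using Gpos Qpos by (simp add: power_mult_distrib field_simps power_mult[symmetric] power_add[symmetric])
    have "stage (Suc j)"
      unfolding stage_def
    proof (intro exI[of _ "rs(j := m g)"] exI[of _ "cs(j := cc)"] exI[of _ "r * \<beta>"] conjI allI impI)
      show "\<bar>(rs(j := m g)) a i\<bar> \<le> int M" if "a < Suc j" "i < D" for a i
        using that rs F(4)[OF g(1)] by (auto simp: less_Suc_eq)
      show "(cs(j := cc)) a < D" if "a < Suc j" for a
        using that cs cc(1) by (auto simp: less_Suc_eq)
      show "minor (Suc j) (rs(j := m g)) (cs(j := cc)) \<noteq> 0" by (rule cc)
      show "1 \<le> r * \<beta>" using r \<beta>1 by simp
      have "r * \<beta> \<le> (w ^ C * fact k) * (H * G ^ j)"
        unfolding \<beta>_def using r \<Delta> b by (intro mult_mono) auto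
      also have "\<dots> \<le> G * G ^ j" using wG by (simp add: mult.assoc[symmetric])
      finally show "r * \<beta> \<le> G ^ Suc j" by simp
      show "dist_int (real (r * \<beta>) ^ k * dot D ((rs(j := m g)) a) \<alpha>) \<le> 1 / real (G ^ (2 * k) * QQ (Suc j) ^ k)"
        if "a < Suc j" for a
      proof (cases "a = j")
        case True
        obtain k' where k': "k = Suc k'" using k by (cases k) auto
        have "real (r * \<beta>) ^ k * dot D (m g) \<alpha> = real (r ^ k') * (real b' * (fact k * \<theta> g))"
          by (simp add: k' \<theta>_def r_def power_mult_distrib mult_ac del: fact_Suc)
        then have "dist_int (real (r * \<beta>) ^ k * dot D (m g) \<alpha>) \<le> real (r ^ k') * (real (w ^ C) / real Q ^ k)"
          using dist_int_mult_nat[of "r ^ k'" "real b' * (fact k * \<theta> g)"] b'(3)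
          by (simp only:) (meson mult_left_mono of_nat_0_le_iff order_trans)
        also have "\<dots> \<le> real (G ^ k') * (real G / real Q ^ k)"
        proof -
          have "w ^ C \<le> w ^ C * fact k" by simp
          then have "w ^ C \<le> G" "r \<le> G" using kG r by linarith+
          then show ?thesis by (intro mult_mono divide_right_mono of_nat_mono power_mono) auto
        qed
        also have "\<dots> = real G ^ k / real (QQ j) ^ k" by (simp add: k' Q_def)
        finally show ?thesis using True tauj by simp
      next
        case False
        then have a: "a < j" using that by simp
        have "real (r * \<beta>) ^ k * dot D (rs a) \<alpha> = real ((r * \<Delta>) ^ k) * (real b ^ k * dot D (rs a) \<alpha>)"
          by (simp add: \<beta>_def power_mult_distrib mult_ac)
        then have "dist_int (real (r * \<beta>) ^ k * dot D (rs a) \<alpha>) \<le> real ((r * \<Delta>) ^ k) * (1 / real (G ^ (2 * k) * QQ j ^ k))"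
          using dist_int_mult_nat[of "(r * \<Delta>) ^ k" "real b ^ k * dot D (rs a) \<alpha>"] rel[OF a]
          by (simp only:) (meson mult_left_mono of_nat_0_le_iff order_trans)
        also have "\<dots> \<le> real (G ^ k) * (1 / real (QQ j ^ k))"
        proof (intro mult_mono divide_left_mono)
          have "r * \<Delta> \<le> w ^ C * fact k * H" using r \<Delta> by (intro mult_mono) auto
          then show "real ((r * \<Delta>) ^ k) \<le> real (G ^ k)" using wG by (intro of_nat_mono power_mono) auto
          show "real (QQ j ^ k) \<le> real (G ^ (2 * k) * QQ j ^ k)"
            using G1 by (intro of_nat_mono) simp
        qed (use Gpos QQj Qpos in auto)
        also have "\<dots> = real G ^ k / real (QQ j) ^ k" by simp
        finally show ?thesis using False tauj by simp
      qed
    qed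
    then show ?thesis .
  qed
  have "stage j" for j
  proof (induction j)
    case 0
    have "minor 0 (\<lambda>_ _. 0) (\<lambda>_. 0) \<noteq> 0" by (simp add: minor_0)
    then show ?case unfolding stage_def by (intro exI[of _ "\<lambda>_ _. 0"] exI[of _ "\<lambda>_. 0"] exI[of _ 1]) auto
  qed (rule step)
  then have "Suc D \<le> D" by (rule stage_le)
  then show False by simp
qed

text \<open>Every factor of \<open>G\<close> is at most a power of u with exponent linear in D, and
  \<open>G\<close> is raised to the power 4 D + 4; this is where D^2 comes from. The polynomial
  exponent is what allows as many as a power of 1/t frequencies later on.\<close>

lemma simultaneous_recurrence:
  assumes k: "k \<ge> 1"
  obtains C :: nat where "\<And>D u \<alpha>. D \<ge> 1 \<Longrightarrow> u \<ge> 2 \<Longrightarrow> D \<le> u \<Longrightarrow>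
     \<exists>q\<ge>1. q \<le> u ^ (C * D\<^sup>2) \<and> (\<forall>i<D. dist_int (real q ^ k * \<alpha> i) \<le> 1 / real u)"
proof -
  obtain C where weyl: "\<And>w Q A f. w \<ge> 2 \<Longrightarrow> Q \<ge> 1 \<Longrightarrow> polyseq k A f \<Longrightarrow> real Q / real w \<le> norm (\<Sum>n<Q. unit_exp (f n)) \<Longrightarrow>
     \<exists>b::nat. 1 \<le> b \<and> b \<le> w ^ C \<and> dist_int (real b * A) \<le> real (w ^ C) / real Q ^ k"
    using weyl[OF k] by blast
  define E where "E = 10 + k * k + 9 * C"
  show ?thesis
  proof (rule that[of "8 * E"])
    fix D u :: nat and \<alpha> :: "nat \<Rightarrow> real"
    assume D: "D \<ge> 1" and u: "u \<ge> 2" and Du: "D \<le> u"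
    define w where "w = 8 * (2 * u ^ 5) ^ D"
    define H where "H = fact D * (u ^ 5) ^ D"
    define G where "G = 8 * D * H * fact k * w ^ C"
    have eight: "8 \<le> u ^ 3" using power_mono[OF u, of 3] by simp
    have "2 * u ^ 5 \<le> u * u ^ 5" using u by (rule mult_right_mono) simp
    then have "2 * u ^ 5 \<le> u ^ 6" by (simp add: numeral_eq_Suc)
    then have "w \<le> u ^ 3 * (u ^ 6) ^ D"
      unfolding w_def using eight by (intro mult_mono power_mono) auto
    also have "\<dots> \<le> u ^ (3 * D) * (u ^ 6) ^ D" using u D by (intro mult_right_mono power_increasing) auto
    also have "\<dots> = u ^ (9 * D)" by (simp only: power_mult[symmetric] power_add[symmetric]) simp
    finally have "w ^ C \<le> (u ^ (9 * D)) ^ C" by (intro power_mono) auto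
    then have wC: "w ^ C \<le> u ^ (9 * C * D)" by (simp add: power_mult[symmetric] mult_ac)
    have "fact D \<le> D ^ D" using fact_le_power[of D, where ?'a = nat] by simp
    also have "\<dots> \<le> u ^ D" using Du by (intro power_mono) auto
    finally have "H \<le> u ^ D * (u ^ 5) ^ D" unfolding H_def by (intro mult_right_mono) auto
    also have "\<dots> = u ^ (6 * D)" by (simp only: power_mult[symmetric] power_add[symmetric]) simp
    finally have H: "H \<le> u ^ (6 * D)" .
    have "fact k \<le> k ^ k" using fact_le_power[of k, where ?'a = nat] by simp
    also have "\<dots> \<le> (2 ^ k) ^ k" by (rule power_mono) (auto intro: less_imp_le less_exp)
    also have "\<dots> \<le> (u ^ k) ^ k" using u by (intro power_mono) auto
    also have "\<dots> = u ^ (k * k)" by (simp add: power_mult)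
    also have "\<dots> \<le> u ^ (k * k * D)" using u D by (intro power_increasing) auto
    finally have fk: "fact k \<le> u ^ (k * k * D)" .
    have "G \<le> u ^ 3 * u * u ^ (6 * D) * u ^ (k * k * D) * u ^ (9 * C * D)"
      unfolding G_def using eight Du H fk wC by (intro mult_mono) auto
    also have "\<dots> = u ^ (4 + 6 * D + k * k * D + 9 * C * D)" by (simp add: power_add numeral_eq_Suc)
    also have "\<dots> \<le> u ^ (E * D)" using u D by (intro power_increasing) (auto simp: E_def algebra_simps)
    finally have "G ^ (4 * D + 4) \<le> (u ^ (E * D)) ^ (4 * D + 4)" by (intro power_mono) auto
    also have "\<dots> = u ^ (E * D * (4 * D + 4))" by (simp only: power_mult)
    also have "\<dots> \<le> u ^ (8 * E * D\<^sup>2)" using u D by (intro power_increasing) (auto simp: power2_eq_square)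
    finally have "G ^ (4 * D + 4) \<le> u ^ (8 * E * D\<^sup>2)" .
    moreover have "\<exists>q\<ge>1. q \<le> G ^ (4 * D + 4) \<and> (\<forall>i<D. dist_int (real q ^ k * \<alpha> i) \<le> 1 / real u)"
      by (rule simultaneous_recurrence_aux[OF k D Du u weyl w_def H_def G_def])
    ultimately show "\<exists>q\<ge>1. q \<le> u ^ (8 * E * D\<^sup>2) \<and> (\<forall>i<D. dist_int (real q ^ k * \<alpha> i) \<le> 1 / real u)"
      using le_trans by blast
  qed
qed

section \<open>Polynomial functions\<close>

definition affine_pt :: "int ^ 'd \<Rightarrow> nat \<Rightarrow> int ^ 'd \<Rightarrow> int ^ 'd" where
  "affine_pt x q y = (\<chi> i. x $ i + int q * y $ i)"

lemma affine_pt_affine_pt: "affine_pt x q (affine_pt x' q' y) = affine_pt (affine_pt x q x') (q * q') y"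
  by (simp add: affine_pt_def Finite_Cartesian_Product.vec_eq_iff algebra_simps)

lemma inj_affine_pt: "q \<ge> 1 \<Longrightarrow> inj (affine_pt x q)"
  by (auto simp: inj_def affine_pt_def Finite_Cartesian_Product.vec_eq_iff)

text \<open>Degree at most \<open>k\<close>, with real coefficients. Only the coordinate rule passes
  to a new index, by one, so rule induction can follow the leading form.\<close>

inductive polyfun :: "nat \<Rightarrow> (int ^ 'd \<Rightarrow> real) \<Rightarrow> bool" where
  const: "polyfun k (\<lambda>_. c)"
| coord: "polyfun k f \<Longrightarrow> polyfun (Suc k) (\<lambda>n. of_int (n $ i) * f n)"
| add: "polyfun k f \<Longrightarrow> polyfun k g \<Longrightarrow> polyfun k (\<lambda>n. f n + g n)"

lemma polyfun_Suc: "polyfun k f \<Longrightarrow> polyfun (Suc k) f"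
  by (induction rule: polyfun.induct) (auto intro: polyfun.intros)

lemma polyfun_mono: "k \<le> k' \<Longrightarrow> polyfun k f \<Longrightarrow> polyfun k' f"
  by (induction rule: dec_induct) (auto intro: polyfun_Suc)

lemma polyfun_cmult: "polyfun k f \<Longrightarrow> polyfun k (\<lambda>n. c * f n)"
proof (induction rule: polyfun.induct)
  case (coord k f i)
  from polyfun.coord[OF coord.IH, of i] show ?case by (simp add: mult_ac)
next
  case (add k f g)
  from polyfun.add[OF add.IH] show ?case by (simp add: distrib_left)
qed (rule polyfun.const)

lemma polyfun_sum: "(\<And>i. i \<in> I \<Longrightarrow> polyfun k (f i)) \<Longrightarrow> polyfun k (\<lambda>n. \<Sum>i\<in>I. f i n)"
  by (induction I rule: infinite_finite_induct) (auto intro: polyfun.intros)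

lemma polyfun_mult: "polyfun a f \<Longrightarrow> polyfun b g \<Longrightarrow> polyfun (a + b) (\<lambda>n. f n * g n)"
proof (induction rule: polyfun.induct)
  case (const k c)
  then show ?case by (intro polyfun_cmult) (rule polyfun_mono, auto)
next
  case (coord k f i)
  from polyfun.coord[OF coord.IH[OF coord.prems], of i] show ?case by (simp add: mult_ac)
next
  case (add k f h)
  from polyfun.add[OF add.IH(1)[OF add.prems] add.IH(2)[OF add.prems]] show ?case by (simp add: distrib_right)
qed

lemma polyfun_affine: "polyfun k f \<Longrightarrow> polyfun k (\<lambda>y. f (affine_pt x q y))"
proof (induction rule: polyfun.induct)
  case (coord k f i)
  have "polyfun (Suc k) (\<lambda>y. of_int (x $ i) * f (affine_pt x q y) + real q * (of_int (y $ i) * f (affine_pt x q y)))"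
    by (intro polyfun.add polyfun_cmult polyfun.coord coord.IH polyfun_Suc)
  then show ?case by (simp add: affine_pt_def algebra_simps)
qed (auto intro: polyfun.intros)

lemma polyfun_0: "polyfun k f \<Longrightarrow> k = 0 \<Longrightarrow> \<exists>c. f = (\<lambda>_. c)"
  by (induction rule: polyfun.induct) auto

text \<open>Ordered words index monomials redundantly, so that multiplication by a coordinate is
  just a new first letter and no multi-indices are needed; there are d^k words of length k.\<close>

definition monom_word :: "'d list \<Rightarrow> int ^ 'd \<Rightarrow> int" where
  "monom_word w y = prod_list (map (\<lambda>i. y $ i) w)"

definition words :: "nat \<Rightarrow> 'd list set" where
  "words k = {w. length w = k}"

lemma finite_words [simp]: "finite (words k :: 'd::finite list set)"
  and card_words: "card (words k :: 'd::finite list set) = CARD('d) ^ k"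
  using finite_lists_length_eq[of "UNIV :: 'd set" k] card_lists_length_eq[of "UNIV :: 'd set" k]
  by (simp_all add: words_def)

lemma words_0: "words 0 = {[]}"
  by (auto simp: words_def)

lemma words_Suc: "words (Suc k) = (\<lambda>(i, w). i # w) ` (UNIV \<times> words k)"
  by (auto simp: words_def length_Suc_conv image_iff)

lemma sum_words_Suc:
  fixes F :: "'d::finite list \<Rightarrow> 'a::comm_monoid_add"
  shows "(\<Sum>w\<in>words (Suc k). F w) = (\<Sum>i\<in>UNIV. \<Sum>w\<in>words k. F (i # w))"
  unfolding words_Suc by (subst sum.reindex) (auto simp: inj_on_def sum.cartesian_product intro!: sum.cong)

text \<open>Degree strictly below \<open>k\<close>. In degree 0 this has to mean the zero function,
  which \<open>polyfun\<close> cannot express by its index.\<close>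

primrec lower_polyfun :: "nat \<Rightarrow> (int ^ 'd \<Rightarrow> real) \<Rightarrow> bool" where
  "lower_polyfun 0 h \<longleftrightarrow> h = (\<lambda>_. 0)"
| "lower_polyfun (Suc k) h \<longleftrightarrow> polyfun k h"

text \<open>The coefficients \<open>c\<close> are the same for all \<open>x\<close> and
  \<open>q\<close>: a translation leaves the top form unchanged and the dilation scales it by q^k.
  So one \<open>q\<close> that makes all q^k c nearly integral works for every translate of a
  cell.\<close>

lemma polyfun_leading:
  fixes f :: "int ^ 'd::finite \<Rightarrow> real"
  shows "polyfun k f \<Longrightarrow> \<exists>c. \<forall>x q. lower_polyfun k
     (\<lambda>y. f (affine_pt x q y) - (\<Sum>w\<in>words k. real q ^ k * c w * of_int (monom_word w y)))"
proof (induction rule: polyfun.induct)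
  case (const k c0)
  show ?case
  proof (cases k)
    case 0
    then show ?thesis by (intro exI[of _ "\<lambda>_. c0"]) (simp add: words_0 monom_word_def)
  next
    case (Suc k')
    then show ?thesis by (intro exI[of _ "\<lambda>_. 0"]) (simp add: polyfun.const)
  qed
next
  case (coord k g i)
  then obtain c where c: "\<And>x q. lower_polyfun k
     (\<lambda>y. g (affine_pt x q y) - (\<Sum>w\<in>words k. real q ^ k * c w * of_int (monom_word w y)))" by blast
  \<comment> \<open>Multiplying the leading form by coordinate \<open>i\<close> puts the letter
    \<open>i\<close> in front of each word; the terms with x $ i, or with the old remainder, have
    lower degree.\<close>
  define c' where "c' w = (if hd w = i then c (tl w) else 0)" for w
  show ?case
  proof (intro exI[of _ c'] allI)
    fix x :: "int ^ 'd" and q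
    define h where "h y = g (affine_pt x q y) - (\<Sum>w\<in>words k. real q ^ k * c w * of_int (monom_word w y))" for y
    have "lower_polyfun k h" unfolding h_def by (rule c)
    then have yh: "polyfun k (\<lambda>y. of_int (y $ i) * h y)"
      by (cases k) (auto intro: polyfun.intros)
    have sum: "(\<Sum>w\<in>words (Suc k). real q ^ Suc k * c' w * of_int (monom_word w y)) =
       real q * of_int (y $ i) * (\<Sum>w\<in>words k. real q ^ k * c w * of_int (monom_word w y))" for y
    proof -
      have "(\<Sum>w\<in>words (Suc k). real q ^ Suc k * c' w * of_int (monom_word w y)) =
         (\<Sum>j\<in>UNIV. if j = i then (\<Sum>w\<in>words k. real q ^ Suc k * c w * of_int (y $ i * monom_word w y)) else 0)"
        unfolding sum_words_Suc by (rule sum.cong) (auto simp: c'_def monom_word_def)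
      also have "\<dots> = (\<Sum>w\<in>words k. real q ^ Suc k * c w * of_int (y $ i * monom_word w y))" by simp
      finally show ?thesis by (simp add: sum_distrib_left mult_ac)
    qed
    have "polyfun k (\<lambda>y. of_int (x $ i) * g (affine_pt x q y) + real q * (of_int (y $ i) * h y))"
      by (intro polyfun.add polyfun_cmult polyfun_affine coord.hyps yh)
    moreover have "of_int (x $ i) * g (affine_pt x q y) + real q * (of_int (y $ i) * h y) =
       of_int (affine_pt x q y $ i) * g (affine_pt x q y) - (\<Sum>w\<in>words (Suc k). real q ^ Suc k * c' w * of_int (monom_word w y))" for y
      unfolding sum h_def by (simp add: affine_pt_def algebra_simps)
    ultimately show "lower_polyfun (Suc k) (\<lambda>y. of_int (affine_pt x q y $ i) * g (affine_pt x q y) -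
       (\<Sum>w\<in>words (Suc k). real q ^ Suc k * c' w * of_int (monom_word w y)))" by simp
  qed
next
  case (add k f g)
  then obtain c c' where c: "\<And>x q. lower_polyfun k
     (\<lambda>y. f (affine_pt x q y) - (\<Sum>w\<in>words k. real q ^ k * c w * of_int (monom_word w y)))"
     and c': "\<And>x q. lower_polyfun k
     (\<lambda>y. g (affine_pt x q y) - (\<Sum>w\<in>words k. real q ^ k * c' w * of_int (monom_word w y)))" by blast
  have lower_add: "lower_polyfun k (\<lambda>y. a y + b y)" if "lower_polyfun k a" "lower_polyfun k b" for a b
    using that by (cases k) (auto intro: polyfun.intros simp: fun_eq_iff)
  show ?case
  proof (intro exI[of _ "\<lambda>w. c w + c' w"] allI)
    fix x :: "int ^ 'd" and q
    from lower_add[OF c[of x q] c'[of x q]]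
    show "lower_polyfun k (\<lambda>y. f (affine_pt x q y) + g (affine_pt x q y) -
       (\<Sum>w\<in>words k. real q ^ k * (c w + c' w) * of_int (monom_word w y)))"
      by (simp add: algebra_simps sum.distrib)
  qed
qed

section \<open>Cells\<close>

lemma grid_eq_Pi: "grid N = (\<lambda>f. \<chi> i. f i) ` (UNIV \<rightarrow>\<^sub>E {1..int N} :: ('d::finite \<Rightarrow> int) set)"
proof (intro Set.set_eqI iffI)
  fix x :: "int ^ 'd" assume "x \<in> grid N"
  then show "x \<in> (\<lambda>f. \<chi> i. f i) ` (UNIV \<rightarrow>\<^sub>E {1..int N})"
    by (intro image_eqI[of _ _ "\<lambda>i. x $ i"]) (auto simp: grid_def)
qed (auto simp: grid_def PiE_iff)

lemma finite_grid [simp]: "finite (grid N :: (int ^ 'd::finite) set)"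
  unfolding grid_eq_Pi by (intro finite_imageI finite_PiE) auto

lemma card_grid: "card (grid N :: (int ^ 'd::finite) set) = N ^ CARD('d)"
proof -
  have "inj_on (\<lambda>f. (\<chi> i. f i) :: int ^ 'd) (UNIV \<rightarrow>\<^sub>E {1..int N} :: ('d \<Rightarrow> int) set)"
    by (auto simp: inj_on_def Finite_Cartesian_Product.vec_eq_iff fun_eq_iff)
  then show ?thesis unfolding grid_eq_Pi by (simp add: card_image card_PiE)
qed

lemma grid_mono: "N \<le> N' \<Longrightarrow> grid N \<subseteq> grid N'"
  unfolding grid_def by (intro Collect_mono impI allI) (meson order_trans of_nat_mono)

lemma density_le_1:
  fixes A :: "(int ^ 'd::finite) set"
  assumes "A \<subseteq> grid N" shows "real (card A) / real N ^ CARD('d) \<le> 1"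
proof -
  have "card A \<le> card (grid N :: (int ^ 'd) set)" using assms by (intro card_mono) auto
  then have "real (card A) \<le> real (N ^ CARD('d))" unfolding card_grid by (rule of_nat_mono)
  then show ?thesis by (cases "N = 0") (simp_all add: divide_le_eq_1)
qed

definition cell :: "nat \<Rightarrow> (int ^ 'd) \<times> nat \<Rightarrow> (int ^ 'd) set" where
  "cell L p = affine_pt (fst p) (snd p) ` grid L"

lemma finite_cell [simp]: "finite (cell L p :: (int ^ 'd::finite) set)"
  by (simp add: cell_def)

lemma card_cell: "snd p \<ge> 1 \<Longrightarrow> card (cell L p :: (int ^ 'd::finite) set) = L ^ CARD('d)"
  unfolding cell_def using inj_affine_pt by (subst card_image) (auto simp: card_grid intro: inj_on_subset)

definition cell_system :: "nat \<Rightarrow> nat \<Rightarrow> ((int ^ 'd) \<times> nat) set \<Rightarrow> bool" where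
  "cell_system N L \<C> \<longleftrightarrow> finite \<C> \<and> (\<forall>p\<in>\<C>. snd p \<ge> 1 \<and> cell L p \<subseteq> grid N) \<and> disjoint_family_on (cell L) \<C>"

abbreviation uncovered :: "nat \<Rightarrow> nat \<Rightarrow> ((int ^ 'd) \<times> nat) set \<Rightarrow> (int ^ 'd) set" where
  "uncovered N L \<C> \<equiv> grid N - (\<Union>p\<in>\<C>. cell L p)"

lemma card_cell_system:
  fixes \<C> :: "((int ^ 'd::finite) \<times> nat) set"
  assumes "cell_system N L \<C>"
  shows "card (\<Union>p\<in>\<C>. cell L p) = card \<C> * L ^ CARD('d)" "card \<C> * L ^ CARD('d) \<le> N ^ CARD('d)"
proof -
  have "card (\<Union>p\<in>\<C>. cell L p) = (\<Sum>p\<in>\<C>. card (cell L p))"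
    by (rule card_UN_disjoint) (use assms in \<open>auto simp: cell_system_def disjoint_family_on_def\<close>)
  also have "\<dots> = (\<Sum>p\<in>\<C>. L ^ CARD('d))"
    by (rule sum.cong) (use assms in \<open>auto simp: cell_system_def card_cell\<close>)
  finally show 1: "card (\<Union>p\<in>\<C>. cell L p) = card \<C> * L ^ CARD('d)" by simp
  have "(\<Union>p\<in>\<C>. cell L p) \<subseteq> grid N" using assms by (auto simp: cell_system_def)
  then have "card (\<Union>p\<in>\<C>. cell L p) \<le> card (grid N :: (int ^ 'd) set)" by (intro card_mono) auto
  then show "card \<C> * L ^ CARD('d) \<le> N ^ CARD('d)" unfolding 1 card_grid .
qed

text \<open>Subdividing every cell of a system. The exceptional proportions add up, since the pieces
  missed inside the cells are a proportion \<rho>' of their union, which has at most N^d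
  points.\<close>

lemma cell_system_compose:
  fixes \<C> :: "((int ^ 'd::finite) \<times> nat) set"
  assumes \<C>: "cell_system N M \<C>" and \<D>: "\<And>p. p \<in> \<C> \<Longrightarrow> cell_system M L (\<D> p)"
    and rem: "real (card (uncovered N M \<C>)) \<le> \<rho> * real N ^ CARD('d)"
    and rem': "\<And>p. p \<in> \<C> \<Longrightarrow> real (card (uncovered M L (\<D> p))) \<le> \<rho>' * real M ^ CARD('d)"
    and \<rho>': "0 \<le> \<rho>'"
    and \<E>: "\<E> = (\<Union>p\<in>\<C>. (\<lambda>p'. (affine_pt (fst p) (snd p) (fst p'), snd p * snd p')) ` \<D> p)"
  shows "cell_system N L \<E>" "real (card (uncovered N L \<E>)) \<le> (\<rho> + \<rho>') * real N ^ CARD('d)"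
proof -
  have cell: "cell L (affine_pt (fst p) (snd p) (fst p'), snd p * snd p') = affine_pt (fst p) (snd p) ` cell L p'" for p p' :: "(int ^ 'd) \<times> nat"
    by (simp add: cell_def image_image affine_pt_affine_pt)
  have sub: "cell L (affine_pt (fst p) (snd p) (fst p'), snd p * snd p') \<subseteq> cell M p" if "p \<in> \<C>" "p' \<in> \<D> p" for p p'
    unfolding cell using \<D>[OF that(1)] that(2) by (auto simp: cell_system_def cell_def[of M])
  have finC: "finite \<C>" using \<C> by (simp add: cell_system_def)
  show "cell_system N L \<E>"
    unfolding cell_system_def
  proof (intro conjI ballI)
    show "finite \<E>" unfolding \<E> using finC \<D> by (auto simp: cell_system_def)
    fix e assume "e \<in> \<E>"
    then obtain p p' where p: "p \<in> \<C>" "p' \<in> \<D> p" "e = (affine_pt (fst p) (snd p) (fst p'), snd p * snd p')"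
      unfolding \<E> by blast
    show "1 \<le> snd e" using p \<C> \<D>[OF p(1)] by (auto simp: cell_system_def Suc_le_eq)
    show "cell L e \<subseteq> grid N" using sub[OF p(1,2)] p \<C> by (auto simp: cell_system_def)
  next
    show "disjoint_family_on (cell L) \<E>"
      unfolding disjoint_family_on_def
    proof (intro ballI impI)
      fix e f assume "e \<in> \<E>" "f \<in> \<E>" "e \<noteq> f"
      obtain p p' where p: "p \<in> \<C>" "p' \<in> \<D> p" "e = (affine_pt (fst p) (snd p) (fst p'), snd p * snd p')"
        using \<open>e \<in> \<E>\<close> unfolding \<E> by blast
      obtain r r' where r: "r \<in> \<C>" "r' \<in> \<D> r" "f = (affine_pt (fst r) (snd r) (fst r'), snd r * snd r')"
        using \<open>f \<in> \<E>\<close> unfolding \<E> by blast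
      show "cell L e \<inter> cell L f = {}"
      proof (cases "p = r")
        case True
        then have "p' \<noteq> r'" using \<open>e \<noteq> f\<close> p r by auto
        then have "cell L p' \<inter> cell L r' = {}"
          using \<D>[OF p(1)] p(2) r(2) True by (auto simp: cell_system_def disjoint_family_on_def)
        moreover have "inj (affine_pt (fst p) (snd p))"
          using p(1) \<C> by (intro inj_affine_pt) (auto simp: cell_system_def)
        ultimately show ?thesis unfolding p(3) r(3) True cell
          by (metis True image_Int image_empty)
      next
        case False
        then have "cell M p \<inter> cell M r = {}"
          using \<C> p(1) r(1) by (auto simp: cell_system_def disjoint_family_on_def)
        then show ?thesis using sub[OF p(1,2)] sub[OF r(1,2)] p(3) r(3) by auto
      qed
    qed
  qed
  have cover: "grid N - (\<Union>p\<in>\<E>. cell L p) \<subseteq>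
     (uncovered N M \<C>) \<union> (\<Union>p\<in>\<C>. affine_pt (fst p) (snd p) ` (uncovered M L (\<D> p)))"
  proof
    fix n assume n: "n \<in> grid N - (\<Union>p\<in>\<E>. cell L p)"
    show "n \<in> (uncovered N M \<C>) \<union> (\<Union>p\<in>\<C>. affine_pt (fst p) (snd p) ` (uncovered M L (\<D> p)))"
    proof (cases "n \<in> (\<Union>p\<in>\<C>. cell M p)")
      case True
      then obtain p y where p: "p \<in> \<C>" "y \<in> grid M" "n = affine_pt (fst p) (snd p) y" by (auto simp: cell_def)
      have "y \<notin> cell L p'" if p': "p' \<in> \<D> p" for p'
      proof
        assume "y \<in> cell L p'"
        then have "n \<in> cell L (affine_pt (fst p) (snd p) (fst p'), snd p * snd p')" unfolding cell p(3) by blast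
        moreover have "(affine_pt (fst p) (snd p) (fst p'), snd p * snd p') \<in> \<E>" unfolding \<E> using p(1) p' by blast
        ultimately show False using n by blast
      qed
      then show ?thesis using p by blast
    qed (use n in blast)
  qed
  let ?R = "\<Union>p\<in>\<C>. affine_pt (fst p) (snd p) ` (uncovered M L (\<D> p))"
  have "card (uncovered N L \<E>) \<le>
     card ((uncovered N M \<C>) \<union> (\<Union>p\<in>\<C>. affine_pt (fst p) (snd p) ` (uncovered M L (\<D> p))))"
    by (rule card_mono[OF _ cover]) (use finC in auto)
  also have "\<dots> \<le> card (uncovered N M \<C>) + card (\<Union>p\<in>\<C>. affine_pt (fst p) (snd p) ` (uncovered M L (\<D> p)))"
    by (rule card_Un_le)
  finally have A: "card (uncovered N L \<E>) \<le> card (uncovered N M \<C>) + card ?R" .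
  have "card ?R \<le>
     (\<Sum>p\<in>\<C>. card (affine_pt (fst p) (snd p) ` (uncovered M L (\<D> p))))"
    by (rule card_UN_le[OF finC])
  also have "\<dots> \<le> (\<Sum>p\<in>\<C>. card (uncovered M L (\<D> p)))"
    by (intro sum_mono card_image_le) auto
  finally have "card (uncovered N L \<E>) \<le>
     card (uncovered N M \<C>) + (\<Sum>p\<in>\<C>. card (uncovered M L (\<D> p)))"
    using A by linarith
  then have "real (card (uncovered N L \<E>)) \<le>
     real (card (uncovered N M \<C>) + (\<Sum>p\<in>\<C>. card (uncovered M L (\<D> p))))"
    by (simp only: of_nat_le_iff)
  also have "\<dots> \<le> \<rho> * real N ^ CARD('d) + (\<Sum>p\<in>\<C>. \<rho>' * real M ^ CARD('d))"
    unfolding of_nat_add of_nat_sum by (intro add_mono rem sum_mono rem')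
  also have "(\<Sum>p\<in>\<C>. \<rho>' * real M ^ CARD('d)) = \<rho>' * real (card \<C> * M ^ CARD('d))" by simp
  also have "\<dots> \<le> \<rho>' * real (N ^ CARD('d))"
    using card_cell_system(2)[OF \<C>] \<rho>' by (intro mult_left_mono of_nat_mono) auto
  finally show "real (card (uncovered N L \<E>)) \<le> (\<rho> + \<rho>') * real N ^ CARD('d)"
    by (simp add: algebra_simps)
qed

lemma power_diff_le_real:
  fixes a b :: real
  assumes "0 \<le> b" "b \<le> a" shows "a ^ n - b ^ n \<le> real n * (a - b) * a ^ (n - 1)"
proof (cases n)
  case (Suc m)
  have "a ^ n - b ^ n = (a - b) * (\<Sum>i<n. b ^ (n - Suc i) * a ^ i)"
    using power_diff_sumr2[of a n b] by simp
  also have "\<dots> \<le> (a - b) * (\<Sum>i<n. a ^ (n - 1))"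
  proof (intro mult_left_mono sum_mono)
    fix i assume i: "i \<in> {..<n}"
    have "b ^ (n - Suc i) * a ^ i \<le> a ^ (n - Suc i) * a ^ i" using assms by (intro mult_right_mono power_mono) auto
    also have "\<dots> = a ^ (n - 1)" using i by (simp add: power_add[symmetric])
    finally show "b ^ (n - Suc i) * a ^ i \<le> a ^ (n - 1)" .
  qed (use assms in auto)
  finally show ?thesis by (simp add: mult_ac)
qed simp

text \<open>In each coordinate, cut [N] into blocks of length q L and each block into its q residue
  classes modulo q; a cell is a product of such classes. Only the last incomplete block is missed in
  each coordinate, which is a proportion at most d q L / N of the box.\<close>

lemma cell_system_uniform:
  assumes q: "q \<ge> 1" and L: "L \<ge> 1" and u: "u \<ge> 1" and N: "CARD('d) * (q * L) * u \<le> N"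
  obtains \<C> :: "((int ^ 'd::finite) \<times> nat) set" where "cell_system N L \<C>" "\<And>p. p \<in> \<C> \<Longrightarrow> snd p = q"
    "real (card (uncovered N L \<C>)) \<le> 1 / real u * real N ^ CARD('d)"
proof -
  define B where "B = N div (q * L)"
  define N' where "N' = B * (q * L)"
  have N': "N' \<le> N" "N - N' < q * L"
    using q L by (auto simp: N'_def B_def minus_div_mult_eq_mod)
  define X :: "(int ^ 'd) set" where "X = (\<lambda>f. \<chi> i. int (fst (f i)) * int (q * L) + int (snd (f i)) - int q) ` (UNIV \<rightarrow>\<^sub>E {..<B} \<times> {1..q})"
  have finX: "finite X" unfolding X_def by (intro finite_imageI finite_PiE) auto
  have coordX: "\<exists>b r. b < B \<and> 1 \<le> r \<and> r \<le> q \<and> x $ i = int b * int (q * L) + int r - int q" if xX: "x \<in> X" for x i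
  proof -
    obtain f where f: "f \<in> UNIV \<rightarrow>\<^sub>E {..<B} \<times> {1..q}" "x = (\<chi> i. int (fst (f i)) * int (q * L) + int (snd (f i)) - int q)"
      using xX unfolding X_def by blast
    have "f i \<in> {..<B} \<times> {1..q}" using f(1) by auto
    then show ?thesis using f(2) by (intro exI[of _ "fst (f i)"] exI[of _ "snd (f i)"]) auto
  qed
  \<comment> \<open>Mixed radix digits: n - 1 = b (q L) + (y - 1) q + (r - 1) with 1 <= y <= L and 1
    <= r <= q. The summand - q in the base point compensates that \<open>y\<close> starts at 1.
    Uniqueness of the digits makes the cells disjoint, and their existence gives the
    covering.\<close>
  have digits: "b = nat (n - 1) div (q * L) \<and> r = nat (n - 1) mod (q * L) mod q + 1 \<and> 1 \<le> n \<and> n \<le> int N'"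
    if b: "b < B" and r: "1 \<le> r" "r \<le> q" and y: "1 \<le> y" "y \<le> int L"
      and n: "n = (int b * int (q * L) + int r - int q) + int q * y" for b r n y
  proof -
    define v where "v = nat y - 1"
    have v: "v < L" "y = int v + 1" using y by (auto simp: v_def)
    define t where "t = v * q + (r - 1)"
    define T where "T = b * (q * L) + t"
    have nT: "n = int T + 1" using r by (simp add: n v(2) T_def t_def algebra_simps of_nat_diff)
    then have nn: "nat (n - 1) = T" by simp
    have "v * q + (r - 1) < v * q + q" using r by simp
    also have "\<dots> = (v + 1) * q" by simp
    also have "\<dots> \<le> L * q" using v by (intro mult_right_mono) auto
    finally have lt: "t < q * L" by (simp add: mult.commute t_def)
    have "T div (q * L) = b"
      by (rule div_nat_eqI) (use lt in \<open>simp_all add: T_def mult.commute\<close>)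
    moreover have "T mod (q * L) = t" unfolding T_def using lt by (simp only: mod_mult_self3 mod_less)
    moreover have "t mod q = r - 1"
    proof -
      have "r - 1 < q" using r by simp
      then show ?thesis unfolding t_def by (simp only: mod_mult_self3 mod_less)
    qed
    moreover have "T < N'"
    proof -
      have "T < (b + 1) * (q * L)" using lt by (simp add: T_def)
      also have "\<dots> \<le> N'" unfolding N'_def using b by (intro mult_right_mono) auto
      finally show ?thesis .
    qed
    ultimately show ?thesis using nn nT r by simp
  qed
  define \<C> where "\<C> = X \<times> {q}"
  have memC: "fst p \<in> X" "snd p = q" if "p \<in> \<C>" for p using that by (auto simp: \<C>_def)
  have mem: "cell L p \<subseteq> grid N'" if pC: "p \<in> \<C>" for p
  proof
    fix n assume "n \<in> cell L p"
    then obtain y where y: "y \<in> grid L" "n = affine_pt (fst p) q y" using memC(2)[OF pC] by (auto simp: cell_def)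
    show "n \<in> grid N'" unfolding grid_def
    proof (intro CollectI allI)
      fix i
      obtain b r where "b < B" "1 \<le> r" "r \<le> q" "fst p $ i = int b * int (q * L) + int r - int q"
        using coordX[OF memC(1)[OF pC], of i] by blast
      then show "1 \<le> n $ i \<and> n $ i \<le> int N'"
        using digits[of b r "y $ i" "n $ i"] y by (auto simp: grid_def affine_pt_def)
    qed
  qed
  have sys: "cell_system N L \<C>"
    unfolding cell_system_def
  proof (intro conjI ballI)
    show "finite \<C>" using finX by (simp add: \<C>_def)
    show "1 \<le> snd p" if "p \<in> \<C>" for p using that q by (auto simp: \<C>_def)
    show "cell L p \<subseteq> grid N" if "p \<in> \<C>" for p using mem[OF that] grid_mono[OF N'(1)] by blast
    show "disjoint_family_on (cell L) \<C>" unfolding disjoint_family_on_def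
    proof (intro ballI impI, rule ccontr)
      fix p p' assume p: "p \<in> \<C>" "p' \<in> \<C>" "p \<noteq> p'" "cell L p \<inter> cell L p' \<noteq> {}"
      then obtain y y' where y: "y \<in> grid L" "y' \<in> grid L" "affine_pt (fst p) q y = affine_pt (fst p') q y'"
        using memC(2)[OF p(1)] memC(2)[OF p(2)] unfolding cell_def by force
      have "fst p $ i = fst p' $ i" for i
      proof -
        obtain b r where b: "b < B" "1 \<le> r" "r \<le> q" "fst p $ i = int b * int (q * L) + int r - int q"
          using coordX[OF memC(1)[OF p(1)], of i] by blast
        obtain b' r' where b': "b' < B" "1 \<le> r'" "r' \<le> q" "fst p' $ i = int b' * int (q * L) + int r' - int q"
          using coordX[OF memC(1)[OF p(2)], of i] by blast
        have e: "affine_pt (fst p) q y $ i = affine_pt (fst p') q y' $ i" using y(3) by simp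
        have 1: "1 \<le> y $ i" "y $ i \<le> int L" "1 \<le> y' $ i" "y' $ i \<le> int L" using y by (auto simp: grid_def)
        have "b = b' \<and> r = r'"
          using digits[OF b(1-3) 1(1,2), of "affine_pt (fst p) q y $ i"] digits[OF b'(1-3) 1(3,4), of "affine_pt (fst p) q y $ i"] b(4) b'(4) e
          unfolding affine_pt_def by simp
        then show ?thesis using b b' by simp
      qed
      then have "fst p = fst p'" by (simp add: Finite_Cartesian_Product.vec_eq_iff)
      then show False using p by (auto simp: \<C>_def)
    qed
  qed
  have cover: "grid N' \<subseteq> (\<Union>p\<in>\<C>. cell L p)"
  proof
    fix n :: "int ^ 'd" assume n: "n \<in> grid N'"
    define m where "m i = nat (n $ i - 1)" for i
    have m: "m i < N'" "n $ i = int (m i) + 1" for i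
    proof -
      have "1 \<le> n $ i \<and> n $ i \<le> int N'" using n by (simp add: grid_def)
      then show "m i < N'" "n $ i = int (m i) + 1" unfolding m_def by linarith+
    qed
    define x :: "int ^ 'd" where "x = (\<chi> i. int (m i div (q * L)) * int (q * L) + int (m i mod (q * L) mod q + 1) - int q)"
    define y :: "int ^ 'd" where "y = (\<chi> i. int (m i mod (q * L) div q) + 1)"
    have "x \<in> X" unfolding X_def
    proof (rule image_eqI)
      show "x = (\<chi> i. int (fst ((\<lambda>i. (m i div (q * L), m i mod (q * L) mod q + 1)) i)) * int (q * L) + int (snd ((\<lambda>i. (m i div (q * L), m i mod (q * L) mod q + 1)) i)) - int q)"
        by (simp add: x_def)
      have "m i div (q * L) < B" for i
        using m(1)[of i] unfolding N'_def by (simp add: less_mult_imp_div_less)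
      moreover have "m i mod (q * L) mod q + 1 \<le> q" for i
      proof -
        have "m i mod (q * L) mod q < q" using q by simp
        then show ?thesis by simp
      qed
      ultimately show "(\<lambda>i. (m i div (q * L), m i mod (q * L) mod q + 1)) \<in> UNIV \<rightarrow>\<^sub>E {..<B} \<times> {1..q}" by auto
    qed
    moreover have "y \<in> grid L"
    proof -
      have "m i mod (q * L) div q < L" for i
      proof (rule less_mult_imp_div_less)
        have "q * L > 0" using q L by simp
        then show "m i mod (q * L) < L * q" by (simp add: mult.commute[of L])
      qed
      then have "int (m i mod (q * L) div q) + 1 \<le> int L" for i
        by (metis Suc_eq_plus1 Suc_leI of_nat_1 of_nat_add of_nat_le_iff)
      then show ?thesis by (simp add: grid_def y_def)
    qed
    moreover have "n = affine_pt x q y"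
    proof -
      have "n $ i = affine_pt x q y $ i" for i
      proof -
        have "m i = m i div (q * L) * (q * L) + (m i mod (q * L) div q * q + m i mod (q * L) mod q)"
          by (simp only: div_mult_mod_eq)
        then have "int (m i) = int (m i div (q * L)) * int (q * L) + (int (m i mod (q * L) div q) * int q + int (m i mod (q * L) mod q))"
          by (metis of_nat_add of_nat_mult)
        then show ?thesis unfolding m(2) by (simp add: affine_pt_def x_def y_def algebra_simps)
      qed
      then show ?thesis by (simp add: Finite_Cartesian_Product.vec_eq_iff)
    qed
    ultimately show "n \<in> (\<Union>p\<in>\<C>. cell L p)" unfolding \<C>_def cell_def by force
  qed
  have "real (card (uncovered N L \<C>)) \<le> real (card (grid N - (grid N' :: (int ^ 'd) set)))"
    using cover by (intro of_nat_mono card_mono) auto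
  also have "\<dots> = real N ^ CARD('d) - real N' ^ CARD('d)"
    using N'(1) by (simp add: card_Diff_subset grid_mono card_grid of_nat_diff power_mono)
  also have "\<dots> \<le> real CARD('d) * (real N - real N') * real N ^ (CARD('d) - 1)"
    using N'(1) by (intro power_diff_le_real) auto
  also have "\<dots> \<le> real CARD('d) * real (q * L) * real N ^ (CARD('d) - 1)"
  proof (intro mult_right_mono mult_left_mono)
    have "real (N - N') \<le> real (q * L)" using N'(2) by (intro of_nat_mono) simp
    then show "real N - real N' \<le> real (q * L)" using N'(1) by (simp only: of_nat_diff)
  qed auto
  also have "\<dots> \<le> (real N / real u) * real N ^ (CARD('d) - 1)"
  proof (intro mult_right_mono)
    have "real (CARD('d) * (q * L) * u) \<le> real N" using N by (rule of_nat_mono)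
    then show "real CARD('d) * real (q * L) \<le> real N / real u" using u by (simp add: field_simps)
  qed simp
  also have "\<dots> = 1 / real u * real N ^ CARD('d)"
    using zero_less_card_finite[where 'a = 'd] by (simp add: power_eq_if)
  finally have "real (card (uncovered N L \<C>)) \<le> 1 / real u * real N ^ CARD('d)" .
  then show ?thesis using sys that[of \<C>] by (auto simp: \<C>_def)
qed

lemma abs_monom_word_le:
  assumes "y \<in> grid L" shows "\<bar>monom_word w y\<bar> \<le> int L ^ length w"
proof (induction w)
  case (Cons i w)
  have "\<bar>y $ i\<bar> \<le> int L" using assms by (auto simp: grid_def intro!: abs_leI) (meson order_trans zero_le_one neg_le_0_iff_le of_nat_0_le_iff)
  then show ?case using Cons by (auto simp: monom_word_def abs_mult intro!: mult_mono)
qed (simp add: monom_word_def)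

text \<open>The requirement is that all phases with index in \<open>I\<close> are nearly constant
  modulo 1 on each cell of one common system. The same O(1/u) bounds the variation and the uncovered
  proportion.\<close>

definition linearizable :: "nat \<Rightarrow> nat \<Rightarrow> nat \<Rightarrow> 'i set \<Rightarrow> ('i \<Rightarrow> int ^ 'd::finite \<Rightarrow> real) \<Rightarrow> bool" where
  "linearizable N u C I \<psi> \<longleftrightarrow> (\<exists>\<C>. cell_system N u \<C> \<and> real (card (uncovered N u \<C>)) \<le> real C / real u * real N ^ CARD('d) \<and>
       (\<forall>i\<in>I. \<forall>p\<in>\<C>. \<forall>n\<in>cell u p. \<forall>n'\<in>cell u p. norm (unit_exp (\<psi> i n) - unit_exp (\<psi> i n')) \<le> real C / real u))"

text \<open>Along a common difference \<open>q\<close> that makes all leading coefficients nearly integral, the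
  phases lose a degree; subdividing the cells repeats this down to constants.\<close>
lemma cells:
  obtains C :: nat where "\<And>D u N (I :: 'i set) (\<psi> :: 'i \<Rightarrow> int ^ 'd::finite \<Rightarrow> real).
     D \<ge> 1 \<Longrightarrow> u \<ge> 2 \<Longrightarrow> D \<le> u \<Longrightarrow> u ^ (C * D ^ C) \<le> N \<Longrightarrow> finite I \<Longrightarrow> card I \<le> D \<Longrightarrow> (\<And>i. i \<in> I \<Longrightarrow> polyfun k (\<psi> i)) \<Longrightarrow>
     linearizable N u C I \<psi>"
proof -
  let ?d = "CARD('d)"
  let ?G = "\<lambda>k C. \<forall>D u N. \<forall>I :: 'i set. \<forall>\<psi> :: 'i \<Rightarrow> int ^ 'd \<Rightarrow> real.
     D \<ge> 1 \<longrightarrow> u \<ge> 2 \<longrightarrow> D \<le> u \<longrightarrow> u ^ (C * D ^ C) \<le> N \<longrightarrow> finite I \<longrightarrow> card I \<le> D \<longrightarrow> (\<forall>i\<in>I. polyfun k (\<psi> i)) \<longrightarrow>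
     linearizable N u C I \<psi>"
  have "\<exists>C. ?G k C"
  proof (induction k)
    case 0
    show ?case
    \<comment> \<open>Constant phases allow cells with common difference 1. The exponent d + 2 pays
      for the u^2 in the size condition of the uniform system and for its factor d, which is at most
      u^d.\<close>
    proof (rule exI[of _ "?d + 2"], intro allI impI)
      fix D u N :: nat and I :: "'i set" and \<psi> :: "'i \<Rightarrow> int ^ 'd \<Rightarrow> real"
      assume D: "D \<ge> 1" and u: "u \<ge> 2" and N: "u ^ ((?d + 2) * D ^ (?d + 2)) \<le> N" and \<psi>: "\<forall>i\<in>I. polyfun 0 (\<psi> i)"
      have "?d \<le> 2 ^ ?d" by (intro less_imp_le less_exp)
      also have "\<dots> \<le> u ^ ?d" using u by (intro power_mono) auto
      finally have "?d * (1 * u) * u \<le> u ^ ?d * (1 * u) * u" by (intro mult_right_mono) auto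
      also have "\<dots> = u ^ (?d + 2)" by (simp add: power_add power2_eq_square)
      also have "\<dots> \<le> u ^ ((?d + 2) * D ^ (?d + 2))"
      proof (rule power_increasing)
        have "1 \<le> D ^ (?d + 2)" using D by simp
        then have "(?d + 2) * 1 \<le> (?d + 2) * D ^ (?d + 2)" by (rule mult_le_mono2)
        then show "?d + 2 \<le> (?d + 2) * D ^ (?d + 2)" by simp
      qed (use u in simp)
      finally have dN: "?d * (1 * u) * u \<le> N" using N by linarith
      obtain \<C> :: "((int ^ 'd) \<times> nat) set" where \<C>: "cell_system N u \<C>" "\<And>p. p \<in> \<C> \<Longrightarrow> snd p = 1"
        "real (card (uncovered N u \<C>)) \<le> 1 / real u * real N ^ ?d"
        by (rule cell_system_uniform[of 1 u u N, where 'd = 'd]) (use u dN in auto)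
      have "1 / real u * real N ^ ?d \<le> real (?d + 2) / real u * real N ^ ?d"
        by (intro mult_right_mono divide_right_mono) auto
      moreover have "norm (unit_exp (\<psi> i n) - unit_exp (\<psi> i n')) \<le> real (?d + 2) / real u" if "i \<in> I" for i n n'
      proof -
        have "polyfun 0 (\<psi> i)" using \<psi> that by blast
        from polyfun_0[OF this refl] obtain c where "\<psi> i = (\<lambda>_. c)" by (elim exE)
        then show ?thesis by simp
      qed
      ultimately show "linearizable N u (?d + 2) I \<psi>" unfolding linearizable_def
        using \<C>(1,3) by (intro exI[of _ \<C>] conjI) (assumption | blast | linarith)+
    qed
  next
    case (Suc k)
    then obtain C where IH: "?G k C" by blast
    obtain C2 :: nat where rec: "\<And>D u \<alpha>. D \<ge> 1 \<Longrightarrow> u \<ge> 2 \<Longrightarrow> D \<le> u \<Longrightarrow>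
     \<exists>q\<ge>1. q \<le> u ^ (C2 * D\<^sup>2) \<and> (\<forall>i<D. dist_int (real q ^ Suc k * \<alpha> i) \<le> 1 / real u)"
      by (rule simultaneous_recurrence[of "Suc k"]) auto
    define W where "W = ?d ^ Suc k"
    have W1: "W \<ge> 1" by (simp add: W_def Suc_le_eq)
    define e where "e = ?d * Suc k + 1"
    define E where "E = ?d + (e + C * Suc k) * C2 * W\<^sup>2 + C + 1 + C + 14"
    show ?case
    proof (rule exI[of _ E], intro allI impI)
      fix D u N :: nat and I :: "'i set" and \<psi> :: "'i \<Rightarrow> int ^ 'd \<Rightarrow> real"
      assume D: "D \<ge> 1" and u: "u \<ge> 2" and Du: "D \<le> u" and N: "u ^ (E * D ^ E) \<le> N"
        and I: "finite I" "card I \<le> D" and \<psi>: "\<forall>i\<in>I. polyfun (Suc k) (\<psi> i)"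
      have upos: "real u > 0" using u by simp
      define M where "M = u ^ (C * D ^ C)"
      \<comment> \<open>The precision demanded of the recurrence: on a cell of side
        \<open>M\<close>, monomials of degree k + 1 reach M^(k+1) and there are \<open>W\<close> of
        them; u^e absorbs \<open>W\<close> and leaves an error 1/u.\<close>
      define u1 where "u1 = u ^ e * M ^ Suc k"
      have M1: "M \<ge> 1" using u by (simp add: M_def)
      have "?d \<le> 2 ^ ?d" by (intro less_imp_le less_exp)
      also have "\<dots> \<le> u ^ ?d" using u by (intro power_mono) auto
      finally have du: "?d \<le> u ^ ?d" .
      have Wu: "W \<le> u ^ (?d * Suc k)" unfolding W_def power_mult using du by (intro power_mono) auto
      have uW: "u * W \<le> u ^ e"
        using Wu by (simp add: e_def)
      have e_u1: "u ^ e \<le> u1" using M1 by (simp add: u1_def)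
      have DW: "D * W \<le> u1" proof -
        have "D * W \<le> u * W" using Du by (rule mult_right_mono) simp
        then show ?thesis using uW e_u1 by linarith
      qed
      have "u * 1 \<le> u * W" using W1 by (intro mult_left_mono) auto
      then have u1: "u1 \<ge> 2" using u uW e_u1 by linarith
      have u1_pow: "u1 = u ^ (e + C * D ^ C * Suc k)" by (simp add: u1_def M_def power_add power_mult)
      have "\<forall>i\<in>I. \<exists>c. \<forall>x q. polyfun k (\<lambda>y. \<psi> i (affine_pt x q y) - (\<Sum>w\<in>words (Suc k). real q ^ Suc k * c w * of_int (monom_word w y)))"
      proof
        fix i assume "i \<in> I"
        then have "polyfun (Suc k) (\<psi> i)" using \<psi> by blast
        from polyfun_leading[OF this] show "\<exists>c. \<forall>x q. polyfun k (\<lambda>y. \<psi> i (affine_pt x q y) - (\<Sum>w\<in>words (Suc k). real q ^ Suc k * c w * of_int (monom_word w y)))"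
          unfolding lower_polyfun.simps .
      qed
      from bchoice[OF this] obtain c where c: "\<And>i x q. i \<in> I \<Longrightarrow> polyfun k (\<lambda>y. \<psi> i (affine_pt x q y) - (\<Sum>w\<in>words (Suc k). real q ^ Suc k * c i w * of_int (monom_word w y)))"
        by blast
      \<comment> \<open>The leading coefficients of all phases together, at most D W numbers, are
        handed to the recurrence at once, so that a single \<open>q\<close> serves every phase and
        every monomial.\<close>
      define X where "X = I \<times> (words (Suc k) :: 'd list set)"
      have finX: "finite X" using I by (simp add: X_def)
      have cardX: "card X \<le> D * W" unfolding X_def card_cartesian_product card_words W_def using I by (intro mult_right_mono) auto
      obtain en where en: "bij_betw en {0..<card X} X" using ex_bij_betw_nat_finite[OF finX] by blast
      define \<alpha> where "\<alpha> j = (if j < card X then c (fst (en j)) (snd (en j)) else 0)" for j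
      obtain q where q: "q \<ge> 1" "q \<le> u1 ^ (C2 * (D * W)\<^sup>2)" "\<And>j. j < D * W \<Longrightarrow> dist_int (real q ^ Suc k * \<alpha> j) \<le> 1 / real u1"
        using rec[of "D * W" u1 \<alpha>] D W1 u1 DW by auto
      have small: "dist_int (real q ^ Suc k * c i w) \<le> 1 / real u1" if iw: "i \<in> I" "w \<in> words (Suc k)" for i w
      proof -
        have "(i, w) \<in> en ` {0..<card X}" using en iw by (simp add: bij_betw_def X_def)
        then obtain j where "j < card X" "en j = (i, w)" by force
        then show ?thesis using q(3)[of j] cardX by (simp add: \<alpha>_def)
      qed
      have "?d * (q * M) * u \<le> u ^ ?d * (u1 ^ (C2 * (D * W)\<^sup>2) * M) * u"
        using du q by (intro mult_mono) auto
      also have "\<dots> = u ^ (?d + ((e + C * D ^ C * Suc k) * (C2 * (D * W)\<^sup>2) + C * D ^ C) + 1)"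
        by (simp only: u1_pow M_def power_mult[symmetric] power_add[symmetric] power_Suc2[symmetric] Suc_eq_plus1)
      \<comment> \<open>The recurrence is quadratic in the number D W of coefficients, so each
        degree raises the exponent of D by 2. After a bounded number of degrees the loss is still
        polynomial in D.\<close>
      also have "\<dots> \<le> u ^ (E * D ^ E)"
      proof (rule power_increasing)
        have D1: "1 \<le> D ^ (C + 2)" using D by simp
        have "D ^ C \<le> D ^ (C + 2)" using D by (intro power_increasing) auto
        have "(e + C * D ^ C * Suc k) \<le> (e + C * Suc k) * D ^ C"
          using D by (simp add: algebra_simps)
        then have "(e + C * D ^ C * Suc k) * (C2 * (D * W)\<^sup>2) \<le> (e + C * Suc k) * D ^ C * (C2 * (D * W)\<^sup>2)"
          by (rule mult_right_mono) simp
        also have "\<dots> = (e + C * Suc k) * C2 * W\<^sup>2 * D ^ (C + 2)" by (simp only: power_add power_mult_distrib mult_ac)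
        finally have "?d + ((e + C * D ^ C * Suc k) * (C2 * (D * W)\<^sup>2) + C * D ^ C) + 1
          \<le> ?d * D ^ (C + 2) + ((e + C * Suc k) * C2 * W\<^sup>2 * D ^ (C + 2) + C * D ^ (C + 2)) + 1 * D ^ (C + 2)"
          using D1 \<open>D ^ C \<le> D ^ (C + 2)\<close> by (intro add_mono mult_left_mono) auto
        also have "\<dots> = (?d + (e + C * Suc k) * C2 * W\<^sup>2 + C + 1) * D ^ (C + 2)" by (simp only: distrib_right add_ac)
        also have "\<dots> \<le> E * D ^ E" using D by (intro mult_mono power_increasing) (auto simp: E_def)
        finally show "?d + ((e + C * D ^ C * Suc k) * (C2 * (D * W)\<^sup>2) + C * D ^ C) + 1 \<le> E * D ^ E" .
      qed (use u in auto)
      finally have dN: "?d * (q * M) * u \<le> N" using N by linarith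
      obtain \<C> :: "((int ^ 'd) \<times> nat) set" where \<C>: "cell_system N M \<C>" "\<And>p. p \<in> \<C> \<Longrightarrow> snd p = q"
        "real (card (uncovered N M \<C>)) \<le> 1 / real u * real N ^ ?d"
        by (rule cell_system_uniform[of q M u N, where 'd = 'd]) (use q(1) M1 u dN in auto)
      define h where "h p i y = \<psi> i (affine_pt (fst p) q y) - (\<Sum>w\<in>words (Suc k). real q ^ Suc k * c i w * of_int (monom_word w y))" for p :: "(int ^ 'd) \<times> nat" and i y
      have lin: "linearizable M u C I (h p)" for p
      proof -
        have "\<forall>i\<in>I. polyfun k (h p i)" unfolding h_def using c by blast
        then show ?thesis using IH D u Du I unfolding M_def by blast
      qed
      obtain \<D> where \<D>: "\<And>p. p \<in> \<C> \<Longrightarrow> cell_system M u (\<D> p)"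
        "\<And>p. p \<in> \<C> \<Longrightarrow> real (card (uncovered M u (\<D> p))) \<le> real C / real u * real M ^ ?d"
        "\<And>p i p' n n'. p \<in> \<C> \<Longrightarrow> i \<in> I \<Longrightarrow> p' \<in> \<D> p \<Longrightarrow> n \<in> cell u p' \<Longrightarrow> n' \<in> cell u p' \<Longrightarrow> norm (unit_exp (h p i n) - unit_exp (h p i n')) \<le> real C / real u"
        using lin unfolding linearizable_def by metis
      define \<E> where "\<E> = (\<Union>p\<in>\<C>. (\<lambda>p'. (affine_pt (fst p) (snd p) (fst p'), snd p * snd p')) ` \<D> p)"
      have sys: "cell_system N u \<E>" and rem: "real (card (uncovered N u \<E>)) \<le> (1 / real u + real C / real u) * real N ^ ?d"
        using cell_system_compose[OF \<C>(1) \<D>(1) \<C>(3) \<D>(2) _ \<E>_def] by auto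
      \<comment> \<open>Removing the leading form changes a phase by at most 1/u modulo 1, hence the
        exponential by at most 2 pi / u < 7 / u. This is paid once for each of two points of a cell,
        which explains the 14 in \<open>E\<close>.\<close>
      have close: "norm (unit_exp (\<psi> i (affine_pt (fst p) q y)) - unit_exp (h p i y)) \<le> 7 / real u" if i: "i \<in> I" and y: "y \<in> grid M" for p i y
      proof -
        define \<Sigma> where "\<Sigma> = (\<Sum>w\<in>words (Suc k). real q ^ Suc k * c i w * of_int (monom_word w y))"
        have "\<psi> i (affine_pt (fst p) q y) = h p i y + \<Sigma>" by (simp add: h_def \<Sigma>_def)
        then have "unit_exp (\<psi> i (affine_pt (fst p) q y)) - unit_exp (h p i y) = unit_exp (h p i y) * (unit_exp \<Sigma> - 1)"
          by (simp add: unit_exp_add algebra_simps)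
        then have "norm (unit_exp (\<psi> i (affine_pt (fst p) q y)) - unit_exp (h p i y)) = norm (unit_exp \<Sigma> - 1)"
          by (simp add: norm_mult)
        also have "\<dots> \<le> 2 * pi * dist_int \<Sigma>" by (rule norm_unit_exp_minus_1_le)
        also have "\<dots> \<le> 7 * dist_int \<Sigma>" using pi_approx by (intro mult_right_mono) auto
        also have "dist_int \<Sigma> \<le> (\<Sum>w\<in>words (Suc k). dist_int (of_int (monom_word w y) * (real q ^ Suc k * c i w)))"
          unfolding \<Sigma>_def by (intro order_trans[OF dist_int_sum]) (simp add: mult_ac)
        also have "\<dots> \<le> (\<Sum>w\<in>(words (Suc k) :: 'd list set). real M ^ Suc k * (1 / real u1))"
        proof (rule sum_mono)
          fix w :: "'d list" assume w: "w \<in> words (Suc k)"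
          have "\<bar>monom_word w y\<bar> \<le> int M ^ Suc k" using abs_monom_word_le[OF y, of w] w by (simp add: words_def)
          then have "real_of_int \<bar>monom_word w y\<bar> \<le> real_of_int (int M ^ Suc k)" by (simp only: of_int_le_iff)
          then have "\<bar>real_of_int (monom_word w y)\<bar> \<le> real M ^ Suc k" by simp
          then show "dist_int (of_int (monom_word w y) * (real q ^ Suc k * c i w)) \<le> real M ^ Suc k * (1 / real u1)"
            by (intro order_trans[OF dist_int_mult] mult_mono small i w) auto
        qed
        also have "\<dots> = real W * (real M ^ Suc k * (1 / real u1))" by (simp add: card_words W_def)
        also have "\<dots> = real W / real u ^ e" using M1 upos by (simp add: u1_def field_simps)
        also have "\<dots> \<le> 1 / real u"
        proof -
          have "real (u * W) \<le> real (u ^ e)" using uW by (rule of_nat_mono)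
          then show ?thesis using upos by (simp add: field_simps)
        qed
        finally show ?thesis by simp
      qed
      have "norm (unit_exp (\<psi> i n) - unit_exp (\<psi> i n')) \<le> real E / real u" if i: "i \<in> I" and p: "p \<in> \<E>" and n: "n \<in> cell u p" "n' \<in> cell u p" for i p n n'
      proof -
        obtain r r' where r: "r \<in> \<C>" "r' \<in> \<D> r" "p = (affine_pt (fst r) (snd r) (fst r'), snd r * snd r')"
          using p unfolding \<E>_def by blast
        have "cell u p = affine_pt (fst r) q ` cell u r'"
          using \<C>(2)[OF r(1)] by (simp add: r(3) cell_def image_image affine_pt_affine_pt)
        then obtain y y' where y: "y \<in> cell u r'" "y' \<in> cell u r'" "n = affine_pt (fst r) q y" "n' = affine_pt (fst r) q y'"
          using n by auto
        have "cell u r' \<subseteq> grid M" using \<D>(1)[OF r(1)] r(2) by (auto simp: cell_system_def)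
        then have yM: "y \<in> grid M" "y' \<in> grid M" using y by auto
        have 3: "norm (a - d) \<le> norm (a - b) + norm (b - c) + norm (d - c)" for a b c d :: complex
        proof -
          have "norm (a - d) = norm ((a - b) + (b - c) - (d - c))" by simp
          also have "\<dots> \<le> norm ((a - b) + (b - c)) + norm (d - c)" by (rule norm_triangle_ineq4)
          also have "\<dots> \<le> norm (a - b) + norm (b - c) + norm (d - c)" by (intro add_right_mono norm_triangle_ineq)
          finally show ?thesis .
        qed
        have "norm (unit_exp (\<psi> i n) - unit_exp (\<psi> i n')) \<le> 7 / real u + real C / real u + 7 / real u"
          using 3[of "unit_exp (\<psi> i n)" "unit_exp (\<psi> i n')" "unit_exp (h r i y)" "unit_exp (h r i y')"]
            close[OF i yM(1), of r] close[OF i yM(2), of r] \<D>(3)[OF r(1) i r(2) y(1,2)] unfolding y(3,4) by linarith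
        also have "\<dots> = real (C + 14) / real u" by (simp add: add_divide_distrib)
        also have "\<dots> \<le> real E / real u" by (intro divide_right_mono of_nat_mono) (auto simp: E_def)
        finally show ?thesis .
      qed
      moreover have "(1 / real u + real C / real u) * real N ^ ?d \<le> real E / real u * real N ^ ?d"
      proof (intro mult_right_mono)
        have "1 / real u + real C / real u = real (C + 1) / real u" by (simp add: add_divide_distrib)
        also have "\<dots> \<le> real E / real u" by (intro divide_right_mono of_nat_mono) (auto simp: E_def)
        finally show "1 / real u + real C / real u \<le> real E / real u" .
      qed simp
      ultimately show "linearizable N u E I \<psi>" unfolding linearizable_def
        using sys rem by (intro exI[of _ \<E>] conjI) (assumption | blast | linarith)+
    qed
  qed
  then show ?thesis using that by blast
qed

section \<open>Integration over the torus\<close>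

definition half_box :: "(real ^ 'r) \<Rightarrow> (real ^ 'r) \<Rightarrow> (real ^ 'r) set" where
  "half_box a b = {\<alpha>. \<forall>j. a $ j \<le> \<alpha> $ j \<and> \<alpha> $ j < b $ j}"

abbreviation unit_cube :: "(real ^ 'r) set" where
  "unit_cube \<equiv> {\<alpha>. \<forall>j. 0 \<le> \<alpha> $ j \<and> \<alpha> $ j < 1}"

lemma half_box_measurable [measurable]: "half_box a b \<in> sets borel"
proof -
  have "half_box a b = (\<Inter>j. {\<alpha>. a $ j \<le> \<alpha> $ j} \<inter> {\<alpha>. \<alpha> $ j < b $ j})"
    by (auto simp: half_box_def)
  moreover have "{\<alpha> :: real ^ 'a. a $ j \<le> \<alpha> $ j} \<inter> {\<alpha>. \<alpha> $ j < b $ j} \<in> sets borel" for j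
    by (intro sets.Int borel_closed borel_open closed_Collect_le open_Collect_less continuous_intros)
  ultimately show ?thesis by (simp add: sets.countable_INT)
qed

lemma unit_cube_eq_half_box: "unit_cube = half_box 0 1"
  by (auto simp: half_box_def)

lemma unit_cube_measurable [measurable]: "unit_cube \<in> sets borel"
  unfolding unit_cube_eq_half_box by simp

lemma emeasure_half_box:
  fixes a b :: "real ^ 'r"
  assumes "\<And>j. a $ j \<le> b $ j"
  shows "emeasure lborel (half_box a b) = ennreal (\<Prod>j\<in>UNIV. b $ j - a $ j)"
proof -
  have le: "a \<bullet> i \<le> b \<bullet> i" if "i \<in> Basis" for i
    using that assms by (auto simp: Basis_vec_def inner_axis)
  have prod: "(\<Prod>i\<in>Basis. (b - a) \<bullet> i) = (\<Prod>j\<in>UNIV. b $ j - a $ j)"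
  proof -
    have "(\<Prod>i\<in>Basis. (b - a) \<bullet> i) = (\<Prod>i\<in>range (\<lambda>j. axis j (1::real)). (b - a) \<bullet> i)"
      by (rule prod.cong) (auto simp: Basis_vec_def)
    also have "\<dots> = (\<Prod>j\<in>UNIV. (b - a) \<bullet> axis j 1)"
      by (subst prod.reindex) (auto simp: inj_on_def axis_eq_axis)
    finally show ?thesis by (simp add: inner_axis)
  qed
  have "box a b \<subseteq> half_box a b" "half_box a b \<subseteq> cbox a b"
    by (auto simp: half_box_def mem_box_cart less_imp_le)
  then have "emeasure lborel (box a b) \<le> emeasure lborel (half_box a b)"
    "emeasure lborel (half_box a b) \<le> emeasure lborel (cbox a b)"
    by (auto intro!: emeasure_mono)
  then show ?thesis using le by (simp add: prod)
qed

lemma emeasure_unit_cube: "emeasure lborel (unit_cube :: (real ^ 'r) set) = 1"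
  unfolding unit_cube_eq_half_box by (subst emeasure_half_box) auto

lemma torus_integral_eq:
  fixes G :: "real ^ 'r \<Rightarrow> 'b::{banach, second_countable_topology}"
  shows "(LINT \<alpha>|torus_measure. G \<alpha>) = (LINT \<alpha>:unit_cube|lborel. G \<alpha>)"
  unfolding torus_measure_def set_lebesgue_integral_def
  by (subst integral_restrict_space) auto

lemma set_integrable_bounded:
  fixes G :: "real ^ 'r \<Rightarrow> 'b::{banach, second_countable_topology}"
  assumes "G \<in> borel_measurable borel" "\<And>x. norm (G x) \<le> B" "S \<in> sets borel" "emeasure lborel S < \<infinity>"
  shows "set_integrable lborel S G"
  unfolding set_integrable_def
  by (rule integrableI_bounded_set_indicator) (use assms in auto)

lemma integral_translate:
  fixes f :: "real ^ 'r \<Rightarrow> 'b::{banach, second_countable_topology}"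
  assumes "f \<in> borel_measurable borel"
  shows "(LINT x|lborel. f (x + c)) = (LINT x|lborel. f x)"
proof -
  have "(LINT x|lborel. f x) = (LINT x|distr lborel borel ((+) c). f x)" by (simp add: lborel_distr_plus)
  also have "\<dots> = (LINT x|lborel. f (c + x))" using assms by (subst integral_distr) auto
  finally show ?thesis by (simp add: add.commute)
qed

lemma integral_dilate:
  fixes f :: "real ^ 'r \<Rightarrow> 'b::{banach, second_countable_topology}"
  assumes "f \<in> borel_measurable borel" "c \<noteq> 0"
  shows "(LINT x|lborel. f x) = \<bar>c\<bar> ^ CARD('r) *\<^sub>R (LINT x|lborel. f (c *\<^sub>R x))"
proof -
  have "(LINT x|lborel. f x) = (LINT x|density (distr lborel borel (\<lambda>x. 0 + c *\<^sub>R x)) (\<lambda>_. ennreal (\<bar>c\<bar> ^ DIM(real ^ 'r))). f x)"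
    using lborel_affine[OF assms(2), of "0 :: real ^ 'r"] by simp
  also have "\<dots> = (LINT x|distr lborel borel (\<lambda>x. 0 + c *\<^sub>R x). \<bar>c\<bar> ^ CARD('r) *\<^sub>R f x)"
    using assms by (subst integral_density) auto
  also have "\<dots> = \<bar>c\<bar> ^ CARD('r) *\<^sub>R (LINT x|distr lborel borel (\<lambda>x. c *\<^sub>R x). f x)"
    by simp
  also have "(LINT x|distr lborel borel (\<lambda>x. c *\<^sub>R x). f x) = (LINT x|lborel. f (c *\<^sub>R x))"
    using assms by (subst integral_distr) auto
  finally show ?thesis .
qed

text \<open>The shifted cube is cut along one coordinate into a piece \<open>A\<close> still inside
  the unit cube and a piece that periodicity moves back by 1 onto \<open>D\<close>; together
  \<open>A\<close> and \<open>D\<close> fill the cube.\<close>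

lemma torus_integral_shift:
  fixes G :: "real ^ 'r \<Rightarrow> 'b::{banach, second_countable_topology}"
  assumes G: "G \<in> borel_measurable borel" "\<And>x. norm (G x) \<le> B"
    and per: "\<And>x. G (x + axis j 1) = G x" and h: "0 \<le> h" "h \<le> 1"
  shows "(LINT x:unit_cube|lborel. G (x + axis j h)) = (LINT x:unit_cube|lborel. G x)"
proof -
  define A :: "(real ^ 'r) set" where "A = half_box (axis j h) 1"
  define D :: "(real ^ 'r) set" where "D = half_box 0 (\<chi> i. if i = j then h else 1)"
  have [measurable]: "A \<in> sets borel" "D \<in> sets borel" by (simp_all add: A_def D_def)
  define R where "R x \<longleftrightarrow> (\<forall>i. i \<noteq> j \<longrightarrow> 0 \<le> x $ i \<and> x $ i < 1)" for x :: "real ^ 'r"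
  have cube: "x \<in> unit_cube \<longleftrightarrow> R x \<and> 0 \<le> x $ j \<and> x $ j < 1" for x by (auto simp: R_def)
  have Aj: "x \<in> A \<longleftrightarrow> R x \<and> h \<le> x $ j \<and> x $ j < 1" for x
  proof -
    have "(axis j h $ i \<le> x $ i \<and> x $ i < 1 $ i) \<longleftrightarrow> (if i = j then h \<le> x $ j \<and> x $ j < 1 else 0 \<le> x $ i \<and> x $ i < 1)" for i
      by (simp add: axis_def)
    then show ?thesis unfolding A_def half_box_def R_def by auto
  qed
  have Dj: "x \<in> D \<longleftrightarrow> R x \<and> 0 \<le> x $ j \<and> x $ j < h" for x
  proof -
    have "(0 $ i \<le> x $ i \<and> x $ i < (\<chi> i. if i = j then h else 1) $ i) \<longleftrightarrow> (if i = j then 0 \<le> x $ j \<and> x $ j < h else 0 \<le> x $ i \<and> x $ i < 1)" for i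
      by simp
    then show ?thesis unfolding D_def half_box_def R_def by auto
  qed
  have Rj: "R (x - axis j t) = R x" "(x - axis j t) $ j = x $ j - t" for x t by (auto simp: R_def axis_def)
  have fin: "emeasure lborel A < \<infinity>" "emeasure lborel D < \<infinity>"
  proof -
    have "A \<subseteq> unit_cube" "D \<subseteq> unit_cube" using h unfolding subset_iff cube Aj Dj by auto
    then have "emeasure lborel A \<le> 1" "emeasure lborel D \<le> 1"
      using emeasure_mono[of A unit_cube lborel] emeasure_mono[of D unit_cube lborel]
      by (simp_all add: emeasure_unit_cube)
    then show "emeasure lborel A < \<infinity>" "emeasure lborel D < \<infinity>"
      by (auto intro: le_less_trans)
  qed
  have ind: "indicat_real unit_cube (x - axis j h) = indicat_real A x + indicat_real D (x - axis j 1)" for x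
    using h unfolding indicator_def cube Aj Dj Rj by auto
  have ind': "indicat_real unit_cube x = indicat_real A x + indicat_real D x" for x
    using h unfolding indicator_def cube Aj Dj by auto
  have int: "integrable lborel (\<lambda>x. indicat_real S x *\<^sub>R G x)" if "S \<in> {A, D}" for S
    using set_integrable_bounded[of G B S] G fin that by (auto simp: set_integrable_def)
  have int': "integrable lborel (\<lambda>x. indicat_real D (x - axis j 1) *\<^sub>R G x)"
  proof -
    have "integrable lborel (\<lambda>x. indicat_real D x *\<^sub>R G (x + axis j 1))" using int[of D] per by simp
    then have "integrable (distr lborel borel ((+) (- axis j 1))) (\<lambda>x. indicat_real D x *\<^sub>R G (x + axis j 1))"
      by (simp add: lborel_distr_plus)
    then have "integrable lborel (\<lambda>x. indicat_real D (- axis j 1 + x) *\<^sub>R G (- axis j 1 + x + axis j 1))"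
      using G by (subst (asm) integrable_distr_eq) auto
    then show ?thesis by (simp add: algebra_simps)
  qed
  have "(LINT x:unit_cube|lborel. G (x + axis j h)) = (LINT x|lborel. (\<lambda>x. indicat_real unit_cube (x - axis j h) *\<^sub>R G x) (x + axis j h))"
    by (simp add: set_lebesgue_integral_def)
  also have "\<dots> = (LINT x|lborel. indicat_real unit_cube (x - axis j h) *\<^sub>R G x)"
    by (rule integral_translate) (use G in measurable)
  also have "\<dots> = (LINT x|lborel. indicat_real A x *\<^sub>R G x + indicat_real D (x - axis j 1) *\<^sub>R G x)"
    by (simp add: ind scaleR_add_left)
  also have "\<dots> = (LINT x|lborel. indicat_real A x *\<^sub>R G x) + (LINT x|lborel. indicat_real D (x - axis j 1) *\<^sub>R G x)"
    by (rule Bochner_Integration.integral_add) (use int int' in auto)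
  also have "(LINT x|lborel. indicat_real D (x - axis j 1) *\<^sub>R G x) = (LINT x|lborel. (\<lambda>x. indicat_real D (x - axis j 1) *\<^sub>R G x) (x + axis j 1))"
    by (rule integral_translate[symmetric]) (use G in measurable)
  also have "\<dots> = (LINT x|lborel. indicat_real D x *\<^sub>R G x)" by (simp add: per)
  also have "(LINT x|lborel. indicat_real A x *\<^sub>R G x) + (LINT x|lborel. indicat_real D x *\<^sub>R G x) =
     (LINT x|lborel. indicat_real A x *\<^sub>R G x + indicat_real D x *\<^sub>R G x)"
    by (rule Bochner_Integration.integral_add[symmetric]) (use int in auto)
  also have "\<dots> = (LINT x:unit_cube|lborel. G x)"
    by (simp add: set_lebesgue_integral_def ind' scaleR_add_left)
  finally show ?thesis .
qed

text \<open>Multiplication by \<open>m\<close> preserves the measure of the torus: the dilated cube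
  is the disjoint union of m^r integer translates of the unit cube, on each of which a periodic
  function has the same integral, and m^r is also the Jacobian.\<close>

lemma torus_integral_dilate:
  fixes G :: "real ^ 'r \<Rightarrow> real" and m :: nat
  assumes G: "G \<in> borel_measurable borel" "\<And>x. norm (G x) \<le> B"
    and per: "\<And>x v. (\<And>j. v $ j \<in> \<int>) \<Longrightarrow> G (x + v) = G x" and m: "m \<ge> 1"
  shows "(LINT x:unit_cube|lborel. G (real m *\<^sub>R x)) = (LINT x:unit_cube|lborel. G x)"
proof -
  define V :: "(real ^ 'r) set" where "V = (\<lambda>f. \<chi> j. real (f j)) ` (UNIV \<rightarrow>\<^sub>E {..<m})"
  have finV: "finite V" unfolding V_def by (intro finite_imageI finite_PiE) auto
  have cardV: "card V = m ^ CARD('r)"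
  proof -
    have "inj_on (\<lambda>f. (\<chi> j. real (f j)) :: real ^ 'r) (UNIV \<rightarrow>\<^sub>E {..<m})"
      by (auto simp: inj_on_def Finite_Cartesian_Product.vec_eq_iff fun_eq_iff)
    then show ?thesis unfolding V_def by (simp add: card_image card_PiE)
  qed
  have Vint: "v $ j \<in> \<int>" if "v \<in> V" for v j using that by (auto simp: V_def)
  have part: "indicat_real unit_cube ((1 / real m) *\<^sub>R x) = (\<Sum>v\<in>V. indicat_real unit_cube (x - v))" for x :: "real ^ 'r"
  proof (cases "(1 / real m) *\<^sub>R x \<in> unit_cube")
    case True
    define w :: "real ^ 'r" where "w = (\<chi> j. of_int \<lfloor>x $ j\<rfloor>)"
    have x: "0 \<le> x $ j" "x $ j < real m" for j using True m by (auto simp: field_simps)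
    have w: "w = (\<chi> j. real (nat \<lfloor>x $ j\<rfloor>))" using x by (simp add: w_def Finite_Cartesian_Product.vec_eq_iff)
    have "w \<in> V" unfolding V_def w
    proof (rule image_eqI[OF refl])
      have "nat \<lfloor>x $ j\<rfloor> < m" for j using x[of j] by linarith
      then show "(\<lambda>j. nat \<lfloor>x $ j\<rfloor>) \<in> UNIV \<rightarrow>\<^sub>E {..<m}" by auto
    qed
    moreover have "x - v \<in> unit_cube \<longleftrightarrow> v = w" if vV: "v \<in> V" for v
    proof -
      obtain f where v: "v = (\<chi> j. real (f j))" using vV by (auto simp: V_def)
      have "(0 \<le> x $ j - real (f j) \<and> x $ j - real (f j) < 1) \<longleftrightarrow> real (f j) = of_int \<lfloor>x $ j\<rfloor>" for j
        by (auto simp: floor_eq_iff) (metis floor_unique of_int_of_nat_eq le_diff_eq add_0 diff_less_eq add.commute, linarith+)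
      then show ?thesis by (auto simp: v w_def Finite_Cartesian_Product.vec_eq_iff)
    qed
    ultimately have "(\<Sum>v\<in>V. indicat_real unit_cube (x - v)) = (\<Sum>v\<in>V. if v = w then 1 else 0)"
      by (intro sum.cong) (auto simp: indicator_def)
    then show ?thesis using True \<open>w \<in> V\<close> finV by simp
  next
    case False
    have "x - v \<notin> unit_cube" if v: "v \<in> V" for v
    proof
      assume a: "x - v \<in> unit_cube"
      have "0 \<le> x $ j / real m \<and> x $ j / real m < 1" for j
      proof -
        obtain f where f: "f \<in> UNIV \<rightarrow>\<^sub>E {..<m}" "v = (\<chi> j. real (f j))" using v by (auto simp: V_def)
        have "f j < m" using f(1) by auto
        then have "real (f j) \<le> real m - 1" using m by linarith
        moreover have "0 \<le> x $ j - real (f j)" "x $ j - real (f j) < 1" using a by (auto simp: f(2))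
        ultimately show ?thesis using m by (simp add: field_simps)
      qed
      then show False using False by simp
    qed
    then have "(\<Sum>v\<in>V. indicat_real unit_cube (x - v)) = 0" by (intro sum.neutral) (simp add: indicator_def)
    moreover have "indicat_real unit_cube ((1 / real m) *\<^sub>R x) = 0" using False by (simp add: indicator_def)
    ultimately show ?thesis by simp
  qed
  have int: "integrable lborel (\<lambda>x. indicat_real unit_cube (x - v) *\<^sub>R G x)" if "v \<in> V" for v
  proof -
    have "set_integrable lborel unit_cube G"
      using G by (intro set_integrable_bounded) (auto simp: emeasure_unit_cube)
    then have "integrable lborel (\<lambda>x. indicat_real unit_cube x *\<^sub>R G (x + v))" using per Vint[OF that] by (simp add: set_integrable_def)
    then have "integrable (distr lborel borel ((+) (- v))) (\<lambda>x. indicat_real unit_cube x *\<^sub>R G (x + v))"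
      by (simp add: lborel_distr_plus)
    then have "integrable lborel (\<lambda>x. indicat_real unit_cube (- v + x) *\<^sub>R G (- v + x + v))"
      using G by (subst (asm) integrable_distr_eq) auto
    then show ?thesis by (simp add: algebra_simps)
  qed
  have each: "(LINT x|lborel. indicat_real unit_cube (x - v) *\<^sub>R G x) = (LINT x:unit_cube|lborel. G x)" if "v \<in> V" for v
  proof -
    have "(LINT x|lborel. indicat_real unit_cube (x - v) *\<^sub>R G x) = (LINT x|lborel. (\<lambda>x. indicat_real unit_cube (x - v) *\<^sub>R G x) (x + v))"
      by (rule integral_translate[symmetric]) (use G in measurable)
    then show ?thesis using per Vint[OF that] by (simp add: set_lebesgue_integral_def)
  qed
  have "(LINT x|lborel. indicat_real unit_cube ((1 / real m) *\<^sub>R x) *\<^sub>R G x)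
      = real m ^ CARD('r) *\<^sub>R (LINT x|lborel. indicat_real unit_cube ((1 / real m) *\<^sub>R (real m *\<^sub>R x)) *\<^sub>R G (real m *\<^sub>R x))"
    using m G by (subst integral_dilate[of _ "real m"]) auto
  also have "\<dots> = real m ^ CARD('r) * (LINT x:unit_cube|lborel. G (real m *\<^sub>R x))"
    using m by (simp add: set_lebesgue_integral_def)
  finally have 1: "(LINT x|lborel. indicat_real unit_cube ((1 / real m) *\<^sub>R x) *\<^sub>R G x) = real m ^ CARD('r) * (LINT x:unit_cube|lborel. G (real m *\<^sub>R x))" .
  have "(LINT x|lborel. indicat_real unit_cube ((1 / real m) *\<^sub>R x) *\<^sub>R G x) = (LINT x|lborel. (\<Sum>v\<in>V. indicat_real unit_cube (x - v) *\<^sub>R G x))"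
    by (simp only: part scaleR_sum_left)
  also have "\<dots> = (\<Sum>v\<in>V. (LINT x|lborel. indicat_real unit_cube (x - v) *\<^sub>R G x))"
    by (rule Bochner_Integration.integral_sum) (rule int)
  also have "\<dots> = (\<Sum>v\<in>V. (LINT x:unit_cube|lborel. G x))" by (rule sum.cong[OF refl each])
  also have "\<dots> = real m ^ CARD('r) * (LINT x:unit_cube|lborel. G x)" by (simp add: cardV)
  finally show ?thesis using 1 m by simp
qed

lemma unit_exp_measurable [measurable]:
  "f \<in> borel_measurable M \<Longrightarrow> (\<lambda>x. unit_exp (f x)) \<in> borel_measurable M"
  unfolding unit_exp_def by measurable

lemma vec_nth_measurable [measurable]: "(\<lambda>x :: real ^ 'r. x $ j) \<in> borel_measurable borel"
  by (intro borel_measurable_continuous_onI continuous_intros)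

text \<open>Iterated integration is avoided: if v j is nonzero, a shift by half a period 1 / (2
  \<bar>v j\<bar>) in coordinate \<open>j\<close> changes the sign of the character, so its integral
  equals its own negative.\<close>

lemma torus_orthogonality:
  fixes v :: "'r::finite \<Rightarrow> int"
  shows "(LINT \<alpha>:unit_cube|lborel. unit_exp (\<Sum>j\<in>UNIV. (\<alpha> :: real ^ 'r) $ j * of_int (v j))) = (if \<forall>j. v j = 0 then 1 else 0)"
proof (cases "\<forall>j. v j = 0")
  case True
  then have "(LINT \<alpha>:unit_cube|lborel. unit_exp (\<Sum>j\<in>UNIV. (\<alpha> :: real ^ 'r) $ j * of_int (v j))) = measure lborel (unit_cube :: (real ^ 'r) set) *\<^sub>R 1"
    by (simp add: set_integral_const emeasure_unit_cube set_lebesgue_integral_def)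
  then show ?thesis using True by (simp add: measure_def emeasure_unit_cube)
next
  case False
  then obtain j where j: "v j \<noteq> 0" by blast
  define G where "G \<alpha> = unit_exp (\<Sum>j\<in>UNIV. (\<alpha> :: real ^ 'r) $ j * of_int (v j))" for \<alpha>
  have shift: "G (\<alpha> + axis j t) = G \<alpha> * unit_exp (t * of_int (v j))" for \<alpha> t
  proof -
    have "(\<Sum>i\<in>UNIV. (\<alpha> + axis j t) $ i * of_int (v i)) = (\<Sum>i\<in>UNIV. \<alpha> $ i * of_int (v i)) + (\<Sum>i\<in>UNIV. if i = j then t * of_int (v j) else 0)"
      unfolding sum.distrib[symmetric] by (rule sum.cong) (auto simp: axis_def algebra_simps)
    then show ?thesis by (simp add: G_def unit_exp_add)
  qed
  define h where "h = 1 / (2 * \<bar>real_of_int (v j)\<bar>)"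
  have "\<bar>real_of_int (v j)\<bar> \<ge> 1" using j by linarith
  then have h: "0 \<le> h" "h \<le> 1" by (auto simp: h_def field_simps)
  have "unit_exp (1 / 2) = -1" "unit_exp (- (1 / 2)) = -1" by (simp_all add: unit_exp_cis complex_eq_iff)
  moreover have "h * of_int (v j) = 1 / 2 \<or> h * of_int (v j) = - (1 / 2)" using j by (auto simp: h_def abs_if)
  ultimately have "unit_exp (h * of_int (v j)) = -1" by (elim disjE) (simp_all only:)
  then have "G (\<alpha> + axis j h) = - G \<alpha>" for \<alpha> using shift[of \<alpha> h] by simp
  moreover have "(LINT x:unit_cube|lborel. G (x + axis j h)) = (LINT x:unit_cube|lborel. G x)"
  proof (rule torus_integral_shift[OF _ _ _ h])
    show "G \<in> borel_measurable borel" unfolding G_def by measurable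
    show "norm (G x) \<le> 1" for x by (simp add: G_def)
    show "G (x + axis j 1) = G x" for x using shift[of x 1] by simp
  qed
  ultimately have "(LINT x:unit_cube|lborel. - G x) = (LINT x:unit_cube|lborel. G x)" by simp
  then have "- (LINT x:unit_cube|lborel. G x) = (LINT x:unit_cube|lborel. G x)"
    by (simp add: set_lebesgue_integral_def)
  then show ?thesis using False by (simp add: G_def)
qed

section \<open>Exponential sums and counting\<close>

abbreviation phase :: "'d::finite int_mpoly ^ 'r \<Rightarrow> real ^ 'r \<Rightarrow> int ^ 'd \<Rightarrow> real" where
  "phase P \<alpha> n \<equiv> (\<Sum>j\<in>UNIV. \<alpha> $ j * of_int (eval_mpoly (P $ j) n))"

abbreviation solutions :: "int ^ 's \<Rightarrow> 'd::finite int_mpoly ^ 'r \<Rightarrow> (int ^ 'd) set \<Rightarrow> (int ^ 'd ^ 's) set" where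
  "solutions l P A \<equiv> {x. (\<forall>i. x $ i \<in> A) \<and> is_solution l P x}"


lemma eval_mpoly_measurable_term [measurable]:
  "(\<lambda>\<alpha> :: real ^ 'r. \<Sum>j\<in>UNIV. \<alpha> $ j * c j) \<in> borel_measurable borel"
  by measurable

lemma exp_sum_measurable [measurable]: "exp_sum P N a \<in> borel_measurable borel"
  unfolding exp_sum_def by measurable

lemma exp_sum_dilate_measurable [measurable]: "(\<lambda>\<alpha>. exp_sum P N a (c *\<^sub>R \<alpha>)) \<in> borel_measurable borel"
  unfolding exp_sum_def by measurable

lemma norm_exp_sum_le: "norm (exp_sum P N a \<alpha>) \<le> (\<Sum>n\<in>grid N. norm (a n))"
  unfolding exp_sum_def by (rule order_trans[OF norm_sum]) (simp add: norm_mult)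

lemma exp_sum_periodic:
  assumes "\<And>j. v $ j \<in> \<int>" shows "exp_sum P N a (\<alpha> + v) = exp_sum P N a \<alpha>"
proof -
  have "unit_exp (\<Sum>j\<in>UNIV. (\<alpha> + v) $ j * of_int (eval_mpoly (P $ j) n)) = unit_exp (phase P \<alpha> n)" for n
  proof -
    have "(\<Sum>j\<in>UNIV. v $ j * of_int (eval_mpoly (P $ j) n)) \<in> \<int>"
      using assms by (intro Ints_sum Ints_mult) auto
    then obtain m where "(\<Sum>j\<in>UNIV. v $ j * of_int (eval_mpoly (P $ j) n)) = of_int m" by (auto elim: Ints_cases)
    then show ?thesis by (simp add: distrib_right sum.distrib)
  qed
  then show ?thesis unfolding exp_sum_def by (simp only:)
qed

lemma exp_sum_uminus:
  assumes "\<And>n. cnj (a n) = a n" shows "exp_sum P N a (- \<alpha>) = cnj (exp_sum P N a \<alpha>)"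
  unfolding exp_sum_def using assms by (simp add: sum_negf unit_exp_minus)

lemma exp_sum_add: "exp_sum P N (\<lambda>n. a n + b n) \<alpha> = exp_sum P N a \<alpha> + exp_sum P N b \<alpha>"
  unfolding exp_sum_def by (simp add: distrib_right sum.distrib)

lemma exp_sum_cmult: "exp_sum P N (\<lambda>n. c * a n) \<alpha> = c * exp_sum P N a \<alpha>"
  unfolding exp_sum_def by (simp add: sum_distrib_left mult.assoc)

text \<open>The coefficients l $ i dilate the argument of the factors in the counting integral;
  dilation preserves moments. Real coefficients \<open>a\<close> reduce negative \<open>m\<close> to
  positive ones by conjugation.\<close>

lemma exp_sum_moment_dilate:
  assumes a: "\<And>n. cnj (a n) = a n" and m: "(m :: int) \<noteq> 0"
  shows "(LINT \<alpha>:unit_cube|lborel. norm (exp_sum P N a (of_int m *\<^sub>R \<alpha>)) ^ k) = (LINT \<alpha>:unit_cube|lborel. norm (exp_sum P N a \<alpha>) ^ k)"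
proof -
  define G where "G \<alpha> = norm (exp_sum P N a \<alpha>) ^ k" for \<alpha>
  have "G (of_int m *\<^sub>R \<alpha>) = G (real (nat \<bar>m\<bar>) *\<^sub>R \<alpha>)" for \<alpha>
  proof (cases "m \<ge> 0")
    case False
    then have "real_of_int m = - real (nat \<bar>m\<bar>)" by simp
    then have "of_int m *\<^sub>R \<alpha> = - (real (nat \<bar>m\<bar>) *\<^sub>R \<alpha>)" by (simp only: scaleR_minus_left)
    then show ?thesis unfolding G_def by (simp only: exp_sum_uminus[of a, OF a] complex_mod_cnj)
  qed simp
  moreover have "(LINT x:unit_cube|lborel. G (real (nat \<bar>m\<bar>) *\<^sub>R x)) = (LINT x:unit_cube|lborel. G x)"
  proof (rule torus_integral_dilate)
    show "G \<in> borel_measurable borel" unfolding G_def by measurable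
    show "norm (G x) \<le> (\<Sum>n\<in>grid N. norm (a n)) ^ k" for x
      unfolding G_def using norm_exp_sum_le[of P N a x] by (simp add: power_mono)
    show "G (x + v) = G x" if "\<And>j. v $ j \<in> \<int>" for x v unfolding G_def by (simp only: exp_sum_periodic[OF that])
    show "1 \<le> nat \<bar>m\<bar>" using m by simp
  qed
  ultimately show ?thesis by (simp add: G_def)
qed

text \<open>The product expands over all tuples from \<open>S\<close>; each contributes a character
  whose frequency vanishes exactly for solutions, so orthogonality counts them.\<close>

lemma count_solutions_integral:
  fixes P :: "'d::finite int_mpoly ^ 'r" and l :: "int ^ 's"
  assumes S: "S \<subseteq> grid N"
  shows "(LINT \<alpha>:unit_cube|lborel. (\<Prod>i\<in>UNIV. exp_sum P N (\<lambda>n. of_bool (n \<in> S)) (of_int (l $ i) *\<^sub>R \<alpha>)))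
    = of_nat (card (solutions l P S))"
proof -
  let ?F = "UNIV \<rightarrow>\<^sub>E S :: ('s \<Rightarrow> int ^ 'd) set"
  define V where "V g j = (\<Sum>i\<in>UNIV. l $ i * eval_mpoly (P $ j) (g i))" for g :: "'s \<Rightarrow> int ^ 'd" and j
  have finS: "finite S" using S finite_grid finite_subset by blast
  have finF: "finite ?F" using finS by (intro finite_PiE) auto
  have es: "exp_sum P N (\<lambda>n. of_bool (n \<in> S)) \<beta> = (\<Sum>n\<in>S. unit_exp (phase P \<beta> n))" for \<beta>
    unfolding exp_sum_def by (rule sum.mono_neutral_cong_right) (use S in auto)
  have prod: "(\<Prod>i\<in>UNIV. exp_sum P N (\<lambda>n. of_bool (n \<in> S)) (of_int (l $ i) *\<^sub>R \<alpha>)) = (\<Sum>g\<in>?F. unit_exp (\<Sum>j\<in>UNIV. \<alpha> $ j * of_int (V g j)))" for \<alpha>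
  proof -
    have "(\<Prod>i\<in>UNIV. exp_sum P N (\<lambda>n. of_bool (n \<in> S)) (of_int (l $ i) *\<^sub>R \<alpha>)) =
       (\<Sum>g\<in>?F. \<Prod>i\<in>UNIV. unit_exp (\<Sum>j\<in>UNIV. (of_int (l $ i) *\<^sub>R \<alpha>) $ j * of_int (eval_mpoly (P $ j) (g i))))"
      unfolding es by (rule prod_sum_PiE) (use finS in auto)
    also have "\<dots> = (\<Sum>g\<in>?F. unit_exp (\<Sum>j\<in>UNIV. \<alpha> $ j * of_int (V g j)))"
    proof (rule sum.cong)
      fix g assume "g \<in> ?F"
      have "(\<Sum>i\<in>UNIV. \<Sum>j\<in>UNIV. (of_int (l $ i) *\<^sub>R \<alpha>) $ j * of_int (eval_mpoly (P $ j) (g i))) = (\<Sum>j\<in>UNIV. \<alpha> $ j * of_int (V g j))"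
        by (subst sum.swap) (simp add: V_def sum_distrib_left mult_ac)
      then show "(\<Prod>i\<in>UNIV. unit_exp (\<Sum>j\<in>UNIV. (of_int (l $ i) *\<^sub>R \<alpha>) $ j * of_int (eval_mpoly (P $ j) (g i)))) = unit_exp (\<Sum>j\<in>UNIV. \<alpha> $ j * of_int (V g j))"
        by (simp add: unit_exp_sum[symmetric])
    qed simp
    finally show ?thesis .
  qed
  have "(LINT \<alpha>:unit_cube|lborel. (\<Sum>g\<in>?F. unit_exp (\<Sum>j\<in>UNIV. (\<alpha> :: real ^ 'r) $ j * of_int (V g j)))) =
     (\<Sum>g\<in>?F. (LINT \<alpha>:unit_cube|lborel. unit_exp (\<Sum>j\<in>UNIV. (\<alpha> :: real ^ 'r) $ j * of_int (V g j))))"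
    unfolding set_lebesgue_integral_def scaleR_sum_right
  proof (rule Bochner_Integration.integral_sum)
    fix g
    have "set_integrable lborel unit_cube (\<lambda>\<alpha>. unit_exp (\<Sum>j\<in>UNIV. (\<alpha> :: real ^ 'r) $ j * of_int (V g j)))"
      by (rule set_integrable_bounded[where B = 1]) (auto simp: emeasure_unit_cube)
    then show "integrable lborel (\<lambda>\<alpha>. indicat_real unit_cube \<alpha> *\<^sub>R unit_exp (\<Sum>j\<in>UNIV. (\<alpha> :: real ^ 'r) $ j * of_int (V g j)))"
      by (simp add: set_integrable_def)
  qed
  also have "\<dots> = (\<Sum>g\<in>?F. if \<forall>j. V g j = 0 then 1 else 0)" by (simp only: torus_orthogonality)
  also have "\<dots> = of_nat (card {g\<in>?F. \<forall>j. V g j = 0})" using finF by (simp add: sum.If_cases Int_def)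
  also have "card {g\<in>?F. \<forall>j. V g j = 0} = card (solutions l P S)"
    by (rule bij_betw_same_card[of "\<lambda>g. \<chi> i. g i"])
      (auto simp: bij_betw_def inj_on_def fun_eq_iff Finite_Cartesian_Product.vec_eq_iff is_solution_def V_def image_iff intro!: exI[of _ "\<lambda>i. _ $ i"])
  finally show ?thesis by (simp only: prod)
qed

text \<open>Peeling off factor j, the difference becomes (x j + y j) times the old difference plus y
  j times the product of the other x i. In every term at least one factor is some y, and the others
  are at most X + Y.\<close>

lemma norm_prod_add_minus_prod:
  fixes x y :: "'a \<Rightarrow> complex"
  assumes "finite I" "\<And>i. i \<in> I \<Longrightarrow> norm (x i) \<le> X" "\<And>i. i \<in> I \<Longrightarrow> norm (y i) \<le> Y" "0 \<le> X" "0 \<le> Y"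
  shows "norm ((\<Prod>i\<in>I. x i + y i) - (\<Prod>i\<in>I. x i)) \<le> real (card I) * Y * (X + Y) ^ (card I - 1)"
  using assms(1-3)
proof (induction I rule: finite_induct)
  case (insert j I)
  define A where "A = (\<Prod>i\<in>I. x i + y i) - (\<Prod>i\<in>I. x i)"
  have IH: "norm A \<le> real (card I) * Y * (X + Y) ^ (card I - 1)" unfolding A_def using insert by auto
  have eq: "(\<Prod>i\<in>insert j I. x i + y i) - (\<Prod>i\<in>insert j I. x i) = (x j + y j) * A + y j * (\<Prod>i\<in>I. x i)"
    using insert by (simp add: A_def algebra_simps)
  have "norm ((x j + y j) * A) \<le> (X + Y) * (real (card I) * Y * (X + Y) ^ (card I - 1))"
    unfolding norm_mult using IH insert.prems assms by (intro mult_mono order_trans[OF norm_triangle_ineq] add_mono) auto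
  also have "\<dots> = real (card I) * Y * (X + Y) ^ card I"
    by (cases "card I") auto
  finally have 1: "norm ((x j + y j) * A) \<le> real (card I) * Y * (X + Y) ^ card I" .
  have "norm (\<Prod>i\<in>I. x i) \<le> (\<Prod>i\<in>I. X + Y)"
    unfolding prod_norm[symmetric] using insert.prems assms by (intro prod_mono) (auto intro: add_increasing2)
  then have "norm (\<Prod>i\<in>I. x i) \<le> (X + Y) ^ card I" by simp
  then have 2: "norm (y j * (\<Prod>i\<in>I. x i)) \<le> Y * (X + Y) ^ card I"
    unfolding norm_mult using insert.prems assms by (intro mult_mono) auto
  have "norm ((x j + y j) * A + y j * (\<Prod>i\<in>I. x i)) \<le> (real (card I) + 1) * Y * (X + Y) ^ card I"
    using norm_triangle_ineq[of "(x j + y j) * A" "y j * (\<Prod>i\<in>I. x i)"] 1 2 by (simp add: algebra_simps)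
  then show ?case using insert.hyps unfolding eq by (simp add: add.commute)
qed simp

text \<open>Splitting according to whether the perturbation or the main term dominates.\<close>
lemma norm_prod_add_minus_prod_powers:
  fixes x y :: "'a \<Rightarrow> complex"
  assumes I: "finite I" "I \<noteq> {}" and \<epsilon>: "0 < \<epsilon>" "\<epsilon> \<le> 1"
  shows "norm ((\<Prod>i\<in>I. x i + y i) - (\<Prod>i\<in>I. x i)) \<le>
     real (card I) * (2 / \<epsilon>) ^ card I * (\<Sum>i\<in>I. norm (y i) ^ card I) + real (card I) * \<epsilon> * 2 ^ card I * (\<Sum>i\<in>I. norm (x i) ^ card I)"
proof -
  define X where "X = Max ((\<lambda>i. norm (x i)) ` I)"
  define Y where "Y = Max ((\<lambda>i. norm (y i)) ` I)"
  define s where "s = card I"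
  have s: "s \<ge> 1" using I by (simp add: s_def Suc_le_eq card_gt_0_iff)
  have le: "norm (x i) \<le> X" "norm (y i) \<le> Y" if "i \<in> I" for i
    using that I by (auto simp: X_def Y_def intro: Max_ge)
  obtain i0 where i0: "i0 \<in> I" using I by blast
  have nn: "0 \<le> X" "0 \<le> Y" using le[OF i0] by (auto intro: order_trans[OF norm_ge_zero])
  have "X \<in> (\<lambda>i. norm (x i)) ` I" "Y \<in> (\<lambda>i. norm (y i)) ` I" unfolding X_def Y_def using I by (intro Max_in; simp)+
  then obtain i j where ij: "i \<in> I" "X = norm (x i)" "j \<in> I" "Y = norm (y j)" by blast
  have Xs: "X ^ s \<le> (\<Sum>i\<in>I. norm (x i) ^ s)" unfolding ij(2) using ij(1) I by (intro member_le_sum) auto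
  have Ys: "Y ^ s \<le> (\<Sum>i\<in>I. norm (y i) ^ s)" unfolding ij(4) using ij(3) I by (intro member_le_sum) auto
  have "norm ((\<Prod>i\<in>I. x i + y i) - (\<Prod>i\<in>I. x i)) \<le> real s * Y * (X + Y) ^ (s - 1)"
    unfolding s_def by (rule norm_prod_add_minus_prod) (use I le nn in auto)
  also have "\<dots> = real s * (Y * (X + Y) ^ (s - 1))" by simp
  also have "Y * (X + Y) ^ (s - 1) \<le> (2 / \<epsilon>) ^ s * Y ^ s + \<epsilon> * 2 ^ s * X ^ s"
  \<comment> \<open>Either X + Y <= (2/\<epsilon>) Y and everything is a power of Y, or X + Y <= 2 X
    and the one factor Y <= \<epsilon> X supplies the small constant. Thus pure s-th powers suffice
    and no mixed moments appear.\<close>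
  proof (cases "Y \<ge> \<epsilon> * X")
    case True
    have "X + Y \<le> (2 / \<epsilon>) * Y"
    proof -
      have "X \<le> Y / \<epsilon>" using True \<epsilon> by (simp add: field_simps)
      moreover have "Y \<le> Y / \<epsilon>" using \<epsilon> nn by (simp add: field_simps mult_left_le)
      ultimately show ?thesis by simp
    qed
    moreover have "Y \<le> (2 / \<epsilon>) * Y" using mult_right_mono[of 1 "2 / \<epsilon>" Y] \<epsilon> nn by simp
    ultimately have "Y * (X + Y) ^ (s - 1) \<le> ((2 / \<epsilon>) * Y) * ((2 / \<epsilon>) * Y) ^ (s - 1)"
      using nn \<epsilon> by (intro mult_mono power_mono) auto
    also have "\<dots> = ((2 / \<epsilon>) * Y) ^ s" using s by (cases s) simp_all
    also have "\<dots> = (2 / \<epsilon>) ^ s * Y ^ s" by (rule power_mult_distrib)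
    finally show ?thesis using nn \<epsilon> by (simp add: add_increasing2)
  next
    case False
    then have Y: "Y \<le> \<epsilon> * X" by simp
    also have "\<dots> \<le> X" using \<epsilon> nn by (simp add: mult_left_le_one_le)
    finally have "X + Y \<le> 2 * X" by simp
    then have "Y * (X + Y) ^ (s - 1) \<le> (\<epsilon> * X) * (2 * X) ^ (s - 1)"
      using nn \<epsilon> Y by (intro mult_mono power_mono) auto
    also have "\<dots> = \<epsilon> * 2 ^ (s - 1) * X ^ s" using s by (cases s) (simp_all add: power_mult_distrib)
    also have "\<dots> \<le> \<epsilon> * 2 ^ s * X ^ s" using nn \<epsilon> by (intro mult_right_mono mult_left_mono power_increasing) auto
    finally show ?thesis using nn \<epsilon> by (simp add: add_increasing)
  qed
  also have "\<dots> \<le> (2 / \<epsilon>) ^ s * (\<Sum>i\<in>I. norm (y i) ^ s) + \<epsilon> * 2 ^ s * (\<Sum>i\<in>I. norm (x i) ^ s)"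
    using Xs Ys \<epsilon> by (intro add_mono mult_left_mono) auto
  finally show ?thesis using s by (simp add: s_def[symmetric] algebra_simps)
qed

section \<open>Discrete restriction\<close>

lemma abs_eval_mpoly_le:
  fixes p :: "'d::finite int_mpoly"
  assumes "homogeneous_of_degree k p" "n \<in> grid N"
  shows "\<bar>eval_mpoly p n\<bar> \<le> (\<Sum>m\<in>Poly_Mapping.keys p. \<bar>Poly_Mapping.lookup p m\<bar>) * int N ^ k"
proof -
  have n: "\<bar>n $ i\<bar> \<le> int N" for i
  proof -
    have "1 \<le> n $ i \<and> n $ i \<le> int N" using assms(2) by (simp add: grid_def)
    then show ?thesis by linarith
  qed
  have "\<bar>eval_mpoly p n\<bar> \<le> (\<Sum>m\<in>Poly_Mapping.keys p. \<bar>Poly_Mapping.lookup p m * (\<Prod>i\<in>UNIV. (n $ i) ^ Poly_Mapping.lookup m i)\<bar>)"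
    unfolding eval_mpoly_def by (rule sum_abs)
  also have "\<dots> \<le> (\<Sum>m\<in>Poly_Mapping.keys p. \<bar>Poly_Mapping.lookup p m\<bar> * int N ^ k)"
  proof (rule sum_mono)
    fix m assume m: "m \<in> Poly_Mapping.keys p"
    have "\<bar>\<Prod>i\<in>UNIV. (n $ i) ^ Poly_Mapping.lookup m i\<bar> \<le> (\<Prod>i\<in>UNIV. int N ^ Poly_Mapping.lookup m i)"
      unfolding abs_prod power_abs using n by (intro prod_mono) (auto intro: power_mono)
    also have "\<dots> = int N ^ k"
      using assms(1) m by (simp add: power_sum[symmetric] homogeneous_of_degree_def)
    finally show "\<bar>Poly_Mapping.lookup p m * (\<Prod>i\<in>UNIV. (n $ i) ^ Poly_Mapping.lookup m i)\<bar> \<le> \<bar>Poly_Mapping.lookup p m\<bar> * int N ^ k"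
      unfolding abs_mult by (intro mult_left_mono) auto
  qed
  finally show ?thesis by (simp add: sum_distrib_right)
qed

lemma sum_power_words:
  fixes z :: "'r::finite \<Rightarrow> 'a::comm_semiring_1"
  shows "(\<Sum>j\<in>UNIV. z j) ^ m = (\<Sum>w\<in>words m. prod_list (map z w))"
proof (induction m)
  case (Suc m)
  show ?case unfolding sum_words_Suc power_Suc Suc sum_product by simp
qed (simp add: words_0)

text \<open>Expanding the phase difference into its power series expresses a value of the exponential sum
  through values at any nearby point, with rapidly decreasing weights.\<close>
lemma exp_sum_taylor:
  fixes P :: "'d::finite int_mpoly ^ 'r" and \<mu> :: "'r \<Rightarrow> real"
  assumes \<mu>: "\<And>j. \<mu> j > 0" and near: "\<And>j. \<bar>\<alpha>' $ j - \<alpha> $ j\<bar> \<le> 1 / \<mu> j"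
    and \<Lambda>: "0 < \<Lambda>" "\<Lambda> \<le> norm (exp_sum P N a \<alpha>')"
  shows "\<exists>w. \<Lambda> / (4 * (2 * real CARD('r)) ^ length w) \<le>
     norm (exp_sum P N (\<lambda>n. a n * of_real (prod_list (map (\<lambda>j. 2 * pi * of_int (eval_mpoly (P $ j) n) / \<mu> j) w))) \<alpha>)"
proof (rule ccontr)
  let ?r = "real CARD('r)"
  define aw where "aw w n = a n * of_real (prod_list (map (\<lambda>j. 2 * pi * of_int (eval_mpoly (P $ j) n) / \<mu> j) w))" for w n
  assume "\<not> ?thesis"
  then have small: "norm (exp_sum P N (aw w) \<alpha>) < \<Lambda> / (4 * (2 * ?r) ^ length w)" for w
    unfolding aw_def by (simp add: not_le)
  define \<beta> where "\<beta> j = (\<alpha>' $ j - \<alpha> $ j) * \<mu> j" for j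
  have \<beta>: "\<bar>\<beta> j\<bar> \<le> 1" for j
    using mult_right_mono[OF near[of j], of "\<mu> j"] \<mu>[of j] by (simp add: \<beta>_def abs_mult)
  define E where "E n = unit_exp (phase P \<alpha> n)" for n
  define z where "z n = \<i> * (\<Sum>j\<in>UNIV. of_real (\<beta> j * (2 * pi * of_int (eval_mpoly (P $ j) n) / \<mu> j)))" for n
  have E': "unit_exp (phase P \<alpha>' n) = E n * exp (z n)" for n
  proof -
    have "(phase P \<alpha>' n) = (phase P \<alpha> n) + (\<Sum>j\<in>UNIV. (\<alpha>' $ j - \<alpha> $ j) * of_int (eval_mpoly (P $ j) n))"
      by (simp add: sum.distrib[symmetric] algebra_simps)
    moreover have "unit_exp (\<Sum>j\<in>UNIV. (\<alpha>' $ j - \<alpha> $ j) * of_int (eval_mpoly (P $ j) n)) = exp (z n)"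
    proof -
      have "(\<alpha>' $ j - \<alpha> $ j) * of_int (eval_mpoly (P $ j) n) * (2 * pi) = \<beta> j * (2 * pi * of_int (eval_mpoly (P $ j) n) / \<mu> j)" for j
        using \<mu>[of j] by (simp add: \<beta>_def)
      then have "z n = \<i> * of_real (\<Sum>j\<in>UNIV. (\<alpha>' $ j - \<alpha> $ j) * of_int (eval_mpoly (P $ j) n) * (2 * pi))"
        by (simp only: z_def of_real_sum)
      also have "\<dots> = 2 * of_real pi * \<i> * of_real (\<Sum>j\<in>UNIV. (\<alpha>' $ j - \<alpha> $ j) * of_int (eval_mpoly (P $ j) n))"
        unfolding sum_distrib_right[symmetric] by simp
      finally show ?thesis by (simp only: unit_exp_def)
    qed
    ultimately show ?thesis by (simp add: unit_exp_add E_def)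
  qed
  have "(\<lambda>m. \<Sum>n\<in>grid N. a n * E n * (z n ^ m /\<^sub>R fact m)) sums (\<Sum>n\<in>grid N. a n * E n * exp (z n))"
    by (intro sums_sum sums_mult exp_converges)
  then have sums: "(\<lambda>m. \<Sum>n\<in>grid N. a n * E n * (z n ^ m /\<^sub>R fact m)) sums exp_sum P N a \<alpha>'"
    by (simp add: exp_sum_def E' mult.assoc)
  \<comment> \<open>The r^m words of length m, each with weight at most \<Lambda> / (4 (2 r)^m),
    contribute at most \<Lambda> / 4 times 2^-m. The whole series stays below \<Lambda> / 2, which
    contradicts the size of the sum.\<close>
  have "(\<lambda>m. \<Lambda> / 4 * (1/2) ^ m) sums (\<Lambda> / 4 * (1 / (1 - 1/2)))"
    by (intro sums_mult geometric_sums) simp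
  then have geo: "(\<lambda>m. \<Lambda> / 4 * (1/2) ^ m) sums (\<Lambda> / 2)" by simp
  have "norm (\<Sum>n\<in>grid N. a n * E n * (z n ^ m /\<^sub>R fact m)) \<le> \<Lambda> / 4 * (1/2) ^ m" for m
  proof -
    have zm: "z n ^ m = \<i> ^ m * (\<Sum>w\<in>words m. of_real (prod_list (map \<beta> w)) * of_real (prod_list (map (\<lambda>j. 2 * pi * of_int (eval_mpoly (P $ j) n) / \<mu> j) w)))" for n
    proof -
      have *: "prod_list (map (\<lambda>j. complex_of_real (\<beta> j * g j)) w) = of_real (prod_list (map \<beta> w)) * of_real (prod_list (map g w))" for g w
        by (induction w) auto
      show ?thesis unfolding z_def power_mult_distrib sum_power_words * ..
    qed
    have "(\<Sum>n\<in>grid N. a n * E n * (z n ^ m /\<^sub>R fact m)) =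
       (\<i> ^ m / fact m) * (\<Sum>w\<in>words m. of_real (prod_list (map \<beta> w)) * exp_sum P N (aw w) \<alpha>)"
    proof -
      have "(\<Sum>n\<in>grid N. a n * E n * (z n ^ m /\<^sub>R fact m)) =
         (\<Sum>n\<in>grid N. \<Sum>w\<in>words m. (\<i> ^ m / fact m) * (of_real (prod_list (map \<beta> w)) * (aw w n * E n)))"
        unfolding zm by (simp add: sum_distrib_left scaleR_conv_of_real aw_def divide_inverse mult_ac)
      also have "\<dots> = (\<Sum>w\<in>words m. \<Sum>n\<in>grid N. (\<i> ^ m / fact m) * (of_real (prod_list (map \<beta> w)) * (aw w n * E n)))"
        by (rule sum.swap)
      finally show ?thesis by (simp add: exp_sum_def E_def sum_distrib_left)
    qed
    then have "norm (\<Sum>n\<in>grid N. a n * E n * (z n ^ m /\<^sub>R fact m)) =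
       1 / fact m * norm (\<Sum>w\<in>words m. of_real (prod_list (map \<beta> w)) * exp_sum P N (aw w) \<alpha>)"
      by (simp add: norm_mult norm_divide norm_power)
    also have "\<dots> \<le> 1 * (\<Sum>w\<in>(words m :: 'r list set). \<Lambda> / (4 * (2 * ?r) ^ m))"
    proof (intro mult_mono)
      have "norm (\<Sum>w\<in>words m. of_real (prod_list (map \<beta> w)) * exp_sum P N (aw w) \<alpha>) \<le>
        (\<Sum>w\<in>words m. norm (of_real (prod_list (map \<beta> w)) * exp_sum P N (aw w) \<alpha>))" by (rule norm_sum)
      also have "\<dots> \<le> (\<Sum>w\<in>(words m :: 'r list set). \<Lambda> / (4 * (2 * ?r) ^ m))"
      proof (rule sum_mono)
        fix w :: "'r list" assume "w \<in> words m"
        then have w: "length w = m" by (simp add: words_def)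
        have "\<bar>prod_list (map \<beta> w)\<bar> \<le> 1"
        proof (induction w)
          case (Cons j w)
          then show ?case using \<beta>[of j] by (simp add: abs_mult mult_le_one)
        qed simp
        then have "norm (of_real (prod_list (map \<beta> w)) * exp_sum P N (aw w) \<alpha>) \<le> 1 * (\<Lambda> / (4 * (2 * ?r) ^ length w))"
          unfolding norm_mult using small[of w] by (intro mult_mono) auto
        then show "norm (of_real (prod_list (map \<beta> w)) * exp_sum P N (aw w) \<alpha>) \<le> \<Lambda> / (4 * (2 * ?r) ^ m)" using w by simp
      qed
      finally show "norm (\<Sum>w\<in>words m. of_real (prod_list (map \<beta> w)) * exp_sum P N (aw w) \<alpha>) \<le> (\<Sum>w\<in>(words m :: 'r list set). \<Lambda> / (4 * (2 * ?r) ^ m))" .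
      show "1 / fact m \<le> (1::real)" by simp
    qed auto
    also have "\<dots> = \<Lambda> / 4 * (1/2) ^ m"
      by (simp add: card_words power_mult_distrib power_one_over field_simps)
    finally show ?thesis .
  qed
  from norm_sums_le[OF sums geo this] have "norm (exp_sum P N a \<alpha>') \<le> \<Lambda> / 2" .
  then show False using \<Lambda> by linarith
qed

lemma norm_two_nonneg: "0 \<le> norm_two N a"
  by (simp add: norm_two_def L2_set_nonneg)

lemma norm_two_mono:
  assumes "\<And>n. n \<in> grid N \<Longrightarrow> norm (a n) \<le> c * norm (b n)" "0 \<le> c"
  shows "norm_two N a \<le> c * norm_two N b"
  unfolding norm_two_def L2_set_right_distrib[OF assms(2)] by (rule L2_set_mono) (use assms in auto)

lemma norm_two_le:
  fixes a :: "int ^ 'd::finite \<Rightarrow> complex"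
  assumes "\<And>n. n \<in> grid N \<Longrightarrow> norm (a n) \<le> 1"
  shows "norm_two N a \<le> real N powr (real CARD('d) / 2)"
proof -
  have "norm_two N a \<le> sqrt (\<Sum>n\<in>(grid N :: (int ^ 'd) set). 1)"
    unfolding norm_two_def L2_set_def using assms by (intro real_sqrt_le_mono sum_mono) (simp add: power_le_one)
  also have "\<dots> = sqrt (real N ^ CARD('d))" by (simp add: card_grid)
  also have "\<dots> = real N powr (real CARD('d) / 2)"
    by (cases "N = 0") (simp_all add: powr_half_sqrt[symmetric] powr_realpow[symmetric] powr_powr)
  finally show ?thesis .
qed

locale large_values =
  fixes P :: "'d::finite int_mpoly ^ 'r" and k :: "nat ^ 'r" and d K s' \<theta> C1 :: real
  assumes d_def: "d = real CARD('d)"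
    and homog: "\<And>j. homogeneous_of_degree (k $ j) (P $ j)"
    and K_def: "K = real (\<Sum>j\<in>UNIV. k $ j)"
    and s'_pos: "0 < s'"
    and C1: "C1 \<ge> 1"
    and large: "\<And>N a. N \<ge> 2 \<Longrightarrow>
       (LINT \<alpha>:{\<alpha>. norm (exp_sum P N a \<alpha>) \<ge> real N powr (d / 2 - \<theta>) * norm_two N a}
            |torus_measure. norm (exp_sum P N a \<alpha>) powr s')
           \<le> C1 * real N powr (d * s' / 2 - K) * norm_two N a powr s'"
begin

text \<open>Chebyshev's inequality: since \<Lambda> is at least the threshold, the set lies in the
  domain of integration of the large values hypothesis.\<close>

lemma large_values_measure:
  assumes N: "N \<ge> 2" and \<Lambda>: "0 < \<Lambda>" "real N powr (d / 2 - \<theta>) * norm_two N a \<le> \<Lambda>"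
  shows "measure lborel (unit_cube \<inter> {\<alpha>. \<Lambda> \<le> norm (exp_sum P N a \<alpha>)}) \<le>
     C1 * real N powr (d * s' / 2 - K) * (norm_two N a / \<Lambda>) powr s'"
proof -
  define S where "S = {\<alpha>. norm (exp_sum P N a \<alpha>) \<ge> real N powr (d / 2 - \<theta>) * norm_two N a}"
  define T where "T = (unit_cube \<inter> {\<alpha>. \<Lambda> \<le> norm (exp_sum P N a \<alpha>)})"
  have S[measurable]: "S \<in> sets borel" unfolding S_def by measurable
  have T[measurable]: "T \<in> sets borel" unfolding T_def by measurable
  have fT: "emeasure lborel T < \<infinity>"
  proof -
    have "emeasure lborel T \<le> emeasure lborel (unit_cube :: (real ^ 'r) set)" by (rule emeasure_mono) (auto simp: T_def)
    then show ?thesis by (auto simp: emeasure_unit_cube intro: le_less_trans)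
  qed
  define B where "B = (\<Sum>n\<in>grid N. norm (a n)) powr s'"
  have "\<Lambda> powr s' * measure lborel T = (LINT \<alpha>|lborel. indicat_real T \<alpha> * \<Lambda> powr s')"
    using fT by (simp add: measure_def)
  also have "\<dots> \<le> (LINT \<alpha>|lborel. indicat_real unit_cube \<alpha> *\<^sub>R (indicat_real S \<alpha> *\<^sub>R norm (exp_sum P N a \<alpha>) powr s'))"
  proof (rule integral_mono)
    show "integrable lborel (\<lambda>\<alpha>. indicat_real T \<alpha> * \<Lambda> powr s')" using fT by (intro integrable_mult_left integrable_real_indicator) auto
    show "integrable lborel (\<lambda>\<alpha>. indicat_real unit_cube \<alpha> *\<^sub>R (indicat_real S \<alpha> *\<^sub>R norm (exp_sum P N a \<alpha>) powr s'))"
      unfolding set_integrable_def[symmetric]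
    proof (rule set_integrable_bounded[where B = B])
      fix x
      have "norm (exp_sum P N a x) powr s' \<le> B" unfolding B_def using norm_exp_sum_le s'_pos by (intro powr_mono2) auto
      then show "norm (indicat_real S x *\<^sub>R norm (exp_sum P N a x) powr s') \<le> B"
        by (auto simp: indicator_def B_def)
    qed (auto simp: emeasure_unit_cube)
    show "indicat_real T \<alpha> * \<Lambda> powr s' \<le> indicat_real unit_cube \<alpha> *\<^sub>R (indicat_real S \<alpha> *\<^sub>R norm (exp_sum P N a \<alpha>) powr s')" for \<alpha>
    proof (cases "\<alpha> \<in> T")
      case True
      then have "\<alpha> \<in> unit_cube" "\<alpha> \<in> S" "\<Lambda> \<le> norm (exp_sum P N a \<alpha>)" using \<Lambda> by (auto simp: T_def S_def)
      moreover have "\<Lambda> powr s' \<le> norm (exp_sum P N a \<alpha>) powr s'" using \<open>\<Lambda> \<le> norm (exp_sum P N a \<alpha>)\<close> \<Lambda> s'_pos by (intro powr_mono2) auto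
      ultimately show ?thesis using True by (simp add: indicator_def)
    qed (simp add: indicator_def)
  qed
  also have "\<dots> = (LINT \<alpha>:S|torus_measure. norm (exp_sum P N a \<alpha>) powr s')"
    unfolding set_lebesgue_integral_def[of torus_measure] torus_integral_eq by (simp add: set_lebesgue_integral_def)
  also have "\<dots> \<le> C1 * real N powr (d * s' / 2 - K) * norm_two N a powr s'"
    unfolding S_def by (rule large[OF N])
  finally have "measure lborel T \<le> C1 * real N powr (d * s' / 2 - K) * norm_two N a powr s' / \<Lambda> powr s'"
    using \<Lambda> by (simp add: field_simps)
  also have "\<dots> = C1 * real N powr (d * s' / 2 - K) * (norm_two N a / \<Lambda>) powr s'"
    using \<Lambda> norm_two_nonneg[of N a] by (simp add: powr_divide)
  finally show ?thesis unfolding T_def .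
qed

text \<open>The scale is natural: P_j is of order at most N^(k_j) on the grid, so each term of a
  phase varies by O(1/M) across a box, and the volume of a box is M^-r N^-K.\<close>

definition torus_box :: "nat \<Rightarrow> nat \<Rightarrow> ('r \<Rightarrow> nat) \<Rightarrow> (real ^ 'r) set" where
  "torus_box M N v = half_box (\<chi> j. real (v j) / real (M * N ^ (k $ j))) (\<chi> j. (real (v j) + 1) / real (M * N ^ (k $ j)))"

definition box_index :: "nat \<Rightarrow> nat \<Rightarrow> ('r \<Rightarrow> nat) set" where
  "box_index M N = PiE UNIV (\<lambda>j. {..<M * N ^ (k $ j)})"

lemma torus_box_measurable [measurable]: "torus_box M N v \<in> sets borel"
  by (simp add: torus_box_def)

lemma measure_torus_box:
  assumes "M \<ge> 1" "N \<ge> 1"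
  shows "emeasure lborel (torus_box M N v) = ennreal (1 / (real M ^ CARD('r) * real N powr K))"
proof -
  have pos: "real (M * N ^ (k $ j)) > 0" for j using assms by simp
  have "emeasure lborel (torus_box M N v) = ennreal (\<Prod>j\<in>UNIV. 1 / real (M * N ^ (k $ j)))"
    unfolding torus_box_def by (subst emeasure_half_box) (use pos in \<open>auto simp: divide_right_mono diff_divide_distrib[symmetric]\<close>)
  also have "(\<Prod>j\<in>UNIV. 1 / real (M * N ^ (k $ j))) = 1 / (real M ^ CARD('r) * real N ^ (\<Sum>j\<in>UNIV. k $ j))"
    by (simp add: prod_dividef prod.distrib power_sum)
  also have "real N ^ (\<Sum>j\<in>UNIV. k $ j) = real N powr K" unfolding K_def by (rule powr_realpow[symmetric]) (use assms in simp)
  finally show ?thesis .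
qed

lemma torus_box_disjoint:
  assumes "\<alpha> \<in> torus_box M N v" "\<alpha> \<in> torus_box M N v'" "M \<ge> 1" "N \<ge> 1"
  shows "v = v'"
proof
  fix j
  define q where "q = real (M * N ^ (k $ j))"
  have q: "q > 0" using assms by (simp add: q_def)
  have "real (v j) / q \<le> \<alpha> $ j" "\<alpha> $ j < (real (v j) + 1) / q" "real (v' j) / q \<le> \<alpha> $ j" "\<alpha> $ j < (real (v' j) + 1) / q"
    using assms(1,2) by (auto simp: torus_box_def half_box_def q_def)
  then have "real (v j) \<le> \<alpha> $ j * q" "\<alpha> $ j * q < real (v j) + 1" "real (v' j) \<le> \<alpha> $ j * q" "\<alpha> $ j * q < real (v' j) + 1"
    using q by (simp_all add: field_simps)
  then show "v j = v' j" by linarith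
qed

lemma torus_box_cover:
  assumes "\<alpha> \<in> unit_cube" "M \<ge> 1" "N \<ge> 1"
  shows "\<exists>v\<in>box_index M N. \<alpha> \<in> torus_box M N v"
proof -
  define q where "q j = real (M * N ^ (k $ j))" for j
  have q: "q j > 0" for j using assms by (simp add: q_def)
  define v where "v j = nat \<lfloor>\<alpha> $ j * q j\<rfloor>" for j
  have \<alpha>: "0 \<le> \<alpha> $ j * q j" "\<alpha> $ j * q j < q j" for j
    using assms(1) q[of j] by auto
  have v: "real (v j) \<le> \<alpha> $ j * q j" "\<alpha> $ j * q j < real (v j) + 1" for j
    using \<alpha>(1)[of j] unfolding v_def by linarith+
  have "\<alpha> \<in> torus_box M N v"
  proof -
    have "real (v j) / q j \<le> \<alpha> $ j \<and> \<alpha> $ j < (real (v j) + 1) / q j" for j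
      using v[of j] q[of j] by (simp add: field_simps)
    then show ?thesis unfolding torus_box_def half_box_def q_def by simp
  qed
  moreover have "v j < M * N ^ (k $ j)" for j
  proof -
    have "real (v j) < real (M * N ^ (k $ j))" using v(1)[of j] \<alpha>(2)[of j] unfolding q_def by linarith
    then show ?thesis by (simp only: of_nat_less_iff)
  qed
  then have "v \<in> box_index M N" by (auto simp: box_index_def)
  ultimately show ?thesis by blast
qed

lemma torus_box_subset:
  assumes "v \<in> box_index M N" "M \<ge> 1" "N \<ge> 1" shows "torus_box M N v \<subseteq> unit_cube"
proof
  fix \<alpha> assume a: "\<alpha> \<in> torus_box M N v"
  show "\<alpha> \<in> unit_cube"
  proof (intro CollectI allI)
    fix j
    define q where "q = real (M * N ^ (k $ j))"
    have q: "q > 0" using assms by (simp add: q_def)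
    have "v j < M * N ^ (k $ j)" using assms(1) by (auto simp: box_index_def)
    then have "v j + 1 \<le> M * N ^ (k $ j)" by simp
    then have "real (v j + 1) \<le> q" unfolding q_def by (simp only: of_nat_le_iff)
    then have "(real (v j) + 1) / q \<le> 1" using q by simp
    moreover have "real (v j) / q \<le> \<alpha> $ j" "\<alpha> $ j < (real (v j) + 1) / q" using a by (auto simp: torus_box_def half_box_def q_def)
    moreover have "0 \<le> real (v j) / q" using q by simp
    ultimately show "0 \<le> \<alpha> $ j \<and> \<alpha> $ j < 1" by linarith
  qed
qed

text \<open>A large value at one point of a box forces, at every other point of that box, a large
  value of some sum with coefficients \<open>aw w\<close>. So the boxes are covered by level sets of
  such sums, whose measure the hypothesis bounds, and comparing volumes bounds their number. One
  point per box is enough; adjacent boxes do no harm.\<close>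

lemma discrete_restriction:
  obtains M0 :: nat where "M0 \<ge> 1"
    "\<And>M N a V \<alpha> \<Lambda>. M \<ge> M0 \<Longrightarrow> N \<ge> 2 \<Longrightarrow> V \<subseteq> box_index M N \<Longrightarrow> (\<And>v. v \<in> V \<Longrightarrow> \<alpha> v \<in> torus_box M N v) \<Longrightarrow>
       0 < \<Lambda> \<Longrightarrow> (\<And>v. v \<in> V \<Longrightarrow> \<Lambda> \<le> norm (exp_sum P N a (\<alpha> v))) \<Longrightarrow>
       4 * real N powr (d / 2 - \<theta>) * norm_two N a \<le> \<Lambda> \<Longrightarrow>
       real (card V) \<le> 2 * 4 powr s' * C1 * real M ^ CARD('r) * (real N powr (d / 2) * norm_two N a / \<Lambda>) powr s'"
proof -
  define r where "r = real CARD('r)"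
  have r: "r \<ge> 1" by (simp add: r_def Suc_le_eq)
  define CP where "CP = (\<Sum>j\<in>UNIV. \<Sum>m\<in>Poly_Mapping.keys (P $ j). \<bar>Poly_Mapping.lookup (P $ j) m\<bar>)"
  \<comment> \<open>Two demands fix \<open>c0\<close>: c0 (2 r) <= 1 keeps the lowered levels above
    the threshold for the coefficients \<open>aw w\<close>, and (c0 (2 r))^s' = 1 / (2 r) makes the
    measures of the level sets summable over the r^m words of each length m. \<open>M0\<close> makes
    every phase factor at most \<open>c0\<close>.\<close>
  define c0 where "c0 = (1 / (2 * r)) * (1 / (2 * r)) powr (1 / s')"
  have c0: "c0 > 0" using r by (simp add: c0_def)
  have c0_le: "c0 * (2 * r) \<le> 1"
  proof -
    have "(1 / (2 * r)) powr (1 / s') \<le> 1" using r s'_pos by (intro powr_le1) auto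
    then show ?thesis using r by (simp add: c0_def)
  qed
  define M0 where "M0 = nat \<lceil>2 * pi * of_int CP / c0\<rceil> + 1"
  have CP0: "CP \<ge> 0" unfolding CP_def by (intro sum_nonneg) auto
  show ?thesis
  proof (rule that[of M0])
    show "M0 \<ge> 1" by (simp add: M0_def)
    fix M N :: nat and a V \<alpha> and \<Lambda> :: real
    assume M: "M \<ge> M0" and N: "N \<ge> 2" and V: "V \<subseteq> box_index M N" and \<alpha>: "\<And>v. v \<in> V \<Longrightarrow> \<alpha> v \<in> torus_box M N v"
      and \<Lambda>: "0 < \<Lambda>" and big: "\<And>v. v \<in> V \<Longrightarrow> \<Lambda> \<le> norm (exp_sum P N a (\<alpha> v))"
      and thr: "4 * real N powr (d / 2 - \<theta>) * norm_two N a \<le> \<Lambda>"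
    have M1: "M \<ge> 1" "N \<ge> 1" using M N by (auto simp: M0_def)
    define \<mu> where "\<mu> j = real (M * N ^ (k $ j))" for j
    have \<mu>: "\<mu> j > 0" for j using M1 by (simp add: \<mu>_def)
    define aw where "aw w n = a n * of_real (prod_list (map (\<lambda>j. 2 * pi * of_int (eval_mpoly (P $ j) n) / \<mu> j) w))" for w n
    have phase: "\<bar>2 * pi * of_int (eval_mpoly (P $ j) n) / \<mu> j\<bar> \<le> c0" if n: "n \<in> grid N" for j n
    proof -
      have "\<bar>eval_mpoly (P $ j) n\<bar> \<le> (\<Sum>m\<in>Poly_Mapping.keys (P $ j). \<bar>Poly_Mapping.lookup (P $ j) m\<bar>) * int N ^ (k $ j)"
        by (rule abs_eval_mpoly_le[OF homog n])
      also have "\<dots> \<le> CP * int N ^ (k $ j)"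
        unfolding CP_def by (intro mult_right_mono member_le_sum sum_nonneg) auto
      finally have "real_of_int \<bar>eval_mpoly (P $ j) n\<bar> \<le> of_int (CP * int N ^ (k $ j))" by (simp only: of_int_le_iff)
      then have "2 * pi * \<bar>real_of_int (eval_mpoly (P $ j) n)\<bar> \<le> 2 * pi * (of_int CP * real N ^ (k $ j))"
        by (intro mult_left_mono) auto
      also have "\<dots> = (2 * pi * of_int CP) * real N ^ (k $ j)" by simp
      also have "\<dots> \<le> (c0 * real M) * real N ^ (k $ j)"
      proof (intro mult_right_mono)
        have "2 * pi * of_int CP / c0 \<le> real M0" unfolding M0_def by linarith
        also have "\<dots> \<le> real M" using M by simp
        finally show "2 * pi * of_int CP \<le> c0 * real M" using c0 by (simp add: field_simps)
      qed simp
      also have "\<dots> = c0 * \<mu> j" by (simp add: \<mu>_def)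
      finally show ?thesis using \<mu>[of j] by (simp add: abs_mult abs_divide field_simps)
    qed
    have aw_le: "norm_two N (aw w) \<le> c0 ^ length w * norm_two N a" for w
    proof (rule norm_two_mono)
      fix n :: "int ^ 'd" assume n: "n \<in> grid N"
      have "\<bar>prod_list (map (\<lambda>j. 2 * pi * of_int (eval_mpoly (P $ j) n) / \<mu> j) w)\<bar> \<le> c0 ^ length w"
      proof (induction w)
        case (Cons j w)
        from mult_mono[OF phase[OF n, of j] this] show ?case using c0 by (simp add: abs_mult)
      qed simp
      then show "norm (aw w n) \<le> c0 ^ length w * norm (a n)"
        unfolding aw_def norm_mult by (simp add: mult.commute[of "norm (a n)"] mult_right_mono)
    qed (use c0 in simp)
    define T where "T w = unit_cube \<inter> {\<alpha>. \<Lambda> / (4 * (2 * r) ^ length w) \<le> norm (exp_sum P N (aw w) \<alpha>)}" for w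
    have Tm[measurable]: "T w \<in> sets borel" for w unfolding T_def by measurable
    have fT: "emeasure lborel (T w) = ennreal (measure lborel (T w))" for w
    proof -
      have "emeasure lborel (T w) \<le> emeasure lborel (unit_cube :: (real ^ 'r) set)" by (rule emeasure_mono) (auto simp: T_def)
      then have "emeasure lborel (T w) \<noteq> \<infinity>" by (auto simp: emeasure_unit_cube top_unique)
      then show ?thesis by (simp add: emeasure_eq_ennreal_measure)
    qed
    define B where "B = C1 * real N powr (d * s' / 2 - K) * (4 * norm_two N a / \<Lambda>) powr s'"
    have B0: "B \<ge> 0" using C1 by (simp add: B_def)
    have meas_T: "measure lborel (T w) \<le> B * (1 / (2 * r)) ^ length w" for w
    proof -
      define m where "m = length w"
      have pw: "(2 * r) ^ m > 0" using r by simp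
      have cp: "(c0 * (2 * r)) ^ m \<le> 1" using c0_le c0 r by (intro power_le_one) auto
      have "real N powr (d / 2 - \<theta>) * norm_two N (aw w) \<le> real N powr (d / 2 - \<theta>) * (c0 ^ m * norm_two N a)"
        using aw_le[of w] by (intro mult_left_mono) (auto simp: m_def)
      also have "\<dots> = (4 * real N powr (d / 2 - \<theta>) * norm_two N a) * (c0 ^ m / 4)" by simp
      also have "\<dots> \<le> \<Lambda> * (c0 ^ m / 4)" using thr c0 by (intro mult_right_mono) auto
      also have "\<dots> = \<Lambda> * (c0 * (2 * r)) ^ m / (4 * (2 * r) ^ m)" using pw r by (simp add: power_mult_distrib)
      also have "\<dots> \<le> \<Lambda> * 1 / (4 * (2 * r) ^ m)" using cp \<Lambda> pw by (intro divide_right_mono mult_left_mono) auto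
      finally have t: "real N powr (d / 2 - \<theta>) * norm_two N (aw w) \<le> \<Lambda> / (4 * (2 * r) ^ m)" by simp
      have "measure lborel (T w) \<le> C1 * real N powr (d * s' / 2 - K) * (norm_two N (aw w) / (\<Lambda> / (4 * (2 * r) ^ m))) powr s'"
        unfolding T_def m_def[symmetric] by (rule large_values_measure[OF N _ t]) (use \<Lambda> pw in simp)
      also have "\<dots> \<le> C1 * real N powr (d * s' / 2 - K) * ((4 * norm_two N a / \<Lambda>) * (c0 * (2 * r)) ^ m) powr s'"
      proof (intro mult_left_mono powr_mono2)
        have "norm_two N (aw w) / (\<Lambda> / (4 * (2 * r) ^ m)) \<le> c0 ^ m * norm_two N a / (\<Lambda> / (4 * (2 * r) ^ m))"
          using aw_le[of w] \<Lambda> pw by (intro divide_right_mono) (auto simp: m_def)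
        also have "\<dots> = (4 * norm_two N a / \<Lambda>) * (c0 * (2 * r)) ^ m" using \<Lambda> by (simp add: power_mult_distrib)
        finally show "norm_two N (aw w) / (\<Lambda> / (4 * (2 * r) ^ m)) \<le> (4 * norm_two N a / \<Lambda>) * (c0 * (2 * r)) ^ m" .
      qed (use C1 s'_pos \<Lambda> pw norm_two_nonneg[of N "aw w"] in auto)
      also have "\<dots> = B * ((c0 * (2 * r)) ^ m) powr s'"
      proof -
        have "((4 * norm_two N a / \<Lambda>) * (c0 * (2 * r)) ^ m) powr s' = (4 * norm_two N a / \<Lambda>) powr s' * ((c0 * (2 * r)) ^ m) powr s'"
          by (rule powr_mult)
        then show ?thesis by (simp add: B_def)
      qed
      also have "((c0 * (2 * r)) ^ m) powr s' = (1 / (2 * r)) ^ m"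
      proof -
        have "c0 * (2 * r) = (1 / (2 * r)) powr (1 / s')" using r by (simp add: c0_def)
        then have "((c0 * (2 * r)) ^ m) powr s' = (((1 / (2 * r)) powr (1 / s')) powr real m) powr s'"
          using r by (simp add: powr_realpow)
        also have "\<dots> = (1 / (2 * r)) powr real m" using s'_pos by (simp add: powr_powr)
        finally show ?thesis using r by (simp add: powr_realpow)
      qed
      finally show ?thesis by (simp add: m_def)
    qed
    define U where "U m = (\<Union>w\<in>words m. T w)" for m
    have U: "emeasure lborel (U m) \<le> ennreal (B * (1/2) ^ m)" for m
    proof -
      have "emeasure lborel (U m) \<le> (\<Sum>w\<in>words m. emeasure lborel (T w))"
        unfolding U_def by (rule emeasure_subadditive_finite) auto
      also have "\<dots> = ennreal (\<Sum>w\<in>words m. measure lborel (T w))" by (simp add: fT)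
      also have "\<dots> \<le> ennreal (\<Sum>w\<in>(words m :: 'r list set). B * (1 / (2 * r)) ^ m)"
      proof (intro ennreal_leI sum_mono)
        fix w :: "'r list" assume "w \<in> words m"
        then show "measure lborel (T w) \<le> B * (1 / (2 * r)) ^ m" using meas_T[of w] by (simp add: words_def)
      qed
      also have "(\<Sum>w\<in>(words m :: 'r list set). B * (1 / (2 * r)) ^ m) = B * (1/2) ^ m"
        using r by (simp add: card_words r_def power_mult_distrib power_divide field_simps)
      finally show ?thesis .
    qed
    have Um[measurable]: "U m \<in> sets borel" for m unfolding U_def by (intro sets.finite_UN) auto
    \<comment> \<open>The expansion is centred at an arbitrary point \<beta> of the box and
      evaluated at the chosen point \<alpha> v, so that entire boxes are covered.\<close>
    have "(\<Union>v\<in>V. torus_box M N v) \<subseteq> (\<Union>m. U m)"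
    proof
      fix \<beta> assume "\<beta> \<in> (\<Union>v\<in>V. torus_box M N v)"
      then obtain v where v: "v \<in> V" "\<beta> \<in> torus_box M N v" by blast
      have "\<bar>\<alpha> v $ j - \<beta> $ j\<bar> \<le> 1 / \<mu> j" for j
      proof -
        have "real (v j) / \<mu> j \<le> \<alpha> v $ j" "\<alpha> v $ j < (real (v j) + 1) / \<mu> j" "real (v j) / \<mu> j \<le> \<beta> $ j" "\<beta> $ j < (real (v j) + 1) / \<mu> j"
          using \<alpha>[OF v(1)] v(2) by (auto simp: torus_box_def half_box_def \<mu>_def)
        then show ?thesis by (simp add: add_divide_distrib abs_le_iff)
      qed
      from exp_sum_taylor[OF \<mu> this \<Lambda> big[OF v(1)]]
      obtain w where "\<Lambda> / (4 * (2 * r) ^ length w) \<le> norm (exp_sum P N (aw w) \<beta>)" unfolding aw_def r_def by blast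
      moreover have "\<beta> \<in> unit_cube" using torus_box_subset[of v M N] v V M1 by blast
      ultimately have "\<beta> \<in> T w" by (simp add: T_def)
      then have "\<beta> \<in> U (length w)" unfolding U_def words_def by blast
      then show "\<beta> \<in> (\<Union>m. U m)" by blast
    qed
    then have "emeasure lborel (\<Union>v\<in>V. torus_box M N v) \<le> emeasure lborel (\<Union>m. U m)"
      by (intro emeasure_mono) auto
    also have "\<dots> \<le> suminf (\<lambda>m. emeasure lborel (U m))"
      by (rule emeasure_subadditive_countably) auto
    also have "\<dots> \<le> suminf (\<lambda>m. ennreal (B * (1/2) ^ m))" by (intro suminf_le U summableI)
    also have "\<dots> = ennreal (B * 2)"
    proof (rule suminf_ennreal_eq)
      have "(\<lambda>m. B * (1/2) ^ m) sums (B * (1 / (1 - 1/2)))" by (intro sums_mult geometric_sums) simp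
      then show "(\<lambda>m. B * (1/2) ^ m) sums (B * 2)" by simp
    qed (use B0 in simp)
    finally have le: "emeasure lborel (\<Union>v\<in>V. torus_box M N v) \<le> ennreal (B * 2)" .
    have finV: "finite V" by (rule finite_subset[OF V]) (auto simp: box_index_def intro: finite_PiE)
    have "emeasure lborel (\<Union>v\<in>V. torus_box M N v) = (\<Sum>v\<in>V. emeasure lborel (torus_box M N v))"
      by (rule sum_emeasure[symmetric]) (use finV torus_box_disjoint M1 in \<open>auto simp: disjoint_family_on_def\<close>)
    also have "\<dots> = ennreal (real (card V) * (1 / (real M ^ CARD('r) * real N powr K)))"
      by (simp add: measure_torus_box[OF M1] ennreal_of_nat_eq_real_of_nat ennreal_mult[symmetric])
    finally have "real (card V) * (1 / (real M ^ CARD('r) * real N powr K)) \<le> B * 2"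
      using le B0 by (simp add: ennreal_le_iff)
    then have "real (card V) \<le> B * 2 * (real M ^ CARD('r) * real N powr K)"
      using M1 by (simp add: field_simps)
    also have "\<dots> = 2 * C1 * real M ^ CARD('r) * (real N powr (d * s' / 2) * (4 * norm_two N a / \<Lambda>) powr s')"
      using M1 by (simp add: B_def powr_diff)
    also have "real N powr (d * s' / 2) * (4 * norm_two N a / \<Lambda>) powr s' = 4 powr s' * (real N powr (d / 2) * norm_two N a / \<Lambda>) powr s'"
      using \<Lambda> norm_two_nonneg[of N a] by (simp add: powr_mult powr_divide powr_powr)
    finally show "real (card V) \<le> 2 * 4 powr s' * C1 * real M ^ CARD('r) * (real N powr (d / 2) * norm_two N a / \<Lambda>) powr s'"
      by (simp add: mult_ac)
  qed
qed

end

section \<open>Moments\<close>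

locale restriction_system = large_values P k d K s' \<theta> C1
  for P :: "'d::finite int_mpoly ^ 'r" and k d K s' \<theta> C1 +
  fixes l :: "int ^ 's" and s s'' C2 c3 :: real
  assumes s_def: "s = real CARD('s)"
    and l_nonzero: "\<And>i. l $ i \<noteq> 0"
    and exps: "0 < s''" "s'' < s'" "s' < s"
    and \<theta>: "\<theta> > 0"
    and C2: "C2 \<ge> 1"
    and moment: "\<And>N a. N \<ge> 2 \<Longrightarrow> (LINT \<alpha>|torus_measure. norm (exp_sum P N a \<alpha>) powr s'')
           \<le> C2 * real N powr (d * s'' - K + \<theta> * (s - s'') / 2) * norm_sup N a powr s''"
    and c3: "c3 > 0"
    and many: "\<And>N. N \<ge> 2 \<Longrightarrow> c3 * real N powr (d * s - K) \<le> real (num_solutions l P N)"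
begin

text \<open>Below N^(d - \<theta>), passing from the s''-th to the s-th moment gains N^(- \<theta>
  (s - s'')). Half of this gain is spent on the \<epsilon> of the moment hypothesis and the other
  half remains as N^(- \<epsilon>0).\<close>

definition \<epsilon>0 :: real where "\<epsilon>0 = \<theta> * (s - s'') / 2"

lemma \<epsilon>0_pos: "\<epsilon>0 > 0"
  using \<theta> exps by (simp add: \<epsilon>0_def)

lemma norm_exp_sum_le_card:
  assumes "\<And>n. n \<in> grid N \<Longrightarrow> norm (a n) \<le> 1" "N \<ge> 1"
  shows "norm (exp_sum P N a \<alpha>) \<le> real N powr d"
proof -
  have "norm (exp_sum P N a \<alpha>) \<le> (\<Sum>n\<in>(grid N :: (int ^ 'd) set). 1)"
    by (rule order_trans[OF norm_exp_sum_le sum_mono]) (use assms in auto)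
  also have "\<dots> = real N powr d" using assms(2) by (simp add: card_grid d_def powr_realpow)
  finally show ?thesis .
qed

text \<open>Off \<open>S\<close> the sum is at most N^(d - \<theta>), so the s''-th moment applies;
  on \<open>S\<close> it is at most \<Lambda> N^d by truncation, so the s'-th moment applies. The
  factor \<Lambda>^(s - s') shows that small values contribute little to the s-th moment.\<close>

lemma truncated_moment:
  assumes N: "N \<ge> 2" and a: "\<And>n. n \<in> grid N \<Longrightarrow> norm (a n) \<le> 1" and \<Lambda>: "\<Lambda> \<ge> 0"
  shows "(LINT \<alpha>:unit_cube|lborel. indicat_real {\<alpha>. norm (exp_sum P N a \<alpha>) \<le> \<Lambda> * real N powr d} \<alpha> * norm (exp_sum P N a \<alpha>) powr s)
     \<le> (C2 * real N powr (- \<epsilon>0) + C1 * \<Lambda> powr (s - s')) * real N powr (d * s - K)"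
proof -
  define F where "F \<alpha> = norm (exp_sum P N a \<alpha>)" for \<alpha>
  define S where "S = {\<alpha>. norm (exp_sum P N a \<alpha>) \<ge> real N powr (d / 2 - \<theta>) * norm_two N a}"
  have [measurable]: "S \<in> sets borel" unfolding S_def by measurable
  have [measurable]: "F \<in> borel_measurable borel" unfolding F_def by measurable
  have N0: "real N \<ge> 1" "real N > 0" using N by auto
  have FN: "F \<alpha> \<le> real N powr d" "0 \<le> F \<alpha>" for \<alpha>
    unfolding F_def using norm_exp_sum_le_card[of N a \<alpha>] a N by auto
  have n2: "norm_two N a \<le> real N powr (d / 2)" using norm_two_le[of N a] a by (simp add: d_def)
  have ns: "norm_sup N a \<le> 1" "0 \<le> norm_sup N a"
  proof -
    have ne: "(grid N :: (int ^ 'd) set) \<noteq> {}" using card_grid[of N, where 'd = 'd] N by (metis card.empty not_numeral_le_zero power_eq_0_iff)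
    then show "norm_sup N a \<le> 1" unfolding norm_sup_def using a by (subst Max_le_iff) auto
    obtain n :: "int ^ 'd" where "n \<in> grid N" using ne by blast
    then have "norm (a n) \<le> norm_sup N a" unfolding norm_sup_def by (intro Max_ge) auto
    then show "0 \<le> norm_sup N a" by (meson norm_ge_zero order_trans)
  qed
  define L where "L = \<Lambda> * real N powr d"
  define M where "M = (real N powr (d - \<theta>)) powr (s - s'')"
  define M' where "M' = L powr (s - s')"
  have pw: "indicat_real {\<alpha>. F \<alpha> \<le> L} \<alpha> * F \<alpha> powr s \<le> M * F \<alpha> powr s'' + M' * (indicat_real S \<alpha> * F \<alpha> powr s')" for \<alpha>
  proof (cases "\<alpha> \<in> S")
    case True
    have "indicat_real {\<alpha>. F \<alpha> \<le> L} \<alpha> * F \<alpha> powr s \<le> M' * F \<alpha> powr s'"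
    proof (cases "F \<alpha> \<le> L")
      case True
      have "F \<alpha> powr s = F \<alpha> powr (s - s') * F \<alpha> powr s'" by (simp add: powr_add[symmetric])
      also have "\<dots> \<le> M' * F \<alpha> powr s'" unfolding M'_def
        using True exps FN by (intro mult_right_mono powr_mono2) auto
      finally show ?thesis using True by simp
    qed (simp add: M'_def)
    then show ?thesis using True by (simp add: M_def add_increasing)
  next
    case False
    then have "F \<alpha> < real N powr (d / 2 - \<theta>) * norm_two N a" by (simp add: S_def F_def)
    also have "\<dots> \<le> real N powr (d / 2 - \<theta>) * real N powr (d / 2)" using n2 by (intro mult_left_mono) auto
    also have "\<dots> = real N powr (d - \<theta>)" by (simp add: powr_add[symmetric])
    finally have lt: "F \<alpha> \<le> real N powr (d - \<theta>)" by simp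
    have "F \<alpha> powr s = F \<alpha> powr (s - s'') * F \<alpha> powr s''" by (simp add: powr_add[symmetric])
    also have "\<dots> \<le> M * F \<alpha> powr s''" unfolding M_def
      using lt exps FN by (intro mult_right_mono powr_mono2) auto
    finally have "F \<alpha> powr s \<le> M * F \<alpha> powr s''" .
    moreover have "indicat_real {\<alpha>. F \<alpha> \<le> L} \<alpha> * F \<alpha> powr s \<le> F \<alpha> powr s" by (simp add: indicator_def)
    ultimately show ?thesis using False by simp
  qed
  have fin: "emeasure lborel (unit_cube :: (real ^ 'r) set) < \<infinity>" by (simp add: emeasure_unit_cube)
  have bd: "F \<alpha> powr p \<le> (real N powr d) powr p" if "p \<ge> 0" for \<alpha> p using FN that by (intro powr_mono2) auto
  have int1: "set_integrable lborel unit_cube (\<lambda>\<alpha>. F \<alpha> powr s'')"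
    by (rule set_integrable_bounded[where B = "(real N powr d) powr s''"]) (use bd exps fin in auto)
  have int2: "set_integrable lborel unit_cube (\<lambda>\<alpha>. indicat_real S \<alpha> * F \<alpha> powr s')"
    by (rule set_integrable_bounded[where B = "(real N powr d) powr s'"]) (use bd[of s'] exps fin in \<open>auto simp: indicator_def\<close>)
  have int3: "set_integrable lborel unit_cube (\<lambda>\<alpha>. indicat_real {\<alpha>. F \<alpha> \<le> L} \<alpha> * F \<alpha> powr s)"
    by (rule set_integrable_bounded[where B = "(real N powr d) powr s"]) (use bd[of s] exps fin in \<open>auto simp: indicator_def\<close>)
  have "(LINT \<alpha>:unit_cube|lborel. indicat_real {\<alpha>. F \<alpha> \<le> L} \<alpha> * F \<alpha> powr s)
    \<le> (LINT \<alpha>:unit_cube|lborel. M * F \<alpha> powr s'' + M' * (indicat_real S \<alpha> * F \<alpha> powr s'))"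
    by (rule set_integral_mono) (use int1 int2 int3 pw in \<open>auto intro!: set_integral_add set_integrable_mult_right\<close>)
  also have "\<dots> = M * (LINT \<alpha>:unit_cube|lborel. F \<alpha> powr s'') + M' * (LINT \<alpha>:unit_cube|lborel. indicat_real S \<alpha> * F \<alpha> powr s')"
    using int1 int2 by (subst set_integral_add) (auto intro!: set_integrable_mult_right)
  also have "\<dots> \<le> M * (C2 * real N powr (d * s'' - K + \<epsilon>0)) + M' * (C1 * real N powr (d * s' - K))"
  proof (intro add_mono mult_left_mono)
    have "(LINT \<alpha>:unit_cube|lborel. F \<alpha> powr s'') = (LINT \<alpha>|torus_measure. norm (exp_sum P N a \<alpha>) powr s'')"
      by (simp add: torus_integral_eq F_def)
    also have "\<dots> \<le> C2 * real N powr (d * s'' - K + \<epsilon>0) * norm_sup N a powr s''"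
      using moment[OF N, of a] by (simp add: \<epsilon>0_def)
    also have "\<dots> \<le> C2 * real N powr (d * s'' - K + \<epsilon>0) * 1"
      using ns exps C2 by (intro mult_left_mono powr_le1) auto
    finally show "(LINT \<alpha>:unit_cube|lborel. F \<alpha> powr s'') \<le> C2 * real N powr (d * s'' - K + \<epsilon>0)" by simp
    have "(LINT \<alpha>:unit_cube|lborel. indicat_real S \<alpha> * F \<alpha> powr s') = (LINT \<alpha>:S|torus_measure. norm (exp_sum P N a \<alpha>) powr s')"
      unfolding set_lebesgue_integral_def[of torus_measure] torus_integral_eq by (simp add: F_def)
    also have "\<dots> \<le> C1 * real N powr (d * s' / 2 - K) * norm_two N a powr s'"
      unfolding S_def by (rule large[OF N])
    also have "\<dots> \<le> C1 * real N powr (d * s' / 2 - K) * (real N powr (d / 2)) powr s'"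
      using n2 s'_pos C1 norm_two_nonneg by (intro mult_left_mono powr_mono2) auto
    also have "\<dots> = C1 * (real N powr (d * s' / 2 - K) * real N powr (d * s' / 2))" by (simp add: powr_powr)
    also have "\<dots> = C1 * real N powr (d * s' - K)" by (simp add: powr_add[symmetric])
    finally show "(LINT \<alpha>:unit_cube|lborel. indicat_real S \<alpha> * F \<alpha> powr s') \<le> C1 * real N powr (d * s' - K)" .
  qed (simp_all add: M_def M'_def)
  also have "\<dots> = (C2 * real N powr (- \<epsilon>0) + C1 * \<Lambda> powr (s - s')) * real N powr (d * s - K)"
  proof -
    have "M * real N powr (d * s'' - K + \<epsilon>0) = real N powr ((d - \<theta>) * (s - s'') + (d * s'' - K + \<epsilon>0))"
      by (simp add: M_def powr_powr powr_add)
    also have "(d - \<theta>) * (s - s'') + (d * s'' - K + \<epsilon>0) = - \<epsilon>0 + (d * s - K)" by (simp add: \<epsilon>0_def field_simps)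
    also have "real N powr (- \<epsilon>0 + (d * s - K)) = real N powr (- \<epsilon>0) * real N powr (d * s - K)" by (rule powr_add)
    finally have 1: "M * real N powr (d * s'' - K + \<epsilon>0) = real N powr (- \<epsilon>0) * real N powr (d * s - K)" .
    have "M' * real N powr (d * s' - K) = \<Lambda> powr (s - s') * (real N powr (d * (s - s')) * real N powr (d * s' - K))"
      using \<Lambda> by (simp add: M'_def L_def powr_mult powr_powr)
    also have "real N powr (d * (s - s')) * real N powr (d * s' - K) = real N powr (d * s - K)"
      by (simp add: powr_add[symmetric] algebra_simps)
    finally have 2: "M' * real N powr (d * s' - K) = \<Lambda> powr (s - s') * real N powr (d * s - K)" .
    have "M * (C2 * real N powr (d * s'' - K + \<epsilon>0)) + M' * (C1 * real N powr (d * s' - K))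
       = C2 * (M * real N powr (d * s'' - K + \<epsilon>0)) + C1 * (M' * real N powr (d * s' - K))" by simp
    then show ?thesis unfolding 1 2 by (simp add: algebra_simps)
  qed
  finally show ?thesis unfolding F_def L_def .
qed

lemma full_moment:
  assumes N: "N \<ge> 2" and a: "\<And>n. n \<in> grid N \<Longrightarrow> norm (a n) \<le> 1"
  shows "(LINT \<alpha>:unit_cube|lborel. norm (exp_sum P N a \<alpha>) powr s) \<le> (C1 + C2) * real N powr (d * s - K)"
proof -
  have "indicat_real {\<alpha>. norm (exp_sum P N a \<alpha>) \<le> 1 * real N powr d} \<alpha> = 1" for \<alpha>
    using norm_exp_sum_le_card[of N a \<alpha>] a N by (simp add: indicator_def)
  then have "(LINT \<alpha>:unit_cube|lborel. norm (exp_sum P N a \<alpha>) powr s) =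
     (LINT \<alpha>:unit_cube|lborel. indicat_real {\<alpha>. norm (exp_sum P N a \<alpha>) \<le> 1 * real N powr d} \<alpha> * norm (exp_sum P N a \<alpha>) powr s)"
    by simp
  also have "\<dots> \<le> (C2 * real N powr (- \<epsilon>0) + C1 * 1 powr (s - s')) * real N powr (d * s - K)"
    by (rule truncated_moment) (use N a in auto)
  also have "\<dots> \<le> (C1 + C2) * real N powr (d * s - K)"
  proof (rule mult_right_mono)
    have "real N powr (- \<epsilon>0) \<le> real N powr 0" using N \<epsilon>0_pos by (intro powr_mono) auto
    then have "real N powr (- \<epsilon>0) \<le> 1" using N by simp
    then have "C2 * real N powr (- \<epsilon>0) \<le> C2 * 1" using C2 by (intro mult_left_mono) auto
    then show "C2 * real N powr (- \<epsilon>0) + C1 * 1 powr (s - s') \<le> C1 + C2" by simp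
  qed simp
  finally show ?thesis .
qed

text \<open>The midpoint is a choice; both strict inequalities matter. With \<sigma> < s the dyadic
  sum below converges, and with \<sigma> > s' the increment exponent \<rho> becomes
  positive.\<close>

definition \<sigma> :: real where "\<sigma> = (s + s') / 2"

lemma \<sigma>_bounds: "s' < \<sigma>" "\<sigma> < s" "0 < \<sigma>"
  using exps by (auto simp: \<sigma>_def)

text \<open>If all level sets were small, summing over dyadic levels would contradict the lower bound for the moment.\<close>
lemma large_level_set:
  assumes c: "0 < c"
  obtains c' where "0 < c'"
    "\<And>N a \<delta> t0. N \<ge> 2 \<Longrightarrow> (\<And>n. n \<in> grid N \<Longrightarrow> norm (a n) \<le> 1) \<Longrightarrow> 0 < \<delta> \<Longrightarrow>
      (\<And>\<alpha>. norm (exp_sum P N a \<alpha>) \<le> 2 * \<delta> * real N powr d) \<Longrightarrow>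
      c * \<delta> powr s * real N powr (d * s - K) \<le> (LINT \<alpha>:unit_cube|lborel. norm (exp_sum P N a \<alpha>) powr s) \<Longrightarrow>
      0 < t0 \<Longrightarrow> C1 * (2 * \<delta> * t0) powr (s - s') \<le> c / 4 * \<delta> powr s \<Longrightarrow> C2 * real N powr (- \<epsilon>0) \<le> c / 4 * \<delta> powr s \<Longrightarrow>
      \<exists>t\<ge>t0. t \<le> 1 \<and> c' * t powr (- \<sigma>) * real N powr (- K) \<le> measure lborel (unit_cube \<inter> {\<alpha>. \<delta> * t * real N powr d \<le> norm (exp_sum P N a \<alpha>)})"
proof -
  define g where "g = (1 / 2 :: real) powr (s - \<sigma>)"
  have g: "0 < g" "g < 1" using \<sigma>_bounds by (auto simp: g_def powr01_less_one)
  \<comment> \<open>With this constant the dyadic levels, summed as a geometric series of ratio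
    \<open>g\<close>, contribute a quarter of the lower bound for the moment. The two small-value
    terms contribute another quarter each.\<close>
  define c' where "c' = c * (1 - g) / (4 * 2 powr s)"
  show ?thesis
  proof (rule that[of c'])
    show "0 < c'" using c g by (simp add: c'_def)
    fix N :: nat and a :: "int ^ 'd \<Rightarrow> complex" and \<delta> t0 :: real
    assume N: "N \<ge> 2" and a: "\<And>n. n \<in> grid N \<Longrightarrow> norm (a n) \<le> 1" and \<delta>: "0 < \<delta>"
      and bound: "\<And>\<alpha>. norm (exp_sum P N a \<alpha>) \<le> 2 * \<delta> * real N powr d"
      and lower: "c * \<delta> powr s * real N powr (d * s - K) \<le> (LINT \<alpha>:unit_cube|lborel. norm (exp_sum P N a \<alpha>) powr s)"
      and t0: "0 < t0" "C1 * (2 * \<delta> * t0) powr (s - s') \<le> c / 4 * \<delta> powr s" and Neps: "C2 * real N powr (- \<epsilon>0) \<le> c / 4 * \<delta> powr s"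
    define F where "F \<alpha> = norm (exp_sum P N a \<alpha>)" for \<alpha>
    have [measurable]: "F \<in> borel_measurable borel" unfolding F_def by measurable
    define X where "X = 2 * \<delta> * real N powr d"
    have X: "X > 0" using \<delta> N by (simp add: X_def)
    have FX: "F \<alpha> \<le> X" "0 \<le> F \<alpha>" for \<alpha> using bound by (auto simp: F_def X_def)
    define J where "J = {j::nat. t0 \<le> (1/2) ^ j}"
    have finJ: "finite J"
    proof -
      obtain n where n: "(1/2 :: real) ^ n < t0" using real_arch_pow_inv[of t0 "1/2"] t0 by auto
      have "J \<subseteq> {..<n}"
      proof
        fix j assume "j \<in> J"
        then have "t0 \<le> (1/2) ^ j" by (simp add: J_def)
        with n have "(1/2 :: real) ^ n < (1/2) ^ j" by (rule less_le_trans)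
        then show "j \<in> {..<n}" by simp
      qed
      then show ?thesis using finite_subset by blast
    qed
    \<comment> \<open>Since \<open>X\<close> contains the factor 2, the lower end X / 2^(j+1) of a
      dyadic range is the level \<delta> t N^d with t = 2^-j.\<close>
    define E where "E j = {\<alpha>. X * (1/2) ^ Suc j \<le> F \<alpha>}" for j
    have Em[measurable]: "E j \<in> sets borel" for j unfolding E_def by measurable
    show "\<exists>t\<ge>t0. t \<le> 1 \<and> c' * t powr (- \<sigma>) * real N powr (- K) \<le> measure lborel (unit_cube \<inter> {\<alpha>. \<delta> * t * real N powr d \<le> norm (exp_sum P N a \<alpha>)})"
    proof (rule ccontr)
      assume neg: "\<not> ?thesis"
      have neg': "measure lborel (unit_cube \<inter> {\<alpha>. \<delta> * t * real N powr d \<le> norm (exp_sum P N a \<alpha>)}) \<le> c' * t powr (- \<sigma>) * real N powr (- K)"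
        if "t0 \<le> t" "t \<le> 1" for t
      proof (rule ccontr)
        assume "\<not> ?thesis"
        then have "c' * t powr (- \<sigma>) * real N powr (- K) \<le> measure lborel (unit_cube \<inter> {\<alpha>. \<delta> * t * real N powr d \<le> norm (exp_sum P N a \<alpha>)})"
          by linarith
        with that have "\<exists>t\<ge>t0. t \<le> 1 \<and> c' * t powr (- \<sigma>) * real N powr (- K) \<le> measure lborel (unit_cube \<inter> {\<alpha>. \<delta> * t * real N powr d \<le> norm (exp_sum P N a \<alpha>)})"
          by (intro exI[of _ t] conjI)
        with neg show False by (rule notE)
      qed
      have small: "measure lborel (unit_cube \<inter> E j) \<le> c' * ((1/2) ^ j) powr (- \<sigma>) * real N powr (- K)" if j: "j \<in> J" for j
      proof -
        have "E j = {\<alpha>. \<delta> * (1/2) ^ j * real N powr d \<le> norm (exp_sum P N a \<alpha>)}" by (simp add: E_def F_def X_def mult_ac)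
        moreover have "t0 \<le> (1/2) ^ j" "(1/2 :: real) ^ j \<le> 1" using j by (auto simp: J_def power_le_one)
        ultimately show ?thesis using neg' by simp
      qed
      have pw: "F \<alpha> powr s \<le> indicat_real {\<alpha>. F \<alpha> \<le> t0 * X} \<alpha> * F \<alpha> powr s + (\<Sum>j\<in>J. (X * (1/2) ^ j) powr s * indicat_real (E j) \<alpha>)" for \<alpha>
      proof (cases "F \<alpha> \<le> t0 * X")
        case True
        then show ?thesis by (simp add: sum_nonneg)
      next
        case False
        define x where "x = F \<alpha> / X"
        have x: "t0 < x" "x \<le> 1" "F \<alpha> = X * x" using False FX X by (auto simp: x_def field_simps)
        obtain n where n: "(1/2 :: real) ^ n < x" using real_arch_pow_inv[of x "1/2"] x t0 by auto
        define m where "m = (LEAST n. (1/2 :: real) ^ n < x)"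
        have m: "(1/2 :: real) ^ m < x" unfolding m_def using n by (rule LeastI)
        have "m \<noteq> 0" using m x(2) by (metis power_0 not_le)
        then obtain j where j: "m = Suc j" using not0_implies_Suc by blast
        have xj: "x \<le> (1/2) ^ j" using not_less_Least[of j "\<lambda>n. (1/2 :: real) ^ n < x"] j unfolding m_def by (simp add: not_less)
        have jJ: "j \<in> J" using xj x(1) by (simp add: J_def)
        have "X * (1/2) ^ Suc j \<le> X * x" using m X j by (intro mult_left_mono) auto
        then have "\<alpha> \<in> E j" by (simp add: E_def x(3))
        have "F \<alpha> powr s \<le> (X * (1/2) ^ j) powr s"
          unfolding x(3) using xj X x t0 exps by (intro powr_mono2 mult_left_mono) auto
        also have "\<dots> = (X * (1/2) ^ j) powr s * indicat_real (E j) \<alpha>" using \<open>\<alpha> \<in> E j\<close> by simp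
        also have "\<dots> \<le> (\<Sum>j\<in>J. (X * (1/2) ^ j) powr s * indicat_real (E j) \<alpha>)"
          using jJ finJ by (intro member_le_sum) auto
        finally show ?thesis using False by simp
      qed
      have fin: "emeasure lborel (unit_cube :: (real ^ 'r) set) < \<infinity>" by (simp add: emeasure_unit_cube)
      have bd: "F \<alpha> powr s \<le> X powr s" for \<alpha> using FX exps by (intro powr_mono2) auto
      have int1: "set_integrable lborel unit_cube (\<lambda>\<alpha>. F \<alpha> powr s)"
        by (rule set_integrable_bounded[where B = "X powr s"]) (use bd fin in auto)
      have int2: "set_integrable lborel unit_cube (\<lambda>\<alpha>. indicat_real {\<alpha>. F \<alpha> \<le> t0 * X} \<alpha> * F \<alpha> powr s)"
        by (rule set_integrable_bounded[where B = "X powr s"]) (use bd fin in \<open>auto simp: indicator_def\<close>)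
      have int3: "set_integrable lborel unit_cube (\<lambda>\<alpha>. (X * (1/2) ^ j) powr s * indicat_real (E j) \<alpha>)" for j
        by (rule set_integrable_bounded[where B = "(X * (1/2) ^ j) powr s"]) (use fin in \<open>auto simp: indicator_def\<close>)
      have int4: "set_integrable lborel unit_cube (\<lambda>\<alpha>. \<Sum>j\<in>J. (X * (1/2) ^ j) powr s * indicat_real (E j) \<alpha>)"
        using int3 unfolding set_integrable_def scaleR_sum_right by (intro Bochner_Integration.integrable_sum) auto
      have Eint: "(LINT \<alpha>:unit_cube|lborel. (X * (1/2) ^ j) powr s * indicat_real (E j) \<alpha>) = (X * (1/2) ^ j) powr s * measure lborel (unit_cube \<inter> E j)" for j
      proof -
        have "(LINT \<alpha>:unit_cube|lborel. (X * (1/2) ^ j) powr s * indicat_real (E j) \<alpha>) = (LINT \<alpha>|lborel. (X * (1/2) ^ j) powr s * indicat_real (unit_cube \<inter> E j) \<alpha>)"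
          unfolding set_lebesgue_integral_def by (rule Bochner_Integration.integral_cong) (auto simp: indicator_def)
        then show ?thesis by simp
      qed
      have "(LINT \<alpha>:unit_cube|lborel. F \<alpha> powr s) \<le>
         (LINT \<alpha>:unit_cube|lborel. indicat_real {\<alpha>. F \<alpha> \<le> t0 * X} \<alpha> * F \<alpha> powr s + (\<Sum>j\<in>J. (X * (1/2) ^ j) powr s * indicat_real (E j) \<alpha>))"
        by (rule set_integral_mono) (use int1 int2 int4 pw in auto)
      also have "\<dots> = (LINT \<alpha>:unit_cube|lborel. indicat_real {\<alpha>. F \<alpha> \<le> t0 * X} \<alpha> * F \<alpha> powr s) +
         (LINT \<alpha>:unit_cube|lborel. (\<Sum>j\<in>J. (X * (1/2) ^ j) powr s * indicat_real (E j) \<alpha>))"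
        by (rule set_integral_add) (rule int2 int4)+
      also have "(LINT \<alpha>:unit_cube|lborel. (\<Sum>j\<in>J. (X * (1/2) ^ j) powr s * indicat_real (E j) \<alpha>)) =
         (\<Sum>j\<in>J. (LINT \<alpha>:unit_cube|lborel. (X * (1/2) ^ j) powr s * indicat_real (E j) \<alpha>))"
        using int3 unfolding set_lebesgue_integral_def set_integrable_def scaleR_sum_right by (intro Bochner_Integration.integral_sum) auto
      also have "\<dots> = (\<Sum>j\<in>J. (X * (1/2) ^ j) powr s * measure lborel (unit_cube \<inter> E j))" by (simp only: Eint)
      also have "\<dots> \<le> (\<Sum>j\<in>J. c' * X powr s * real N powr (- K) * g ^ j)"
      proof (rule sum_mono)
        fix j assume j: "j \<in> J"
        have "(X * (1/2) ^ j) powr s * measure lborel (unit_cube \<inter> E j) \<le> (X * (1/2) ^ j) powr s * (c' * ((1/2) ^ j) powr (- \<sigma>) * real N powr (- K))"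
          using small[OF j] by (intro mult_left_mono) auto
        also have "\<dots> = c' * X powr s * real N powr (- K) * (((1/2) ^ j) powr s * ((1/2) ^ j) powr (- \<sigma>))"
          by (simp add: powr_mult)
        also have "((1/2 :: real) ^ j) powr s * ((1/2) ^ j) powr (- \<sigma>) = g ^ j"
          by (simp add: powr_add[symmetric] g_def powr_realpow[symmetric] powr_powr algebra_simps)
        finally show "(X * (1/2) ^ j) powr s * measure lborel (unit_cube \<inter> E j) \<le> c' * X powr s * real N powr (- K) * g ^ j" .
      qed
      also have "\<dots> = c' * X powr s * real N powr (- K) * (\<Sum>j\<in>J. g ^ j)" by (simp add: sum_distrib_left)
      also have "\<dots> \<le> c' * X powr s * real N powr (- K) * (1 / (1 - g))"
      proof (rule mult_left_mono)
        have "(\<Sum>j\<in>J. g ^ j) \<le> suminf (\<lambda>j. g ^ j)" using g finJ by (intro sum_le_suminf summable_geometric) auto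
        then show "(\<Sum>j\<in>J. g ^ j) \<le> 1 / (1 - g)" using g by (simp add: suminf_geometric)
      qed (use c g in \<open>simp add: c'_def\<close>)
      also have "\<dots> = c / 4 * \<delta> powr s * real N powr (d * s - K)"
      proof -
        have "X powr s * real N powr (- K) = 2 powr s * \<delta> powr s * (real N powr (d * s) * real N powr (- K))"
          using \<delta> by (simp add: X_def powr_mult powr_powr)
        also have "real N powr (d * s) * real N powr (- K) = real N powr (d * s - K)" by (simp add: powr_add[symmetric])
        finally have "X powr s * real N powr (- K) = 2 powr s * \<delta> powr s * real N powr (d * s - K)" .
        moreover have "c' * X powr s * real N powr (- K) * (1 / (1 - g)) = c / (4 * 2 powr s) * (X powr s * real N powr (- K))"
          using g by (simp add: c'_def)
        ultimately show ?thesis by simp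
      qed
      finally have "(LINT \<alpha>:unit_cube|lborel. F \<alpha> powr s) \<le>
         (LINT \<alpha>:unit_cube|lborel. indicat_real {\<alpha>. F \<alpha> \<le> t0 * X} \<alpha> * F \<alpha> powr s) + c / 4 * \<delta> powr s * real N powr (d * s - K)" by simp
      also have "(LINT \<alpha>:unit_cube|lborel. indicat_real {\<alpha>. F \<alpha> \<le> t0 * X} \<alpha> * F \<alpha> powr s) \<le>
         (C2 * real N powr (- \<epsilon>0) + C1 * (2 * \<delta> * t0) powr (s - s')) * real N powr (d * s - K)"
        using truncated_moment[OF N a, where \<Lambda> = "2 * \<delta> * t0"] \<delta> t0 by (simp add: F_def X_def mult_ac)
      also have "\<dots> \<le> (c / 4 * \<delta> powr s + c / 4 * \<delta> powr s) * real N powr (d * s - K)"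
        using t0 Neps by (intro mult_right_mono add_mono) auto
      finally have "(LINT \<alpha>:unit_cube|lborel. F \<alpha> powr s) \<le> 3 / 4 * (c * \<delta> powr s * real N powr (d * s - K))"
        by (simp add: algebra_simps)
      moreover have "c * \<delta> powr s * real N powr (d * s - K) > 0" using c \<delta> N by simp
      ultimately show False using lower unfolding F_def by linarith
    qed
  qed
qed

definition balanced :: "nat \<Rightarrow> (int ^ 'd) set \<Rightarrow> int ^ 'd \<Rightarrow> complex" where
  "balanced N A n = of_bool (n \<in> A) - of_real (real (card A) / real N ^ CARD('d)) * of_bool (n \<in> grid N)"

text \<open>Write 1_A = \<delta> + f in the counting integral: the main term is \<delta>^s times the
  full count, so a deficit of half of it must come from terms containing f. Both the main term and
  the moments of the constant part scale as \<delta>^s, so the second error term can be absorbed and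
  the lower bound for f loses no further power of \<delta>.\<close>

lemma balanced_moment_lower:
  obtains c where "0 < c" "\<And>N A \<delta>. N \<ge> 2 \<Longrightarrow> A \<subseteq> grid N \<Longrightarrow> \<delta> = real (card A) / real N ^ CARD('d) \<Longrightarrow>
     real (card (solutions l P A)) \<le> \<delta> ^ CARD('s) / 2 * real (num_solutions l P N) \<Longrightarrow>
     c * \<delta> powr s * real N powr (d * s - K) \<le> (LINT \<alpha>:unit_cube|lborel. norm (exp_sum P N (balanced N A) \<alpha>) powr s)"
proof -
  let ?s = "CARD('s)"
  have s1: "?s \<ge> 1" by (simp add: Suc_le_eq)
  \<comment> \<open>Small enough that the error term in the main factors, estimated by the full
    moment, is at most a quarter of the lower bound for the main term; the deficit is half of
    it.\<close>
  define \<epsilon> where "\<epsilon> = min 1 (c3 / (4 * s\<^sup>2 * 2 ^ ?s * (C1 + C2)))"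
  have C12: "C1 + C2 > 0" using C1 C2 by simp
  have s0: "s > 0" using exps by simp
  have \<epsilon>: "0 < \<epsilon>" "\<epsilon> \<le> 1" using c3 C12 s0 by (auto simp: \<epsilon>_def)
  have \<epsilon>_le: "s\<^sup>2 * \<epsilon> * 2 ^ ?s * (C1 + C2) \<le> c3 / 4"
  proof -
    have "\<epsilon> * (4 * s\<^sup>2 * 2 ^ ?s * (C1 + C2)) \<le> c3 / (4 * s\<^sup>2 * 2 ^ ?s * (C1 + C2)) * (4 * s\<^sup>2 * 2 ^ ?s * (C1 + C2))"
      using C12 by (intro mult_right_mono) (auto simp: \<epsilon>_def)
    also have "\<dots> = c3" using C12 s0 by simp
    finally show ?thesis by (simp add: algebra_simps)
  qed
  define B where "B = s\<^sup>2 * (2 / \<epsilon>) ^ ?s"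
  have B: "B > 0" using s0 \<epsilon> by (simp add: B_def)
  show ?thesis
  proof (rule that[of "c3 / (4 * B)"])
    show "0 < c3 / (4 * B)" using c3 B by simp
    fix N :: nat and A :: "(int ^ 'd) set" and \<delta> :: real
    assume N: "N \<ge> 2" and A: "A \<subseteq> grid N" and \<delta>_def: "\<delta> = real (card A) / real N ^ CARD('d)"
      and few: "real (card (solutions l P A)) \<le> \<delta> ^ ?s / 2 * real (num_solutions l P N)"
    have \<delta>0: "\<delta> \<ge> 0" by (simp add: \<delta>_def)
    define one :: "int ^ 'd \<Rightarrow> complex" where "one = (\<lambda>n. of_bool (n \<in> grid N))"
    define x where "x \<alpha> i = of_real \<delta> * exp_sum P N one (of_int (l $ i) *\<^sub>R \<alpha>)" for \<alpha> i
    define y where "y \<alpha> i = exp_sum P N (balanced N A) (of_int (l $ i) *\<^sub>R \<alpha>)" for \<alpha> i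
    define f where "f \<alpha> = (\<Prod>i\<in>UNIV. x \<alpha> i + y \<alpha> i)" for \<alpha>
    define g where "g \<alpha> = (\<Prod>i\<in>UNIV. x \<alpha> i)" for \<alpha>
    have [measurable]: "(\<lambda>\<alpha>. x \<alpha> i) \<in> borel_measurable borel" "(\<lambda>\<alpha>. y \<alpha> i) \<in> borel_measurable borel" for i
      unfolding x_def y_def by measurable
    have fg[measurable]: "f \<in> borel_measurable borel" "g \<in> borel_measurable borel" unfolding f_def g_def by measurable
    have xy: "x \<alpha> i + y \<alpha> i = exp_sum P N (\<lambda>n. of_bool (n \<in> A)) (of_int (l $ i) *\<^sub>R \<alpha>)" for \<alpha> i
      unfolding x_def y_def exp_sum_cmult[symmetric] exp_sum_add[symmetric] by (simp add: one_def balanced_def \<delta>_def)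
    have intf: "(LINT \<alpha>:unit_cube|lborel. f \<alpha>) = of_nat (card (solutions l P A))"
      unfolding f_def xy by (rule count_solutions_integral[OF A])
    have intg: "(LINT \<alpha>:unit_cube|lborel. g \<alpha>) = of_real (\<delta> ^ ?s) * of_nat (num_solutions l P N)"
    proof -
      have "g \<alpha> = of_real (\<delta> ^ ?s) * (\<Prod>i\<in>UNIV. exp_sum P N (\<lambda>n. of_bool (n \<in> grid N)) (of_int (l $ i) *\<^sub>R \<alpha>))" for \<alpha>
        by (simp add: g_def x_def prod.distrib one_def)
      then show ?thesis by (simp add: count_solutions_integral num_solutions_def)
    qed
    have fin: "emeasure lborel (unit_cube :: (real ^ 'r) set) < \<infinity>" by (simp add: emeasure_unit_cube)
    have bx: "\<exists>B. \<forall>\<alpha> i. norm (x \<alpha> i) \<le> B"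
      using norm_exp_sum_le[of P N one] by (intro exI[of _ "\<delta> * (\<Sum>n\<in>grid N. norm (one n))"]) (auto simp: x_def norm_mult \<delta>0 intro!: mult_left_mono)
    have by': "\<exists>B. \<forall>\<alpha> i. norm (y \<alpha> i) \<le> B"
      using norm_exp_sum_le[of P N "balanced N A"] by (intro exI[of _ "\<Sum>n\<in>grid N. norm (balanced N A n)"]) (auto simp: y_def)
    obtain Bx By where Bx: "\<And>\<alpha> i. norm (x \<alpha> i) \<le> Bx" and By: "\<And>\<alpha> i. norm (y \<alpha> i) \<le> By" using bx by' by blast
    have Bnn: "0 \<le> Bx" "0 \<le> By" using Bx By norm_ge_zero order_trans by blast+
    have setint: "set_integrable lborel unit_cube f" "set_integrable lborel unit_cube g"
    proof -
      have "norm (f \<alpha>) \<le> (Bx + By) ^ ?s" for \<alpha>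
      proof -
        have "norm (f \<alpha>) \<le> (\<Prod>i\<in>(UNIV :: 's set). Bx + By)"
          unfolding f_def prod_norm[symmetric] by (intro prod_mono conjI norm_ge_zero order_trans[OF norm_triangle_ineq] add_mono Bx By)
        then show ?thesis by simp
      qed
      then show "set_integrable lborel unit_cube f" using fin by (intro set_integrable_bounded) auto
      have "norm (g \<alpha>) \<le> Bx ^ ?s" for \<alpha>
      proof -
        have "norm (g \<alpha>) \<le> (\<Prod>i\<in>(UNIV :: 's set). Bx)"
          unfolding g_def prod_norm[symmetric] by (intro prod_mono conjI norm_ge_zero Bx)
        then show ?thesis by simp
      qed
      then show "set_integrable lborel unit_cube g" using fin by (intro set_integrable_bounded) auto
    qed
    define Iy where "Iy = (LINT \<alpha>:unit_cube|lborel. norm (exp_sum P N (balanced N A) \<alpha>) ^ ?s)"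
    define I1 where "I1 = (LINT \<alpha>:unit_cube|lborel. norm (exp_sum P N one \<alpha>) ^ ?s)"
    have powr_pow: "z powr s = z ^ ?s" if "z \<ge> 0" for z
      using that s1 by (cases "z = 0") (auto simp: s_def powr_realpow)
    have iy: "(LINT \<alpha>:unit_cube|lborel. norm (y \<alpha> i) ^ ?s) = Iy" for i
      unfolding y_def Iy_def by (rule exp_sum_moment_dilate) (auto simp: balanced_def l_nonzero)
    have ix: "(LINT \<alpha>:unit_cube|lborel. norm (x \<alpha> i) ^ ?s) = \<delta> ^ ?s * I1" for i
    proof -
      have "(LINT \<alpha>:unit_cube|lborel. norm (x \<alpha> i) ^ ?s) = (LINT \<alpha>:unit_cube|lborel. \<delta> ^ ?s * norm (exp_sum P N one (of_int (l $ i) *\<^sub>R \<alpha>)) ^ ?s)"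
        using \<delta>0 by (simp add: x_def norm_mult power_mult_distrib)
      also have "\<dots> = \<delta> ^ ?s * (LINT \<alpha>:unit_cube|lborel. norm (exp_sum P N one (of_int (l $ i) *\<^sub>R \<alpha>)) ^ ?s)" by simp
      also have "(LINT \<alpha>:unit_cube|lborel. norm (exp_sum P N one (of_int (l $ i) *\<^sub>R \<alpha>)) ^ ?s) = I1"
        unfolding I1_def by (rule exp_sum_moment_dilate) (auto simp: one_def l_nonzero)
      finally show ?thesis .
    qed
    have inty: "set_integrable lborel unit_cube (\<lambda>\<alpha>. norm (y \<alpha> i) ^ ?s)" for i
      by (rule set_integrable_bounded[where B = "By ^ ?s"]) (use By fin in \<open>auto intro: power_mono\<close>)
    have intx: "set_integrable lborel unit_cube (\<lambda>\<alpha>. norm (x \<alpha> i) ^ ?s)" for i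
      by (rule set_integrable_bounded[where B = "Bx ^ ?s"]) (use Bx fin in \<open>auto intro: power_mono\<close>)
    have sumy: "set_integrable lborel unit_cube (\<lambda>\<alpha>. \<Sum>i\<in>UNIV. norm (y \<alpha> i) ^ ?s)" "(LINT \<alpha>:unit_cube|lborel. (\<Sum>i\<in>UNIV. norm (y \<alpha> i) ^ ?s)) = s * Iy"
    proof -
      show "set_integrable lborel unit_cube (\<lambda>\<alpha>. \<Sum>i\<in>UNIV. norm (y \<alpha> i) ^ ?s)"
        using inty unfolding set_integrable_def scaleR_sum_right by (intro Bochner_Integration.integrable_sum) auto
      have "(LINT \<alpha>:unit_cube|lborel. (\<Sum>i\<in>UNIV. norm (y \<alpha> i) ^ ?s)) = (\<Sum>i\<in>(UNIV :: 's set). (LINT \<alpha>:unit_cube|lborel. norm (y \<alpha> i) ^ ?s))"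
        using inty unfolding set_lebesgue_integral_def set_integrable_def scaleR_sum_right by (intro Bochner_Integration.integral_sum) auto
      then show "(LINT \<alpha>:unit_cube|lborel. (\<Sum>i\<in>UNIV. norm (y \<alpha> i) ^ ?s)) = s * Iy" by (simp add: iy s_def)
    qed
    have sumx: "set_integrable lborel unit_cube (\<lambda>\<alpha>. \<Sum>i\<in>UNIV. norm (x \<alpha> i) ^ ?s)" "(LINT \<alpha>:unit_cube|lborel. (\<Sum>i\<in>UNIV. norm (x \<alpha> i) ^ ?s)) = s * (\<delta> ^ ?s * I1)"
    proof -
      show "set_integrable lborel unit_cube (\<lambda>\<alpha>. \<Sum>i\<in>UNIV. norm (x \<alpha> i) ^ ?s)"
        using intx unfolding set_integrable_def scaleR_sum_right by (intro Bochner_Integration.integrable_sum) auto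
      have "(LINT \<alpha>:unit_cube|lborel. (\<Sum>i\<in>UNIV. norm (x \<alpha> i) ^ ?s)) = (\<Sum>i\<in>(UNIV :: 's set). (LINT \<alpha>:unit_cube|lborel. norm (x \<alpha> i) ^ ?s))"
        using intx unfolding set_lebesgue_integral_def set_integrable_def scaleR_sum_right by (intro Bochner_Integration.integral_sum) auto
      then show "(LINT \<alpha>:unit_cube|lborel. (\<Sum>i\<in>UNIV. norm (x \<alpha> i) ^ ?s)) = s * (\<delta> ^ ?s * I1)" by (simp add: ix s_def)
    qed
    have "\<delta> ^ ?s * real (num_solutions l P N) - real (card (solutions l P A)) \<le>
       norm ((LINT \<alpha>:unit_cube|lborel. f \<alpha>) - (LINT \<alpha>:unit_cube|lborel. g \<alpha>))"
    proof -
      have "(LINT \<alpha>:unit_cube|lborel. f \<alpha>) - (LINT \<alpha>:unit_cube|lborel. g \<alpha>) =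
        of_real (real (card (solutions l P A)) - \<delta> ^ ?s * real (num_solutions l P N))"
        unfolding intf intg by simp
      then show ?thesis by (simp only: norm_of_real)
    qed
    also have "\<dots> = norm (LINT \<alpha>:unit_cube|lborel. f \<alpha> - g \<alpha>)" using setint by (subst set_integral_diff) auto
    also have "\<dots> \<le> (LINT \<alpha>:unit_cube|lborel. norm (f \<alpha> - g \<alpha>))"
      using setint by (intro set_integral_norm_bound set_integral_diff)
    also have "\<dots> \<le> (LINT \<alpha>:unit_cube|lborel. s * (2 / \<epsilon>) ^ ?s * (\<Sum>i\<in>UNIV. norm (y \<alpha> i) ^ ?s) + s * \<epsilon> * 2 ^ ?s * (\<Sum>i\<in>UNIV. norm (x \<alpha> i) ^ ?s))"
    proof (rule set_integral_mono)
      show "set_integrable lborel unit_cube (\<lambda>\<alpha>. norm (f \<alpha> - g \<alpha>))" using setint by (intro set_integrable_norm set_integral_diff)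
      show "set_integrable lborel unit_cube (\<lambda>\<alpha>. s * (2 / \<epsilon>) ^ ?s * (\<Sum>i\<in>UNIV. norm (y \<alpha> i) ^ ?s) + s * \<epsilon> * 2 ^ ?s * (\<Sum>i\<in>UNIV. norm (x \<alpha> i) ^ ?s))"
        using sumx sumy by (intro set_integral_add set_integrable_mult_right)
      show "norm (f \<alpha> - g \<alpha>) \<le> s * (2 / \<epsilon>) ^ ?s * (\<Sum>i\<in>UNIV. norm (y \<alpha> i) ^ ?s) + s * \<epsilon> * 2 ^ ?s * (\<Sum>i\<in>UNIV. norm (x \<alpha> i) ^ ?s)" for \<alpha>
        using norm_prod_add_minus_prod_powers[of "UNIV :: 's set" \<epsilon> "x \<alpha>" "y \<alpha>"] \<epsilon> by (simp add: f_def g_def s_def)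
    qed
    also have "\<dots> = s * (2 / \<epsilon>) ^ ?s * (s * Iy) + s * \<epsilon> * 2 ^ ?s * (s * (\<delta> ^ ?s * I1))"
      using sumx sumy by (subst set_integral_add) (auto intro!: set_integrable_mult_right)
    also have "\<dots> = B * Iy + (s\<^sup>2 * \<epsilon> * 2 ^ ?s * I1) * \<delta> ^ ?s" by (simp add: B_def power2_eq_square)
    finally have 1: "\<delta> ^ ?s * real (num_solutions l P N) - real (card (solutions l P A)) \<le> B * Iy + (s\<^sup>2 * \<epsilon> * 2 ^ ?s * I1) * \<delta> ^ ?s" .
    define Y where "Y = real N powr (d * s - K)"
    have Y: "Y > 0" using N by (simp add: Y_def)
    have "I1 \<le> (C1 + C2) * Y"
      using full_moment[OF N, of one] by (simp add: one_def I1_def Y_def powr_pow)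
    then have "s\<^sup>2 * \<epsilon> * 2 ^ ?s * I1 \<le> s\<^sup>2 * \<epsilon> * 2 ^ ?s * ((C1 + C2) * Y)" using \<epsilon> by (intro mult_left_mono) auto
    also have "\<dots> = (s\<^sup>2 * \<epsilon> * 2 ^ ?s * (C1 + C2)) * Y" by simp
    also have "\<dots> \<le> c3 / 4 * Y" using \<epsilon>_le Y by (intro mult_right_mono) auto
    finally have "(s\<^sup>2 * \<epsilon> * 2 ^ ?s * I1) * \<delta> ^ ?s \<le> (c3 / 4 * Y) * \<delta> ^ ?s" using \<delta>0 by (intro mult_right_mono) auto
    moreover have "\<delta> ^ ?s / 2 * (c3 * Y) \<le> \<delta> ^ ?s / 2 * real (num_solutions l P N)"
      using many[OF N] \<delta>0 by (intro mult_left_mono) (auto simp: Y_def)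
    moreover have "\<delta> ^ ?s * real (num_solutions l P N) = \<delta> ^ ?s / 2 * real (num_solutions l P N) + \<delta> ^ ?s / 2 * real (num_solutions l P N)" by simp
    moreover have "\<delta> ^ ?s / 2 * (c3 * Y) - (c3 / 4 * Y) * \<delta> ^ ?s = c3 / 4 * \<delta> ^ ?s * Y" by (simp add: field_simps)
    ultimately have "c3 / 4 * \<delta> ^ ?s * Y \<le> B * Iy" using 1 few by linarith
    then have "c3 / (4 * B) * \<delta> ^ ?s * Y \<le> Iy" using B by (simp add: field_simps)
    then show "c3 / (4 * B) * \<delta> powr s * real N powr (d * s - K) \<le> (LINT \<alpha>:unit_cube|lborel. norm (exp_sum P N (balanced N A) \<alpha>) powr s)"
      by (simp add: Iy_def Y_def powr_pow \<delta>0)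
  qed
qed

end

section \<open>Density increment\<close>

lemma polyfun_coord_power: "polyfun e (\<lambda>n. of_int (n $ i) ^ e)"
proof (induction e)
  case (Suc e)
  from polyfun.coord[OF Suc, of i] show ?case by simp
qed (simp add: polyfun.const)

lemma polyfun_monomial:
  "finite I \<Longrightarrow> polyfun (\<Sum>i\<in>I. e i) (\<lambda>n. \<Prod>i\<in>I. of_int (n $ i) ^ e i)"
proof (induction I rule: finite_induct)
  case (insert i I)
  from polyfun_mult[OF polyfun_coord_power[of "e i" i] insert.IH] show ?case using insert by simp
qed (simp add: polyfun.const)

lemma polyfun_eval_mpoly:
  fixes p :: "'d::finite int_mpoly"
  assumes "homogeneous_of_degree k p" shows "polyfun k (\<lambda>n. of_int (eval_mpoly p n))"
proof -
  have "polyfun k (\<lambda>n. \<Sum>m\<in>Poly_Mapping.keys p. of_int (Poly_Mapping.lookup p m) * (\<Prod>i\<in>UNIV. of_int (n $ i) ^ Poly_Mapping.lookup m i))"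
  proof (intro polyfun_sum polyfun_cmult)
    fix m assume "m \<in> Poly_Mapping.keys p"
    then have "(\<Sum>i\<in>UNIV. Poly_Mapping.lookup m i) = k" using assms by (simp add: homogeneous_of_degree_def)
    then show "polyfun k (\<lambda>n. \<Prod>i\<in>UNIV. of_int (n $ i) ^ Poly_Mapping.lookup m i)"
      using polyfun_monomial[of "UNIV :: 'd set" "Poly_Mapping.lookup m"] by simp
  qed
  then show ?thesis by (simp add: eval_mpoly_def)
qed

definition cell_density :: "(int ^ 'd::finite) set \<Rightarrow> nat \<Rightarrow> (int ^ 'd) \<times> nat \<Rightarrow> real" where
  "cell_density A u p = real (card (A \<inter> cell u p)) / real u ^ CARD('d)"

text \<open>The conditional expectation of f = 1_A - \<delta> on the cells, extended by 0 to
  uncovered points.\<close>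

definition cell_average :: "((int ^ 'd::finite) \<times> nat) set \<Rightarrow> real \<Rightarrow> (int ^ 'd) set \<Rightarrow> nat \<Rightarrow> int ^ 'd \<Rightarrow> complex" where
  "cell_average \<C> \<delta> A u n = (\<Sum>p\<in>\<C>. of_bool (n \<in> cell u p) * of_real (cell_density A u p - \<delta>))"

lemma cell_average_in:
  assumes "cell_system N u \<C>" "p \<in> \<C>" "n \<in> cell u p"
  shows "cell_average \<C> \<delta> A u n = of_real (cell_density A u p - \<delta>)"
proof -
  have fin: "finite \<C>" using assms(1) by (simp add: cell_system_def)
  have "n \<notin> cell u p'" if "p' \<in> \<C>" "p' \<noteq> p" for p'
  proof -
    have "cell u p \<inter> cell u p' = {}"
      using assms(1,2) that unfolding cell_system_def disjoint_family_on_def by metis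
    then show ?thesis using assms(3) by blast
  qed
  then have "cell_average \<C> \<delta> A u n = (\<Sum>p'\<in>\<C>. if p' = p then of_real (cell_density A u p - \<delta>) else 0)"
    unfolding cell_average_def using assms(3) by (intro sum.cong) auto
  then show ?thesis using fin assms(2) by simp
qed

lemma cell_average_out: "n \<notin> (\<Union>p\<in>\<C>. cell u p) \<Longrightarrow> cell_average \<C> \<delta> A u n = 0"
  unfolding cell_average_def by (rule sum.neutral) auto

lemma sum_grid_cells:
  fixes \<C> :: "((int ^ 'd::finite) \<times> nat) set" and h :: "int ^ 'd \<Rightarrow> 'b::comm_monoid_add"
  assumes "cell_system N u \<C>"
  shows "(\<Sum>n\<in>grid N. h n) = (\<Sum>n\<in>uncovered N u \<C>. h n) + (\<Sum>p\<in>\<C>. \<Sum>n\<in>cell u p. h n)"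
proof -
  have sub: "(\<Union>p\<in>\<C>. cell u p) \<subseteq> grid N" using assms by (auto simp: cell_system_def)
  have "(\<Sum>n\<in>(\<Union>p\<in>\<C>. cell u p). h n) = (\<Sum>p\<in>\<C>. \<Sum>n\<in>cell u p. h n)"
    by (rule sum.UNION_disjoint) (use assms in \<open>auto simp: cell_system_def disjoint_family_on_def\<close>)
  then show ?thesis using sum.subset_diff[OF sub finite_grid, of h] by simp
qed

lemma cell_density_bounds:
  fixes A :: "(int ^ 'd::finite) set"
  assumes "snd p \<ge> 1" "u \<ge> 1"
  shows "0 \<le> cell_density A u p" "cell_density A u p \<le> 1"
proof -
  show "0 \<le> cell_density A u p" by (simp add: cell_density_def)
  have "card (A \<inter> cell u p) \<le> card (cell u p)" by (intro card_mono) auto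
  also have "\<dots> = u ^ CARD('d)" using assms by (simp add: card_cell)
  finally have "real (card (A \<inter> cell u p)) \<le> real (u ^ CARD('d))" by (rule of_nat_mono)
  then show "cell_density A u p \<le> 1" using assms by (simp add: cell_density_def)
qed

text \<open>An upper bound on the cell densities already bounds their variance, because their mean
  is nearly \<delta>: from c^2 <= \<delta> (1 + \<nu>) c the quadratic sum becomes linear in the
  densities. Read conversely, averages of large L^2 norm force a dense cell.\<close>

lemma norm_two_cell_average:
  fixes A :: "(int ^ 'd::finite) set"
  assumes sys: "cell_system N u \<C>" and u: "u \<ge> 1" and N: "N \<ge> 1" and A: "A \<subseteq> grid N"
    and \<delta>: "\<delta> = real (card A) / real N ^ CARD('d)"
    and rem: "real (card (uncovered N u \<C>)) \<le> \<rho> * real N ^ CARD('d)"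
    and dens: "\<And>p. p \<in> \<C> \<Longrightarrow> cell_density A u p \<le> \<delta> * (1 + \<nu>)" and \<nu>: "0 \<le> \<nu>"
  shows "(norm_two N (cell_average \<C> \<delta> A u))\<^sup>2 \<le> (\<delta>\<^sup>2 * \<nu> + \<delta> * \<rho>) * real N ^ CARD('d)"
proof -
  define U where "U = real u ^ CARD('d)"
  define Nd where "Nd = real N ^ CARD('d)"
  have Nd: "Nd > 0" using N by (simp add: Nd_def)
  have U: "U > 0" using u by (simp add: U_def)
  have \<delta>0: "\<delta> \<ge> 0" by (simp add: \<delta>)
  have cardA: "real (card A) = \<delta> * Nd" using Nd by (simp add: \<delta> Nd_def)
  have finC: "finite \<C>" and q: "\<And>p. p \<in> \<C> \<Longrightarrow> snd p \<ge> 1" using sys by (auto simp: cell_system_def)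
  have cardc: "real (card (cell u p)) = U" if "p \<in> \<C>" for p using card_cell[OF q[OF that], of u] by (simp add: U_def)
  have finA: "finite A" using A finite_subset finite_grid by blast
  define a' where "a' = (\<Sum>p\<in>\<C>. U * cell_density A u p)"
  define S where "S = real (card \<C>) * U"
  have S: "S \<le> Nd" using of_nat_mono[OF card_cell_system(2)[OF sys], where ?'a = real] by (simp add: S_def U_def Nd_def)
  have Ucd: "U * cell_density A u p = real (card (A \<inter> cell u p))" for p using U by (simp add: cell_density_def U_def)
  have "real (card A) = (\<Sum>n\<in>grid N. of_bool (n \<in> A))"
    using A by (simp add: Int_absorb1 Int_absorb2)
  also have "\<dots> = (\<Sum>n\<in>uncovered N u \<C>. of_bool (n \<in> A)) + (\<Sum>p\<in>\<C>. \<Sum>n\<in>cell u p. of_bool (n \<in> A))"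
    by (rule sum_grid_cells[OF sys])
  also have "(\<Sum>p\<in>\<C>. \<Sum>n\<in>cell u p. of_bool (n \<in> A)) = a'"
    unfolding a'_def Ucd by (simp add: Int_commute)
  finally have split: "\<delta> * Nd = (\<Sum>n\<in>uncovered N u \<C>. of_bool (n \<in> A)) + a'" using cardA by simp
  have "(\<Sum>n\<in>uncovered N u \<C>. of_bool (n \<in> A)) \<le> (\<Sum>n\<in>uncovered N u \<C>. (1::real))"
    by (intro sum_mono) auto
  also have "\<dots> \<le> \<rho> * Nd" using rem by (simp add: Nd_def)
  finally have a'_ge: "\<delta> * Nd - \<rho> * Nd \<le> a'" using split by linarith
  have a'_le: "a' \<le> \<delta> * Nd" unfolding split by (simp add: sum_nonneg)
  have "(norm_two N (cell_average \<C> \<delta> A u))\<^sup>2 = (\<Sum>n\<in>grid N. (norm (cell_average \<C> \<delta> A u n))\<^sup>2)"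
    by (simp add: norm_two_def L2_set_def sum_nonneg)
  also have "\<dots> = (\<Sum>n\<in>uncovered N u \<C>. (norm (cell_average \<C> \<delta> A u n))\<^sup>2) + (\<Sum>p\<in>\<C>. \<Sum>n\<in>cell u p. (norm (cell_average \<C> \<delta> A u n))\<^sup>2)"
    by (rule sum_grid_cells[OF sys])
  also have "(\<Sum>n\<in>uncovered N u \<C>. (norm (cell_average \<C> \<delta> A u n))\<^sup>2) = 0"
    by (rule sum.neutral) (auto simp: cell_average_out)
  also have "(\<Sum>p\<in>\<C>. \<Sum>n\<in>cell u p. (norm (cell_average \<C> \<delta> A u n))\<^sup>2) = (\<Sum>p\<in>\<C>. U * (cell_density A u p - \<delta>)\<^sup>2)"
  proof (rule sum.cong)
    fix p assume p: "p \<in> \<C>"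
    have "(\<Sum>n\<in>cell u p. (norm (cell_average \<C> \<delta> A u n))\<^sup>2) = (\<Sum>n\<in>cell u p. (cell_density A u p - \<delta>)\<^sup>2)"
    proof (rule sum.cong)
      fix n assume "n \<in> cell u p"
      then show "(norm (cell_average \<C> \<delta> A u n))\<^sup>2 = (cell_density A u p - \<delta>)\<^sup>2"
        by (simp only: cell_average_in[OF sys p] norm_of_real power2_abs)
    qed simp
    then show "(\<Sum>n\<in>cell u p. (norm (cell_average \<C> \<delta> A u n))\<^sup>2) = U * (cell_density A u p - \<delta>)\<^sup>2"
      using cardc[OF p] by simp
  qed simp
  also have "\<dots> \<le> (\<Sum>p\<in>\<C>. \<delta> * (\<nu> - 1) * (U * cell_density A u p) + \<delta>\<^sup>2 * U)"
  proof (rule sum_mono)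
    fix p assume p: "p \<in> \<C>"
    define c where "c = cell_density A u p"
    have c: "0 \<le> c" "c \<le> \<delta> * (1 + \<nu>)" using dens[OF p] cell_density_bounds[OF q[OF p] u] by (auto simp: c_def)
    have "c * c \<le> c * (\<delta> * (1 + \<nu>))" using c by (intro mult_left_mono) auto
    then have "(c - \<delta>)\<^sup>2 \<le> \<delta> * (\<nu> - 1) * c + \<delta>\<^sup>2" by (simp add: power2_eq_square algebra_simps)
    then have "U * (c - \<delta>)\<^sup>2 \<le> U * (\<delta> * (\<nu> - 1) * c + \<delta>\<^sup>2)" using U by (intro mult_left_mono) auto
    then show "U * (cell_density A u p - \<delta>)\<^sup>2 \<le> \<delta> * (\<nu> - 1) * (U * cell_density A u p) + \<delta>\<^sup>2 * U"
      by (simp add: c_def algebra_simps)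
  qed
  also have "\<dots> = \<delta> * (\<nu> - 1) * a' + \<delta>\<^sup>2 * S"
    by (simp add: sum.distrib sum_distrib_left a'_def S_def)
  also have "\<dots> \<le> \<delta> * (\<nu> - 1) * a' + \<delta>\<^sup>2 * Nd" using S by (intro add_left_mono mult_left_mono) auto
  also have "\<dots> \<le> (\<delta>\<^sup>2 * \<nu> + \<delta> * \<rho>) * Nd"
  proof -
    have \<rho>: "0 \<le> \<rho>"
    proof -
      have "0 \<le> \<rho> * Nd" using rem unfolding Nd_def by (rule order_trans[OF of_nat_0_le_iff])
      then show ?thesis using Nd by (simp add: zero_le_mult_iff)
    qed
    show ?thesis
    \<comment> \<open>\<nu> is of the order t^-\<rho> and may exceed 1. According to the sign of
      \<nu> - 1, the covered mass a' is bounded from above or from below.\<close>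
    proof (cases "\<nu> \<ge> 1")
      case True
      have "\<delta> * (\<nu> - 1) * a' \<le> \<delta> * (\<nu> - 1) * (\<delta> * Nd)" using a'_le True \<delta>0 by (intro mult_left_mono) auto
      moreover have "\<delta> * \<rho> * Nd \<ge> 0" using \<delta>0 \<rho> Nd by simp
      ultimately show ?thesis by (simp add: algebra_simps power2_eq_square)
    next
      case False
      have "\<delta> * (1 - \<nu>) * (\<delta> * Nd - \<rho> * Nd) \<le> \<delta> * (1 - \<nu>) * a'" using a'_ge False \<delta>0 by (intro mult_left_mono) auto
      moreover have "\<delta> * \<nu> * \<rho> * Nd \<ge> 0" using \<delta>0 \<nu> \<rho> Nd by simp
      ultimately show ?thesis by (simp add: algebra_simps power2_eq_square)
    qed
  qed
  finally show ?thesis by (simp add: Nd_def)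
qed

context restriction_system
begin

lemma norm_balanced_le:
  assumes "N \<ge> 1" "A \<subseteq> grid N" shows "norm (balanced N A n) \<le> 1"
proof -
  have "real (card A) / real N ^ CARD('d) \<le> 1" using assms(2) by (rule density_le_1)
  moreover have "norm (1 - complex_of_real c) = \<bar>1 - c\<bar>" for c by (metis norm_of_real of_real_1 of_real_diff)
  moreover have "0 \<le> real (card A) / real N ^ CARD('d)" by simp
  moreover have "n \<in> grid N" if "n \<in> A" using that assms(2) by blast
  ultimately show ?thesis unfolding balanced_def by (cases "n \<in> A"; cases "n \<in> grid N") (simp_all del: of_real_divide)
qed

text \<open>The trivial bound carries the factor \<delta>. Hence levels are measured as \<delta> t
  N^d with t <= 1, and no power of \<delta> is lost when t is close to 1.\<close>

lemma norm_exp_sum_balanced_le: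
  assumes "N \<ge> 1" "A \<subseteq> grid N"
  shows "norm (exp_sum P N (balanced N A) \<alpha>) \<le> 2 * (real (card A) / real N ^ CARD('d)) * real N powr d"
proof -
  define \<delta> where "\<delta> = real (card A) / real N ^ CARD('d)"
  have \<delta>: "\<delta> \<ge> 0" by (simp add: \<delta>_def)
  have Nd: "real N powr d = real N ^ CARD('d)" using assms(1) by (simp add: d_def powr_realpow)
  have "norm (balanced N A n) \<le> of_bool (n \<in> A) + \<delta>" for n
  proof -
    have "norm (balanced N A n) \<le> norm (of_bool (n \<in> A) :: complex) + norm (of_real \<delta> * of_bool (n \<in> grid N) :: complex)"
      unfolding balanced_def \<delta>_def[symmetric] by (rule norm_triangle_ineq4)
    moreover have "norm (of_bool (n \<in> A) :: complex) = of_bool (n \<in> A)" by simp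
    moreover have "norm (of_real \<delta> * of_bool (n \<in> grid N) :: complex) \<le> \<delta>" using \<delta> by simp
    ultimately show ?thesis by linarith
  qed
  then have "norm (exp_sum P N (balanced N A) \<alpha>) \<le> (\<Sum>n\<in>grid N. of_bool (n \<in> A) + \<delta>)"
    by (intro order_trans[OF norm_exp_sum_le sum_mono])
  also have "\<dots> = real (card A) + real N ^ CARD('d) * \<delta>"
    using assms(2) by (simp add: sum.distrib card_grid Int_absorb1 Int_absorb2)
  also have "\<dots> = 2 * \<delta> * real N powr d" using assms(1) by (simp add: \<delta>_def Nd)
  finally show ?thesis by (simp add: \<delta>_def)
qed

text \<open>On each cell f and its average have the same sum, so only the variation of the phase
  inside the cell is seen. Uncovered points contribute at most 1 each.\<close>

lemma exp_sum_cell_average: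
  assumes sys: "cell_system N u \<C>" and u: "u \<ge> 1" and N: "N \<ge> 1" and A: "A \<subseteq> grid N"
    and \<delta>: "\<delta> = real (card A) / real N ^ CARD('d)"
    and rem: "real (card (uncovered N u \<C>)) \<le> \<rho> * real N ^ CARD('d)"
    and close: "\<And>p n n'. p \<in> \<C> \<Longrightarrow> n \<in> cell u p \<Longrightarrow> n' \<in> cell u p \<Longrightarrow>
      norm (unit_exp (phase P \<alpha> n) - unit_exp (phase P \<alpha> n')) \<le> \<eta>"
    and \<eta>: "0 \<le> \<eta>"
  shows "norm (exp_sum P N (balanced N A) \<alpha> - exp_sum P N (cell_average \<C> \<delta> A u) \<alpha>) \<le> (\<rho> + \<eta>) * real N ^ CARD('d)"
proof -
  define E where "E n = unit_exp (phase P \<alpha> n)" for n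
  have E1: "norm (E n) = 1" for n by (simp add: E_def)
  define h where "h n = balanced N A n - cell_average \<C> \<delta> A u n" for n
  have finC: "finite \<C>" and q: "\<And>p. p \<in> \<C> \<Longrightarrow> snd p \<ge> 1" and cg: "\<And>p. p \<in> \<C> \<Longrightarrow> cell u p \<subseteq> grid N" using sys by (auto simp: cell_system_def)
  have cardc: "card (cell u p) = u ^ CARD('d)" if "p \<in> \<C>" for p by (rule card_cell[OF q[OF that]])
  have "exp_sum P N (balanced N A) \<alpha> - exp_sum P N (cell_average \<C> \<delta> A u) \<alpha> = (\<Sum>n\<in>grid N. h n * E n)"
    by (simp add: exp_sum_def h_def E_def sum_subtractf left_diff_distrib)
  also have "\<dots> = (\<Sum>n\<in>uncovered N u \<C>. h n * E n) + (\<Sum>p\<in>\<C>. \<Sum>n\<in>cell u p. h n * E n)"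
    by (rule sum_grid_cells[OF sys])
  finally have eq: "exp_sum P N (balanced N A) \<alpha> - exp_sum P N (cell_average \<C> \<delta> A u) \<alpha> =
    (\<Sum>n\<in>uncovered N u \<C>. h n * E n) + (\<Sum>p\<in>\<C>. \<Sum>n\<in>cell u p. h n * E n)" .
  have "norm (\<Sum>n\<in>uncovered N u \<C>. h n * E n) \<le> (\<Sum>n\<in>uncovered N u \<C>. 1)"
  proof (rule order_trans[OF norm_sum sum_mono])
    fix n assume "n \<in> grid N - (\<Union>p\<in>\<C>. cell u p)"
    then have "h n = balanced N A n" by (simp add: h_def cell_average_out)
    then show "norm (h n * E n) \<le> 1" using norm_balanced_le[OF N A, of n] by (simp add: norm_mult E1)
  qed
  then have 1: "norm (\<Sum>n\<in>uncovered N u \<C>. h n * E n) \<le> \<rho> * real N ^ CARD('d)" using rem by simp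
  have each: "norm (\<Sum>n\<in>cell u p. h n * E n) \<le> real (u ^ CARD('d)) * \<eta>" if p: "p \<in> \<C>" for p
  proof -
    define c where "c = cell_density A u p"
    have c: "0 \<le> c" "c \<le> 1" using cell_density_bounds[OF q[OF p] u] by (auto simp: c_def)
    have h: "h n = of_bool (n \<in> A) - of_real c" if n: "n \<in> cell u p" for n
    proof -
      have "n \<in> grid N" using cg[OF p] n by blast
      then show ?thesis by (simp add: h_def cell_average_in[OF sys p n] balanced_def \<delta> c_def)
    qed
    have "cell u p \<noteq> {}" using cardc[OF p] u by (metis card.empty not_one_le_zero power_eq_0_iff)
    then obtain n0 where n0: "n0 \<in> cell u p" by blast
    have zero: "(\<Sum>n\<in>cell u p. h n) = 0"
    proof -
      have "(\<Sum>n\<in>cell u p. h n) = (\<Sum>n\<in>cell u p. of_bool (n \<in> A) - of_real c)" by (rule sum.cong) (auto simp: h)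
      also have "\<dots> = of_nat (card (A \<inter> cell u p)) - of_nat (u ^ CARD('d)) * of_real c"
        by (simp add: sum_subtractf cardc[OF p] Int_commute)
      also have "\<dots> = of_real (real (card (A \<inter> cell u p)) - real u ^ CARD('d) * c)" by simp
      also have "real (card (A \<inter> cell u p)) - real u ^ CARD('d) * c = 0" using u by (simp add: c_def cell_density_def)
      finally show ?thesis by simp
    qed
    have "(\<Sum>n\<in>cell u p. h n * E n) = (\<Sum>n\<in>cell u p. h n * (E n - E n0))"
      using zero by (simp add: right_diff_distrib sum_subtractf sum_distrib_right[symmetric])
    also have "norm \<dots> \<le> (\<Sum>n\<in>cell u p. \<eta>)"
    proof (rule order_trans[OF norm_sum sum_mono])
      fix n assume n: "n \<in> cell u p"
      have "norm (h n) \<le> 1" 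
      proof -
        have "norm (1 - complex_of_real c) = \<bar>1 - c\<bar>" by (metis norm_of_real of_real_1 of_real_diff)
        then show ?thesis unfolding h[OF n] using c by (cases "n \<in> A") simp_all
      qed
      then have "norm (h n) * norm (E n - E n0) \<le> 1 * \<eta>"
        using close[OF p n n0] by (intro mult_mono) (auto simp: E_def)
      then show "norm (h n * (E n - E n0)) \<le> \<eta>" by (simp add: norm_mult)
    qed
    also have "\<dots> = real (u ^ CARD('d)) * \<eta>" by (simp add: cardc[OF p])
    finally show ?thesis .
  qed
  have 2: "norm (\<Sum>p\<in>\<C>. \<Sum>n\<in>cell u p. h n * E n) \<le> \<eta> * real N ^ CARD('d)"
  proof -
    have "norm (\<Sum>p\<in>\<C>. \<Sum>n\<in>cell u p. h n * E n) \<le> (\<Sum>p\<in>\<C>. real (u ^ CARD('d)) * \<eta>)"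
      by (rule order_trans[OF norm_sum sum_mono]) (rule each)
    also have "\<dots> = \<eta> * real (card \<C> * u ^ CARD('d))" by simp
    also have "\<dots> \<le> \<eta> * real (N ^ CARD('d))"
      using card_cell_system(2)[OF sys] \<eta> by (intro mult_left_mono of_nat_mono) auto
    finally show ?thesis by simp
  qed
  show ?thesis unfolding eq
    using norm_triangle_ineq[of "\<Sum>n\<in>uncovered N u \<C>. h n * E n" "\<Sum>p\<in>\<C>. \<Sum>n\<in>cell u p. h n * E n"] 1 2
    by (simp add: algebra_simps)
qed

text \<open>The level t and the number D of frequencies depend on A, but the side u is left free
  afterwards, subject only to being at least a power of 1/\<delta> and to u^(C D^C) <= N. The
  iteration can thus take u nearly as large as the recurrence permits. The same D bounds the
  logarithmic loss and, through t, the gain.\<close>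

lemma density_increment:
  obtains \<kappa> \<rho> G :: real and C :: nat where "0 < \<kappa>" "\<kappa> \<le> 1" "0 < \<rho>" "1 \<le> G"
    "\<And>N A \<delta>. N \<ge> 2 \<Longrightarrow> A \<subseteq> grid N \<Longrightarrow> \<delta> = real (card A) / real N ^ CARD('d) \<Longrightarrow> 0 < \<delta> \<Longrightarrow>
     real (card (solutions l P A)) \<le> \<delta> ^ CARD('s) / 2 * real (num_solutions l P N) \<Longrightarrow>
     G * \<delta> powr (- G) \<le> real N powr (1 / G) \<Longrightarrow>
     \<exists>t D. 0 < t \<and> t \<le> 1 \<and> 1 \<le> D \<and> real D \<le> 2 * t powr (- \<sigma>) \<and> real D \<le> G * \<delta> powr (- G) \<and>
       (\<forall>u\<ge>2. G * \<delta> powr (- G) \<le> real u \<longrightarrow> u ^ (C * D ^ C) \<le> N \<longrightarrow>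
         (\<exists>p. snd p \<ge> 1 \<and> cell u p \<subseteq> grid N \<and> \<delta> * (1 + \<kappa> * t powr (- \<rho>)) \<le> cell_density A u p))"
proof -
  obtain c where c: "0 < c" "\<And>N A \<delta>. N \<ge> 2 \<Longrightarrow> A \<subseteq> grid N \<Longrightarrow> \<delta> = real (card A) / real N ^ CARD('d) \<Longrightarrow>
     real (card (solutions l P A)) \<le> \<delta> ^ CARD('s) / 2 * real (num_solutions l P N) \<Longrightarrow>
     c * \<delta> powr s * real N powr (d * s - K) \<le> (LINT \<alpha>:unit_cube|lborel. norm (exp_sum P N (balanced N A) \<alpha>) powr s)"
    using balanced_moment_lower by blast
  obtain c' where c': "0 < c'"
    "\<And>N a \<delta> t0. N \<ge> 2 \<Longrightarrow> (\<And>n. n \<in> grid N \<Longrightarrow> norm (a n) \<le> 1) \<Longrightarrow> 0 < \<delta> \<Longrightarrow>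
      (\<And>\<alpha>. norm (exp_sum P N a \<alpha>) \<le> 2 * \<delta> * real N powr d) \<Longrightarrow>
      c * \<delta> powr s * real N powr (d * s - K) \<le> (LINT \<alpha>:unit_cube|lborel. norm (exp_sum P N a \<alpha>) powr s) \<Longrightarrow>
      0 < t0 \<Longrightarrow> C1 * (2 * \<delta> * t0) powr (s - s') \<le> c / 4 * \<delta> powr s \<Longrightarrow> C2 * real N powr (- \<epsilon>0) \<le> c / 4 * \<delta> powr s \<Longrightarrow>
      \<exists>t\<ge>t0. t \<le> 1 \<and> c' * t powr (- \<sigma>) * real N powr (- K) \<le> measure lborel (unit_cube \<inter> {\<alpha>. \<delta> * t * real N powr d \<le> norm (exp_sum P N a \<alpha>)})"
    using large_level_set[OF c(1)] by blast
  obtain M0 :: nat where M0: "M0 \<ge> 1"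
    "\<And>M N a V \<alpha> \<Lambda>. M \<ge> M0 \<Longrightarrow> N \<ge> 2 \<Longrightarrow> V \<subseteq> box_index M N \<Longrightarrow> (\<And>v. v \<in> V \<Longrightarrow> \<alpha> v \<in> torus_box M N v) \<Longrightarrow>
       0 < \<Lambda> \<Longrightarrow> (\<And>v. v \<in> V \<Longrightarrow> \<Lambda> \<le> norm (exp_sum P N a (\<alpha> v))) \<Longrightarrow>
       4 * real N powr (d / 2 - \<theta>) * norm_two N a \<le> \<Lambda> \<Longrightarrow>
       real (card V) \<le> 2 * 4 powr s' * C1 * real M ^ CARD('r) * (real N powr (d / 2) * norm_two N a / \<Lambda>) powr s'"
    using discrete_restriction by blast
  define Kn where "Kn = (\<Sum>j\<in>UNIV. k $ j)"
  obtain C :: nat where C: "\<And>D u N (I :: ('r \<Rightarrow> nat) set) (\<psi> :: ('r \<Rightarrow> nat) \<Rightarrow> int ^ 'd \<Rightarrow> real).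
     D \<ge> 1 \<Longrightarrow> u \<ge> 2 \<Longrightarrow> D \<le> u \<Longrightarrow> u ^ (C * D ^ C) \<le> N \<Longrightarrow> finite I \<Longrightarrow> card I \<le> D \<Longrightarrow> (\<And>i. i \<in> I \<Longrightarrow> polyfun Kn (\<psi> i)) \<Longrightarrow>
     linearizable N u C I \<psi>"
    using cells[where 'd = 'd and 'i = "'r \<Rightarrow> nat" and k = Kn] by blast
  \<comment> \<open>A finer partition has more boxes: with c' M^r >= 1 the level set meets at least
    t^-\<sigma> of them.\<close>
  define M where "M = M0 + nat \<lceil>1 / c'\<rceil>"
  have M: "M \<ge> M0" "M \<ge> 1" using M0(1) by (auto simp: M_def)
  have cM: "1 \<le> c' * real M ^ CARD('r)"
  proof -
    have "1 / c' \<le> real M" unfolding M_def by simp linarith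
    also have "\<dots> \<le> real M ^ CARD('r)" using M by (intro self_le_power) (auto simp: Suc_le_eq)
    finally show ?thesis using c'(1) by (simp add: field_simps)
  qed
  define C5 where "C5 = 2 * 4 powr s' * C1 * real M ^ CARD('r)"
  have C5: "C5 > 0" using C1 M by (simp add: C5_def)
  \<comment> \<open>Solving t^-\<sigma> <= C5 (2 sqrt \<nu> / t)^s' for \<nu> gives a constant times
    t^(2 - 2 \<sigma> / s').\<close>
  define \<rho> where "\<rho> = 2 * \<sigma> / s' - 2"
  have \<rho>: "\<rho> > 0" using \<sigma>_bounds s'_pos by (simp add: \<rho>_def field_simps)
  define \<kappa>' where "\<kappa>' = min 1 (C5 powr (- 2 / s') / 4)"
  have \<kappa>': "0 < \<kappa>'" "\<kappa>' \<le> 1" "\<kappa>' \<le> C5 powr (- 2 / s') / 4" using C5 by (auto simp: \<kappa>'_def)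
  \<comment> \<open>\<open>e\<close> and \<open>c6\<close> solve C1 (2 \<delta> t0)^(s - s') = (c/4)
    \<delta>^s in the form t0 = c6 \<delta>^e, using (1 + e)(s - s') = s. Values of f below this
    level are negligible, so t is at least a power of \<delta>.\<close>
  define e where "e = s' / (s - s')"
  have e: "e > 0" using exps s'_pos by (simp add: e_def)
  define c6 where "c6 = (c / (4 * C1)) powr (1 / (s - s')) / 2"
  have c6: "c6 > 0" using c(1) C1 by (simp add: c6_def)
  \<comment> \<open>The sum of all constants and exponents that occur, so that G \<delta>^-G
    dominates each of them at once.\<close>
  define G where "G = 1 + s + 1 / \<epsilon>0 + 1 / \<theta> + 4 * C2 / c + (8 + 4 * real C) / c6 + 2 * c6 powr (- \<sigma>) + e * \<sigma> + (1 + e) + 4 * real C / \<kappa>'"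
  have s0: "s > 0" using exps by simp
  have nn: "0 \<le> s" "0 \<le> 1 / \<epsilon>0" "0 \<le> 1 / \<theta>" "0 \<le> 4 * C2 / c" "0 \<le> (8 + 4 * real C) / c6" "0 \<le> 2 * c6 powr (- \<sigma>)" "0 \<le> e * \<sigma>" "0 \<le> 1 + e" "0 \<le> 4 * real C / \<kappa>'"
    using s0 \<epsilon>0_pos \<theta> C2 c(1) c6 e \<sigma>_bounds \<kappa>' by auto
  have G: "1 \<le> G" "s \<le> G" "1 / \<epsilon>0 \<le> G" "1 / \<theta> \<le> G" "4 * C2 / c \<le> G" "(8 + 4 * real C) / c6 \<le> G" "2 * c6 powr (- \<sigma>) \<le> G" "e * \<sigma> \<le> G" "1 + e \<le> G" "4 * real C / \<kappa>' \<le> G"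
    unfolding G_def using nn by linarith+
  show ?thesis
  proof (rule that[of "\<kappa>' / 4" \<rho> G C])
    show "0 < \<kappa>' / 4" "\<kappa>' / 4 \<le> 1" "0 < \<rho>" "1 \<le> G" using \<kappa>' \<rho> G by auto
    fix N :: nat and A :: "(int ^ 'd) set" and \<delta> :: real
    assume N: "N \<ge> 2" and A: "A \<subseteq> grid N" and \<delta>_def: "\<delta> = real (card A) / real N ^ CARD('d)" and \<delta>: "0 < \<delta>"
      and few: "real (card (solutions l P A)) \<le> \<delta> ^ CARD('s) / 2 * real (num_solutions l P N)"
      and Nbig: "G * \<delta> powr (- G) \<le> real N powr (1 / G)"
    have N1: "N \<ge> 1" and Npos: "real N > 0" "real N \<ge> 1" using N by auto
    have Nd: "real N powr d = real N ^ CARD('d)" using N by (simp add: d_def powr_realpow)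
    have \<delta>1: "\<delta> \<le> 1"
    using density_le_1[of A N] A by (simp add: \<delta>_def)
    have below: "X * \<delta> powr (- a) \<le> G * \<delta> powr (- G)" if "0 \<le> X" "X \<le> G" "a \<le> G" for X a
    proof (intro mult_mono)
      show "\<delta> powr (- a) \<le> \<delta> powr (- G)" using \<delta> \<delta>1 that by (intro powr_mono') auto
    qed (use that G in auto)
    have NG: "G * \<delta> powr (- G) \<le> real N powr x" if "1 / x \<le> G" "0 < x" for x
    proof -
      have "1 / G \<le> x" using that G by (simp add: field_simps)
      then have "real N powr (1 / G) \<le> real N powr x" using Npos by (intro powr_mono) auto
      then show ?thesis using Nbig by linarith
    qed
    define t0 where "t0 = c6 * \<delta> powr e"
    have t0: "t0 > 0" using c6 \<delta> by (simp add: t0_def)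
    have cond1: "C1 * (2 * \<delta> * t0) powr (s - s') \<le> c / 4 * \<delta> powr s"
    proof -
      have "2 * \<delta> * t0 = (c / (4 * C1)) powr (1 / (s - s')) * (\<delta> powr 1 * \<delta> powr e)"
        using \<delta> by (simp add: t0_def c6_def)
      also have "\<dots> = (c / (4 * C1)) powr (1 / (s - s')) * \<delta> powr (1 + e)" by (simp only: powr_add)
      finally have "(2 * \<delta> * t0) powr (s - s') = ((c / (4 * C1)) powr (1 / (s - s'))) powr (s - s') * (\<delta> powr (1 + e)) powr (s - s')"
        by (simp only: powr_mult)
      also have "\<dots> = c / (4 * C1) * \<delta> powr ((1 + e) * (s - s'))" using exps c(1) C1 by (simp add: powr_powr)
      also have "(1 + e) * (s - s') = s" using exps by (simp add: e_def field_simps)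
      finally show ?thesis using C1 by simp
    qed
    have cond2: "C2 * real N powr (- \<epsilon>0) \<le> c / 4 * \<delta> powr s"
    proof -
      have "4 * C2 / c * \<delta> powr (- s) \<le> G * \<delta> powr (- G)" using below G nn by blast
      also have "\<dots> \<le> real N powr \<epsilon>0" using NG G \<epsilon>0_pos by blast
      finally have "4 * C2 / c * \<delta> powr (- s) \<le> real N powr \<epsilon>0" .
      then show ?thesis using c(1) \<delta> Npos by (simp add: powr_minus field_simps)
    qed
    have "\<exists>t\<ge>t0. t \<le> 1 \<and> c' * t powr (- \<sigma>) * real N powr (- K) \<le> measure lborel (unit_cube \<inter> {\<alpha>. \<delta> * t * real N powr d \<le> norm (exp_sum P N (balanced N A) \<alpha>)})"
    proof (rule c'(2)[OF N _ \<delta> _ _ t0 cond1 cond2])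
      show "norm (balanced N A n) \<le> 1" for n by (rule norm_balanced_le[OF N1 A])
      show "norm (exp_sum P N (balanced N A) \<alpha>) \<le> 2 * \<delta> * real N powr d" for \<alpha>
        using norm_exp_sum_balanced_le[OF N1 A] by (simp add: \<delta>_def)
      show "c * \<delta> powr s * real N powr (d * s - K) \<le> (LINT \<alpha>:unit_cube|lborel. norm (exp_sum P N (balanced N A) \<alpha>) powr s)"
        by (rule c(2)[OF N A \<delta>_def few])
    qed
    then obtain t where t: "t0 \<le> t" "t \<le> 1" and level: "c' * t powr (- \<sigma>) * real N powr (- K) \<le> measure lborel (unit_cube \<inter> {\<alpha>. \<delta> * t * real N powr d \<le> norm (exp_sum P N (balanced N A) \<alpha>)})"
      by blast
    have tpos: "t > 0" using t t0 by linarith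
    define E where "E = unit_cube \<inter> {\<alpha>. \<delta> * t * real N powr d \<le> norm (exp_sum P N (balanced N A) \<alpha>)}"
    define D where "D = nat \<lceil>t powr (- \<sigma>)\<rceil>"
    have tsig: "t powr (- \<sigma>) \<ge> 1" using tpos t \<sigma>_bounds powr_mono'[of "- \<sigma>" 0 t] by simp
    have D: "1 \<le> D" "t powr (- \<sigma>) \<le> real D" "real D \<le> 2 * t powr (- \<sigma>)"
      using tsig unfolding D_def by linarith+
    have D_G: "real D \<le> G * \<delta> powr (- G)"
    proof -
      have "t powr (- \<sigma>) \<le> t0 powr (- \<sigma>)" using t t0 \<sigma>_bounds by (intro powr_mono2') auto
      also have "\<dots> = c6 powr (- \<sigma>) * \<delta> powr (- (e * \<sigma>))" using c6 \<delta> by (simp add: t0_def powr_mult powr_powr)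
      finally have "real D \<le> 2 * c6 powr (- \<sigma>) * \<delta> powr (- (e * \<sigma>))" using D(3) by linarith
      also have "\<dots> \<le> G * \<delta> powr (- G)" using below G nn by blast
      finally show ?thesis .
    qed
    have inv_t: "X / (\<delta> * t) \<le> G * \<delta> powr (- G)" if X: "0 \<le> X" "X / c6 \<le> G" for X
    proof -
      have "X / (\<delta> * t) \<le> X / (\<delta> * t0)" using X \<delta> t t0 by (intro divide_left_mono mult_left_mono mult_pos_pos) auto
      also have "\<dots> = X / c6 * \<delta> powr (- (1 + e))"
      proof -
        have "\<delta> powr (- (1 + e)) = inverse (\<delta> powr (1 + e))" by (rule powr_minus)
        also have "\<delta> powr (1 + e) = \<delta> * \<delta> powr e" using \<delta> by (simp add: powr_add)
        finally show ?thesis by (simp add: t0_def divide_inverse)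
      qed
      also have "\<dots> \<le> G * \<delta> powr (- G)" using below[of "X / c6" "1 + e"] X G c6 by simp
      finally show ?thesis .
    qed
    \<comment> \<open>Boxes meeting the level set. Their number is at least the measure of the set
      divided by the volume of a box, and one frequency is taken from each of D of them.\<close>
    define W where "W = {v \<in> box_index M N. torus_box M N v \<inter> E \<noteq> {}}"
    have "finite (box_index M N)" unfolding box_index_def by (intro finite_PiE) auto
    then have finW: "finite W" by (simp add: W_def)
    have "D \<le> card W"
    proof -
      have Em: "E \<in> sets borel" unfolding E_def by measurable
      have "E \<subseteq> (\<Union>v\<in>W. torus_box M N v)"
      proof
        fix \<alpha> assume \<alpha>: "\<alpha> \<in> E"
        then obtain v where "v \<in> box_index M N" "\<alpha> \<in> torus_box M N v" using torus_box_cover[of \<alpha> M N] M N1 by (auto simp: E_def)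
        then show "\<alpha> \<in> (\<Union>v\<in>W. torus_box M N v)" using \<alpha> by (auto simp: W_def)
      qed
      then have "emeasure lborel E \<le> emeasure lborel (\<Union>v\<in>W. torus_box M N v)"
        using finW by (intro emeasure_mono) auto
      also have "\<dots> \<le> (\<Sum>v\<in>W. emeasure lborel (torus_box M N v))"
        by (rule emeasure_subadditive_finite) (use finW in auto)
      also have "\<dots> = ennreal (real (card W) * (1 / (real M ^ CARD('r) * real N powr K)))"
        by (simp add: measure_torus_box[OF M(2) N1] ennreal_of_nat_eq_real_of_nat ennreal_mult[symmetric])
      finally have "measure lborel E \<le> real (card W) * (1 / (real M ^ CARD('r) * real N powr K))"
        unfolding measure_def by (intro enn2real_leI) auto
      then have "c' * t powr (- \<sigma>) * real N powr (- K) \<le> real (card W) * (1 / (real M ^ CARD('r) * real N powr K))"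
        using level unfolding E_def by linarith
      then have "(c' * real M ^ CARD('r)) * t powr (- \<sigma>) \<le> real (card W)"
        using M Npos by (simp add: powr_minus field_simps)
      moreover have "1 * t powr (- \<sigma>) \<le> (c' * real M ^ CARD('r)) * t powr (- \<sigma>)" using cM by (intro mult_right_mono) auto
      ultimately have "t powr (- \<sigma>) \<le> real (card W)" by linarith
      then show ?thesis unfolding D_def by (simp add: ceiling_le_iff nat_le_iff)
    qed
    then obtain V where V: "V \<subseteq> W" "card V = D" using obtain_subset_with_card_n by metis
    have finV: "finite V" using V(1) finW finite_subset by blast
    have "\<forall>v\<in>V. \<exists>\<alpha>. \<alpha> \<in> torus_box M N v \<inter> E" using V(1) by (auto simp: W_def)
    then obtain \<alpha> where \<alpha>: "\<And>v. v \<in> V \<Longrightarrow> \<alpha> v \<in> torus_box M N v" "\<And>v. v \<in> V \<Longrightarrow> \<alpha> v \<in> E" by (metis IntE)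
    define \<psi> where "\<psi> v n = (\<Sum>j\<in>UNIV. \<alpha> v $ j * of_int (eval_mpoly (P $ j) n))" for v n
    have poly: "polyfun Kn (\<psi> v)" for v
      unfolding \<psi>_def
    proof (intro polyfun_sum polyfun_cmult)
      fix j
      have "k $ j \<le> Kn" unfolding Kn_def by (rule member_le_sum) auto
      then show "polyfun Kn (\<lambda>n. of_int (eval_mpoly (P $ j) n))"
        using polyfun_eval_mpoly[OF homog[of j]] polyfun_mono by blast
    qed
    have "\<exists>p. snd p \<ge> 1 \<and> cell u p \<subseteq> grid N \<and> \<delta> * (1 + \<kappa>' / 4 * t powr (- \<rho>)) \<le> cell_density A u p"
      if u: "u \<ge> 2" "G * \<delta> powr (- G) \<le> real u" "u ^ (C * D ^ C) \<le> N" for u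
    proof (rule ccontr)
      assume neg: "\<not> ?thesis"
      have Du: "D \<le> u" using D_G u(2) by linarith
      have u1: "u \<ge> 1" and upos: "real u > 0" using u(1) by auto
      obtain \<C> where sys: "cell_system N u \<C>"
        and rem: "real (card (uncovered N u \<C>)) \<le> real C / real u * real N ^ CARD('d)"
        and close: "\<And>v p n n'. v \<in> V \<Longrightarrow> p \<in> \<C> \<Longrightarrow> n \<in> cell u p \<Longrightarrow> n' \<in> cell u p \<Longrightarrow> norm (unit_exp (\<psi> v n) - unit_exp (\<psi> v n')) \<le> real C / real u"
        using C[OF D(1) u(1) Du u(3) finV] V(2) poly unfolding linearizable_def by blast
      define g where "g = cell_average \<C> \<delta> A u"
      define \<nu> where "\<nu> = \<kappa>' / 4 * t powr (- \<rho>)"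
      have \<nu>: "0 \<le> \<nu>" using \<kappa>' by (simp add: \<nu>_def)
      have dens: "cell_density A u p \<le> \<delta> * (1 + \<nu>)" if "p \<in> \<C>" for p
        using neg that sys unfolding cell_system_def \<nu>_def by (meson le_cases)
      \<comment> \<open>The second summand is the effect of the uncovered points on the L^2 norm;
        since u is at least a large multiple of 1/\<delta>, it is no larger than the increment
        constant \<kappa>' / 4.\<close>
      define \<nu>' where "\<nu>' = \<nu> + real C / real u / \<delta>"
      have \<nu>'0: "0 \<le> \<nu>'" using \<nu> \<delta> by (simp add: \<nu>'_def)
      have g2: "(norm_two N g)\<^sup>2 \<le> \<delta>\<^sup>2 * \<nu>' * real N powr d"
      proof -
        have "(norm_two N g)\<^sup>2 \<le> (\<delta>\<^sup>2 * \<nu> + \<delta> * (real C / real u)) * real N ^ CARD('d)"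
          unfolding g_def by (rule norm_two_cell_average[OF sys u1 N1 A \<delta>_def rem dens \<nu>])
        also have "\<delta>\<^sup>2 * \<nu> + \<delta> * (real C / real u) = \<delta>\<^sup>2 * \<nu>'" using \<delta> by (simp add: \<nu>'_def power2_eq_square algebra_simps)
        finally show ?thesis by (simp add: Nd)
      qed
      \<comment> \<open>Half of the level: replacing f by its averages changes the sum at each
        chosen frequency by at most this amount, so this amount also survives.\<close>
      define \<Lambda> where "\<Lambda> = \<delta> * t * real N powr d / 2"
      have \<Lambda>: "\<Lambda> > 0" using \<delta> tpos Npos by (simp add: \<Lambda>_def)
      have "4 * real C / (\<delta> * t) \<le> G * \<delta> powr (- G)"
      proof (rule inv_t)
        have "4 * real C / c6 \<le> (8 + 4 * real C) / c6" using c6 by (intro divide_right_mono) auto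
        then show "4 * real C / c6 \<le> G" using G by linarith
      qed simp
      then have uC: "4 * real C / (\<delta> * t) \<le> real u" using u(2) by linarith
      have Cu: "2 * (real C / real u) \<le> \<delta> * t / 2" using uC \<delta> tpos upos by (simp add: field_simps)
      have large: "\<Lambda> \<le> norm (exp_sum P N g (\<alpha> v))" if v: "v \<in> V" for v
      proof -
        have "norm (exp_sum P N (balanced N A) (\<alpha> v) - exp_sum P N g (\<alpha> v)) \<le> (real C / real u + real C / real u) * real N ^ CARD('d)"
          unfolding g_def by (rule exp_sum_cell_average[OF sys u1 N1 A \<delta>_def rem]) (use close[OF v] in \<open>simp_all add: \<psi>_def\<close>)
        also have "\<dots> \<le> (\<delta> * t / 2) * real N powr d" unfolding Nd using Cu by (intro mult_right_mono) auto
        finally have "norm (exp_sum P N (balanced N A) (\<alpha> v) - exp_sum P N g (\<alpha> v)) \<le> \<Lambda>" by (simp add: \<Lambda>_def)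
        moreover have "2 * \<Lambda> \<le> norm (exp_sum P N (balanced N A) (\<alpha> v))" using \<alpha>(2)[OF v] by (simp add: E_def \<Lambda>_def)
        ultimately show ?thesis
          using norm_triangle_sub[of "exp_sum P N (balanced N A) (\<alpha> v)" "exp_sum P N g (\<alpha> v)"] by linarith
      qed
      have thr: "4 * real N powr (d / 2 - \<theta>) * norm_two N g \<le> \<Lambda>"
      proof -
        have "norm_two N g \<le> real N powr (d / 2)"
          unfolding d_def
        proof (rule norm_two_le)
          fix n
          show "norm (g n) \<le> 1"
          proof (cases "n \<in> (\<Union>p\<in>\<C>. cell u p)")
            case True
            then obtain p where p: "p \<in> \<C>" "n \<in> cell u p" by blast
            have "snd p \<ge> 1" using p sys by (auto simp: cell_system_def)
            from cell_density_bounds[OF this u1, of A]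
            have "\<bar>cell_density A u p - \<delta>\<bar> \<le> 1" using \<delta> \<delta>1 by (simp add: abs_le_iff)
            then show ?thesis unfolding g_def cell_average_in[OF sys p] norm_of_real .
          qed (simp add: g_def cell_average_out)
        qed
        then have "4 * real N powr (d / 2 - \<theta>) * norm_two N g \<le> 4 * real N powr (d / 2 - \<theta>) * real N powr (d / 2)"
          by (intro mult_left_mono) auto
        also have "\<dots> = 4 * (real N powr (d / 2 - \<theta>) * real N powr (d / 2))" by simp
        also have "real N powr (d / 2 - \<theta>) * real N powr (d / 2) = real N powr d * real N powr (- \<theta>)"
          by (simp add: powr_add[symmetric])
        also have "4 * (real N powr d * real N powr (- \<theta>)) \<le> \<Lambda>"
        proof -
          have "8 / (\<delta> * t) \<le> G * \<delta> powr (- G)"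
          proof (rule inv_t)
            have "8 / c6 \<le> (8 + 4 * real C) / c6" using c6 by (intro divide_right_mono) auto
            then show "8 / c6 \<le> G" using G by linarith
          qed simp
          also have "\<dots> \<le> real N powr \<theta>" using NG G \<theta> by blast
          finally have "8 \<le> real N powr \<theta> * (\<delta> * t)" using \<delta> tpos by (simp add: field_simps)
          then have "8 * (real N powr d * real N powr (- \<theta>)) \<le> (real N powr \<theta> * (\<delta> * t)) * (real N powr d * real N powr (- \<theta>))"
            by (intro mult_right_mono) auto
          also have "\<dots> = (real N powr \<theta> * real N powr (- \<theta>)) * (\<delta> * t * real N powr d)" by (simp add: mult_ac)
          also have "real N powr \<theta> * real N powr (- \<theta>) = 1" using Npos by (simp add: powr_add[symmetric])
          finally show ?thesis by (simp add: \<Lambda>_def)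
        qed
        finally show ?thesis .
      qed
      have "real D \<le> C5 * (real N powr (d / 2) * norm_two N g / \<Lambda>) powr s'"
        unfolding C5_def V(2)[symmetric]
        by (rule M0(2)[OF M(1) N _ \<alpha>(1) \<Lambda> large thr]) (use V(1) in \<open>auto simp: W_def\<close>)
      also have "real N powr (d / 2) * norm_two N g / \<Lambda> \<le> 2 * sqrt \<nu>' / t"
      proof -
        have "norm_two N g \<le> sqrt (\<delta>\<^sup>2 * \<nu>' * real N powr d)"
          using g2 norm_two_nonneg real_le_rsqrt by blast
        also have "\<dots> = \<delta> * sqrt \<nu>' * real N powr (d / 2)"
          using \<delta> by (simp add: real_sqrt_mult powr_half_sqrt_powr)
        finally have "real N powr (d / 2) * norm_two N g \<le> real N powr (d / 2) * (\<delta> * sqrt \<nu>' * real N powr (d / 2))" by (intro mult_left_mono) auto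
        also have "\<dots> = (real N powr (d / 2) * real N powr (d / 2)) * (\<delta> * sqrt \<nu>')" by simp
        also have "real N powr (d / 2) * real N powr (d / 2) = real N powr d" by (simp add: powr_add[symmetric])
        finally have "real N powr (d / 2) * norm_two N g / \<Lambda> \<le> real N powr d * (\<delta> * sqrt \<nu>') / \<Lambda>" using \<Lambda> by (intro divide_right_mono) auto
        also have "\<dots> = 2 * sqrt \<nu>' / t" using \<delta> Npos by (simp add: \<Lambda>_def field_simps)
        finally show ?thesis .
      qed
      then have "C5 * (real N powr (d / 2) * norm_two N g / \<Lambda>) powr s' \<le> C5 * (2 * sqrt \<nu>' / t) powr s'"
        using C5 s'_pos \<Lambda> by (intro mult_left_mono powr_mono2 divide_nonneg_nonneg mult_nonneg_nonneg norm_two_nonneg) auto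
      also have "\<dots> < C5 * (C5 powr (- 1 / s') * t powr (- \<sigma> / s')) powr s'"
      proof (intro mult_strict_left_mono powr_less_mono2)
        have "\<nu>' < C5 powr (- 2 / s') / 4 * t powr (- \<rho>)"
        proof -
          have tr: "t powr (- \<rho>) \<ge> 1" using tpos t \<rho> powr_mono'[of "- \<rho>" 0 t] by simp
          have "4 * real C / \<kappa>' * \<delta> powr (- 1) \<le> G * \<delta> powr (- G)" using below[of "4 * real C / \<kappa>'" 1] G nn by simp
          then have "4 * real C / \<kappa>' * \<delta> powr (- 1) \<le> real u" using u(2) by linarith
          then have "4 * real C / (\<kappa>' * \<delta>) \<le> real u" using \<delta> by (simp add: powr_minus divide_inverse mult_ac)
          then have "real C / real u / \<delta> \<le> \<kappa>' / 4" using \<kappa>' \<delta> upos by (simp add: field_simps)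
          also have "\<dots> \<le> \<kappa>' / 4 * t powr (- \<rho>)" using \<kappa>' tr by simp
          finally have "\<nu>' \<le> \<kappa>' / 2 * t powr (- \<rho>)" unfolding \<nu>'_def \<nu>_def by linarith
          also have "\<dots> < \<kappa>' * t powr (- \<rho>)" using \<kappa>' tpos by simp
          also have "\<dots> \<le> C5 powr (- 2 / s') / 4 * t powr (- \<rho>)" using \<kappa>' by (intro mult_right_mono) auto
          finally show ?thesis .
        qed
        then have "sqrt \<nu>' < sqrt (C5 powr (- 2 / s') / 4 * t powr (- \<rho>))" by (rule real_sqrt_less_mono)
        also have "\<dots> = C5 powr (- 1 / s') * t powr (- \<rho> / 2) / 2"
        proof -
          have sq: "sqrt (x powr a) = x powr (a / 2)" if "x \<ge> 0" for x a :: real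
            by (simp add: powr_half_sqrt_powr[OF that])
          have "sqrt (C5 powr (- 2 / s') / 4 * t powr (- \<rho>)) = sqrt (C5 powr (- 2 / s')) / sqrt 4 * sqrt (t powr (- \<rho>))"
            by (simp only: real_sqrt_mult real_sqrt_divide)
          also have "sqrt (C5 powr (- 2 / s')) = C5 powr (- 1 / s')" using sq[of C5 "- 2 / s'"] C5 by simp
          also have "sqrt (t powr (- \<rho>)) = t powr (- \<rho> / 2)" using sq[of t "- \<rho>"] tpos by simp
          finally show ?thesis by simp
        qed
        finally have "2 * sqrt \<nu>' / t < C5 powr (- 1 / s') * t powr (- \<rho> / 2) / t" using tpos by (simp add: divide_strict_right_mono)
        also have "\<dots> = C5 powr (- 1 / s') * t powr (- \<rho> / 2 - 1)" using tpos by (simp add: powr_diff)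
        also have "- \<rho> / 2 - 1 = - \<sigma> / s'" using s'_pos by (simp add: \<rho>_def field_simps)
        finally show "2 * sqrt \<nu>' / t < C5 powr (- 1 / s') * t powr (- \<sigma> / s')" .
      qed (use C5 s'_pos \<nu>'0 tpos in auto)
      also have "\<dots> = t powr (- \<sigma>)"
      proof -
        have "(C5 powr (- 1 / s') * t powr (- \<sigma> / s')) powr s' = C5 powr (- 1 / s' * s') * t powr (- \<sigma> / s' * s')"
          by (simp only: powr_mult powr_powr)
        also have "- 1 / s' * s' = - 1" using s'_pos by simp
        also have "- \<sigma> / s' * s' = - \<sigma>" using s'_pos by simp
        finally show ?thesis using C5 by (simp add: powr_minus)
      qed
      finally show False using D(2) by linarith
    qed
    then show "\<exists>t D. 0 < t \<and> t \<le> 1 \<and> 1 \<le> D \<and> real D \<le> 2 * t powr (- \<sigma>) \<and> real D \<le> G * \<delta> powr (- G) \<and>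
       (\<forall>u\<ge>2. G * \<delta> powr (- G) \<le> real u \<longrightarrow> u ^ (C * D ^ C) \<le> N \<longrightarrow>
         (\<exists>p. snd p \<ge> 1 \<and> cell u p \<subseteq> grid N \<and> \<delta> * (1 + \<kappa>' / 4 * t powr (- \<rho>)) \<le> cell_density A u p))"
      using tpos t D D_G by (intro exI[of _ t] exI[of _ D]) auto
  qed
qed

end

section \<open>Iteration\<close>

lemma eval_mpoly_dilate:
  fixes p :: "'d::finite int_mpoly"
  assumes "homogeneous_of_degree k p"
  shows "eval_mpoly p (\<chi> i. q * y $ i) = q ^ k * eval_mpoly p y"
proof -
  have "Poly_Mapping.lookup p m * (\<Prod>i\<in>UNIV. ((\<chi> i. q * y $ i) $ i) ^ Poly_Mapping.lookup m i) =
     q ^ k * (Poly_Mapping.lookup p m * (\<Prod>i\<in>UNIV. (y $ i) ^ Poly_Mapping.lookup m i))" if "m \<in> Poly_Mapping.keys p" for m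
  proof -
    have "(\<Prod>i\<in>UNIV. ((\<chi> i. q * y $ i) $ i) ^ Poly_Mapping.lookup m i) = q ^ (\<Sum>i\<in>UNIV. Poly_Mapping.lookup m i) * (\<Prod>i\<in>UNIV. (y $ i) ^ Poly_Mapping.lookup m i)"
      by (simp add: power_mult_distrib prod.distrib power_sum)
    then show ?thesis using assms that by (simp add: homogeneous_of_degree_def)
  qed
  then show ?thesis unfolding eval_mpoly_def sum_distrib_left by (intro sum.cong) auto
qed

text \<open>The negation of the desired conclusion for A. In this form it is inherited by subsets
  and, by the next lemma, by cells, which is what the induction needs.\<close>

definition solutions_in :: "int ^ 's \<Rightarrow> 'd::finite int_mpoly ^ 'r \<Rightarrow> (rat ^ 'd ^ 's) set \<Rightarrow> (int ^ 'd) set \<Rightarrow> bool" where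
  "solutions_in l P Z A \<longleftrightarrow> (\<forall>x. (\<forall>i. x $ i \<in> A) \<longrightarrow> is_solution l P x \<longrightarrow> rat_tuple x \<in> Z)"

text \<open>A solution y in cell coordinates becomes the solution q y + c in A: homogeneity gives
  the dilation, although the degrees differ, and translation invariance the shift. To return from Z
  one translates by - c and dilates by 1/q, which is why Z lives over the rationals.\<close>

lemma solutions_in_affine:
  fixes P :: "'d::finite int_mpoly ^ 'r" and l :: "int ^ 's"
  assumes homog: "\<And>j. homogeneous_of_degree (k $ j) (P $ j)" and inv: "translation_invariant_system l P"
    and Z: "translation_dilation_invariant Z" and A: "solutions_in l P Z A" and q: "q \<ge> 1"
  shows "solutions_in l P Z {y. affine_pt c q y \<in> A}"
  unfolding solutions_in_def
proof (intro allI impI)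
  fix y :: "int ^ 'd ^ 's" assume y: "\<forall>i. y $ i \<in> {y. affine_pt c q y \<in> A}" and sol: "is_solution l P y"
  define x where "x = (\<chi> i. affine_pt c q (y $ i))"
  have "is_solution l P (\<chi> i. \<chi> m. int q * y $ i $ m)"
    unfolding is_solution_def
  proof
    fix j
    have "(\<Sum>i\<in>UNIV. l $ i * eval_mpoly (P $ j) ((\<chi> i. \<chi> m. int q * y $ i $ m) $ i)) = int q ^ (k $ j) * (\<Sum>i\<in>UNIV. l $ i * eval_mpoly (P $ j) (y $ i))"
      by (simp add: eval_mpoly_dilate[OF homog] sum_distrib_left mult_ac)
    then show "(\<Sum>i\<in>UNIV. l $ i * eval_mpoly (P $ j) ((\<chi> i. \<chi> m. int q * y $ i $ m) $ i)) = 0"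
      using sol by (simp add: is_solution_def)
  qed
  then have "is_solution l P (\<chi> i. (\<chi> i. \<chi> m. int q * y $ i $ m) $ i + c)"
    using inv unfolding translation_invariant_system_def by blast
  also have "(\<chi> i. (\<chi> i. \<chi> m. int q * y $ i $ m) $ i + c) = x"
    by (simp add: x_def affine_pt_def Finite_Cartesian_Product.vec_eq_iff)
  finally have "rat_tuple x \<in> Z" using A y unfolding solutions_in_def by (simp add: x_def)
  define c' :: "rat ^ 'd" where "c' = (\<chi> m. - of_int (c $ m))"
  have "(\<chi> i. rat_tuple x $ i + c') \<in> Z"
    using Z \<open>rat_tuple x \<in> Z\<close> unfolding translation_dilation_invariant_def by blast
  then have "(\<chi> i. (1 / of_nat q) *s ((\<chi> i. rat_tuple x $ i + c') $ i)) \<in> Z"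
    using Z unfolding translation_dilation_invariant_def by blast
  also have "(\<chi> i. (1 / of_nat q) *s ((\<chi> i. rat_tuple x $ i + c') $ i)) = rat_tuple y"
    using q by (simp add: rat_tuple_def x_def c'_def affine_pt_def Finite_Cartesian_Product.vec_eq_iff add_divide_distrib)
  finally show "rat_tuple y \<in> Z" .
qed

text \<open>Convexity of exp between 0 and a ln x. It compares a small power of 1/t with the affine
  expression 1 + \<kappa> t^-\<rho>.\<close>

lemma weighted_am_gm_powr:
  fixes x w a :: real
  assumes "x > 0" "0 \<le> w" "w \<le> 1" shows "x powr (a * w) \<le> (1 - w) + w * x powr a"
proof -
  have "exp ((1 - w) *\<^sub>R 0 + w *\<^sub>R (a * ln x)) \<le> (1 - w) * exp 0 + w * exp (a * ln x)"
    using assms by (intro convex_onD[OF exp_convex]) auto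
  then show ?thesis using assms by (simp add: powr_def mult_ac)
qed

context restriction_system
begin

text \<open>Strong induction on N. If the bound fails for N, the dense cell, viewed as a subset of
  the grid of side u < N, violates it for u, because the density gain outweighs the loss in the
  logarithm. There is no base case: for small N the bound exceeds 1. The constants are fixed before
  Z.\<close>

lemma density_bound:
  assumes inv: "translation_invariant_system l P" and \<omega>: "\<omega> > 0"
  obtains B c :: real where "B \<ge> 2" "c > 0"
    "\<And>Z N A. translation_dilation_invariant Z \<Longrightarrow>
       (\<And>N. N \<ge> 2 \<Longrightarrow> real (num_solutions_in Z l P N) \<le> CZ * real N powr (d * s - K - \<omega>)) \<Longrightarrow>
       N \<ge> 2 \<Longrightarrow> A \<subseteq> grid N \<Longrightarrow> solutions_in l P Z A \<Longrightarrow>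
       real (card A) / real N ^ CARD('d) \<le> B * ln (real N) powr (- c)"
proof -
  obtain \<kappa> \<rho> G :: real and C :: nat where \<kappa>: "0 < \<kappa>" "\<kappa> \<le> 1" and \<rho>: "0 < \<rho>" and G: "1 \<le> G"
    and incr: "\<And>N A \<delta>. N \<ge> 2 \<Longrightarrow> A \<subseteq> grid N \<Longrightarrow> \<delta> = real (card A) / real N ^ CARD('d) \<Longrightarrow> 0 < \<delta> \<Longrightarrow>
     real (card (solutions l P A)) \<le> \<delta> ^ CARD('s) / 2 * real (num_solutions l P N) \<Longrightarrow>
     G * \<delta> powr (- G) \<le> real N powr (1 / G) \<Longrightarrow>
     \<exists>t D. 0 < t \<and> t \<le> 1 \<and> 1 \<le> D \<and> real D \<le> 2 * t powr (- \<sigma>) \<and> real D \<le> G * \<delta> powr (- G) \<and>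
       (\<forall>u\<ge>2. G * \<delta> powr (- G) \<le> real u \<longrightarrow> u ^ (C * D ^ C) \<le> N \<longrightarrow>
         (\<exists>p. snd p \<ge> 1 \<and> cell u p \<subseteq> grid N \<and> \<delta> * (1 + \<kappa> * t powr (- \<rho>)) \<le> cell_density A u p))"
    by (rule density_increment) (rule that; assumption)
  define CZ' where "CZ' = max 1 CZ"
  have CZ': "CZ' > 0" "CZ \<le> CZ'" by (auto simp: CZ'_def)
  define E0 where "E0 = (real C + 2) * G ^ C"
  have E0: "E0 > 0" using G by (simp add: E0_def)
  \<comment> \<open>The loss in the logarithm apart from the power of t: E <= (C + 2)(2
    t^-\<sigma>)^C, and a further 2 for rounding the root of N down.\<close>
  define \<kappa>2 where "\<kappa>2 = 1 / (2 * (real C + 2) * 2 ^ C)"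
  have \<kappa>2: "0 < \<kappa>2" "\<kappa>2 < 1"
  proof -
    show "0 < \<kappa>2" by (simp add: \<kappa>2_def)
    have "(2::real) * 2 * 1 \<le> 2 * (real C + 2) * 2 ^ C" by (intro mult_mono) auto
    then show "\<kappa>2 < 1" by (simp add: \<kappa>2_def)
  qed
  define w where "w = \<kappa> / (1 + \<kappa>)"
  have w: "0 < w" "w \<le> 1" using \<kappa> by (auto simp: w_def)
  have s0: "s > 0" using exps by simp
  \<comment> \<open>In this order: the powers of 1/\<delta> coming from \<open>G\<close> stay below
    the square root of log N; \<delta>^-s stays below log N; \<kappa>2^-c <= 1 + \<kappa>; and the
    power of 1/t lost through the logarithm is at most t^-(\<rho> w).\<close>
  define c where "c = Min {1 / (2 * G * (real C + 1)), 1 / s, ln (1 + \<kappa>) / (- ln \<kappa>2), \<rho> * w / (real C * \<sigma> + 1)}"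
  have c: "c > 0" "c \<le> 1 / (2 * G * (real C + 1))" "c \<le> 1 / s" "c \<le> ln (1 + \<kappa>) / (- ln \<kappa>2)" "c \<le> \<rho> * w / (real C * \<sigma> + 1)"
  proof -
    let ?S = "{1 / (2 * G * (real C + 1)), 1 / s, ln (1 + \<kappa>) / (- ln \<kappa>2), \<rho> * w / (real C * \<sigma> + 1)}"
    have "real C * \<sigma> + 1 > 0" using \<sigma>_bounds by (simp add: add_nonneg_pos)
    moreover have "- ln \<kappa>2 > 0" using \<kappa>2 by simp
    moreover have "ln (1 + \<kappa>) > 0" using \<kappa> by simp
    moreover have "1 / (2 * G * (real C + 1)) > 0" using G by simp
    ultimately have "\<forall>x\<in>?S. 0 < x" using s0 \<rho> w by (auto intro!: divide_pos_pos simp del: divide_minus_right)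
    moreover have "c \<in> ?S" unfolding c_def by (rule Min_in) auto
    ultimately show "c > 0" by blast
  qed (simp_all add: c_def)
  have cG: "c * G * (real C + 1) \<le> 1/2"
  proof -
    define Y where "Y = G * (real C + 1)"
    have "Y > 0" using G by (simp add: Y_def)
    moreover have "c \<le> 1 / (2 * Y)" using c(2) by (simp add: Y_def mult.assoc)
    ultimately have "c * Y \<le> 1 / 2" by (simp add: field_simps)
    then show ?thesis by (simp add: Y_def mult.assoc)
  qed
  have cGC: "c * G * real C \<le> 1/2" "c * G \<le> 1/2"
  proof -
    have "c * G * real C \<ge> 0" "c * G \<ge> 0" using c(1) G by auto
    moreover have "c * G * (real C + 1) = c * G * real C + c * G" by (simp add: algebra_simps)
    ultimately show "c * G * real C \<le> 1/2" "c * G \<le> 1/2" using cG by linarith+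
  qed
  have cs: "c * s \<le> 1" using c(3) s0 by (simp add: field_simps)
  \<comment> \<open>For L = log N and \<delta> >= L^-c these conditions ensure that N^\<omega>
    outweighs \<delta>^-s, that N^(1/G) outweighs G \<delta>^-G, and that the root N^(1/E) exceeds
    the least admissible side of a cell.\<close>
  have "eventually (\<lambda>L::real. L \<ge> 1 \<and> 2 * CZ' / c3 * L \<le> exp (\<omega> * L) \<and> G * L powr (1/2) \<le> exp (L / G) \<and>
      4 + 2 * G * L powr (1/2) \<le> exp (L powr (1/2) / E0)) at_top"
  proof (intro eventually_conj)
    show "eventually (\<lambda>L::real. L \<ge> 1) at_top" by (rule eventually_ge_at_top)
    show "eventually (\<lambda>L::real. 2 * CZ' / c3 * L \<le> exp (\<omega> * L)) at_top" using \<omega> by real_asymp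
    show "eventually (\<lambda>L::real. G * L powr (1/2) \<le> exp (L / G)) at_top" using G by real_asymp
    show "eventually (\<lambda>L::real. 4 + 2 * G * L powr (1/2) \<le> exp (L powr (1/2) / E0)) at_top" using G E0 by real_asymp
  qed
  then obtain L0 where L0: "\<And>L. L \<ge> L0 \<Longrightarrow> L \<ge> 1 \<and> 2 * CZ' / c3 * L \<le> exp (\<omega> * L) \<and> G * L powr (1/2) \<le> exp (L / G) \<and>
      4 + 2 * G * L powr (1/2) \<le> exp (L powr (1/2) / E0)"
    unfolding eventually_at_top_linorder by blast
  \<comment> \<open>For L <= max 1 L0 the claimed bound is at least 1, so a violation of it forces L
    into the range where the asymptotic inequalities hold.\<close>
  define B where "B = max 2 ((max 1 L0) powr c)"
  have B: "B \<ge> 2" by (simp add: B_def)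
  show ?thesis
  proof (rule that[OF B c(1)])
    fix Z :: "(rat ^ 'd ^ 's) set" and N :: nat and A :: "(int ^ 'd) set"
    assume Z: "translation_dilation_invariant Z"
      and few: "\<And>N. N \<ge> 2 \<Longrightarrow> real (num_solutions_in Z l P N) \<le> CZ * real N powr (d * s - K - \<omega>)"
    show "N \<ge> 2 \<Longrightarrow> A \<subseteq> grid N \<Longrightarrow> solutions_in l P Z A \<Longrightarrow>
       real (card A) / real N ^ CARD('d) \<le> B * ln (real N) powr (- c)"
    proof (induction N arbitrary: A rule: less_induct)
      case (less N)
      note N = less.prems(1) and A = less.prems(2) and sA = less.prems(3)
      define \<delta> where "\<delta> = real (card A) / real N ^ CARD('d)"
      define L where "L = ln (real N)"
      have Npos: "real N > 0" "N \<ge> 1" and L: "L > 0" using N by (auto simp: L_def)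
      have NL: "real N powr x = exp (x * L)" for x using Npos by (simp add: powr_def L_def)
      show ?case
      proof (rule ccontr)
        assume "\<not> ?case"
        then have big: "\<delta> > B * L powr (- c)" by (simp add: \<delta>_def L_def)
        have "B * L powr (- c) > 0" using B L by simp
        then have \<delta>: "\<delta> > 0" using big by linarith
        have \<delta>1: "\<delta> \<le> 1"
        using density_le_1[of A N] A by (simp add: \<delta>_def)
        have "B * L powr (- c) < 1" using big \<delta>1 by linarith
        then have "B < L powr c" using L by (simp add: powr_minus field_simps)
        then have "(max 1 L0) powr c < L powr c" by (simp add: B_def)
        then have "max 1 L0 < L" using c(1) L by (meson powr_mono2 less_imp_le not_le)
        then have L1: "L \<ge> 1" "2 * CZ' / c3 * L \<le> exp (\<omega> * L)" "G * L powr (1/2) \<le> exp (L / G)" "4 + 2 * G * L powr (1/2) \<le> exp (L powr (1/2) / E0)"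
          using L0[of L] by auto
        have inv_\<delta>: "\<delta> powr (- x) \<le> L powr y" if "0 \<le> x" "c * x \<le> y" for x y
        proof -
          have "L powr (- c) \<le> B * L powr (- c)" using mult_right_mono[of 1 B "L powr (- c)"] B by simp
          then have "L powr (- c) \<le> \<delta>" using big by linarith
          then have "\<delta> powr (- x) \<le> (L powr (- c)) powr (- x)" using L that by (intro powr_mono2') auto
          also have "\<dots> = L powr (c * x)" by (simp add: powr_powr)
          also have "\<dots> \<le> L powr y" using L1 that by (intro powr_mono) auto
          finally show ?thesis .
        qed
        have GG: "G * \<delta> powr (- G) \<le> G * L powr (1/2)" using inv_\<delta>[of G "1/2"] G cGC by (intro mult_left_mono) auto
        \<comment> \<open>All solutions in A lie in Z and so are fewer than the full count by a
          factor N^-\<omega>, up to constants; this is below \<delta>^s / 2 of it.\<close>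
        have cond1: "real (card (solutions l P A)) \<le> \<delta> ^ CARD('s) / 2 * real (num_solutions l P N)"
        proof -
          have fin: "finite {x. (\<forall>i. x $ i \<in> grid N) \<and> is_solution l P x \<and> rat_tuple x \<in> Z}"
          proof (rule finite_subset)
            show "{x. (\<forall>i. x $ i \<in> grid N) \<and> is_solution l P x \<and> rat_tuple x \<in> Z} \<subseteq> (\<lambda>f. (\<chi> i. f i)) ` (UNIV \<rightarrow>\<^sub>E grid N)"
              by (auto intro!: image_eqI[of _ _ "\<lambda>i. _ $ i"])
            show "finite ((\<lambda>f. (\<chi> i. f i)) ` (UNIV \<rightarrow>\<^sub>E grid N) :: (int ^ 'd ^ 's) set)"
              by (intro finite_imageI finite_PiE) auto
          qed
          have "card (solutions l P A) \<le> num_solutions_in Z l P N"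
            unfolding num_solutions_in_def using fin
            by (rule card_mono) (use sA A in \<open>auto simp: solutions_in_def\<close>)
          then have "real (card (solutions l P A)) \<le> CZ * real N powr (d * s - K - \<omega>)"
            using few[OF N] of_nat_mono order_trans by blast
          also have "\<dots> \<le> CZ' * real N powr (d * s - K - \<omega>)" using CZ' by (intro mult_right_mono) auto
          also have "\<dots> = CZ' * real N powr (- \<omega>) * real N powr (d * s - K)"
            by (simp add: mult.assoc powr_add[symmetric])
          also have "\<dots> \<le> (\<delta> powr s / 2 * c3) * real N powr (d * s - K)"
          proof (rule mult_right_mono)
            have "\<delta> powr (- s) \<le> L powr 1" using inv_\<delta>[of s 1] s0 cs by simp
            then have "2 * CZ' / c3 * \<delta> powr (- s) \<le> 2 * CZ' / c3 * L" using L CZ' c3 by (intro mult_left_mono) auto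
            also have "\<dots> \<le> real N powr \<omega>" using L1 by (simp add: NL)
            finally have "2 * CZ' / c3 * \<delta> powr (- s) \<le> real N powr \<omega>" .
            then show "CZ' * real N powr (- \<omega>) \<le> \<delta> powr s / 2 * c3"
              using \<delta> Npos c3 by (simp add: powr_minus field_simps)
          qed simp
          also have "\<dots> = \<delta> powr s / 2 * (c3 * real N powr (d * s - K))" by simp
          also have "\<dots> \<le> \<delta> powr s / 2 * real (num_solutions l P N)" using many[OF N] by (intro mult_left_mono) auto
          finally show ?thesis using \<delta> by (simp add: s_def powr_realpow)
        qed
        have cond2: "G * \<delta> powr (- G) \<le> real N powr (1 / G)"
          using GG L1(3) by (simp add: NL)
        obtain t D where t: "0 < t" "t \<le> 1" and D: "1 \<le> D" "real D \<le> 2 * t powr (- \<sigma>)" "real D \<le> G * \<delta> powr (- G)"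
          and cells: "\<And>u. u \<ge> 2 \<Longrightarrow> G * \<delta> powr (- G) \<le> real u \<Longrightarrow> u ^ (C * D ^ C) \<le> N \<Longrightarrow>
             \<exists>p. snd p \<ge> 1 \<and> cell u p \<subseteq> grid N \<and> \<delta> * (1 + \<kappa> * t powr (- \<rho>)) \<le> cell_density A u p"
          using incr[OF N A \<delta>_def \<delta> cond1 cond2] by blast
        \<comment> \<open>u is the integer part of the E-th root of N. The summand 2 keeps E
          positive even for C = 0 and gives u^2 <= N, hence u < N.\<close>
        define E where "E = C * D ^ C + 2"
        define x where "x = exp (L / real E)"
        define u where "u = nat \<lfloor>x\<rfloor>"
        have E_le: "real E \<le> (real C + 2) * real D ^ C"
        proof -
          have "1 \<le> real D ^ C" using D by (intro one_le_power) auto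
          then show ?thesis by (simp add: E_def algebra_simps)
        qed
        have "E > 0" by (simp add: E_def)
        then have Epos: "real E > 0" by (simp only: of_nat_0_less_iff)
        have "real E \<le> E0 * L powr (1/2)"
        proof -
          have "real D ^ C \<le> (G * \<delta> powr (- G)) ^ C" using D by (intro power_mono) auto
          also have "\<dots> = G ^ C * \<delta> powr (- (G * real C))" using \<delta> by (simp add: power_mult_distrib powr_realpow[symmetric] powr_powr)
          also have "\<dots> \<le> G ^ C * L powr (1/2)" using inv_\<delta>[of "G * real C" "1/2"] G cGC by (intro mult_left_mono) (auto simp: mult.assoc)
          finally have "(real C + 2) * real D ^ C \<le> (real C + 2) * (G ^ C * L powr (1/2))" by (intro mult_left_mono) auto
          from order_trans[OF E_le this] show ?thesis by (simp only: E0_def mult.assoc)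
        qed
        then have "L powr (1/2) / E0 \<le> L / real E"
        proof -
          assume "real E \<le> E0 * L powr (1/2)"
          then have "real E * L powr (1/2) \<le> E0 * L powr (1/2) * L powr (1/2)" by (intro mult_right_mono) auto
          also have "\<dots> = E0 * L" using L by (simp add: mult.assoc powr_add[symmetric])
          finally show ?thesis using E0 Epos by (simp add: field_simps)
        qed
        then have x: "4 + 2 * G * L powr (1/2) \<le> x" using L1(4) unfolding x_def by (meson exp_le_cancel_iff order_trans)
        have x4: "x \<ge> 4"
        proof -
          have "0 \<le> 2 * G * L powr (1/2)" using G by simp
          then show ?thesis using x by linarith
        qed
        have ux: "real u \<le> x" "real u \<ge> x / 2" using x4 unfolding u_def by linarith+
        have u2: "u \<ge> 2" using ux(2) x4 by linarith
        have uG: "G * \<delta> powr (- G) \<le> real u" using ux(2) x GG by linarith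
        have uE: "u ^ E \<le> N"
        proof -
          have "real u ^ E \<le> x ^ E" using ux by (intro power_mono) auto
          also have "\<dots> = real N" using Epos Npos by (simp add: x_def exp_of_nat_mult[symmetric] L_def)
          finally have "real (u ^ E) \<le> real N" by simp
          then show ?thesis by (simp only: of_nat_le_iff)
        qed
        have "u ^ (C * D ^ C) \<le> u ^ E" using u2 by (intro power_increasing) (auto simp: E_def)
        then have uC: "u ^ (C * D ^ C) \<le> N" using uE by linarith
        have uN: "u < N"
        proof -
          have "u * 1 < u * u" using u2 by simp
          also have "u * u = u ^ 2" by (simp add: power2_eq_square)
          also have "\<dots> \<le> u ^ E" using u2 by (intro power_increasing) (auto simp: E_def)
          finally show ?thesis using uE by simp
        qed
        obtain p where p: "snd p \<ge> 1" "cell u p \<subseteq> grid N" "\<delta> * (1 + \<kappa> * t powr (- \<rho>)) \<le> cell_density A u p"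
          using cells[OF u2 uG uC] by blast
        define A' where "A' = {y \<in> grid u. affine_pt (fst p) (snd p) y \<in> A}"
        have "solutions_in l P Z {y. affine_pt (fst p) (snd p) y \<in> A}"
          by (rule solutions_in_affine[OF homog inv Z sA p(1)])
        then have sA': "solutions_in l P Z A'" unfolding solutions_in_def A'_def by blast
        have "A \<inter> cell u p = affine_pt (fst p) (snd p) ` A'" by (auto simp: A'_def cell_def)
        then have "card (A \<inter> cell u p) = card A'"
          by (simp add: card_image[OF inj_on_subset[OF inj_affine_pt[OF p(1)] subset_UNIV]])
        then have "cell_density A u p = real (card A') / real u ^ CARD('d)" by (simp add: cell_density_def)
        also have "\<dots> \<le> B * ln (real u) powr (- c)"
          by (rule less.IH[OF uN u2 _ sA']) (auto simp: A'_def)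
        finally have upper: "\<delta> * (1 + \<kappa> * t powr (- \<rho>)) \<le> B * ln (real u) powr (- c)" using p(3) by linarith
        have lnu: "ln (real u) \<ge> \<kappa>2 * t powr (real C * \<sigma>) * L"
        proof -
          have "exp (L / real E / 2) ^ 2 = x" by (simp add: x_def power2_eq_square exp_add[symmetric])
          then have sq: "sqrt x = exp (L / real E / 2)" by (metis exp_ge_zero real_sqrt_unique)
          have "sqrt x \<le> x / 2"
          proof (rule real_le_lsqrt)
            have "4 * x \<le> x * x" using x4 by (intro mult_right_mono) auto
            then show "x \<le> (x / 2)\<^sup>2" by (simp add: power2_eq_square)
          qed (use x4 in auto)
          then have "exp (L / real E / 2) \<le> real u" using ux sq by linarith
          then have "L / real E / 2 \<le> ln (real u)" using u2 by (simp add: ln_ge_iff)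
          moreover have "\<kappa>2 * t powr (real C * \<sigma>) * L \<le> L / real E / 2"
          proof -
            have "real D ^ C \<le> (2 * t powr (- \<sigma>)) ^ C" using D by (intro power_mono) auto
            also have "\<dots> = 2 ^ C * t powr (- (real C * \<sigma>))" using t by (simp add: power_mult_distrib powr_realpow[symmetric] powr_powr mult.commute)
            finally have "(real C + 2) * real D ^ C \<le> (real C + 2) * (2 ^ C * t powr (- (real C * \<sigma>)))" by (intro mult_left_mono) auto
            from order_trans[OF E_le this] have "real E \<le> (real C + 2) * 2 ^ C * t powr (- (real C * \<sigma>))" by (simp only: mult.assoc)
            then have "L / real E / 2 \<ge> L / ((real C + 2) * 2 ^ C * t powr (- (real C * \<sigma>))) / 2"
              using L Epos t by (intro divide_right_mono divide_left_mono mult_pos_pos) auto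
            then show ?thesis using t by (simp add: \<kappa>2_def powr_minus field_simps)
          qed
          ultimately show ?thesis by linarith
        qed
        have "B * ln (real u) powr (- c) \<le> B * (\<kappa>2 * t powr (real C * \<sigma>) * L) powr (- c)"
          using lnu \<kappa>2 t L c(1) B by (intro mult_left_mono powr_mono2') auto
        also have "\<dots> = (B * L powr (- c)) * (\<kappa>2 powr (- c) * t powr (- (real C * \<sigma> * c)))"
          by (simp add: powr_mult powr_powr)
        also have "\<dots> < \<delta> * (\<kappa>2 powr (- c) * t powr (- (real C * \<sigma> * c)))"
          using big \<kappa>2 t by (intro mult_strict_right_mono) auto
        also have "\<dots> \<le> \<delta> * (1 + \<kappa> * t powr (- \<rho>))"
        proof (intro mult_left_mono)
          have "\<kappa>2 powr (- c) \<le> 1 + \<kappa>"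
          proof -
            have "c * (- ln \<kappa>2) \<le> ln (1 + \<kappa>)" using c(4) \<kappa>2 by (simp add: field_simps)
            then have "exp (c * (- ln \<kappa>2)) \<le> exp (ln (1 + \<kappa>))" by (simp only: exp_le_cancel_iff)
            then show ?thesis using \<kappa> \<kappa>2 by (simp add: powr_def)
          qed
          moreover have "t powr (- (real C * \<sigma> * c)) \<le> t powr (- (\<rho> * w))"
          proof (rule powr_mono')
            have "real C * \<sigma> + 1 > 0" using \<sigma>_bounds by (simp add: add_nonneg_pos)
            then have "(real C * \<sigma> + 1) * c \<le> \<rho> * w" using c(5) by (simp add: field_simps)
            moreover have "(real C * \<sigma> + 1) * c = real C * \<sigma> * c + c" by (simp add: algebra_simps)
            ultimately show "- (\<rho> * w) \<le> - (real C * \<sigma> * c)" using c(1) by linarith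
          qed (use t in auto)
          ultimately have "\<kappa>2 powr (- c) * t powr (- (real C * \<sigma> * c)) \<le> (1 + \<kappa>) * t powr (- (\<rho> * w))"
            using \<kappa> by (intro mult_mono) auto
          also have "t powr (- (\<rho> * w)) = t powr (- \<rho> * w)" by simp
          \<comment> \<open>The weight w = \<kappa> / (1 + \<kappa>) is chosen so that multiplying 1
            - w and w by 1 + \<kappa> gives exactly 1 and \<kappa>, the coefficients of the
            increment.\<close>
          also have "(1 + \<kappa>) * t powr (- \<rho> * w) \<le> (1 + \<kappa>) * ((1 - w) + w * t powr (- \<rho>))"
            using weighted_am_gm_powr[of t w "- \<rho>"] t w \<kappa> by (intro mult_left_mono) auto
          also have "\<dots> = 1 + \<kappa> * t powr (- \<rho>)" using \<kappa> by (simp add: w_def field_simps)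
          finally show "\<kappa>2 powr (- c) * t powr (- (real C * \<sigma> * c)) \<le> 1 + \<kappa> * t powr (- \<rho>)" .
        qed (use \<delta> in simp)
        finally show False using upper by linarith
      qed
    qed
  qed
qed

end

section \<open>Trading the constant B for 2 by lowering the exponent\<close>

theorem theorem1p3:
  fixes l :: "int ^ 's"
    and P :: "'d::finite int_mpoly ^ 'r"
    and k :: "nat ^ 'r"
    and d s K \<omega> C\<^sub>Z s' s'' \<theta> :: real
  assumes d_def: "d = real CARD('d)"
    and s_def: "s = real CARD('s)"
    and K_def: "K = real (\<Sum>j\<in>UNIV. k $ j)"
    and s_ge: "CARD('s) \<ge> 3"
    and l_nonzero: "\<forall>i. l $ i \<noteq> 0"
    and l_sum: "(\<Sum>i\<in>UNIV. l $ i) = 0"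
    and k_ge: "\<forall>j. k $ j \<ge> 1"
    and homog: "\<forall>j. homogeneous_of_degree (k $ j) (P $ j)"
    and dimension: "has_full_dimension P"
    and trans_inv: "translation_invariant_system l P"
    and omega_pos: "\<omega> > 0"
    and many_solutions:
      "\<exists>C>0. \<forall>N\<ge>2. real (num_solutions l P N) \<ge> C * real N powr (d * s - K)"
    and exponents: "0 < s''" "s'' < s'" "s' < s"
    and theta_pos: "\<theta> > 0"
    and moment_bound:
      "\<forall>\<epsilon>>0. \<exists>C. \<forall>N\<ge>2. \<forall>a.
         (LINT \<alpha>|torus_measure. norm (exp_sum P N a \<alpha>) powr s'')
           \<le> C * real N powr (d * s'' - K + \<epsilon>) * norm_sup N a powr s''"
    and large_values_bound:
      "\<exists>C. \<forall>N\<ge>2. \<forall>a.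
         (LINT \<alpha>:{\<alpha>. norm (exp_sum P N a \<alpha>) \<ge> real N powr (d / 2 - \<theta>) * norm_two N a}
            |torus_measure. norm (exp_sum P N a \<alpha>) powr s')
           \<le> C * real N powr (d * s' / 2 - K) * norm_two N a powr s'"
  shows "\<exists>c>0. \<forall>Z :: (rat ^ 'd ^ 's) set.
           translation_dilation_invariant Z \<longrightarrow>
           (\<forall>N\<ge>2. real (num_solutions_in Z l P N) \<le> C\<^sub>Z * real N powr (d * s - K - \<omega>)) \<longrightarrow>
           (\<forall>N\<ge>2. \<forall>A. A \<subseteq> grid N \<and>
              real (card A) \<ge> 2 * ln (real N) powr (- c) * real N powr d \<longrightarrow>
              (\<exists>x. (\<forall>i. x $ i \<in> A) \<and> rat_tuple x \<notin> Z \<and> is_solution l P x))"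
proof -
  obtain c3 where c3: "c3 > 0" "\<And>N. N \<ge> 2 \<Longrightarrow> c3 * real N powr (d * s - K) \<le> real (num_solutions l P N)"
    using many_solutions by blast
  have "\<theta> * (s - s'') / 2 > 0" using theta_pos exponents by simp
  then obtain C2 where C2: "\<And>N a. N \<ge> 2 \<Longrightarrow> (LINT \<alpha>|torus_measure. norm (exp_sum P N a \<alpha>) powr s'')
           \<le> C2 * real N powr (d * s'' - K + \<theta> * (s - s'') / 2) * norm_sup N a powr s''"
    using moment_bound by blast
  obtain C1 where C1: "\<And>N a. N \<ge> 2 \<Longrightarrow> (LINT \<alpha>:{\<alpha>. norm (exp_sum P N a \<alpha>) \<ge> real N powr (d / 2 - \<theta>) * norm_two N a}
            |torus_measure. norm (exp_sum P N a \<alpha>) powr s')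
           \<le> C1 * real N powr (d * s' / 2 - K) * norm_two N a powr s'"
    using large_values_bound by blast
  interpret restriction_system P k d K s' \<theta> "max 1 C1" l s s'' "max 1 C2" c3
  proof unfold_locales
    show "d = real CARD('d)" "K = real (\<Sum>j\<in>UNIV. k $ j)" "s = real CARD('s)" by fact+
    show "0 < s'" "0 < s''" "s'' < s'" "s' < s" "\<theta> > 0" "c3 > 0" using exponents theta_pos c3 by auto
    show "homogeneous_of_degree (k $ j) (P $ j)" for j using homog by blast
    show "l $ i \<noteq> 0" for i using l_nonzero by blast
    show "(LINT \<alpha>:{\<alpha>. norm (exp_sum P N a \<alpha>) \<ge> real N powr (d / 2 - \<theta>) * norm_two N a}
            |torus_measure. norm (exp_sum P N a \<alpha>) powr s')
           \<le> max 1 C1 * real N powr (d * s' / 2 - K) * norm_two N a powr s'" if "N \<ge> 2" for N a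
      by (rule order_trans[OF C1[OF that]]) (intro mult_right_mono; simp)
    show "(LINT \<alpha>|torus_measure. norm (exp_sum P N a \<alpha>) powr s'')
           \<le> max 1 C2 * real N powr (d * s'' - K + \<theta> * (s - s'') / 2) * norm_sup N a powr s''" if "N \<ge> 2" for N a
      by (rule order_trans[OF C2[OF that]]) (intro mult_right_mono; simp)
    show "c3 * real N powr (d * s - K) \<le> real (num_solutions l P N)" if "N \<ge> 2" for N by (rule c3(2)[OF that])
  qed auto
  obtain B c where B: "B \<ge> 2" and c: "c > 0" and bound: "\<And>Z N A. translation_dilation_invariant Z \<Longrightarrow>
       (\<And>N. N \<ge> 2 \<Longrightarrow> real (num_solutions_in Z l P N) \<le> C\<^sub>Z * real N powr (d * s - K - \<omega>)) \<Longrightarrow>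
       N \<ge> 2 \<Longrightarrow> A \<subseteq> grid N \<Longrightarrow> solutions_in l P Z A \<Longrightarrow>
       real (card A) / real N ^ CARD('d) \<le> B * ln (real N) powr (- c)"
    using density_bound[OF trans_inv omega_pos] by metis
  \<comment> \<open>Beyond log N = M half of the exponent absorbs B, since B = M^(c/2). Up to M the
    assumed density would exceed 1: c' <= 1 / (2 ln M) gives (log N)^c' <= exp (1/2) < 2.\<close>
  define M where "M = B powr (2 / c)"
  have "1 powr (2 / c) < B powr (2 / c)" using B c by (intro powr_less_mono2) auto
  then have M: "M > 1" by (simp add: M_def)
  define c' where "c' = min (c / 2) (1 / (2 * ln M))"
  have c': "c' > 0" "c' \<le> c / 2" "c' \<le> 1 / (2 * ln M)" using c M by (auto simp: c'_def)
  show ?thesis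
  proof (intro exI[of _ c'] conjI allI impI)
    show "c' > 0" by fact
    fix Z :: "(rat ^ 'd ^ 's) set" and N :: nat and A :: "(int ^ 'd) set"
    assume Z: "translation_dilation_invariant Z"
      and few: "\<forall>N\<ge>2. real (num_solutions_in Z l P N) \<le> C\<^sub>Z * real N powr (d * s - K - \<omega>)"
      and N: "N \<ge> 2" and A: "A \<subseteq> grid N \<and> real (card A) \<ge> 2 * ln (real N) powr (- c') * real N powr d"
    define L where "L = ln (real N)"
    have L: "L > 0" and Npos: "real N > 0" using N by (auto simp: L_def)
    have Nd: "real N powr d = real N ^ CARD('d)" using N by (simp add: d_def powr_realpow)
    have dens: "2 * L powr (- c') \<le> real (card A) / real N ^ CARD('d)"
      using A Npos unfolding Nd L_def by (simp add: field_simps)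
    show "\<exists>x. (\<forall>i. x $ i \<in> A) \<and> rat_tuple x \<notin> Z \<and> is_solution l P x"
    proof (rule ccontr)
      assume "\<not> ?thesis"
      then have "solutions_in l P Z A" unfolding solutions_in_def by blast
      then have "real (card A) / real N ^ CARD('d) \<le> B * L powr (- c)"
        unfolding L_def using bound[OF Z _ N, of A] few A by blast
      then have le: "2 * L powr (- c') \<le> B * L powr (- c)" using dens by linarith
      show False
      proof (cases "L \<le> M")
        case True
        have "L powr c' \<le> M powr c'" using True L c' by (intro powr_mono2) auto
        also have "\<dots> \<le> M powr (1 / (2 * ln M))" using M c' by (intro powr_mono) auto
        also have "\<dots> = exp (1 / 2)" using M by (simp add: powr_def)
        also have "\<dots> < 2"
        proof -
          have "exp (1 / 2 :: real) ^ 2 = exp 1" by (simp add: power2_eq_square exp_add[symmetric])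
          also have "\<dots> < 2 ^ 2" using exp_le by simp
          finally show ?thesis by (rule power_less_imp_less_base) simp
        qed
        finally have "2 * L powr (- c') > 1" using L by (simp add: powr_minus field_simps)
        moreover have "real (card A) / real N ^ CARD('d) \<le> 1"
        proof -
          have "card A \<le> card (grid N :: (int ^ 'd) set)" using A by (intro card_mono) auto
          then have "card A \<le> N ^ CARD('d)" unfolding card_grid .
          then have "real (card A) \<le> real (N ^ CARD('d))" by (rule of_nat_mono)
          then show ?thesis using N by simp
        qed
        ultimately show False using dens by linarith
      next
        case False
        have "B = M powr (c / 2)" using B c by (simp add: M_def powr_powr)
        also have "\<dots> < L powr (c / 2)" using False M c by (intro powr_less_mono2) auto
        also have "\<dots> \<le> L powr (c - c')" using False M c' by (intro powr_mono) auto
        finally have "B * L powr (- c) < L powr (c - c') * L powr (- c)" using L by (intro mult_strict_right_mono) auto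
        also have "\<dots> = L powr (- c')" by (simp add: powr_add[symmetric])
        finally have "2 * L powr (- c') < L powr (- c')" using le by linarith
        then show False using powr_ge_zero[of L "- c'"] by linarith
      qed
    qed
  qed
qed

end
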